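(* Let $(G,\sigma)$ be a flow-admissible signed graph and let $\epsilon_N$ be the number of negative edges in a minimum signature of $(G,\sigma)$. Then $(G,\sigma)$ has a signed circuit cover of length at most $\frac{5}{3}\cdot|E(G)|+2\cdot|V(G)|+\frac{1}{3}\cdot\epsilon_N-2$.
   Context: Graphs are finite, have at least one vertex, and may have parallel edges and loops. A signed graph $(G,\sigma)$ is a graph $G$ with a signature $\sigma:E(G)\to\{1,-1\}$; edges of value $1$ are positive, edges of value $-1$ are negative. A circuit is a connected 2-regular graph (a loop is a circuit, and so is a pair of parallel edges). A circuit is balanced if it has an even number of negative edges, and unbalanced otherwise. Two signed graphs $(G,\sigma_1)$, $(G,\sigma_2)$ on the same graph are equivalent if they have the same balanced circuits. "A minimum signature of $(G,\sigma)$" means a signature with fewest negative edges among all signatures equivalent to $\sigma$. A signed circuit is a signed graph of one of the following forms: (1) a balanced circuit; (2) the union of two unbalanced circuits which meet at a single vertex (a short barbell); (3) the union of two disjoint unbalanced circuits with a path which meets the circuits only at its ends, one end on each circuit (a long barbell). A signed graph is flow-admissible if it admits a signed nowhere-zero (integer) flow; equivalently (a known result of Bouchet), if every edge of it belongs to a signed circuit of it. A signed circuit cover of $(G,\sigma)$ is a collection $\mathcal C$ of subgraphs of $(G,\sigma)$, each a signed circuit, such that each edge of $G$ is contained in at least one member of $\mathcal C$. Its length is $\sum_{F\in\mathcal C}|E(F)|$. *)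

theory Defs
  imports
    Complex_Main
    "HOL-Library.Multiset"
    "Graph_Theory.Digraph_Component"
begin

text \<open>
  A finite graph with parallel edges and loops is a \<^locale>\<open>fin_digraph\<close>: the edges are the
  arcs, and the two ends of an edge are its tail and its head. Which end is the tail is an
  arbitrary choice (a reference orientation); it serves to tell apart the two half-edges of an
  edge, also for a loop, and none of the notions below depends on it.
\<close>

definition degree :: "('a, 'b) pre_digraph \<Rightarrow> 'a \<Rightarrow> nat" where
  "degree G v = out_degree G v + in_degree G v"

definition circuit :: "('a, 'b) pre_digraph \<Rightarrow> bool" where
  "circuit C \<longleftrightarrow>
     fin_digraph C \<and> Digraph_Component.connected C \<and> (\<forall>v \<in> verts C. degree C v = 2)"

definition is_path :: "('a, 'b) pre_digraph \<Rightarrow> 'a \<Rightarrow> 'a \<Rightarrow> bool" where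
  "is_path P u w \<longleftrightarrow>
     (\<exists>vs es. length vs = Suc (length es) \<and> distinct vs \<and> distinct es \<and>
        hd vs = u \<and> last vs = w \<and> verts P = set vs \<and> arcs P = set es \<and>
        (\<forall>i < length es. {tail P (es ! i), head P (es ! i)} = {vs ! i, vs ! Suc i}))"

definition is_signature :: "('a, 'b) pre_digraph \<Rightarrow> ('b \<Rightarrow> int) \<Rightarrow> bool" where
  "is_signature G \<sigma> \<longleftrightarrow> (\<forall>e \<in> arcs G. \<sigma> e \<in> {1, -1})"

definition negative_edges :: "('a, 'b) pre_digraph \<Rightarrow> ('b \<Rightarrow> int) \<Rightarrow> 'b set" where
  "negative_edges G \<sigma> = {e \<in> arcs G. \<sigma> e = -1}"

definition balanced_circuit :: "('b \<Rightarrow> int) \<Rightarrow> ('a, 'b) pre_digraph \<Rightarrow> bool" where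
  "balanced_circuit \<sigma> C \<longleftrightarrow> circuit C \<and> even (card (negative_edges C \<sigma>))"

definition unbalanced_circuit :: "('b \<Rightarrow> int) \<Rightarrow> ('a, 'b) pre_digraph \<Rightarrow> bool" where
  "unbalanced_circuit \<sigma> C \<longleftrightarrow> circuit C \<and> odd (card (negative_edges C \<sigma>))"

definition equivalent_signatures ::
  "('a, 'b) pre_digraph \<Rightarrow> ('b \<Rightarrow> int) \<Rightarrow> ('b \<Rightarrow> int) \<Rightarrow> bool" where
  "equivalent_signatures G \<sigma> \<sigma>' \<longleftrightarrow>
     (\<forall>C. subgraph C G \<longrightarrow> balanced_circuit \<sigma> C = balanced_circuit \<sigma>' C)"

definition minimum_signature ::
  "('a, 'b) pre_digraph \<Rightarrow> ('b \<Rightarrow> int) \<Rightarrow> ('b \<Rightarrow> int) \<Rightarrow> bool" where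
  "minimum_signature G \<sigma> \<tau> \<longleftrightarrow>
     is_signature G \<tau> \<and> equivalent_signatures G \<sigma> \<tau> \<and>
     (\<forall>\<rho>. is_signature G \<rho> \<and> equivalent_signatures G \<sigma> \<rho> \<longrightarrow>
        card (negative_edges G \<tau>) \<le> card (negative_edges G \<rho>))"

text \<open>
  In a short barbell the two circuits must also be edge-disjoint: otherwise a single unbalanced
  loop, taken twice, would meet itself in exactly one vertex. For a long barbell this follows
  from vertex-disjointness. The shared tail and head functions are part of \<^const>\<open>subgraph\<close>.
\<close>

definition short_barbell :: "('b \<Rightarrow> int) \<Rightarrow> ('a, 'b) pre_digraph \<Rightarrow> bool" where
  "short_barbell \<sigma> F \<longleftrightarrow>
     (\<exists>C1 C2. subgraph C1 F \<and> subgraph C2 F \<and>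
        unbalanced_circuit \<sigma> C1 \<and> unbalanced_circuit \<sigma> C2 \<and>
        (\<exists>v. verts C1 \<inter> verts C2 = {v}) \<and> arcs C1 \<inter> arcs C2 = {} \<and>
        verts F = verts C1 \<union> verts C2 \<and> arcs F = arcs C1 \<union> arcs C2)"

definition long_barbell :: "('b \<Rightarrow> int) \<Rightarrow> ('a, 'b) pre_digraph \<Rightarrow> bool" where
  "long_barbell \<sigma> F \<longleftrightarrow>
     (\<exists>C1 C2 P u w. subgraph C1 F \<and> subgraph C2 F \<and> subgraph P F \<and>
        unbalanced_circuit \<sigma> C1 \<and> unbalanced_circuit \<sigma> C2 \<and>
        verts C1 \<inter> verts C2 = {} \<and>
        is_path P u w \<and> verts P \<inter> verts C1 = {u} \<and> verts P \<inter> verts C2 = {w} \<and>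
        verts F = verts C1 \<union> verts C2 \<union> verts P \<and>
        arcs F = arcs C1 \<union> arcs C2 \<union> arcs P)"

definition signed_circuit :: "('b \<Rightarrow> int) \<Rightarrow> ('a, 'b) pre_digraph \<Rightarrow> bool" where
  "signed_circuit \<sigma> F \<longleftrightarrow> balanced_circuit \<sigma> F \<or> short_barbell \<sigma> F \<or> long_barbell \<sigma> F"

text \<open>
  An orientation of a signed graph directs every half-edge. Here \<open>ot e\<close> and \<open>oh e\<close> are the
  directions of the half-edges of \<open>e\<close> at its tail and at its head: \<open>1\<close> if the half-edge is
  directed away from its vertex, \<open>-1\<close> if towards it. The two half-edges of a positive edge agree
  (one leaves its end, the other enters its end); those of a negative edge both leave or both
  enter.
\<close>

definition is_orientation ::
  "('a, 'b) pre_digraph \<Rightarrow> ('b \<Rightarrow> int) \<Rightarrow> ('b \<Rightarrow> int) \<Rightarrow> ('b \<Rightarrow> int) \<Rightarrow> bool" where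
  "is_orientation G \<sigma> ot oh \<longleftrightarrow>
     (\<forall>e \<in> arcs G. ot e \<in> {1, -1} \<and> oh e \<in> {1, -1} \<and> ot e * oh e = - \<sigma> e)"

definition is_flow ::
  "('a, 'b) pre_digraph \<Rightarrow> ('b \<Rightarrow> int) \<Rightarrow> ('b \<Rightarrow> int) \<Rightarrow> ('b \<Rightarrow> int) \<Rightarrow> bool" where
  "is_flow G ot oh f \<longleftrightarrow>
     (\<forall>v \<in> verts G.
        (\<Sum>e \<in> out_arcs G v. ot e * f e) + (\<Sum>e \<in> in_arcs G v. oh e * f e) = 0)"

definition flow_admissible :: "('a, 'b) pre_digraph \<Rightarrow> ('b \<Rightarrow> int) \<Rightarrow> bool" where
  "flow_admissible G \<sigma> \<longleftrightarrow>
     (\<exists>ot oh f. is_orientation G \<sigma> ot oh \<and> is_flow G ot oh f \<and> (\<forall>e \<in> arcs G. f e \<noteq> 0))"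

definition signed_circuit_cover ::
  "('a, 'b) pre_digraph \<Rightarrow> ('b \<Rightarrow> int) \<Rightarrow> ('a, 'b) pre_digraph multiset \<Rightarrow> bool" where
  "signed_circuit_cover G \<sigma> \<C> \<longleftrightarrow>
     (\<forall>F \<in># \<C>. subgraph F G \<and> signed_circuit \<sigma> F) \<and>
     (\<forall>e \<in> arcs G. \<exists>F \<in># \<C>. e \<in> arcs F)"

definition cover_length :: "('a, 'b) pre_digraph multiset \<Rightarrow> nat" where
  "cover_length \<C> = (\<Sum>F \<in># \<C>. card (arcs F))"

end

theory Submission
  imports Defs "HOL-Library.Disjoint_Sets"
begin

text \<open>
  Let \<open>N\<close> be the set of negative edges of a minimum signature of a connected graph and \<open>T\<close> a spanning
  tree of the set \<open>P\<close> of the other edges; \<open>T\<close> exists because no cut has more negative than positive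
  edges. The edges of \<open>P\<close> that are no bridges of \<open>P\<close> are covered by three even sets of total size at most
  \<open>5/3 |P|\<close>: a weighted argument of Sebo gives a set \<open>a\<close> of even degrees whose complement has at most
  a third of the edges and meets each 3-edge cut once; contracting \<open>a\<close> leaves cuts of at least four
  edges, hence two disjoint connectors and two even sets that cover the rest, and of the covers that
  arise by adding \<open>a\<close> to some of the sets one is short enough.

  The negative edges and the bridges of \<open>P\<close> remain, with a budget of \<open>2 |T| + 2 |N|\<close>. The even set \<open>X\<close>
  with \<open>N \<subseteq> X \<subseteq> N \<union> T\<close> is decomposed into circuits, as many of them balanced as possible; then two
  unbalanced ones share at most one vertex and form a barbell with every path between them. Touring
  the circuits and the edges of \<open>T\<close> connects the unbalanced circuits to barbells that use every edge
  at most twice and cross every bridge. If a decomposition of \<open>X\<close> has only one unbalanced circuit,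
  or none on one side of a bridge, then circuits that leave \<open>X\<close> along \<open>T\<close> take over.
\<close>

section \<open>Cuts and joins\<close>

text \<open>The bound is the sum of two budgets: \<open>5/3 (|E| - |N|)\<close> for \<open>P\<close>
  and \<open>2 (|V| - 1) + 2 |N|\<close> for the rest, so that every edge of
  \<open>T \<union> N\<close> may be used twice. The signature is irrelevant for the first part,
  since circuits in \<open>P\<close> are balanced. In the second part an unbalanced circuit is
  useless alone, and the links that turn it into a barbell compete for the same second use of each
  edge; how many circuits remain unpaired in a part of the graph is a matter of parity. Hence each
  part has to offer both one and two open ends at the same price. Bridges of \<open>P\<close> are of
  two kinds. A bridge of the whole graph lies on no circuit and can only be covered by the path of a
  barbell, which is possible because both of its sides have negative edges. Any other bridge of
  \<open>P\<close> forms a cut of two edges with one negative edge, by minimality of the signature,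
  and lies on every circuit through that edge. A single negative edge is excluded by the flow; this
  matters when all negative edges lie on one circuit.\<close>

lemma finite_ex_least:
  fixes f :: "'c \<Rightarrow> 'd :: linorder"
  assumes "finite A" "x \<in> A"
  obtains y where "y \<in> A" "\<And>z. z \<in> A \<Longrightarrow> f y \<le> f z"
proof -
  have "Min (f ` A) \<in> f ` A" using assms by (intro Min_in) auto
  then obtain y where "y \<in> A" "f y = Min (f ` A)" by auto
  then show thesis using that[of y] assms(1) by simp
qed

lemma odd_ge_3: "odd n \<Longrightarrow> n \<noteq> 1 \<Longrightarrow> 3 \<le> (n :: nat)"
  by presburger

lemma odd_card_sym_diff:
  assumes "finite A" "finite B"
  shows "odd (card (sym_diff A B)) \<longleftrightarrow> odd (card A) \<noteq> odd (card B)"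
proof -
  have 1: "card A = card (A - B) + card (A \<inter> B)"
    using assms by (metis Int_commute Diff_Int_distrib2 card_Diff_subset_Int card_mono finite_Int inf_le2 le_add_diff_inverse2 add.commute)
  have 2: "card B = card (B - A) + card (A \<inter> B)"
    using assms by (metis Int_commute card_Diff_subset_Int card_mono finite_Int inf_le2 le_add_diff_inverse2)
  have "card (sym_diff A B) = card (A - B) + card (B - A)"
    using assms by (intro card_Un_disjoint) auto
  then show ?thesis using 1 2 by presburger
qed

lemma odd_card_sym_diff_Int:
  assumes "finite A" "finite B"
  shows "odd (card (sym_diff A B \<inter> S)) \<longleftrightarrow> odd (card (A \<inter> S)) \<noteq> odd (card (B \<inter> S))"
proof -
  have "sym_diff A B \<inter> S = sym_diff (A \<inter> S) (B \<inter> S)" by auto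
  then show ?thesis using odd_card_sym_diff[of "A \<inter> S" "B \<inter> S"] assms by simp
qed

locale multigraph =
  fixes t h :: "'b \<Rightarrow> 'a"
begin

definition cut :: "'a set \<Rightarrow> 'b set" where
  "cut S = {e. (t e \<in> S) \<noteq> (h e \<in> S)}"

text \<open>
  Paths and closed trails are handled modulo 2: \<open>joins J a b\<close> says that the vertices of odd
  degree in \<open>J\<close> are exactly \<open>a\<close> and \<open>b\<close>, and \<open>joins J a a\<close> that all degrees in \<open>J\<close> are even.
\<close>

definition joins :: "'b set \<Rightarrow> 'a \<Rightarrow> 'a \<Rightarrow> bool" where
  "joins J a b \<longleftrightarrow> finite J \<and> (\<forall>v. odd (card (J \<inter> cut {v})) \<longleftrightarrow> (v = a) \<noteq> (v = b))"

definition even_set :: "'b set \<Rightarrow> bool" where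
  "even_set J \<longleftrightarrow> finite J \<and> (\<forall>v. even (card (J \<inter> cut {v})))"

definition conn :: "'b set \<Rightarrow> 'a \<Rightarrow> 'a \<Rightarrow> bool" where
  "conn E a b \<longleftrightarrow> (\<exists>J\<subseteq>E. joins J a b)"

definition ends :: "'b set \<Rightarrow> 'a set" where
  "ends E = t ` E \<union> h ` E"

lemma cut_compl: "cut (- S) = cut S"
  by (auto simp: cut_def)

lemma joins_refl_iff: "joins J a a \<longleftrightarrow> even_set J"
  by (auto simp: joins_def even_set_def)

lemma joinsD: "joins J a b \<Longrightarrow> finite J"
  by (simp add: joins_def)

lemma even_setD: "even_set J \<Longrightarrow> finite J"
  by (simp add: even_set_def)

lemma joins_sym: "joins J a b \<Longrightarrow> joins J b a"
  by (auto simp: joins_def)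

lemma even_set_empty [simp]: "even_set {}"
  by (simp add: even_set_def)

lemma joins_empty: "joins {} a a"
  by (simp add: joins_def)

lemma in_cut_single: "e \<in> cut {v} \<longleftrightarrow> t e \<noteq> h e \<and> (v = t e \<or> v = h e)"
  by (auto simp: cut_def)

lemma joins_edge: "joins {e} (t e) (h e)"
proof -
  have "odd (card ({e} \<inter> cut {v})) \<longleftrightarrow> e \<in> cut {v}" for v
    by (cases "e \<in> cut {v}") auto
  then show ?thesis by (auto simp: joins_def in_cut_single)
qed

lemma joins_trans:
  assumes "joins J a b" "joins K b c"
  shows "joins (sym_diff J K) a c"
  using assms unfolding joins_def by (auto simp: odd_card_sym_diff_Int)

lemma even_set_sym_diff: "even_set A \<Longrightarrow> even_set B \<Longrightarrow> even_set (sym_diff A B)"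
  using joins_trans[of A undefined undefined B undefined] by (simp add: joins_refl_iff)

lemma joins_even: "joins J a b \<Longrightarrow> even_set C \<Longrightarrow> joins (sym_diff J C) a b"
  using joins_trans[of J a b C b] by (simp add: joins_refl_iff)

lemma joins_joins_even: "joins J a b \<Longrightarrow> joins K a b \<Longrightarrow> even_set (sym_diff J K)"
  using joins_trans[of J a b K a] joins_sym by (simp add: joins_refl_iff)

lemma even_set_Diff: "even_set A \<Longrightarrow> even_set B \<Longrightarrow> B \<subseteq> A \<Longrightarrow> even_set (A - B)"
  using even_set_sym_diff[of A B] by (simp add: Diff_eq_empty_iff[THEN iffD2])

lemma even_set_Un: "even_set A \<Longrightarrow> even_set B \<Longrightarrow> A \<inter> B = {} \<Longrightarrow> even_set (A \<union> B)"
  using even_set_sym_diff[of A B] by (simp add: Diff_triv Int_commute)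

lemma joins_Diff_even: "joins J a b \<Longrightarrow> even_set C \<Longrightarrow> C \<subseteq> J \<Longrightarrow> joins (J - C) a b"
  using joins_even[of J a b C] by (simp add: Diff_eq_empty_iff[THEN iffD2])

lemma joins_Un: "joins J a b \<Longrightarrow> joins K b c \<Longrightarrow> J \<inter> K = {} \<Longrightarrow> joins (J \<union> K) a c"
  using joins_trans[of J a b K c] by (simp add: Diff_triv Int_commute)

lemma joins_Diff: "joins J a b \<Longrightarrow> joins K a c \<Longrightarrow> K \<subseteq> J \<Longrightarrow> joins (J - K) c b"
  using joins_trans[of K c a J b] joins_sym[of K a c]
  by (simp add: Diff_eq_empty_iff[THEN iffD2])

lemma even_set_loop: "t e = h e \<Longrightarrow> even_set {e}"
  using joins_edge[of e] by (simp add: joins_refl_iff)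

text \<open>Handshake modulo 2: in the sum of the degrees over \<open>S\<close>, an edge inside
  \<open>S\<close> counts twice and an edge of \<open>cut S\<close> once.\<close>

lemma odd_cut_handshake:
  assumes "finite J"
  shows "odd (card (J \<inter> cut S)) \<longleftrightarrow> odd (card {v \<in> S. odd (card (J \<inter> cut {v}))})"
  using assms
proof (induction J)
  case empty
  then show ?case by simp
next
  case (insert e J)
  have ins: "odd (card (insert e J \<inter> X)) \<longleftrightarrow> odd (card (J \<inter> X)) \<noteq> (e \<in> X)" for X
    using insert by (cases "e \<in> X") auto
  have fin: "finite {v \<in> S. odd (card (J \<inter> cut {v}))}"
  proof (rule finite_subset)
    show "{v \<in> S. odd (card (J \<inter> cut {v}))} \<subseteq> ends J"
    proof
      fix v assume "v \<in> {v \<in> S. odd (card (J \<inter> cut {v}))}"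
      then have "J \<inter> cut {v} \<noteq> {}" by (auto intro: ccontr)
      then show "v \<in> ends J" by (auto simp: in_cut_single ends_def)
    qed
    show "finite (ends J)" using insert by (simp add: ends_def)
  qed
  have eq: "{v \<in> S. odd (card (insert e J \<inter> cut {v}))} =
      sym_diff {v \<in> S. odd (card (J \<inter> cut {v}))} {v \<in> S. e \<in> cut {v}}"
    by (auto simp: ins)
  have fin2: "finite {v \<in> S. e \<in> cut {v}}"
    by (rule finite_subset[of _ "{t e, h e}"]) (auto simp: in_cut_single)
  have "odd (card {v \<in> S. e \<in> cut {v}}) \<longleftrightarrow> e \<in> cut S"
  proof -
    have "{v \<in> S. e \<in> cut {v}} = (if t e = h e then {} else {t e, h e} \<inter> S)"
      by (auto simp: in_cut_single)
    then show ?thesis by (auto simp: cut_def Int_insert_left)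
  qed
  then show ?case
    using insert.IH by (simp only: ins[of "cut S"] eq odd_card_sym_diff[OF fin fin2])
qed

lemma joins_cut:
  assumes "joins J a b"
  shows "odd (card (J \<inter> cut S)) \<longleftrightarrow> (a \<in> S) \<noteq> (b \<in> S)"
proof -
  have "{v \<in> S. odd (card (J \<inter> cut {v}))} = (if a = b then {} else {a, b} \<inter> S)"
    using assms by (auto simp: joins_def)
  then show ?thesis
    using odd_cut_handshake[of J S] assms by (auto simp: joins_def Int_insert_left)
qed

lemma even_set_cut: "even_set J \<Longrightarrow> even (card (J \<inter> cut S))"
  using joins_cut[of J undefined undefined S] by (simp add: joins_refl_iff)

lemma conn_refl: "conn E a a"
  unfolding conn_def using joins_empty by blast

lemma conn_sym: "conn E a b \<Longrightarrow> conn E b a"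
  unfolding conn_def using joins_sym by blast

lemma conn_trans:
  assumes "conn E a b" "conn E b c" shows "conn E a c"
proof -
  obtain J K where "J \<subseteq> E" "joins J a b" "K \<subseteq> E" "joins K b c"
    using assms unfolding conn_def by blast
  then show ?thesis unfolding conn_def using joins_trans[of J a b K c] by (intro exI[of _ "sym_diff J K"]) auto
qed

lemma conn_mono: "conn E a b \<Longrightarrow> E \<subseteq> F \<Longrightarrow> conn F a b"
  unfolding conn_def by blast

lemma conn_edge: "e \<in> E \<Longrightarrow> conn E (t e) (h e)"
  unfolding conn_def using joins_edge by blast

lemma comp_cut: "E \<inter> cut {v. conn E a v} = {}"
proof -
  have "conn E a (t e) \<longleftrightarrow> conn E a (h e)" if "e \<in> E" for e
    using conn_edge[OF that] conn_trans conn_sym by metis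
  then show ?thesis unfolding cut_def by auto
qed

text \<open>The usual substitute for induction on paths: \<open>S\<close> is chosen as the set of
  vertices that are already known to be reachable, and it remains to see that no edge leaves
  it.\<close>

lemma conn_closed:
  assumes "conn E a b" "E \<inter> cut S = {}" shows "a \<in> S \<longleftrightarrow> b \<in> S"
proof -
  obtain J where J: "J \<subseteq> E" "joins J a b" using assms unfolding conn_def by blast
  then have "J \<inter> cut S = {}" using assms by blast
  then show ?thesis using joins_cut[OF J(2), of S] by auto
qed

text \<open>The component of \<open>a\<close> in \<open>P\<close> without the edges at \<open>b\<close> is left by an edge at \<open>b\<close>.\<close>

lemma joins_once:
  assumes "joins P a b" "a \<noteq> b"
  obtains Q e c where "Q \<subseteq> P" "e \<in> P" "e \<in> cut {b}" "Q \<inter> cut {b} = {}" "joins Q a c"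
    "joins (insert e Q) a b" "{t e, h e} = {b, c}"
proof -
  let ?P = "P - cut {b}"
  let ?S = "{v. conn ?P a v}"
  have "b \<notin> ?S"
  proof
    assume "b \<in> ?S"
    then have "conn ?P a b" by simp
    then have "a \<in> {b} \<longleftrightarrow> b \<in> {b}" by (rule conn_closed) auto
    then show False using assms by simp
  qed
  moreover have "a \<in> ?S" by (simp add: conn_refl)
  ultimately have "odd (card (P \<inter> cut ?S))" using joins_cut[OF assms(1), of ?S] by blast
  then obtain e where e: "e \<in> P" "e \<in> cut ?S" by (metis Int_iff card.empty equals0I odd_pos less_irrefl)
  have eb: "e \<in> cut {b}" using comp_cut[of ?P a] e by blast
  define c where "c = (if t e = b then h e else t e)"
  have ec: "{t e, h e} = {b, c}" "c \<noteq> b" using eb by (auto simp: c_def in_cut_single)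
  have "c \<in> ?S" using e(2) ec \<open>b \<notin> ?S\<close> unfolding cut_def doubleton_eq_iff by auto
  then obtain Q where Q: "Q \<subseteq> ?P" "joins Q a c" unfolding conn_def by blast
  have ee: "joins {e} c b" using joins_edge[of e] ec(1) joins_sym unfolding doubleton_eq_iff by auto
  have "joins (insert e Q) a b"
    using joins_Un[OF Q(2) ee] Q(1) eb by auto
  moreover have "Q \<subseteq> P" "Q \<inter> cut {b} = {}" using Q(1) by blast+
  ultimately show thesis using that e(1) eb Q(2) ec(1) by metis
qed

text \<open>The handshake within the component of \<open>g\<close>: the number of odd vertices there
  is even, so \<open>g\<close> is not the only one.\<close>

lemma odd_vertex_partner:
  assumes "finite J" "odd (card (J \<inter> cut {g}))"
  obtains g' K where "g' \<noteq> g" "odd (card (J \<inter> cut {g'}))" "K \<subseteq> J" "joins K g g'"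
proof -
  let ?S = "{v. conn J g v}"
  have "even (card {v \<in> ?S. odd (card (J \<inter> cut {v}))})"
    using odd_cut_handshake[OF assms(1), of ?S] comp_cut[of J g] by simp
  moreover have "g \<in> {v \<in> ?S. odd (card (J \<inter> cut {v}))}" using assms conn_refl by simp
  ultimately have "{v \<in> ?S. odd (card (J \<inter> cut {v}))} \<noteq> {g}" by auto
  then obtain g' where "g' \<noteq> g" "conn J g g'" "odd (card (J \<inter> cut {g'}))"
    using \<open>g \<in> _\<close> by blast
  then show thesis using that unfolding conn_def by blast
qed

lemma even_set_meets_twice:
  assumes "even_set C" "e \<in> C" "e \<in> cut S"
  obtains e' where "e' \<in> C" "e' \<in> cut S" "e' \<noteq> e"
proof -
  have "even (card (C \<inter> cut S))" using even_set_cut assms by blast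
  then have "C \<inter> cut S \<noteq> {e}" by auto
  then show thesis using assms that by blast
qed

text \<open>Each edge of \<open>D\<close> is closed to an even set by a join in \<open>T\<close>. In
  the sum modulo 2 of these sets only edges of \<open>T\<close> can cancel, so all of
  \<open>D\<close> survives.\<close>

lemma even_completion:
  assumes "finite D" "D \<inter> T = {}" "\<And>e. e \<in> D \<Longrightarrow> conn T (t e) (h e)"
  obtains J where "J \<subseteq> T" "even_set (D \<union> J)"
proof -
  have "\<exists>J\<subseteq>T. even_set (D \<union> J)" using assms
  proof (induction D)
    case empty
    then show ?case by (intro exI[of _ "{}"]) auto
  next
    case (insert e D)
    then obtain J where J: "J \<subseteq> T" "even_set (D \<union> J)" by auto
    obtain K where K: "K \<subseteq> T" "joins K (t e) (h e)" using insert.prems(2)[of e] unfolding conn_def by auto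
    have "joins (insert e K) (t e) (t e)"
      using joins_Un[OF K(2) joins_sym[OF joins_edge[of e]]] K(1) insert.prems(1) by auto
    then have "even_set (sym_diff (D \<union> J) (insert e K))"
      using even_set_sym_diff J(2) by (simp add: joins_refl_iff)
    moreover have "sym_diff (D \<union> J) (insert e K) = insert e D \<union> sym_diff J K"
      using insert.hyps insert.prems(1) J K by auto
    ultimately show ?case using J K by (intro exI[of _ "sym_diff J K"]) auto
  qed
  then show thesis using that by blast
qed

section \<open>Circuits as minimal elements of the cycle space\<close>

definition circ :: "'b set \<Rightarrow> bool" where
  "circ C \<longleftrightarrow> even_set C \<and> C \<noteq> {} \<and> (\<forall>D\<subseteq>C. even_set D \<longrightarrow> D = {} \<or> D = C)"

lemma circD: "circ C \<Longrightarrow> even_set C" "circ C \<Longrightarrow> C \<noteq> {}" "circ C \<Longrightarrow> finite C"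
  by (auto simp: circ_def even_set_def)

lemma circ_sub: "circ C \<Longrightarrow> D \<subseteq> C \<Longrightarrow> even_set D \<Longrightarrow> D \<noteq> {} \<Longrightarrow> D = C"
  by (auto simp: circ_def)

lemma circ_loop: "circ C \<Longrightarrow> x \<in> C \<Longrightarrow> t x = h x \<Longrightarrow> C = {x}"
  using even_set_loop[of x] circ_sub[of C "{x}"] by auto

text \<open>A circuit has degree two: the join that is left after removing \<open>e\<close> contains
  one that uses a single edge at \<open>b\<close>. Together with \<open>e\<close> this is an even
  subset, so by minimality it is the whole circuit.\<close>

lemma circ_at:
  assumes "circ C" "e \<in> C" "e \<in> cut {b}"
  obtains e' where "e' \<noteq> e" "C \<inter> cut {b} = {e, e'}"
proof -
  define c where "c = (if t e = b then h e else t e)"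
  have c: "{t e, h e} = {b, c}" "c \<noteq> b" using assms by (auto simp: c_def in_cut_single)
  have e: "joins {e} b c" using joins_edge[of e] joins_sym c(1) by (auto simp: doubleton_eq_iff)
  have "joins (C - {e}) c b"
  proof -
    have "joins C b b" using circD assms by (simp add: joins_refl_iff)
    then show ?thesis using joins_Diff[OF _ e] assms by auto
  qed
  then obtain Q e' c' where Q: "Q \<subseteq> C - {e}" "e' \<in> C - {e}" "e' \<in> cut {b}" "Q \<inter> cut {b} = {}"
      "joins (insert e' Q) c b"
    using c(2) by (rule joins_once)
  have "joins (insert e' Q \<union> {e}) c c"
    using joins_Un[OF Q(5) e] Q by auto
  then have "even_set (insert e' Q \<union> {e})" by (simp add: joins_refl_iff)
  moreover have "insert e' Q \<union> {e} \<subseteq> C" using Q assms by auto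
  ultimately have "C = insert e' Q \<union> {e}" using circ_sub[OF assms(1)] by blast
  then have "C \<inter> cut {b} = {e, e'}" using Q(3,4) assms(3) by blast
  then show thesis using that Q(2) by blast
qed

lemma even_set_inside:
  assumes "even_set C" "C \<inter> cut S = {}"
  shows "even_set {x \<in> C. t x \<in> S}"
proof -
  have "{x \<in> C. t x \<in> S} \<inter> cut {v} = (if v \<in> S then C \<inter> cut {v} else {})" for v
    using assms(2) unfolding cut_def by auto
  then show ?thesis using assms(1) by (auto simp: even_set_def)
qed

text \<open>The edges of one component form an even subset, which by minimality is
  everything.\<close>

lemma circ_conn:
  assumes "circ C" "u \<in> ends C" "v \<in> ends C"
  shows "conn C u v"
proof -
  let ?S = "{v. conn C u v}"
  have d: "C \<inter> cut ?S = {}" by (rule comp_cut)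
  have eq: "t x \<in> ?S \<longleftrightarrow> h x \<in> ?S" if "x \<in> C" for x using d that unfolding cut_def by blast
  obtain x where "x \<in> C" "u = t x \<or> u = h x" using assms(2) by (auto simp: ends_def)
  then have "x \<in> {x \<in> C. t x \<in> ?S}" using eq conn_refl[of C u] by auto
  then have "{x \<in> C. t x \<in> ?S} = C"
    using circ_sub[OF assms(1) _ even_set_inside[OF circD(1)[OF assms(1)] d]] by blast
  then show ?thesis using assms(3) eq unfolding ends_def by blast
qed

text \<open>Contraction of \<open>e\<close> is the renaming of \<open>t e\<close> to
  \<open>h e\<close>, so the types of vertices and edges stay the same. In the contracted graph only
  the sum of the degrees at the two ends of \<open>e\<close> is known to be even: either both are
  even, or both are odd and adding \<open>e\<close> repairs them.\<close>

lemma contract_even: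
  assumes "multigraph.even_set ((\<lambda>v. if v = t e then h e else v) \<circ> t) ((\<lambda>v. if v = t e then h e else v) \<circ> h) C"
    and "e \<notin> C"
  shows "even_set C \<or> even_set (insert e C)"
proof -
  let ?r = "\<lambda>v. if v = t e then h e else v"
  have cut': "multigraph.cut (?r \<circ> t) (?r \<circ> h) S = cut (?r -` S)" for S
    by (auto simp: multigraph.cut_def)
  have fin: "finite C" using assms(1) by (simp add: multigraph.even_set_def)
  have ev: "even (card (C \<inter> cut (?r -` {v})))" for v
    using assms(1) cut' by (simp add: multigraph.even_set_def)
  show ?thesis
  proof (cases "t e = h e")
    case True
    then have "?r -` {v} = {v}" for v by auto
    then show ?thesis using ev fin by (simp add: even_set_def)
  next
    case False
    have v: "even (card (C \<inter> cut {v}))" if "v \<noteq> t e" "v \<noteq> h e" for v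
    proof -
      have "?r -` {v} = {v}" using that by auto
      then show ?thesis using ev[of v] by simp
    qed
    have "?r -` {h e} = {t e, h e}" by auto
    then have "even (card (C \<inter> cut {t e, h e}))" using ev[of "h e"] by simp
    then have "even (card {v \<in> {t e, h e}. odd (card (C \<inter> cut {v}))})"
      using odd_cut_handshake[OF fin] by blast
    moreover have "{v \<in> {t e, h e}. odd (card (C \<inter> cut {v}))} =
        (if odd (card (C \<inter> cut {t e})) then {t e} else {}) \<union> (if odd (card (C \<inter> cut {h e})) then {h e} else {})"
      by auto
    ultimately have same: "odd (card (C \<inter> cut {t e})) \<longleftrightarrow> odd (card (C \<inter> cut {h e}))"
      using False by (auto split: if_splits)
    show ?thesis
    proof (cases "odd (card (C \<inter> cut {t e}))")
      case True
      then have "joins C (t e) (h e)" using v same fin False unfolding joins_def by metis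
      then have "joins (C \<union> {e}) (t e) (t e)"
        using joins_Un[OF _ joins_sym[OF joins_edge]] assms(2) by blast
      then show ?thesis by (simp add: joins_refl_iff)
    next
      case False
      then show ?thesis using v same fin unfolding even_set_def by metis
    qed
  qed
qed

text \<open>
  \<open>P\<close> is an open trail of least weight, where the edges of \<open>F\<close> count negatively, and \<open>b\<close> is its
  last vertex. Then lowering all weights at \<open>b\<close> by one preserves the minimality of \<open>F\<close>.
\<close>

lemma light_join_step:
  fixes w :: "'b \<Rightarrow> nat"
  assumes fin: "finite E" and FE: "F \<subseteq> E" and F: "F \<noteq> {}"
    and w: "\<And>e. e \<in> E \<Longrightarrow> 1 \<le> w e"
    and cons: "\<And>C. C \<subseteq> E \<Longrightarrow> even_set C \<Longrightarrow> sum w (C \<inter> F) \<le> sum w (C - F)"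
    and par: "\<And>C. C \<subseteq> E \<Longrightarrow> even_set C \<Longrightarrow> even (sum w C)"
  shows "\<exists>b f. F \<inter> cut {b} = {f} \<and>
    (\<forall>C\<subseteq>E. even_set C \<longrightarrow> sum (\<lambda>e. if e \<in> cut {b} then w e - 1 else w e) (C \<inter> F) \<le>
       sum (\<lambda>e. if e \<in> cut {b} then w e - 1 else w e) (C - F))"
proof -
  define sg :: "'b \<Rightarrow> int" where "sg e = (if e \<in> F then - int (w e) else int (w e))" for e
  have sg: "sum sg C = int (sum w (C - F)) - int (sum w (C \<inter> F))" if "C \<subseteq> E" for C
  proof -
    have f: "finite C" using that fin finite_subset by blast
    have "sum sg C = sum sg (C \<inter> F) + sum sg (C - F)" using sum.Int_Diff[OF f] by blast
    also have "sum sg (C \<inter> F) = - int (sum w (C \<inter> F))" by (simp add: sg_def sum_negf)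
    also have "sum sg (C - F) = int (sum w (C - F))" by (simp add: sg_def)
    finally show ?thesis by simp
  qed
  have cons': "0 \<le> sum sg C" if "C \<subseteq> E" "even_set C" for C
    using sg[OF that(1)] cons[OF that] by linarith
  define PP where "PP = {P. P \<subseteq> E \<and> (\<exists>a b. joins P a b)}"
  \<comment> \<open>Lexicographic order, weight before number of edges, as \<open>card E + 1\<close>
    exceeds every number of edges that occurs. The second criterion makes every proper part of
    \<open>P\<close> that is again a join strictly heavier than \<open>P\<close>.\<close>
  define key where "key P = sum sg P * (int (card E) + 1) + int (card P)" for P
  have "finite PP" unfolding PP_def using fin by simp
  moreover have "{} \<in> PP" unfolding PP_def using joins_empty by blast
  ultimately obtain P where P: "P \<in> PP" "\<And>P'. P' \<in> PP \<Longrightarrow> key P \<le> key P'"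
    using finite_ex_least[of PP "{}" key] by blast
  have cardle: "card P' \<le> card E" if "P' \<in> PP" for P' using that fin card_mono unfolding PP_def by blast
  have M1: "sum sg P \<le> sum sg P'" if "P' \<in> PP" for P'
  proof (rule ccontr)
    assume "\<not> sum sg P \<le> sum sg P'"
    then have "sum sg P' + 1 \<le> sum sg P" by simp
    then have "(sum sg P' + 1) * (int (card E) + 1) \<le> sum sg P * (int (card E) + 1)"
      by (intro mult_right_mono) auto
    then have "key P' < key P" using cardle[OF that] unfolding key_def by (simp add: algebra_simps)
    then show False using P(2)[OF that] by simp
  qed
  have M2: "card P \<le> card P'" if "P' \<in> PP" "sum sg P' \<le> sum sg P" for P'
    using P(2)[OF that(1)] M1[OF that(1)] that(2) unfolding key_def by simp
  obtain a b where ab: "joins P a b" and PE: "P \<subseteq> E" using P(1) unfolding PP_def by blast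
  have PPI: "P' \<in> PP" if "P' \<subseteq> E" "joins P' x y" for P' x y using that unfolding PP_def by blast
  have finP: "finite P" using ab by (rule joinsD)
  obtain f0 where f0: "f0 \<in> F" using F by blast
  have "sum sg {f0} < 0" using f0 w[of f0] FE by (auto simp: sg_def)
  moreover have "{f0} \<in> PP" using PPI joins_edge f0 FE by blast
  ultimately have neg: "sum sg P < 0" using M1 by fastforce
  have anb: "a \<noteq> b" using neg cons'[OF PE] ab joins_refl_iff by auto
  obtain Q e0 c0 where Q: "Q \<subseteq> P" "e0 \<in> P" "e0 \<in> cut {b}" "Q \<inter> cut {b} = {}" "joins Q a c0"
      "joins (insert e0 Q) a b" "{t e0, h e0} = {b, c0}"
    using ab anb by (rule joins_once)
  \<comment> \<open>A smaller join with the same ends differs from \<open>P\<close> by an even set.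
    This has nonnegative weight, so the smaller join would be no heavier.\<close>
  have sub_eq: "P' = P" if "P' \<subseteq> P" "joins P' a b" for P'
  proof -
    have e: "even_set (P - P')" using joins_joins_even[OF ab that(2)] that(1) by (simp add: Diff_eq_empty_iff[THEN iffD2])
    have "sum sg P = sum sg P' + sum sg (P - P')"
      using sum.subset_diff[OF that(1) finP, of sg] by simp
    then have "sum sg P' \<le> sum sg P" using cons'[OF _ e] PE by auto
    then have "card P \<le> card P'" using M2 PPI[OF _ that(2)] that(1) PE by blast
    then show ?thesis using that(1) finP card_seteq by blast
  qed
  have PQ: "insert e0 Q = P" using sub_eq Q(1,2,6) by blast
  have Pb: "P \<inter> cut {b} = {e0}" using PQ Q(3,4) by blast
  have e0Q: "e0 \<notin> Q" using Q(3,4) by blast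
  \<comment> \<open>A last edge of positive weight could be dropped.\<close>
  have e0F: "e0 \<in> F"
  proof (rule ccontr)
    assume "e0 \<notin> F"
    then have "sg e0 > 0" using w[of e0] Q(2) PE by (auto simp: sg_def)
    moreover have "sum sg P = sg e0 + sum sg Q"
      using PQ e0Q finP by (metis finite_insert sum.insert)
    moreover have "sum sg P \<le> sum sg Q" using M1 PPI Q(1,5) PE by blast
    ultimately show False by simp
  qed
  \<comment> \<open>A second edge of \<open>F\<close> at \<open>b\<close> would prolong
    \<open>P\<close> to a lighter join.\<close>
  have Fb: "F \<inter> cut {b} = {e0}"
  proof -
    have "f = e0" if f: "f \<in> F" "f \<in> cut {b}" for f
    proof (rule ccontr)
      assume "f \<noteq> e0"
      then have fP: "f \<notin> P" using Pb f by blast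
      define c where "c = (if t f = b then h f else t f)"
      have "joins {f} b c" using joins_edge[of f] joins_sym f(2) by (auto simp: c_def in_cut_single)
      then have "joins (P \<union> {f}) a c" using joins_Un ab fP by blast
      moreover have "P \<union> {f} \<subseteq> E" using PE f FE by blast
      ultimately have "sum sg P \<le> sum sg (P \<union> {f})" using M1 PPI by blast
      also have "\<dots> = sum sg P + sg f" using fP finP by simp
      finally show False using w[of f] f FE by (auto simp: sg_def)
    qed
    then show ?thesis using e0F Q(3) by blast
  qed
  \<comment> \<open>The signed form of lowering all weights at \<open>b\<close>: edges of
    \<open>F\<close> gain one, the others lose one.\<close>
  define sg' where "sg' e = sg e + (if e \<in> cut {b} then (if e \<in> F then 1 else -1) else 0)" for e
  have main: "0 \<le> sum sg' C" if "C \<subseteq> E" "even_set C" for C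
    using that
  proof (induction "card C" arbitrary: C rule: less_induct)
    case less
    have finC: "finite C" using less.prems even_setD by blast
    show ?case
    proof (cases "C = {} \<or> circ C")
      case False
      then obtain D where D: "D \<subseteq> C" "even_set D" "D \<noteq> {}" "D \<noteq> C"
        using less.prems unfolding circ_def by blast
      have "card D < card C" "card (C - D) < card C"
        using D finC by (auto intro!: psubset_card_mono)
      moreover have "even_set (C - D)" using even_set_Diff less.prems D by blast
      ultimately have "0 \<le> sum sg' D" "0 \<le> sum sg' (C - D)"
        using less.hyps less.prems D by blast+
      then show ?thesis using sum.subset_diff[OF D(1) finC, of sg'] by simp
    next
      case True
      show ?thesis
      proof (cases "C \<inter> cut {b} = {}")
        case True
        then have "sum sg' C = sum sg C" by (intro sum.cong) (auto simp: sg'_def)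
        then show ?thesis using cons' less.prems by simp
      next
        case False
        then have C: "circ C" using \<open>C = {} \<or> circ C\<close> by blast
        obtain e1 where e1: "e1 \<in> C" "e1 \<in> cut {b}" using False by blast
        obtain e2 where e2: "e2 \<noteq> e1" "C \<inter> cut {b} = {e1, e2}" using circ_at[OF C e1] by blast
        define d where "d e = (if e \<in> cut {b} then (if e \<in> F then 1 else -1) else 0 :: int)" for e
        have "sum d C = sum d (C \<inter> cut {b})"
          using finC by (intro sum.mono_neutral_right) (auto simp: d_def)
        then have dC: "sum d C = d e1 + d e2" using e2 by simp
        have sC: "sum sg' C = sum sg C + sum d C"
          unfolding sum.distrib[symmetric] by (intro sum.cong) (auto simp: sg'_def d_def)
        show ?thesis
        \<comment> \<open>If one of the two edges at \<open>b\<close> is \<open>e0\<close>, the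
          changes cancel. Otherwise the circuit loses two; since its weight is even and nonnegative,
          only weight zero would be harmful.\<close>
        proof (cases "e0 \<in> C")
          case True
          then have "e0 \<in> {e1, e2}" using e2 Q(3) by blast
          moreover have "e1 \<in> cut {b}" "e2 \<in> cut {b}" using e2 by blast+
          ultimately have "d e1 + d e2 = 0" using Fb e2(1) e0F by (auto simp: d_def)
          then show ?thesis using sC dC cons' less.prems by simp
        next
          case e0C: False
          have e2': "e2 \<in> C" "e2 \<in> cut {b}" using e2(2) by auto
          have nF: "x \<notin> F" if "x \<in> C" "x \<in> cut {b}" for x
            using that Fb e0C by (metis IntI singletonD)
          have "e1 \<notin> F" "e2 \<notin> F" using nF e1 e2' by simp_all
          then have d2: "sum d C = -2" using dC e1 e2' by (simp add: d_def)
          have "even (sum sg C)"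
          proof -
            have "even (sum w (C \<inter> F) + sum w (C - F))" using par[OF less.prems] sum.Int_Diff[OF finC, of w F] by simp
            then show ?thesis unfolding sg[OF less.prems(1)] by (simp del: of_nat_sum)
          qed
          moreover have "sum sg C \<noteq> 0"
          proof
            assume z: "sum sg C = 0"
            have noloop: "t x \<noteq> h x" if "x \<in> C" for x
              using circ_loop[OF C that] e1 e2(1) e2' by (metis singletonD)
            \<comment> \<open>\<open>NZ\<close> consists of the edges at the vertices of
              \<open>C\<close> other than \<open>b\<close>, so \<open>?S\<close> is what
              \<open>P\<close> reaches from \<open>b\<close> before it touches \<open>C\<close>
              elsewhere.\<close>
            define Z where "Z = ends C - {b}"
            define NZ where "NZ = {x. t x \<in> Z \<or> h x \<in> Z}"
            let ?S = "{v. conn (P - NZ) b v}"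
            have SZ: "?S \<inter> Z = {}"
            proof -
              have "(P - NZ) \<inter> cut Z = {}" by (auto simp: NZ_def cut_def)
              then show ?thesis using conn_closed[of "P - NZ" b _ Z] by (auto simp: Z_def)
            qed
            have onlyb: "False" if "x \<in> C" "x \<notin> NZ" for x
              using that noloop[OF that(1)] unfolding NZ_def Z_def ends_def by auto
            show False
            proof (cases "a \<in> ?S")
              \<comment> \<open>If \<open>P\<close> meets \<open>C\<close> only in \<open>b\<close>,
                it can be prolonged by \<open>C - {e1}\<close>, whose weight \<open>- sg e1\<close>
                is negative because \<open>C\<close> weighs nothing.\<close>
              case True
              then obtain P' where "P' \<subseteq> P - NZ" "joins P' b a" unfolding conn_def by blast
              then have "P \<inter> NZ = {}" using sub_eq[of P'] joins_sym by blast
              then have dis: "P \<inter> C = {}" using onlyb by blast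
              define c where "c = (if t e1 = b then h e1 else t e1)"
              have "joins {e1} b c" using joins_edge[of e1] joins_sym e1(2) by (auto simp: c_def in_cut_single)
              then have "joins (C - {e1}) b c"
                using joins_Diff[of C b b "{e1}" c] circD(1)[OF C] e1(1) joins_sym by (auto simp: joins_refl_iff)
              then have "joins (P \<union> (C - {e1})) a c" using joins_Un[OF ab] dis by blast
              then have "sum sg P \<le> sum sg (P \<union> (C - {e1}))"
                using M1[OF PPI[of "P \<union> (C - {e1})" a c]] PE less.prems(1) by blast
              also have "\<dots> = sum sg P + sum sg (C - {e1})"
                using dis finP finC by (intro sum.union_disjoint) auto
              also have "sum sg (C - {e1}) = - sg e1"
                using sum_diff1[OF finC, of sg e1] e1(1) z by simp
              finally show False using \<open>e1 \<notin> F\<close> w[of e1] e1(1) less.prems(1) by (auto simp: sg_def)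
            next
              \<comment> \<open>Here \<open>p\<close> is the vertex where \<open>P\<close>, read
                from \<open>b\<close>, first meets \<open>Z\<close>. The part between
                \<open>b\<close> and \<open>p\<close> is negative, as the remainder has fewer edges
                than \<open>P\<close> and is therefore heavier. Both arcs of \<open>C\<close>
                between \<open>p\<close> and \<open>b\<close> close this part to even sets, whose
                weights add up to twice the negative part plus the zero weight of
                \<open>C\<close>.\<close>
              case False
              moreover have "b \<in> ?S" by (simp add: conn_refl)
              ultimately have "odd (card (P \<inter> cut ?S))" using joins_cut[OF ab, of ?S] by blast
              then obtain g where g: "g \<in> P" "g \<in> cut ?S"
                by (metis Int_iff card.empty equals0I odd_pos less_irrefl)
              have gN: "g \<in> NZ" using comp_cut[of "P - NZ" b] g by blast
              obtain s p where sp: "{t g, h g} = {s, p}" "s \<in> ?S" "p \<notin> ?S"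
                using g(2) unfolding cut_def by auto
              have pZ: "p \<in> Z"
                using gN sp SZ unfolding NZ_def doubleton_eq_iff by auto
              obtain K where K: "K \<subseteq> P - NZ" "joins K b s" using sp(2) unfolding conn_def by blast
              have "joins {g} s p" using joins_edge[of g] joins_sym sp(1) by (auto simp: doubleton_eq_iff)
              moreover have gK: "g \<notin> K" using gN K by blast
              ultimately have P2: "joins (K \<union> {g}) b p" using joins_Un[OF K(2)] by blast
              have P2P: "K \<union> {g} \<subseteq> P" using K g by blast
              have "joins (P - (K \<union> {g})) a p" using joins_Diff[OF joins_sym[OF ab] P2 P2P] joins_sym by blast
              then have P1: "P - (K \<union> {g}) \<in> PP" using PPI[of "P - (K \<union> {g})" a p] PE by blast
              have "card (P - (K \<union> {g})) < card P" using g finP by (intro psubset_card_mono) auto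
              then have "sum sg P < sum sg (P - (K \<union> {g}))" using M2[OF P1] by linarith
              then have n2: "sum sg (K \<union> {g}) < 0"
                using sum.subset_diff[OF P2P finP, of sg] by simp
              have "g \<notin> C"
              proof
                assume gC: "g \<in> C"
                have "s \<in> ends C" using gC sp(1) unfolding ends_def doubleton_eq_iff by auto
                then have "s = b" using SZ sp(2) unfolding Z_def by blast
                then have "g \<in> cut {b}" using sp pZ unfolding in_cut_single Z_def doubleton_eq_iff by auto
                then have "g = e0" using Pb g(1) by (metis IntI singletonD)
                then show False using e0C gC by simp
              qed
              moreover have "K \<inter> C = {}" using K onlyb by blast
              ultimately have dis: "(K \<union> {g}) \<inter> C = {}" by blast
              have "b \<in> ends C" using e1 unfolding ends_def in_cut_single by auto
              then obtain D1 where D1: "D1 \<subseteq> C" "joins D1 p b"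
                using circ_conn[OF C, of p b] pZ unfolding conn_def Z_def by blast
              have D2: "joins (C - D1) b p"
                using joins_Diff[of C p p D1 b] D1 circD(1)[OF C] by (simp add: joins_refl_iff joins_sym)
              have "even_set ((K \<union> {g}) \<union> D1)" "even_set ((K \<union> {g}) \<union> (C - D1))"
                using joins_Un[OF P2 D1(2)] joins_Un[OF P2 joins_sym[OF D2]] dis D1(1)
                by (auto simp: joins_refl_iff)
              then have ge: "0 \<le> sum sg ((K \<union> {g}) \<union> D1)" "0 \<le> sum sg ((K \<union> {g}) \<union> (C - D1))"
                using cons'[of "(K \<union> {g}) \<union> D1"] cons'[of "(K \<union> {g}) \<union> (C - D1)"] P2P PE D1(1) less.prems(1)
                by blast+
              have fK: "finite (K \<union> {g})" using P2P finP finite_subset by blast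
              have "sum sg ((K \<union> {g}) \<union> D1) = sum sg (K \<union> {g}) + sum sg D1"
                using fK finC D1(1) dis by (intro sum.union_disjoint) (auto intro: finite_subset)
              moreover have "sum sg ((K \<union> {g}) \<union> (C - D1)) = sum sg (K \<union> {g}) + sum sg (C - D1)"
                using fK finC D1(1) dis by (intro sum.union_disjoint) auto
              moreover have "sum sg C = sum sg (C - D1) + sum sg D1"
                using sum.subset_diff[OF D1(1) finC] by blast
              ultimately show False using ge n2 z by linarith
            qed
          qed
          moreover have "0 \<le> sum sg C" using cons' less.prems by blast
          ultimately have "2 \<le> sum sg C" by presburger
          then show ?thesis using sC d2 by simp
        qed
      qed
    qed
  qed
  let ?w' = "\<lambda>e. if e \<in> cut {b} then w e - 1 else w e"
  have "sum ?w' (C \<inter> F) \<le> sum ?w' (C - F)" if C: "C \<subseteq> E" "even_set C" for C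
  proof -
    have f: "finite C" using that fin finite_subset by blast
    have s1: "sum sg' (C \<inter> F) = - int (sum ?w' (C \<inter> F))"
      unfolding of_nat_sum sum_negf[symmetric]
      using w C(1) by (intro sum.cong refl) (auto simp: sg'_def sg_def of_nat_diff subset_iff)
    have s2: "sum sg' (C - F) = int (sum ?w' (C - F))"
      unfolding of_nat_sum
      using w C(1) by (intro sum.cong refl) (auto simp: sg'_def sg_def of_nat_diff subset_iff)
    show ?thesis using main[OF C] sum.Int_Diff[OF f, of sg' F] s1 s2 by linarith
  qed
  then show ?thesis using Fb by blast
qed

end

text \<open>
  A minimum \<open>T\<close>-join weighs at most a third of the graph if no \<open>T\<close>-cut has fewer than three
  edges. This is the consequence that is needed of Seymour's theorem on packing \<open>T\<close>-cuts; the
  proof follows Sebo.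
\<close>

lemma light_join:
  fixes t h :: "'b \<Rightarrow> 'a" and w :: "'b \<Rightarrow> nat"
  assumes "finite E" "F \<subseteq> E"
    and "\<And>C. C \<subseteq> E \<Longrightarrow> multigraph.even_set t h C \<Longrightarrow> sum w (C \<inter> F) \<le> sum w (C - F)"
    and "\<And>C. C \<subseteq> E \<Longrightarrow> multigraph.even_set t h C \<Longrightarrow> even (sum w C)"
    and "\<And>S. odd (card (F \<inter> multigraph.cut t h S)) \<Longrightarrow> 3 \<le> card (E \<inter> multigraph.cut t h S)"
  shows "3 * sum w F \<le> sum w E"
  using assms
\<comment> \<open>Lowering weights at a vertex decreases the first summand; contracting an edge of
  weight zero keeps it and decreases the second.\<close>
proof (induction "sum w E + card E" arbitrary: t h E F w rule: less_induct)
  case less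
  interpret multigraph t h .
  note fin = less.prems(1) and FE = less.prems(2) and cons = less.prems(3) and par = less.prems(4)
    and T = less.prems(5)
  show ?case
  proof (cases "\<exists>e\<in>E. w e = 0")
    case True
    then obtain e where e: "e \<in> E" "w e = 0" by blast
    let ?r = "\<lambda>v. if v = t e then h e else v"
    have cut': "multigraph.cut (?r \<circ> t) (?r \<circ> h) S = cut (?r -` S)" for S
      by (auto simp: multigraph.cut_def)
    have ecut: "e \<notin> cut (?r -` S)" for S by (auto simp: cut_def)
    have we: "sum w A = sum w (A - {e})" if "finite A" for A
    proof (cases "e \<in> A")
      case True
      then show ?thesis using sum.remove[OF that True, of w] e(2) by simp
    qed simp
    have lift: "sum w (C \<inter> (F - {e})) \<le> sum w (C - (F - {e})) \<and> even (sum w C)"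
      if C: "C \<subseteq> E - {e}" "multigraph.even_set (?r \<circ> t) (?r \<circ> h) C" for C
    proof -
      have eC: "e \<notin> C" using C(1) by blast
      have fC: "finite C" using C(1) fin finite_subset by blast
      obtain C' where C': "C' = C \<or> C' = insert e C" "even_set C'"
        using contract_even[OF C(2) eC] by blast
      have "C' \<subseteq> E" using C' C(1) e(1) by auto
      then have *: "sum w (C' \<inter> F) \<le> sum w (C' - F)" "even (sum w C')" using cons par C'(2) by blast+
      have fC': "finite C'" using C'(1) fC by auto
      have "C' \<inter> F - {e} = C \<inter> (F - {e})" "C' - F - {e} = C - (F - {e})" "C' - {e} = C"
        using C'(1) eC by auto
      then have "sum w (C' \<inter> F) = sum w (C \<inter> (F - {e}))" "sum w (C' - F) = sum w (C - (F - {e}))"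
          "sum w C' = sum w C"
        using we[of "C' \<inter> F"] we[of "C' - F"] we[of C'] fC' by (metis finite_Int, metis finite_Diff, metis)
      then show ?thesis using * by simp
    qed
    have "card (E - {e}) < card E" using e(1) fin by (meson card_Diff1_less)
    moreover have "sum w (E - {e}) = sum w E" using we[OF fin] by simp
    ultimately have m: "sum w (E - {e}) + card (E - {e}) < sum w E + card E" by simp
    have c: "3 \<le> card ((E - {e}) \<inter> multigraph.cut (?r \<circ> t) (?r \<circ> h) S)"
      if "odd (card ((F - {e}) \<inter> multigraph.cut (?r \<circ> t) (?r \<circ> h) S))" for S
    proof -
      have "(A - {e}) \<inter> cut (?r -` S) = A \<inter> cut (?r -` S)" for A using ecut by blast
      then show ?thesis using that T[of "?r -` S"] cut' by simp
    qed
    have "3 * sum w (F - {e}) \<le> sum w (E - {e})"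
    proof -
      have p: "finite (E - {e})" "F - {e} \<subseteq> E - {e}" using fin FE by blast+
      note l1 = lift[THEN conjunct1] and l2 = lift[THEN conjunct2]
      show ?thesis
        using less.hyps[where w=w and E="E - {e}" and F="F - {e}" and t="?r \<circ> t" and h="?r \<circ> h",
            OF m p l1 l2 c] .
    qed
    moreover have "finite F" using FE fin finite_subset by blast
    ultimately show ?thesis using we[OF fin] we[of F] by simp
  next
    case False
    then have w1: "\<And>e. e \<in> E \<Longrightarrow> 1 \<le> w e" by (metis less_one not_le)
    show ?thesis
    proof (cases "F = {}")
      case False
      obtain b f where bf: "F \<inter> cut {b} = {f}" and cons':
        "\<And>C. C \<subseteq> E \<Longrightarrow> even_set C \<Longrightarrow>
          sum (\<lambda>e. if e \<in> cut {b} then w e - 1 else w e) (C \<inter> F) \<le>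
          sum (\<lambda>e. if e \<in> cut {b} then w e - 1 else w e) (C - F)"
        using light_join_step[OF fin FE False w1 cons par] by blast
      let ?w = "\<lambda>e. if e \<in> cut {b} then w e - 1 else w e"
      have sw: "sum ?w A + card (A \<inter> cut {b}) = sum w A" if "A \<subseteq> E" for A
      proof -
        have fA: "finite A" using that fin finite_subset by blast
        have "card (A \<inter> cut {b}) = (\<Sum>e\<in>A. if e \<in> cut {b} then 1 else 0)"
          using fA by (simp add: sum.If_cases)
        then have "sum ?w A + card (A \<inter> cut {b}) = (\<Sum>e\<in>A. ?w e + (if e \<in> cut {b} then 1 else 0))"
          by (simp add: sum.distrib)
        also have "\<dots> = sum w A"
        proof (intro sum.cong refl)
          fix x assume "x \<in> A"
          then have "1 \<le> w x" using w1 that by blast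
          then show "?w x + (if x \<in> cut {b} then 1 else 0) = w x" by simp
        qed
        finally show ?thesis .
      qed
      \<comment> \<open>The vertex \<open>b\<close> has one edge of \<open>F\<close> and therefore
        at least three of \<open>E\<close>: this is the factor three, as \<open>F\<close> loses one
        unit of weight and \<open>E\<close> at least three.\<close>
      have f3: "3 \<le> card (E \<inter> cut {b})" using T[of "{b}"] bf by simp
      have m: "sum ?w E + card E < sum w E + card E" using sw[of E] f3 by simp
      have par': "even (sum ?w C)" if "C \<subseteq> E" "even_set C" for C
        using sw[OF that(1)] par[OF that] even_set_cut[OF that(2), of "{b}"] by (metis even_add)
      have "3 * sum ?w F \<le> sum ?w E"
        using less.hyps[where w="?w" and E=E and F=F and t=t and h=h, OF m fin FE cons' par' T] .
      moreover have "sum ?w F + 1 = sum w F" using sw[OF FE] bf by simp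
      moreover have "sum ?w E + card (E \<inter> cut {b}) = sum w E" using sw[of E] by simp
      ultimately show ?thesis using f3 by linarith
    qed simp
  qed
qed

context multigraph
begin

text \<open>
  The weights make it expensive to meet a cut of three edges more than once; by parity every
  candidate meets it at least once.
\<close>

lemma thin_postman:
  assumes fin: "finite E" and br: "\<And>S. card (E \<inter> cut S) \<noteq> 1"
  obtains F where "F \<subseteq> E" "even_set (E - F)" "3 * card F \<le> card E"
    "\<And>S. card (E \<inter> cut S) = 3 \<Longrightarrow> card (F \<inter> cut S) = 1"
proof -
  define TT where "TT = {D. D \<subseteq> E \<and> (\<exists>S. D = E \<inter> cut S) \<and> card D = 3}"
  have finT: "finite TT" unfolding TT_def using fin by simp
  define K where "K = card E + 1"
  define w where "w e = 2 * (1 + K * card {D \<in> TT. e \<in> D})" for e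
  define CC where "CC = {F. F \<subseteq> E \<and> even_set (E - F)}"
  have "finite CC" "E \<in> CC" unfolding CC_def using fin by auto
  then obtain F where F: "F \<in> CC" "\<And>F'. F' \<in> CC \<Longrightarrow> sum w F \<le> sum w F'"
    using finite_ex_least[of CC E "sum w"] by blast
  have FE: "F \<subseteq> E" and ev: "even_set (E - F)" using F(1) unfolding CC_def by auto
  have finF: "finite F" using FE fin finite_subset by blast
  have cons: "sum w (C \<inter> F) \<le> sum w (C - F)" if C: "C \<subseteq> E" "even_set C" for C
  proof -
    have fC: "finite C" using C fin finite_subset by blast
    have "E - sym_diff F C = sym_diff (E - F) C" using FE C(1) by blast
    then have "sym_diff F C \<in> CC" unfolding CC_def using FE C(1) even_set_sym_diff[OF ev C(2)] by auto
    then have "sum w F \<le> sum w (sym_diff F C)" using F(2) by blast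
    also have "\<dots> = sum w (F - C) + sum w (C - F)" using finF fC by (intro sum.union_disjoint) auto
    also have "sum w F = sum w (F - C) + sum w (C \<inter> F)"
      using sum.Int_Diff[OF finF, of w C] by (simp add: Int_commute add.commute)
    finally show ?thesis by simp
  qed
  have par: "even (sum w C)" for C unfolding w_def by (intro dvd_sum) simp
  have odd_iff: "odd (card (F \<inter> cut S)) \<longleftrightarrow> odd (card (E \<inter> cut S))" for S
  proof -
    have "card (E \<inter> cut S) = card (F \<inter> cut S) + card ((E - F) \<inter> cut S)"
      using FE fin finF by (subst card_Un_disjoint[symmetric]) (auto intro: arg_cong[of _ _ card])
    then show ?thesis using even_set_cut[OF ev, of S] by simp
  qed
  have T: "3 \<le> card (E \<inter> cut S)" if "odd (card (F \<inter> cut S))" for S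
    using that odd_iff[of S] br[of S] odd_ge_3 by blast
  have main: "3 * sum w F \<le> sum w E"
    by (rule light_join[OF fin FE cons par T])
  have dc: "sum w A = 2 * card A + 2 * K * (\<Sum>D\<in>TT. card (A \<inter> D))" if "finite A" for A
  proof -
    have "(\<Sum>e\<in>A. card {D \<in> TT. e \<in> D}) = (\<Sum>e\<in>A. \<Sum>D\<in>TT. if e \<in> D then 1 else 0)"
      using finT by (simp add: sum.If_cases Collect_conj_eq)
    also have "\<dots> = (\<Sum>D\<in>TT. \<Sum>e\<in>A. if e \<in> D then 1 else 0)" by (rule sum.swap)
    also have "\<dots> = (\<Sum>D\<in>TT. card (A \<inter> D))" using that by (simp add: sum.If_cases)
    finally have "(\<Sum>e\<in>A. card {D \<in> TT. e \<in> D}) = (\<Sum>D\<in>TT. card (A \<inter> D))" .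
    moreover have "sum w A = (\<Sum>e\<in>A. 2 + 2 * K * card {D \<in> TT. e \<in> D})"
      by (intro sum.cong refl) (simp add: w_def)
    ultimately show ?thesis by (simp only: sum.distrib sum_distrib_left[symmetric] sum_constant) simp
  qed
  have E3: "(\<Sum>D\<in>TT. card (E \<inter> D)) = 3 * card TT"
  proof -
    have "card (E \<inter> D) = 3" if "D \<in> TT" for D using that unfolding TT_def by (auto simp: Int_absorb1)
    then show ?thesis by simp
  qed
  have odd1: "odd (card (F \<inter> D))" if D: "D \<in> TT" for D
  proof -
    obtain S where "D = E \<inter> cut S" "card D = 3" using D unfolding TT_def by auto
    moreover have "F \<inter> (E \<inter> cut S) = F \<inter> cut S" using FE by blast
    ultimately show ?thesis using odd_iff[of S] by simp
  qed
  have ineq: "3 * card F + 3 * (K * (\<Sum>D\<in>TT. card (F \<inter> D))) \<le> card E + 3 * (K * card TT)"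
    using main unfolding dc[OF finF] dc[OF fin] E3 by (simp add: algebra_simps)
  have ge: "card TT \<le> (\<Sum>D\<in>TT. card (F \<inter> D))"
  proof -
    have "1 \<le> card (F \<inter> D)" if "D \<in> TT" for D using odd_pos[OF odd1[OF that]] by simp
    then show ?thesis using sum_mono[of TT "\<lambda>_. 1" "\<lambda>D. card (F \<inter> D)"] by simp
  qed
  \<comment> \<open>Each cut of \<open>TT\<close> contributes three edges to \<open>E\<close> and at
    least one to \<open>F\<close>, so the factor three leaves room for nothing but equality.\<close>
  have eq: "(\<Sum>D\<in>TT. card (F \<inter> D)) = card TT"
  proof (rule ccontr)
    assume "\<not> ?thesis"
    then have "card TT + 1 \<le> (\<Sum>D\<in>TT. card (F \<inter> D))" using ge by simp
    then have "K * (card TT + 1) \<le> K * (\<Sum>D\<in>TT. card (F \<inter> D))" by (rule mult_le_mono2)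
    then show False using ineq unfolding K_def by simp
  qed
  have "3 * card F \<le> card E" using ineq unfolding eq by simp
  moreover have "card (F \<inter> cut S) = 1" if S: "card (E \<inter> cut S) = 3" for S
  proof -
    have D: "E \<inter> cut S \<in> TT" using S unfolding TT_def by auto
    have "card (F \<inter> D) = 1" if "D \<in> TT" for D
    proof (rule ccontr)
      assume "card (F \<inter> D) \<noteq> 1"
      then have "1 < card (F \<inter> D)" using odd_ge_3[OF odd1[OF that]] by simp
      moreover have "\<forall>D\<in>TT. 1 \<le> card (F \<inter> D)" using odd1 by (metis odd_pos One_nat_def Suc_leI)
      ultimately have "(\<Sum>D\<in>TT. 1) < (\<Sum>D\<in>TT. card (F \<inter> D))"
        using that by (intro sum_strict_mono_ex1[OF finT]) auto
      then show False using eq by simp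
    qed
    then have "card (F \<inter> (E \<inter> cut S)) = 1" using D by blast
    moreover have "F \<inter> (E \<inter> cut S) = F \<inter> cut S" using FE by blast
    ultimately show ?thesis by simp
  qed
  ultimately show thesis using that FE ev by blast
qed

section \<open>Disjoint connectors\<close>

lemma conn_iff_cut: "conn E a b \<longleftrightarrow> (\<forall>S. E \<inter> cut S = {} \<longrightarrow> (a \<in> S \<longleftrightarrow> b \<in> S))"
  using conn_closed comp_cut[of E a] conn_refl[of E a] by blast

definition ins :: "'b set \<Rightarrow> 'a set \<Rightarrow> 'b set" where
  "ins I U = {e \<in> I. t e \<in> U \<and> h e \<in> U}"

text \<open>The count of Nash-Williams for unions of two forests, at most \<open>2 (|U| - 1)\<close>
  edges inside \<open>U\<close>, written without subtraction. Sets with equality are called tight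
  below.\<close>

definition sparse :: "'a set \<Rightarrow> 'b set \<Rightarrow> bool" where
  "sparse V I \<longleftrightarrow> (\<forall>U\<subseteq>V. U \<noteq> {} \<longrightarrow> card (ins I U) + 2 \<le> 2 * card U)"

lemma sparseD: "sparse V I \<Longrightarrow> U \<subseteq> V \<Longrightarrow> U \<noteq> {} \<Longrightarrow> card (ins I U) + 2 \<le> 2 * card U"
  by (auto simp: sparse_def)

lemma finite_ins: "finite I \<Longrightarrow> finite (ins I U)"
  by (simp add: ins_def)

text \<open>Uncrossing: the number of edges inside a set is supermodular and its size is modular, so
  the bounds for union and intersection must both be attained. The bound for the intersection is
  available because it is nonempty.\<close>

lemma tight_Un:
  assumes "sparse V I" "finite V" "finite I" "U \<subseteq> V" "W \<subseteq> V" "U \<inter> W \<noteq> {}"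
    and "card (ins I U) + 2 = 2 * card U" "card (ins I W) + 2 = 2 * card W"
  shows "card (ins I (U \<union> W)) + 2 = 2 * card (U \<union> W)"
proof -
  have fU: "finite U" "finite W" using assms finite_subset by blast+
  have "ins I U \<inter> ins I W = ins I (U \<inter> W)" by (auto simp: ins_def)
  then have "card (ins I U) + card (ins I W) = card (ins I U \<union> ins I W) + card (ins I (U \<inter> W))"
    using card_Un_Int[of "ins I U" "ins I W"] assms(3) finite_ins by simp
  moreover have "card (ins I U \<union> ins I W) \<le> card (ins I (U \<union> W))"
    using assms(3) finite_ins by (intro card_mono) (auto simp: ins_def)
  moreover have "card (ins I (U \<inter> W)) + 2 \<le> 2 * card (U \<inter> W)"
    using assms(4,6) by (intro sparseD[OF assms(1)]) auto
  moreover have "card (ins I (U \<union> W)) + 2 \<le> 2 * card (U \<union> W)"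
  proof -
    have "U \<union> W \<subseteq> V" "U \<union> W \<noteq> {}" using assms(4-6) by auto
    then show ?thesis by (rule sparseD[OF assms(1)])
  qed
  moreover have "card U + card W = card (U \<union> W) + card (U \<inter> W)" using fU by (rule card_Un_Int)
  ultimately show ?thesis using assms(7,8) by linarith
qed

text \<open>The degrees add up to \<open>2 |I| = 4 |V| - 4\<close>, so their average is below
  four.\<close>

lemma small_degree:
  assumes "finite V" "V \<noteq> {}" "finite I" "\<And>e. e \<in> I \<Longrightarrow> t e \<in> V \<and> h e \<in> V"
    and noloop: "\<And>e. e \<in> I \<Longrightarrow> t e \<noteq> h e" and "card I + 2 = 2 * card V"
  obtains v where "v \<in> V" "card (I \<inter> cut {v}) \<le> 3"
proof -
  have "\<exists>v\<in>V. card (I \<inter> cut {v}) \<le> 3"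
  proof (rule ccontr)
    assume "\<not> ?thesis"
    then have "4 \<le> card (I \<inter> cut {v})" if "v \<in> V" for v using that by fastforce
    then have "4 * card V \<le> (\<Sum>v\<in>V. card (I \<inter> cut {v}))"
      using sum_mono[of V "\<lambda>_. 4" "\<lambda>v. card (I \<inter> cut {v})"] by (simp add: mult.commute)
    also have "\<dots> = (\<Sum>v\<in>V. \<Sum>e\<in>I. if e \<in> cut {v} then 1 else 0)"
      using assms(3) by (simp add: sum.If_cases)
    also have "\<dots> = (\<Sum>e\<in>I. \<Sum>v\<in>V. if e \<in> cut {v} then 1 else 0)" by (rule sum.swap)
    also have "\<dots> = (\<Sum>e\<in>I. card {v \<in> V. e \<in> cut {v}})"
      using assms(1) by (simp add: sum.If_cases Collect_conj_eq)
    also have "\<dots> = (\<Sum>e\<in>I. 2)"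
    proof (rule sum.cong[OF refl])
      fix e assume e: "e \<in> I"
      have "{v \<in> V. e \<in> cut {v}} = {t e, h e}"
        using assms(4)[OF e] noloop[OF e] by (auto simp: in_cut_single)
      then show "card {v \<in> V. e \<in> cut {v}} = 2" using noloop[OF e] by simp
    qed
    finally show False using assms(6) by simp
  qed
  then show thesis using that by blast
qed

end

text \<open>
  Edge sets with \<open>2 (|V| - 1)\<close> edges that are sparse are taken apart as in Henneberg's
  construction: a vertex of degree three is split off by replacing two of its edges by a new edge
  between their other ends. In the proof, one of the two edges takes the role of the new edge.
\<close>

lemma tight_split:
  fixes t h :: "'b \<Rightarrow> 'a"
  assumes "finite V" "V \<noteq> {}" "finite I" "\<And>e. e \<in> I \<Longrightarrow> t e \<in> V \<and> h e \<in> V"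
    and "multigraph.sparse t h V I" "card I + 2 = 2 * card V"
  shows "\<exists>T1 T2. T1 \<union> T2 = I \<and> T1 \<inter> T2 = {} \<and>
    (\<forall>u\<in>V. \<forall>v\<in>V. multigraph.conn t h T1 u v \<and> multigraph.conn t h T2 u v)"
  using assms
proof (induction "card V" arbitrary: t h V I rule: less_induct)
  case less
  interpret multigraph t h .
  note finV = less.prems(1) and V = less.prems(2) and finI = less.prems(3) and IV = less.prems(4)
    and sp = less.prems(5) and cI = less.prems(6)
  have noloop: "t e \<noteq> h e" if e: "e \<in> I" for e
  proof
    assume l: "t e = h e"
    have "e \<in> ins I {t e}" using e l by (simp add: ins_def)
    then have "card (ins I {t e}) > 0" using finite_ins[OF finI] card_gt_0_iff by blast
    moreover have "card (ins I {t e}) + 2 \<le> 2 * card {t e}"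
      using IV[OF e] by (intro sparseD[OF sp]) auto
    ultimately show False by simp
  qed
  show ?case
  proof (cases "card V = 1")
    case True
    then obtain v where "V = {v}" by (rule card_1_singletonE)
    moreover have "I = {}" using cI True finI by simp
    ultimately show ?thesis using conn_refl by auto
  next
    case False
    obtain v where v: "v \<in> V" "card (I \<inter> cut {v}) \<le> 3"
      using finV V finI IV noloop cI by (rule small_degree)
    define V' where "V' = V - {v}"
    have V': "finite V'" "V' \<noteq> {}" "card V' + 1 = card V" "card V' < card V"
    proof -
      show "finite V'" using finV by (simp add: V'_def)
      show 1: "card V' + 1 = card V" using v finV by (simp add: V'_def card_gt_0_iff V)
      show "card V' < card V" using 1 by simp
      show "V' \<noteq> {}" using 1 False by auto
    qed
    have insV': "ins I V' = I - cut {v}"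
      using IV noloop by (auto simp: ins_def V'_def in_cut_single)
    have cIv: "card I = card (I \<inter> cut {v}) + card (I - cut {v})"
      using finI card_Int_Diff by blast
    have "card (ins I V') + 2 \<le> 2 * card V'" using V' by (intro sparseD[OF sp]) (auto simp: V'_def)
    \<comment> \<open>At most \<open>2 |V'| - 2 = 2 |V| - 4\<close> edges avoid \<open>v\<close>, so
      at least two of the \<open>2 |V| - 2\<close> edges are at \<open>v\<close>.\<close>
    then have deg2: "2 \<le> card (I \<inter> cut {v})" using insV' cIv cI V'(3) by simp
    define x where "x e = (if t e = v then h e else t e)" for e
    have x: "{t e, h e} = {v, x e}" "x e \<in> V'" "x e \<noteq> v" if "e \<in> I \<inter> cut {v}" for e
      using that IV by (auto simp: x_def V'_def in_cut_single)
    have xcut: "e \<notin> cut S \<Longrightarrow> v \<in> S \<longleftrightarrow> x e \<in> S" if "e \<in> I \<inter> cut {v}" for e S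
      using x(1)[OF that] unfolding cut_def doubleton_eq_iff by auto
    have ext: "\<forall>u\<in>V. \<forall>w\<in>V. conn (insert e T) u w"
      if e: "e \<in> I \<inter> cut {v}" and T: "\<And>u w S. u \<in> V' \<Longrightarrow> w \<in> V' \<Longrightarrow> insert e T \<inter> cut S = {} \<Longrightarrow> u \<in> S \<longleftrightarrow> w \<in> S" for e T
    proof (intro ballI)
      fix u w assume uw: "u \<in> V" "w \<in> V"
      show "conn (insert e T) u w"
        unfolding conn_iff_cut
      proof (intro allI impI)
        fix S assume S: "insert e T \<inter> cut S = {}"
        then have "v \<in> S \<longleftrightarrow> x e \<in> S" using xcut[OF e] by blast
        moreover have "y \<in> S \<longleftrightarrow> x e \<in> S" if "y \<in> V'" for y using T[OF that x(2)[OF e] S] .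
        ultimately show "u \<in> S \<longleftrightarrow> w \<in> S" using uw unfolding V'_def by blast
      qed
    qed
    show ?thesis
    \<comment> \<open>In degree two, each of the connectors of the rest receives one of the two
      edges at \<open>v\<close>.\<close>
    proof (cases "card (I \<inter> cut {v}) = 2")
      case True
      then obtain e1 e2 where e: "I \<inter> cut {v} = {e1, e2}" "e1 \<noteq> e2" by (meson card_2_iff)
      have "sparse V' (I - cut {v})"
        unfolding sparse_def
      proof (intro allI impI)
        fix U assume U: "U \<subseteq> V'" "U \<noteq> {}"
        have "card (ins (I - cut {v}) U) \<le> card (ins I U)"
          using finI by (intro card_mono finite_ins) (auto simp: ins_def)
        then show "card (ins (I - cut {v}) U) + 2 \<le> 2 * card U"
          using sparseD[OF sp, of U] U unfolding V'_def by fastforce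
      qed
      moreover have "card (I - cut {v}) + 2 = 2 * card V'" using cIv True cI V'(3) by simp
      moreover have "t e \<in> V' \<and> h e \<in> V'" if "e \<in> I - cut {v}" for e
        using insV' that by (auto simp: ins_def)
      ultimately obtain T1 T2 where T: "T1 \<union> T2 = I - cut {v}" "T1 \<inter> T2 = {}"
          "\<forall>u\<in>V'. \<forall>w\<in>V'. conn T1 u w \<and> conn T2 u w"
        using less.hyps[OF V'(4,1,2), of "I - cut {v}" t h] finI by blast
      have "\<forall>u\<in>V. \<forall>w\<in>V. conn (insert e1 T1) u w"
        using T(3) conn_iff_cut e(1) by (intro ext) (blast+)
      moreover have "\<forall>u\<in>V. \<forall>w\<in>V. conn (insert e2 T2) u w"
        using T(3) conn_iff_cut e(1) by (intro ext) (blast+)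
      moreover have "insert e1 T1 \<union> insert e2 T2 = I" "insert e1 T1 \<inter> insert e2 T2 = {}"
      proof -
        have n: "e1 \<notin> T1 \<union> T2" "e2 \<notin> T1 \<union> T2" using T(1) e(1) by auto
        have "I = (I - cut {v}) \<union> {e1, e2}" using e(1) by blast
        then show "insert e1 T1 \<union> insert e2 T2 = I" using T(1) by auto
        show "insert e1 T1 \<inter> insert e2 T2 = {}" using n T(2) e(2) by auto
      qed
      ultimately show ?thesis
        by (intro exI[of _ "insert e1 T1"] exI[of _ "insert e2 T2"] conjI ballI) simp_all
    next
      case False
      then have c3: "card (I \<inter> cut {v}) = 3" using v(2) deg2 by simp
      define tight where "tight U \<longleftrightarrow> U \<subseteq> V' \<and> card (ins I U) + 2 = 2 * card U" for U
      \<comment> \<open>Adding \<open>v\<close> to such a set would add three edges, but the bound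
        grows by only two.\<close>
      have all3: "\<not> x ` (I \<inter> cut {v}) \<subseteq> U" if U: "tight U" for U
      proof
        assume sub: "x ` (I \<inter> cut {v}) \<subseteq> U"
        have fU: "finite U" "v \<notin> U" "U \<subseteq> V" using U V'(1) finite_subset unfolding tight_def V'_def by blast+
        have "ins I U \<union> (I \<inter> cut {v}) \<subseteq> ins I (insert v U)"
        proof -
          have "t e \<in> insert v U \<and> h e \<in> insert v U" if "e \<in> I \<inter> cut {v}" for e
            using x(1)[OF that] sub that unfolding doubleton_eq_iff by auto
          then show ?thesis by (auto simp: ins_def)
        qed
        moreover have "ins I U \<inter> (I \<inter> cut {v}) = {}" using fU by (auto simp: ins_def in_cut_single)
        ultimately have "card (ins I U) + 3 \<le> card (ins I (insert v U))"
          using card_mono[of "ins I (insert v U)"] finite_ins[OF finI] finI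
          by (metis c3 card_Un_disjoint finite_Int)
        moreover have "card (ins I (insert v U)) + 2 \<le> 2 * card (insert v U)"
          using fU v(1) by (intro sparseD[OF sp]) auto
        ultimately show False using U fU unfolding tight_def by simp
      qed
      have tUn: "tight (U \<union> W)" if "tight U" "tight W" "U \<inter> W \<noteq> {}" for U W
        using tight_Un[OF sp finV finI, of U W] that unfolding tight_def V'_def by blast
      have tsing: "tight {y}" if "y \<in> V'" for y
      proof -
        have "card (ins I {y}) + 2 \<le> 2 * card {y}" using that by (intro sparseD[OF sp]) (auto simp: V'_def)
        then show ?thesis using that by (simp add: tight_def)
      qed
      \<comment> \<open>If the ends of \<open>f1\<close> and \<open>f2\<close> lie in a tight set
        \<open>U\<close>, those of \<open>f1\<close> and \<open>f3\<close> cannot lie in a tight set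
        \<open>W\<close>: by uncrossing \<open>U \<union> W\<close> would be tight with all
        three.\<close>
      have "\<exists>p q r. I \<inter> cut {v} = {p, q, r} \<and> p \<noteq> q \<and> p \<noteq> r \<and> q \<noteq> r \<and> x p \<noteq> x q \<and>
        \<not> (\<exists>U. tight U \<and> x p \<in> U \<and> x q \<in> U)"
      proof -
        obtain e1 e2 e3 where e: "I \<inter> cut {v} = {e1, e2, e3}" "e1 \<noteq> e2" "e1 \<noteq> e3" "e2 \<noteq> e3"
          using c3 by (metis card_3_iff)
        have ne: "\<not> (x e1 = x e2 \<and> x e1 = x e3)"
          using all3[of "{x e1}"] tsing[of "x e1"] x(2)[of e1] e(1) by auto
        then obtain f1 f2 f3 where f: "I \<inter> cut {v} = {f1, f2, f3}" "f1 \<noteq> f2" "f1 \<noteq> f3" "f2 \<noteq> f3" "x f1 \<noteq> x f2"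
        proof (cases "x e1 = x e2")
          case True
          then have "x e1 \<noteq> x e3" using ne by simp
          moreover have "I \<inter> cut {v} = {e1, e3, e2}" using e(1) by auto
          ultimately show thesis using that[of e1 e3 e2] e by simp
        qed (use e in blast)
        show ?thesis
        proof (cases "\<exists>U. tight U \<and> x f1 \<in> U \<and> x f2 \<in> U")
          case False
          then show ?thesis using f by blast
        next
          case True
          then obtain U where U: "tight U" "x f1 \<in> U" "x f2 \<in> U" by blast
          then have n: "x f3 \<notin> U" using all3[OF U(1)] f(1) by auto
          have "\<not> (tight W \<and> x f1 \<in> W \<and> x f3 \<in> W)" for W
            using tUn[OF U(1), of W] U all3[of "U \<union> W"] f(1) by auto
          moreover have "x f1 \<noteq> x f3" using n U by auto
          moreover have "I \<inter> cut {v} = {f1, f3, f2}" using f(1) by auto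
          ultimately show ?thesis using f(2-4) by metis
        qed
      qed
      then obtain p q r where pqr: "I \<inter> cut {v} = {p, q, r}" "p \<noteq> q" "p \<noteq> r" "q \<noteq> r" "x p \<noteq> x q"
        and unb: "\<And>U. tight U \<Longrightarrow> x p \<in> U \<Longrightarrow> x q \<in> U \<Longrightarrow> False" by blast
      have pI: "p \<in> I \<inter> cut {v}" "q \<in> I \<inter> cut {v}" "r \<in> I \<inter> cut {v}" using pqr by auto
      \<comment> \<open>\<open>p\<close> is redirected to join \<open>x p\<close> and
        \<open>x q\<close>. Sparsity survives, as no tight set contains both of these
        vertices.\<close>
      define t' where "t' = t(p := x p)"
      define h' where "h' = h(p := x q)"
      define I' where "I' = I - {q, r}"
      have other: "e \<in> I' \<Longrightarrow> e \<noteq> p \<Longrightarrow> e \<in> ins I V'" for e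
        using insV' pqr(1) unfolding I'_def by blast
      have I'V: "t' e \<in> V' \<and> h' e \<in> V'" if "e \<in> I'" for e
        using other[OF that] x(2)[OF pI(1)] x(2)[OF pI(2)] by (auto simp: t'_def h'_def ins_def)
      have sp': "multigraph.sparse t' h' V' I'"
        unfolding multigraph.sparse_def
      proof (intro allI impI)
        fix U assume U: "U \<subseteq> V'" "U \<noteq> {}"
        have base: "card (ins I U) + 2 \<le> 2 * card U"
          using U by (intro sparseD[OF sp]) (auto simp: V'_def)
        have vU: "v \<notin> U" using U by (auto simp: V'_def)
        have sub: "multigraph.ins t' h' I' U \<subseteq> (if x p \<in> U \<and> x q \<in> U then insert p (ins I U) else ins I U)"
          by (auto simp: multigraph.ins_def t'_def h'_def I'_def split: if_splits)
        show "card (multigraph.ins t' h' I' U) + 2 \<le> 2 * card U"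
        proof (cases "x p \<in> U \<and> x q \<in> U")
          case True
          then have "\<not> tight U" using unb by blast
          then have "card (ins I U) + 3 \<le> 2 * card U" using base U(1) unfolding tight_def by simp
          moreover have "card (multigraph.ins t' h' I' U) \<le> card (insert p (ins I U))"
            using sub True finite_ins[OF finI] by (intro card_mono) auto
          moreover have "card (insert p (ins I U)) \<le> card (ins I U) + 1"
            using finite_ins[OF finI] by (simp add: card_insert_if)
          ultimately show ?thesis by simp
        next
          case False
          then have "card (multigraph.ins t' h' I' U) \<le> card (ins I U)"
            using sub finite_ins[OF finI] by (intro card_mono) auto
          then show ?thesis using base by simp
        qed
      qed
      have "card I' = card I - 2"
        unfolding I'_def using pI pqr(4) finI by (subst card_Diff_subset) auto
      moreover have "2 \<le> card I" using card_mono[of I "{q, r}"] pI pqr(4) finI by simp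
      ultimately have cI': "card I' + 2 = 2 * card V'" using cI V'(3) by simp
      obtain T1 T2 where T: "T1 \<union> T2 = I'" "T1 \<inter> T2 = {}"
          "\<And>u w. u \<in> V' \<Longrightarrow> w \<in> V' \<Longrightarrow> multigraph.conn t' h' T1 u w \<and> multigraph.conn t' h' T2 u w"
        using less.hyps[OF V'(4,1,2) _ I'V sp' cI'] finI unfolding I'_def by fastforce
      have pI': "p \<in> I'" using pI pqr by (auto simp: I'_def)
      \<comment> \<open>In the connector that contains the new edge, this is replaced by
        \<open>p\<close> and \<open>q\<close> through \<open>v\<close>; the other connector is
        attached to \<open>v\<close> by \<open>r\<close>.\<close>
      have main: ?thesis if T: "T1 \<union> T2 = I'" "T1 \<inter> T2 = {}" "p \<in> T1"
          "\<And>u w. u \<in> V' \<Longrightarrow> w \<in> V' \<Longrightarrow> multigraph.conn t' h' T1 u w \<and> multigraph.conn t' h' T2 u w" for T1 T2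
      proof -
        have cuteq: "e \<in> multigraph.cut t' h' S \<longleftrightarrow> e \<in> cut S" if "e \<noteq> p" for e S
          using that by (auto simp: multigraph.cut_def t'_def h'_def)
        have "\<forall>u\<in>V. \<forall>w\<in>V. conn (insert q T1) u w"
        proof (rule ext[OF pI(2)])
          fix u w S assume uw: "u \<in> V'" "w \<in> V'" and S: "insert q T1 \<inter> cut S = {}"
          have "p \<notin> multigraph.cut t' h' S"
            using S T(3) xcut[OF pI(1), of S] xcut[OF pI(2), of S]
            by (auto simp: multigraph.cut_def t'_def h'_def)
          then have "T1 \<inter> multigraph.cut t' h' S = {}"
            using S cuteq by (intro equals0I) (metis IntD1 IntD2 IntI insertI2 empty_iff)
          then show "u \<in> S \<longleftrightarrow> w \<in> S"
            using T(4)[OF uw] multigraph.conn_iff_cut[of t' h' T1 u w] by blast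
        qed
        moreover have "\<forall>u\<in>V. \<forall>w\<in>V. conn (insert r T2) u w"
        proof (rule ext[OF pI(3)])
          fix u w S assume uw: "u \<in> V'" "w \<in> V'" and S: "insert r T2 \<inter> cut S = {}"
          have "p \<notin> T2" using T by blast
          then have "T2 \<inter> multigraph.cut t' h' S = {}"
            using S cuteq by (intro equals0I) (metis IntD1 IntD2 IntI insertI2 empty_iff)
          then show "u \<in> S \<longleftrightarrow> w \<in> S"
            using T(4)[OF uw] multigraph.conn_iff_cut[of t' h' T2 u w] by blast
        qed
        moreover have "insert q T1 \<union> insert r T2 = I" "insert q T1 \<inter> insert r T2 = {}"
        proof -
          have n: "q \<notin> T1 \<union> T2" "r \<notin> T1 \<union> T2" using T(1) unfolding I'_def by auto
          have "I = I' \<union> {q, r}" using pI unfolding I'_def by blast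
          then show "insert q T1 \<union> insert r T2 = I" using T(1) by auto
          show "insert q T1 \<inter> insert r T2 = {}" using n T(2) pqr(4) by auto
        qed
        ultimately show ?thesis
          by (intro exI[of _ "insert q T1"] exI[of _ "insert r T2"] conjI ballI) simp_all
      qed
      show ?thesis
      proof (cases "p \<in> T1")
        case True
        then show ?thesis using main[of T1 T2] T by blast
      next
        case False
        then have "p \<in> T2" using T(1) pI' by blast
        then show ?thesis using main[of T2 T1] T by (metis Un_commute Int_commute)
      qed
    qed
  qed
qed

context multigraph
begin

text \<open>The maximal tight sets of a maximal sparse subset of \<open>F\<close> are unions of components of \<open>F\<close>.\<close>

lemma two_connectors:
  assumes finF: "finite F" and cuts: "\<And>S. F \<inter> cut S = {} \<or> 4 \<le> card (F \<inter> cut S)"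
  obtains T1 T2 where "T1 \<subseteq> F" "T2 \<subseteq> F" "T1 \<inter> T2 = {}"
    "\<And>e. e \<in> F \<Longrightarrow> conn T1 (t e) (h e) \<and> conn T2 (t e) (h e)"
proof -
  define V where "V = ends F"
  have finV: "finite V" using finF by (simp add: V_def ends_def)
  have FV: "t e \<in> V \<and> h e \<in> V" if "e \<in> F" for e using that by (auto simp: V_def ends_def)
  have card1: "1 \<le> card U" if "U \<subseteq> V" "U \<noteq> {}" for U
    using finite_subset[OF that(1) finV] that(2) by (simp add: Suc_leI card_gt_0_iff)
  let ?I = "{I. I \<subseteq> F \<and> sparse V I}"
  have "sparse V {}"
    unfolding sparse_def
  proof (intro allI impI)
    fix U assume "U \<subseteq> V" "U \<noteq> {}"
    from card1[OF this] show "card (ins {} U) + 2 \<le> 2 * card U" by (simp add: ins_def)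
  qed
  then have "{} \<in> ?I" by simp
  moreover have "finite ?I" using finF by simp
  ultimately obtain I where I: "I \<in> ?I" "\<And>I'. I' \<in> ?I \<Longrightarrow> card F - card I \<le> card F - card I'"
    using finite_ex_least[of ?I "{}" "\<lambda>I. card F - card I"] by blast
  have IF: "I \<subseteq> F" and sp: "sparse V I" using I(1) by auto
  have finI: "finite I" using IF finF finite_subset by blast
  have maxI: "\<not> sparse V (insert e I)" if e: "e \<in> F" "e \<notin> I" for e
  proof
    assume "sparse V (insert e I)"
    then have "card F - card I \<le> card F - card (insert e I)" using I(2) IF e by simp
    moreover have "card (insert e I) \<le> card F" using IF e finF by (intro card_mono) auto
    ultimately show False using e finI by simp
  qed
  define tight where "tight U \<longleftrightarrow> U \<subseteq> V \<and> U \<noteq> {} \<and> card (ins I U) + 2 = 2 * card U" for U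
  have tUn: "tight (U \<union> W)" if "tight U" "tight W" "U \<inter> W \<noteq> {}" for U W
    using tight_Un[OF sp finV finI, of U W] that unfolding tight_def by blast
  have tsing: "tight {v}" if "v \<in> V" for v
  proof -
    have "card (ins I {v}) + 2 \<le> 2 * card {v}" using that by (intro sparseD[OF sp]) auto
    then show ?thesis using that by (simp add: tight_def)
  qed
  have "\<exists>M. \<forall>v\<in>V. tight (M v) \<and> v \<in> M v \<and> (\<forall>U. tight U \<longrightarrow> v \<in> U \<longrightarrow> U \<subseteq> M v)"
  proof (rule bchoice, rule ballI)
    fix v assume v: "v \<in> V"
    let ?A = "{U. tight U \<and> v \<in> U}"
    have "finite ?A" by (rule finite_subset[of _ "Pow V"]) (use finV in \<open>auto simp: tight_def\<close>)
    moreover have "{v} \<in> ?A" using tsing[OF v] by simp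
    ultimately obtain M where M: "M \<in> ?A" "\<And>U. U \<in> ?A \<Longrightarrow> card V - card M \<le> card V - card U"
      using finite_ex_least[of ?A "{v}" "\<lambda>U. card V - card U"] by blast
    have "U \<subseteq> M" if U: "tight U" "v \<in> U" for U
    proof (rule ccontr)
      assume n: "\<not> U \<subseteq> M"
      have t: "tight (U \<union> M)" using tUn[OF U(1), of M] M(1) U(2) by blast
      then have "card V - card M \<le> card V - card (U \<union> M)" using M(2) U(2) by simp
      moreover have "card (U \<union> M) \<le> card V" using t finV card_mono unfolding tight_def by blast
      moreover have "card M < card (U \<union> M)"
        using n t finV by (intro psubset_card_mono) (auto simp: tight_def intro: finite_subset)
      ultimately show False by simp
    qed
    then show "\<exists>M. tight M \<and> v \<in> M \<and> (\<forall>U. tight U \<longrightarrow> v \<in> U \<longrightarrow> U \<subseteq> M)" using M(1) by blast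
  qed
  then obtain M where M: "\<And>v. v \<in> V \<Longrightarrow> tight (M v)" "\<And>v. v \<in> V \<Longrightarrow> v \<in> M v"
      "\<And>v U. v \<in> V \<Longrightarrow> tight U \<Longrightarrow> v \<in> U \<Longrightarrow> U \<subseteq> M v" by auto
  have MV: "M v \<subseteq> V" if "v \<in> V" for v using M(1)[OF that] by (simp add: tight_def)
  have Meq: "M w = M v" if "v \<in> V" "w \<in> M v" for v w
  proof -
    have w: "w \<in> V" using MV that by blast
    have 1: "M v \<subseteq> M w" using M(3)[OF w M(1)[OF that(1)] that(2)] .
    then have "v \<in> M w" using M(2)[OF that(1)] by blast
    then have "M w \<subseteq> M v" using M(3)[OF that(1) M(1)[OF w]] by blast
    then show ?thesis using 1 by blast
  qed
  define X where "X = {e \<in> F. h e \<notin> M (t e)}"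
  \<comment> \<open>An edge of \<open>F\<close> that is missing in the maximal set \<open>I\<close>
    was refused because of a tight set with both of its ends, so its ends lie in the same maximal
    tight set.\<close>
  have XI: "X \<subseteq> I"
  proof
    fix e assume e: "e \<in> X"
    show "e \<in> I"
    proof (rule ccontr)
      assume n: "e \<notin> I"
      have eF: "e \<in> F" using e by (simp add: X_def)
      obtain U where U: "U \<subseteq> V" "U \<noteq> {}" "\<not> card (ins (insert e I) U) + 2 \<le> 2 * card U"
        using maxI[OF eF n] unfolding sparse_def by blast
      have base: "card (ins I U) + 2 \<le> 2 * card U" using sparseD[OF sp U(1,2)] .
      have eU: "t e \<in> U \<and> h e \<in> U"
      proof (rule ccontr)
        assume "\<not> ?thesis"
        then have "ins (insert e I) U = ins I U" by (auto simp: ins_def)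
        then show False using base U(3) by simp
      qed
      have "card (ins (insert e I) U) \<le> card (insert e (ins I U))"
        using finite_ins[OF finI] by (intro card_mono) (auto simp: ins_def)
      also have "\<dots> \<le> card (ins I U) + 1" using finite_ins[OF finI] by (simp add: card_insert_if)
      finally have "tight U" using base U by (simp add: tight_def)
      then have "U \<subseteq> M (t e)" using M(3) FV[OF eF] eU by blast
      then show False using e eU by (auto simp: X_def)
    qed
  qed
  have Xempty: "X = {}"
  proof (rule ccontr)
    assume Xne: "X \<noteq> {}"
    \<comment> \<open>The classes touched by \<open>X\<close>. Each is left by at least four edges
      of \<open>X\<close>, and each edge serves two classes, whence \<open>|X| \<ge> 2 |CC|\<close>.
      Their union \<open>W\<close> then has \<open>2 |C| - 2\<close> edges inside each class
      \<open>C\<close> and at least two more per class, that is \<open>2 |W|\<close> edges, contrary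
      to sparsity.\<close>
    define CC where "CC = M ` (t ` X \<union> h ` X)"
    have finX: "finite X" using finF by (simp add: X_def)
    have finC: "finite CC" unfolding CC_def using finX by simp
    have XV: "t e \<in> V \<and> h e \<in> V" if "e \<in> X" for e using FV that by (simp add: X_def)
    have CV: "\<exists>v\<in>V. C = M v" if "C \<in> CC" for C using that XV unfolding CC_def by blast
    have disC: "C \<inter> D = {}" if CD: "C \<in> CC" "D \<in> CC" "C \<noteq> D" for C D
    proof -
      obtain v w where "v \<in> V" "C = M v" "w \<in> V" "D = M w" using CV CD by metis
      then show ?thesis using Meq CD(3) by blast
    qed
    have cutC: "F \<inter> cut C = X \<inter> cut C" if C: "C \<in> CC" for C
    proof -
      obtain v where v: "v \<in> V" "C = M v" using CV C by blast
      have "h e \<notin> M (t e)" if e: "e \<in> F" "e \<in> cut C" for e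
      proof
        assume a: "h e \<in> M (t e)"
        have "M (h e) = M (t e)" using Meq[OF _ a] FV[OF e(1)] by blast
        moreover have "t e \<in> C \<Longrightarrow> M (t e) = C" "h e \<in> C \<Longrightarrow> M (h e) = C" using Meq v by blast+
        ultimately show False using e FV[OF e(1)] M(2) unfolding cut_def by blast
      qed
      then show ?thesis by (auto simp: X_def)
    qed
    have ne: "F \<inter> cut C \<noteq> {}" if C: "C \<in> CC" for C
    proof -
      obtain e where e: "e \<in> X" "C = M (t e) \<or> C = M (h e)" using C unfolding CC_def by blast
      have V2: "t e \<in> V" "h e \<in> V" using XV[OF e(1)] by auto
      have n: "h e \<notin> M (t e)" using e(1) by (simp add: X_def)
      then have "t e \<notin> M (h e)" using Meq V2 M(2) by metis
      then have "e \<in> cut C" using e(2) n M(2) V2 by (auto simp: cut_def)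
      then show ?thesis using e(1) by (auto simp: X_def)
    qed
    have four: "4 \<le> card (X \<inter> cut C)" if "C \<in> CC" for C
      using cuts[of C] ne[OF that] cutC[OF that] by simp
    have "4 * card CC \<le> (\<Sum>C\<in>CC. card (X \<inter> cut C))"
      using sum_mono[of CC "\<lambda>_. 4" "\<lambda>C. card (X \<inter> cut C)"] four by (simp add: mult.commute)
    also have "\<dots> = (\<Sum>C\<in>CC. \<Sum>e\<in>X. if e \<in> cut C then 1 else 0)"
      using finX by (simp add: sum.If_cases)
    also have "\<dots> = (\<Sum>e\<in>X. \<Sum>C\<in>CC. if e \<in> cut C then 1 else 0)" by (rule sum.swap)
    also have "\<dots> = (\<Sum>e\<in>X. card {C \<in> CC. e \<in> cut C})"
      using finC by (simp add: sum.If_cases Collect_conj_eq)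
    also have "\<dots> \<le> (\<Sum>e\<in>X. 2)"
    proof (rule sum_mono)
      fix e assume e: "e \<in> X"
      have "{C \<in> CC. e \<in> cut C} \<subseteq> {M (t e), M (h e)}"
      proof
        fix C assume C: "C \<in> {C \<in> CC. e \<in> cut C}"
        then obtain v where v: "v \<in> V" "C = M v" using CV by blast
        have "t e \<in> C \<or> h e \<in> C" using C by (auto simp: cut_def)
        then show "C \<in> {M (t e), M (h e)}" using Meq v by blast
      qed
      then have "card {C \<in> CC. e \<in> cut C} \<le> card {M (t e), M (h e)}" by (intro card_mono) auto
      also have "\<dots> \<le> 2" by (simp add: card_insert_if)
      finally show "card {C \<in> CC. e \<in> cut C} \<le> 2" .
    qed
    finally have X2: "2 * card CC \<le> card X" by simp
    define W where "W = \<Union>CC"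
    have W: "W \<subseteq> V" "W \<noteq> {}"
    proof -
      show "W \<subseteq> V" using CV MV unfolding W_def by blast
      obtain e where "e \<in> X" using Xne by blast
      then show "W \<noteq> {}" using M(2) XV unfolding W_def CC_def by blast
    qed
    have finCs: "finite C" if "C \<in> CC" for C using CV[OF that] MV finV finite_subset by metis
    have cW: "card W = (\<Sum>C\<in>CC. card C)"
      unfolding W_def using finCs disC by (intro card_Union_disjoint) (auto simp: pairwise_def disjnt_def)
    have dis2: "ins I C \<inter> ins I D = {}" if "C \<in> CC" "D \<in> CC" "C \<noteq> D" for C D
      using disC[OF that] by (auto simp: ins_def)
    have "(\<Sum>C\<in>CC. card (ins I C)) = card (\<Union>C\<in>CC. ins I C)"
      using finC finite_ins[OF finI] dis2 by (subst card_UN_disjoint) auto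
    moreover have "card (\<Union>C\<in>CC. ins I C) + card X \<le> card (ins I W)"
    proof -
      have "(\<Union>C\<in>CC. ins I C) \<inter> X = {}"
      proof -
        have "e \<notin> X" if "C \<in> CC" "e \<in> ins I C" for C e
        proof -
          obtain v where "v \<in> V" "C = M v" using CV \<open>C \<in> CC\<close> by blast
          then have "M (t e) = C" using Meq that(2) by (auto simp: ins_def)
          then show ?thesis using that(2) by (auto simp: ins_def X_def)
        qed
        then show ?thesis by blast
      qed
      moreover have "(\<Union>C\<in>CC. ins I C) \<union> X \<subseteq> ins I W"
      proof -
        have "ins I C \<subseteq> ins I W" if "C \<in> CC" for C using that unfolding W_def ins_def by blast
        moreover have "e \<in> ins I W" if e: "e \<in> X" for e
        proof -
          have "M (t e) \<in> CC" "M (h e) \<in> CC" using e unfolding CC_def by auto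
          then have "t e \<in> W" "h e \<in> W" using M(2) XV[OF e] unfolding W_def by blast+
          then show ?thesis using XI e by (auto simp: ins_def)
        qed
        ultimately show ?thesis by blast
      qed
      ultimately show ?thesis
        using finC finite_ins[OF finI] finX card_mono[of "ins I W" "(\<Union>C\<in>CC. ins I C) \<union> X"]
        by (simp add: card_Un_disjoint)
    qed
    moreover have "(\<Sum>C\<in>CC. card (ins I C)) + 2 * card CC = 2 * card W"
    proof -
      have "(\<Sum>C\<in>CC. card (ins I C)) + 2 * card CC = (\<Sum>C\<in>CC. card (ins I C) + 2)"
        by (simp add: sum.distrib del: add_2_eq_Suc')
      also have "\<dots> = (\<Sum>C\<in>CC. 2 * card C)"
        using CV M(1) by (intro sum.cong refl) (fastforce simp: tight_def)
      finally show ?thesis by (simp add: cW sum_distrib_left)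
    qed
    moreover have "card (ins I W) + 2 \<le> 2 * card W" using sparseD[OF sp W] .
    ultimately show False using X2 by linarith
  qed
  have "\<exists>f. \<forall>C\<in>M ` V. fst (f C) \<union> snd (f C) = ins I C \<and> fst (f C) \<inter> snd (f C) = {} \<and>
      (\<forall>u\<in>C. \<forall>v\<in>C. conn (fst (f C)) u v \<and> conn (snd (f C)) u v)"
  proof (rule bchoice, rule ballI)
    fix C assume "C \<in> M ` V"
    then have C: "tight C" using M(1) by blast
    have spC: "sparse C (ins I C)"
      unfolding sparse_def
    proof (intro allI impI)
      fix U assume U: "U \<subseteq> C" "U \<noteq> {}"
      then have "ins (ins I C) U = ins I U" by (auto simp: ins_def)
      then show "card (ins (ins I C) U) + 2 \<le> 2 * card U"
        using sparseD[OF sp, of U] U C by (auto simp: tight_def)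
    qed
    have "finite C" using C finV finite_subset unfolding tight_def by blast
    moreover have "\<And>e. e \<in> ins I C \<Longrightarrow> t e \<in> C \<and> h e \<in> C" by (simp add: ins_def)
    ultimately obtain T1 T2 where "T1 \<union> T2 = ins I C" "T1 \<inter> T2 = {}"
        "\<forall>u\<in>C. \<forall>v\<in>C. conn T1 u v \<and> conn T2 u v"
      using tight_split[of C "ins I C" t h] C spC finite_ins[OF finI] unfolding tight_def by blast
    then show "\<exists>f. fst f \<union> snd f = ins I C \<and> fst f \<inter> snd f = {} \<and>
      (\<forall>u\<in>C. \<forall>v\<in>C. conn (fst f) u v \<and> conn (snd f) u v)"
      by (intro exI[of _ "(T1, T2)"]) simp
  qed
  then obtain f where f: "\<And>C. C \<in> M ` V \<Longrightarrow> fst (f C) \<union> snd (f C) = ins I C"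
      "\<And>C. C \<in> M ` V \<Longrightarrow> fst (f C) \<inter> snd (f C) = {}"
      "\<And>C u v. C \<in> M ` V \<Longrightarrow> u \<in> C \<Longrightarrow> v \<in> C \<Longrightarrow> conn (fst (f C)) u v \<and> conn (snd (f C)) u v"
    by fastforce
  let ?T1 = "\<Union>C\<in>M ` V. fst (f C)" and ?T2 = "\<Union>C\<in>M ` V. snd (f C)"
  show thesis
  proof (rule that[of ?T1 ?T2])
    have sub: "fst (f C) \<subseteq> ins I C" "snd (f C) \<subseteq> ins I C" if "C \<in> M ` V" for C using f(1)[OF that] by auto
    then show "?T1 \<subseteq> F" "?T2 \<subseteq> F" using IF unfolding ins_def by blast+
    show "?T1 \<inter> ?T2 = {}"
    proof -
      have "e \<notin> snd (f D)" if C: "C \<in> M ` V" "D \<in> M ` V" "e \<in> fst (f C)" for C D e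
      proof
        assume D: "e \<in> snd (f D)"
        have "t e \<in> C" "t e \<in> D" using sub[OF C(1)] sub[OF C(2)] C(3) D by (auto simp: ins_def)
        then have "C = D" using C(1,2) Meq by blast
        then show False using f(2)[OF C(1)] C(3) D by blast
      qed
      then show ?thesis by blast
    qed
    fix e assume e: "e \<in> F"
    have V2: "t e \<in> V" using FV[OF e] by simp
    have hM: "h e \<in> M (t e)" using Xempty e by (auto simp: X_def)
    have C: "M (t e) \<in> M ` V" using V2 by blast
    have c: "conn (fst (f (M (t e)))) (t e) (h e) \<and> conn (snd (f (M (t e)))) (t e) (h e)"
      using f(3)[OF C M(2)[OF V2] hM] .
    show "conn ?T1 (t e) (h e) \<and> conn ?T2 (t e) (h e)"
      using c C by (meson UN_upper conn_mono)
  qed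
qed

end

section \<open>Covering a bridgeless graph by three even sets\<close>

text \<open>With two disjoint connectors, \<open>F - T1\<close> is completed to an even set inside
  \<open>T1\<close> and \<open>F - T2\<close> inside \<open>T2\<close>, and no edge is missing from
  both. If there is a cut of two edges, one of them is contracted; it returns together with the
  other, since even sets meet the cut evenly. Cuts of a contracted graph are cuts of the original
  one, so the exclusion of one and three edges persists.\<close>

lemma four_flow:
  fixes t h :: "'b \<Rightarrow> 'a"
  assumes "finite F" "\<And>S. card (F \<inter> multigraph.cut t h S) \<noteq> 1" "\<And>S. card (F \<inter> multigraph.cut t h S) \<noteq> 3"
  shows "\<exists>B C. multigraph.even_set t h B \<and> multigraph.even_set t h C \<and> B \<union> C = F"
  using assms
proof (induction "card F" arbitrary: t h F rule: less_induct)
  case less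
  interpret multigraph t h .
  note fin = less.prems(1)
  show ?case
  proof (cases "\<exists>S. card (F \<inter> cut S) = 2")
    case True
    then obtain S e e' where S: "F \<inter> cut S = {e, e'}" "e \<noteq> e'" by (meson card_2_iff)
    have eF: "e \<in> F" "e \<in> cut S" using S by auto
    let ?r = "\<lambda>v. if v = t e then h e else v"
    have cut': "multigraph.cut (?r \<circ> t) (?r \<circ> h) S' = cut (?r -` S')" for S'
      by (auto simp: multigraph.cut_def)
    have eq: "(F - {e}) \<inter> multigraph.cut (?r \<circ> t) (?r \<circ> h) S' = F \<inter> cut (?r -` S')" for S'
    proof -
      have "e \<notin> cut (?r -` S')" by (auto simp: cut_def)
      then show ?thesis unfolding cut' by blast
    qed
    have "card (F - {e}) < card F" using fin eF by (meson card_Diff1_less)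
    then obtain B C where BC: "multigraph.even_set (?r \<circ> t) (?r \<circ> h) B" "multigraph.even_set (?r \<circ> t) (?r \<circ> h) C"
        "B \<union> C = F - {e}"
      using less.hyps[of "F - {e}" "?r \<circ> t" "?r \<circ> h"] fin less.prems(2,3) eq by auto
    obtain B' where B': "even_set B'" "B' = B \<or> B' = insert e B"
      using contract_even[OF BC(1)] BC(3) by blast
    obtain C' where C': "even_set C'" "C' = C \<or> C' = insert e C"
      using contract_even[OF BC(2)] BC(3) by blast
    have "e' \<in> B \<union> C" using S BC(3) by auto
    then have e': "e' \<in> B' \<union> C'" using B'(2) C'(2) by auto
    have sub: "B' \<subseteq> F" "C' \<subseteq> F" using B'(2) C'(2) BC(3) eF by auto
    have ein: "e \<in> D" if D: "even_set D" "D \<subseteq> F" "e' \<in> D" for D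
    proof -
      have "e' \<in> cut S" using S by auto
      then obtain x where "x \<in> D" "x \<in> cut S" "x \<noteq> e'" using even_set_meets_twice[OF D(1,3)] by blast
      then have "x \<in> F \<inter> cut S" using D(2) by blast
      then show ?thesis using S \<open>x \<noteq> e'\<close> \<open>x \<in> D\<close> by auto
    qed
    have "e \<in> B' \<union> C'" using e' ein B'(1) C'(1) sub by blast
    moreover have "F - {e} \<subseteq> B' \<union> C'" using BC(3) B'(2) C'(2) by auto
    ultimately have "B' \<union> C' = F" using sub by blast
    then show ?thesis using B'(1) C'(1) by blast
  next
    case False
    have cuts: "F \<inter> cut S = {} \<or> 4 \<le> card (F \<inter> cut S)" for S
    proof (cases "F \<inter> cut S = {}")
      case ne: False
      then have "card (F \<inter> cut S) \<noteq> 0" using fin by simp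
      moreover have "card (F \<inter> cut S) \<noteq> 1" "card (F \<inter> cut S) \<noteq> 2" "card (F \<inter> cut S) \<noteq> 3"
        using less.prems False by blast+
      ultimately show ?thesis by linarith
    qed simp
    obtain T1 T2 where T: "T1 \<subseteq> F" "T2 \<subseteq> F" "T1 \<inter> T2 = {}"
        "\<And>e. e \<in> F \<Longrightarrow> conn T1 (t e) (h e) \<and> conn T2 (t e) (h e)"
      using two_connectors[OF fin cuts] by blast
    obtain J1 where J1: "J1 \<subseteq> T1" "even_set ((F - T1) \<union> J1)"
      using even_completion[of "F - T1" T1] T(4) fin by blast
    obtain J2 where J2: "J2 \<subseteq> T2" "even_set ((F - T2) \<union> J2)"
      using even_completion[of "F - T2" T2] T(4) fin by blast
    have "((F - T1) \<union> J1) \<union> ((F - T2) \<union> J2) = F" using T J1(1) J2(1) by blast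
    then show ?thesis using J1(2) J2(2) by blast
  qed
qed

context multigraph
begin

text \<open>\<open>p\<close> sends a vertex to its representative after contracting the edges of
  \<open>A\<close> one by one. The cuts of the contracted graph are the cuts of preimages under
  \<open>p\<close>, and these miss \<open>A\<close>. As the vertex type is kept, results on
  arbitrary multigraphs apply to \<open>p \<circ> t\<close> and \<open>p \<circ> h\<close>.\<close>

lemma contract_all:
  assumes "finite A"
  shows "\<exists>p :: 'a \<Rightarrow> 'a. (\<forall>S. A \<inter> cut (p -` S) = {}) \<and>
    (\<forall>C. multigraph.even_set (p \<circ> t) (p \<circ> h) C \<longrightarrow> C \<inter> A = {} \<longrightarrow> (\<exists>J\<subseteq>A. even_set (C \<union> J)))"
  using assms
proof (induction A)
  case empty
  show ?case by (intro exI[of _ "\<lambda>x. x"]) (auto simp: comp_def)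
next
  case (insert e A)
  then obtain p :: "'a \<Rightarrow> 'a" where p: "\<And>S. A \<inter> cut (p -` S) = {}"
      "\<And>C. multigraph.even_set (p \<circ> t) (p \<circ> h) C \<Longrightarrow> C \<inter> A = {} \<Longrightarrow> \<exists>J\<subseteq>A. even_set (C \<union> J)"
    by blast
  let ?r = "\<lambda>v. if v = (p \<circ> t) e then (p \<circ> h) e else v"
  let ?q = "?r \<circ> p"
  have "insert e A \<inter> cut (?q -` S) = {}" for S
  proof -
    have "?q -` S = p -` (?r -` S)" by auto
    then have "A \<inter> cut (?q -` S) = {}" using p(1)[of "?r -` S"] by simp
    moreover have "e \<notin> cut (?q -` S)" by (auto simp: cut_def)
    ultimately show ?thesis by blast
  qed
  moreover have "\<exists>J\<subseteq>insert e A. even_set (C \<union> J)"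
    if C: "multigraph.even_set (?q \<circ> t) (?q \<circ> h) C" "C \<inter> insert e A = {}" for C
  proof -
    have "multigraph.even_set (?r \<circ> (p \<circ> t)) (?r \<circ> (p \<circ> h)) C" using C(1) by (simp add: comp_assoc)
    then have "multigraph.even_set (p \<circ> t) (p \<circ> h) C \<or> multigraph.even_set (p \<circ> t) (p \<circ> h) (insert e C)"
      using multigraph.contract_even[of "p \<circ> t" e "p \<circ> h" C] C(2) by blast
    then show ?thesis
    proof
      assume "multigraph.even_set (p \<circ> t) (p \<circ> h) C"
      then obtain J where "J \<subseteq> A" "even_set (C \<union> J)" using p(2)[of C] C(2) by blast
      then show ?thesis by blast
    next
      assume "multigraph.even_set (p \<circ> t) (p \<circ> h) (insert e C)"
      then obtain J where "J \<subseteq> A" "even_set (insert e C \<union> J)"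
        using p(2)[of "insert e C"] C(2) insert.hyps by blast
      then show ?thesis by (intro exI[of _ "insert e J"]) auto
    qed
  qed
  ultimately show ?case by (intro exI[of _ ?q]) blast
qed

text \<open>
  The six sets below are the even sets generated by \<open>a\<close>, \<open>b\<close> and \<open>c\<close> other than \<open>a\<close> itself. An edge
  of \<open>a\<close> is in three of them and any other edge in four, and each of the two triples covers everything.
\<close>

lemma even_cover:
  assumes fin: "finite E" and br: "\<And>S. card (E \<inter> cut S) \<noteq> 1"
  obtains A B C where "even_set A" "even_set B" "even_set C" "A \<union> B \<union> C = E"
    "3 * (card A + card B + card C) \<le> 5 * card E"
proof -
  obtain F where F: "F \<subseteq> E" "even_set (E - F)" "3 * card F \<le> card E"
      "\<And>S. card (E \<inter> cut S) = 3 \<Longrightarrow> card (F \<inter> cut S) = 1"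
    using thin_postman[OF fin br] by blast
  have finF: "finite F" using F fin finite_subset by blast
  define a where "a = E - F"
  have fina: "finite a" using fin by (simp add: a_def)
  obtain p :: "'a \<Rightarrow> 'a" where p: "\<And>S. a \<inter> cut (p -` S) = {}"
      "\<And>C. multigraph.even_set (p \<circ> t) (p \<circ> h) C \<Longrightarrow> C \<inter> a = {} \<Longrightarrow> \<exists>J\<subseteq>a. even_set (C \<union> J)"
    using contract_all[OF fina] by blast
  have cut': "multigraph.cut (p \<circ> t) (p \<circ> h) S = cut (p -` S)" for S
    by (auto simp: multigraph.cut_def)
  have Fc: "F \<inter> cut (p -` S) = E \<inter> cut (p -` S)" for S using p(1)[of S] F(1) unfolding a_def by blast
  have "card (F \<inter> multigraph.cut (p \<circ> t) (p \<circ> h) S) \<noteq> 1" for S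
    using br[of "p -` S"] Fc[of S] cut' by simp
  \<comment> \<open>A cut that survives the contraction of \<open>a\<close> lies inside
    \<open>F\<close>, whereas \<open>F\<close> has only one edge in a cut of three.\<close>
  moreover have "card (F \<inter> multigraph.cut (p \<circ> t) (p \<circ> h) S) \<noteq> 3" for S
    using F(4)[of "p -` S"] Fc[of S] cut' by fastforce
  ultimately obtain B C where BC: "multigraph.even_set (p \<circ> t) (p \<circ> h) B"
      "multigraph.even_set (p \<circ> t) (p \<circ> h) C" "B \<union> C = F"
    using four_flow[OF finF, of "p \<circ> t" "p \<circ> h"] by blast
  have Ba: "B \<inter> a = {}" "C \<inter> a = {}" using BC(3) by (auto simp: a_def)
  obtain J1 where J1: "J1 \<subseteq> a" "even_set (B \<union> J1)" using p(2)[OF BC(1) Ba(1)] by blast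
  obtain J2 where J2: "J2 \<subseteq> a" "even_set (C \<union> J2)" using p(2)[OF BC(2) Ba(2)] by blast
  define b c where "b = B \<union> J1" and "c = C \<union> J2"
  have ev: "even_set a" "even_set b" "even_set c" using F(2) J1(2) J2(2) by (simp_all add: a_def b_def c_def)
  have sub: "a \<subseteq> E" "b \<subseteq> E" "c \<subseteq> E" using J1(1) J2(1) BC(3) F(1) by (auto simp: a_def b_def c_def)
  have bcF: "F \<subseteq> b \<union> c" using BC(3) by (auto simp: b_def c_def)
  have fins: "finite a" "finite b" "finite c" using ev even_setD by blast+
  have ind: "card X = (\<Sum>e\<in>E. if e \<in> X then 1 else 0)" if "X \<subseteq> E" for X
    using that fin by (simp add: sum.If_cases Int_absorb1)
  define s1 s2 where "s1 = card b + card (sym_diff b c) + card (sym_diff a b)"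
    and "s2 = card c + card (sym_diff a c) + card (sym_diff a (sym_diff b c))"
  have "s1 + s2 = (\<Sum>e\<in>E. (if e \<in> b then 1 else 0) + (if e \<in> sym_diff b c then 1 else 0) +
      (if e \<in> sym_diff a b then 1 else 0) + (if e \<in> c then 1 else 0) + (if e \<in> sym_diff a c then 1 else 0) +
      (if e \<in> sym_diff a (sym_diff b c) then 1 else 0))"
  proof -
    have "sym_diff b c \<subseteq> E" "sym_diff a b \<subseteq> E" "sym_diff a c \<subseteq> E" "sym_diff a (sym_diff b c) \<subseteq> E"
      using sub by auto
    then show ?thesis
      by (simp only: s1_def s2_def sum.distrib ind[OF sub(2)] ind[OF sub(3)]
          ind[of "sym_diff b c"] ind[of "sym_diff a b"] ind[of "sym_diff a c"] ind[of "sym_diff a (sym_diff b c)"] add.assoc)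
  qed
  also have "\<dots> = (\<Sum>e\<in>E. 3 + (if e \<in> F then 1 else 0))"
  proof (rule sum.cong[OF refl])
    fix e assume "e \<in> E"
    then have "e \<in> a \<longleftrightarrow> e \<notin> F" by (simp add: a_def)
    then show "(if e \<in> b then 1 else 0) + (if e \<in> sym_diff b c then 1 else 0) +
      (if e \<in> sym_diff a b then 1 else 0) + (if e \<in> c then 1 else 0) + (if e \<in> sym_diff a c then 1 else 0) +
      (if e \<in> sym_diff a (sym_diff b c) then 1 else 0) = 3 + (if e \<in> F then 1 else (0 :: nat))"
      using bcF by auto
  qed
  also have "\<dots> = 3 * card E + card F" unfolding sum.distrib using ind[OF F(1)] by simp
  finally have s: "s1 + s2 = 3 * card E + card F" .
  show thesis
  \<comment> \<open>Since \<open>card F\<close> is at most a third of \<open>card E\<close>, the two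
    sums together are at most \<open>10/3 |E|\<close>, and the smaller is at most
    \<open>5/3 |E|\<close>.\<close>
  proof (cases "s1 \<le> s2")
    case True
    have "b \<union> sym_diff b c \<union> sym_diff a b = E" using bcF sub F(1) unfolding a_def by blast
    moreover have "3 * s1 \<le> 5 * card E" using s True F(3) by linarith
    ultimately show thesis using that[of b "sym_diff b c" "sym_diff a b"] ev even_set_sym_diff
      unfolding s1_def by blast
  next
    case False
    have "c \<union> sym_diff a c \<union> sym_diff a (sym_diff b c) = E" using bcF sub F(1) unfolding a_def by blast
    moreover have "3 * s2 \<le> 5 * card E" using s False F(3) by linarith
    ultimately show thesis using that[of c "sym_diff a c" "sym_diff a (sym_diff b c)"] ev even_set_sym_diff
      unfolding s2_def by blast
  qed
qed

section \<open>Walks and signed circuits\<close>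

text \<open>A walk from \<open>u\<close> is the list of its edges, each with the vertex that it leads to.\<close>

fun walk :: "'a \<Rightarrow> ('b \<times> 'a) list \<Rightarrow> bool" where
  "walk u [] \<longleftrightarrow> True"
| "walk u ((e, x) # s) \<longleftrightarrow> {t e, h e} = {u, x} \<and> walk x s"

abbreviation stops :: "'a \<Rightarrow> ('b \<times> 'a) list \<Rightarrow> 'a list" where
  "stops u s \<equiv> u # map snd s"

lemma walk_append: "walk u (s @ s') \<longleftrightarrow> walk u s \<and> walk (last (stops u s)) s'"
  by (induction u s rule: walk.induct) auto

lemma walk_edge_ends: "walk u s \<Longrightarrow> e \<in> fst ` set s \<Longrightarrow> {t e, h e} \<subseteq> set (stops u s)"
  by (induction u s rule: walk.induct) auto

lemma joins_single: "{t e, h e} = {a, b} \<Longrightarrow> joins {e} a b"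
  using joins_edge[of e] joins_sym[of "{e}" "t e" "h e"] by (auto simp: doubleton_eq_iff)

lemma conn_single: "{t e, h e} = {a, b} \<Longrightarrow> e \<in> J \<Longrightarrow> conn J a b"
  using joins_single[of e a b] unfolding conn_def by blast

lemma walk_joins:
  "walk u s \<Longrightarrow> distinct (map fst s) \<Longrightarrow> joins (fst ` set s) u (last (stops u s))"
proof (induction u s rule: walk.induct)
  case (1 u)
  then show ?case by (simp add: joins_empty)
next
  case (2 u e x s)
  have "joins {e} u x" using 2(2) by (intro joins_single) simp
  moreover have "joins (fst ` set s) x (last (stops x s))" using 2 by simp
  moreover have "{e} \<inter> fst ` set s = {}" using 2(3) by auto
  ultimately have "joins ({e} \<union> fst ` set s) u (last (stops x s))" by (rule joins_Un)
  then show ?case by simp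
qed

lemma walk_conn: "walk u s \<Longrightarrow> fst ` set s \<subseteq> J \<Longrightarrow> x \<in> set (stops u s) \<Longrightarrow> conn J u x"
proof (induction u s rule: walk.induct)
  case (1 u)
  then show ?case by (simp add: conn_refl)
next
  case (2 u e y s)
  have "conn J u y" using 2(2,3) by (intro conn_single[of e]) auto
  then show ?case using 2 conn_trans[of J u y x] conn_refl[of J u] by (cases "x = u") auto
qed

lemma conn_walk:
  assumes "conn J u w"
  obtains s where "walk u s" "last (stops u s) = w" "fst ` set s \<subseteq> J"
proof -
  let ?S = "{w. \<exists>s. walk u s \<and> last (stops u s) = w \<and> fst ` set s \<subseteq> J}"
  have step: "y \<in> ?S" if x: "x \<in> ?S" and e: "e \<in> J" "{t e, h e} = {x, y}" for x y e
  proof -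
    from x obtain s where s: "walk u s" "last (stops u s) = x" "fst ` set s \<subseteq> J" by blast
    have "walk u (s @ [(e, y)])" using s e by (simp add: walk_append)
    moreover have "last (stops u (s @ [(e, y)])) = y" by simp
    moreover have "fst ` set (s @ [(e, y)]) \<subseteq> J" using s e by simp
    ultimately show ?thesis by blast
  qed
  have "J \<inter> cut ?S = {}"
  proof (rule equals0I)
    fix e assume e: "e \<in> J \<inter> cut ?S"
    then have "t e \<in> ?S \<longleftrightarrow> h e \<notin> ?S" unfolding cut_def by blast
    moreover have "t e \<in> ?S \<Longrightarrow> h e \<in> ?S" by (rule step[of "t e" e]) (use e in auto)
    moreover have "h e \<in> ?S \<Longrightarrow> t e \<in> ?S" by (rule step[of "h e" e]) (use e in auto)
    ultimately show False by blast
  qed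
  moreover have "u \<in> ?S" using walk.simps(1) by (intro CollectI exI[of _ "[]"]) simp
  ultimately have "w \<in> ?S" using conn_closed[OF assms] by blast
  then show thesis using that by blast
qed

lemma walk_distinct: "walk u s \<Longrightarrow> distinct (stops u s) \<Longrightarrow> distinct (map fst s)"
proof (induction u s rule: walk.induct)
  case (1 u)
  then show ?case by simp
next
  case (2 u e x s)
  have "e \<notin> fst ` set s"
  proof
    assume "e \<in> fst ` set s"
    then have "{u, x} \<subseteq> set (stops x s)" using walk_edge_ends[of x s e] 2(2) by fastforce
    then show False using 2(3) by auto
  qed
  then show ?case using 2 by simp
qed

text \<open>A walk of least length among all walks from \<open>A\<close> to \<open>B\<close>: a
  repeated vertex, a return to \<open>A\<close> or an early visit of \<open>B\<close> would give a
  shorter one. Such a walk is the path of a barbell, which may meet the circuits only at its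
  ends.\<close>

lemma shortest_walk:
  assumes "conn J u0 w0" "u0 \<in> A" "w0 \<in> B"
  obtains u s where "walk u s" "u \<in> A" "last (stops u s) \<in> B" "fst ` set s \<subseteq> J"
    "distinct (stops u s)" "set (map snd s) \<inter> A = {}" "set (butlast (stops u s)) \<inter> B = {}"
proof -
  let ?P = "\<lambda>(u, s). walk u s \<and> u \<in> A \<and> last (stops u s) \<in> B \<and> fst ` set s \<subseteq> J"
  obtain s0 where "walk u0 s0" "last (stops u0 s0) = w0" "fst ` set s0 \<subseteq> J"
    using conn_walk[OF assms(1)] .
  then have "?P (u0, s0)" using assms by simp
  then obtain us where us: "?P us" "\<And>us'. ?P us' \<Longrightarrow> length (snd us) \<le> length (snd us')"
    using ex_has_least_nat[of ?P "(u0, s0)" "\<lambda>us. length (snd us)"] by blast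
  obtain u s where "us = (u, s)" by fastforce
  then have P: "walk u s" "u \<in> A" "last (stops u s) \<in> B" "fst ` set s \<subseteq> J"
    and min: "\<And>u' s'. walk u' s' \<Longrightarrow> u' \<in> A \<Longrightarrow> last (stops u' s') \<in> B \<Longrightarrow> fst ` set s' \<subseteq> J
      \<Longrightarrow> length s \<le> length s'"
    using us(1) us(2)[of "(_, _)"] by auto
  have A: "x \<notin> A" if x: "(e, x) \<in> set s" for e x
  proof
    assume xA: "x \<in> A"
    obtain s1 s2 where s: "s = s1 @ (e, x) # s2" using x split_list by metis
    have "walk x s2" using P(1) s by (simp add: walk_append)
    moreover have "last (stops x s2) \<in> B" using P(3) s by (cases s2) auto
    moreover have "fst ` set s2 \<subseteq> J" using P(4) s by auto
    ultimately have "length s \<le> length s2" using min xA by blast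
    then show False using s by simp
  qed
  have B: "x \<notin> B" if s: "s = s1 @ (e, x) # s2" "s2 \<noteq> []" for s1 e x s2
  proof
    assume "x \<in> B"
    moreover have "walk u (s1 @ [(e, x)])" using P(1) s by (simp add: walk_append)
    moreover have "fst ` set (s1 @ [(e, x)]) \<subseteq> J" using P(4) s by auto
    ultimately have "length s \<le> length (s1 @ [(e, x)])" using min[of u] P(2) by fastforce
    then show False using s by simp
  qed
  have uB: "u \<notin> B" if "s \<noteq> []"
  proof
    assume "u \<in> B"
    then have "length s \<le> length ([] :: ('b \<times> 'a) list)" using min[of u "[]"] P(2) by simp
    then show False using that by simp
  qed
  have dist: "distinct (map snd s)"
  proof (rule ccontr)
    assume "\<not> distinct (map snd s)"
    then obtain xs y ys zs where "map snd s = xs @ [y] @ ys @ [y] @ zs" using not_distinct_decomp by blast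
    then obtain s1 e1 s2 e2 s3 where s: "s = s1 @ (e1, y) # s2 @ (e2, y) # s3"
      by (auto simp: map_eq_append_conv Cons_eq_map_conv append_eq_map_conv map_eq_Cons_conv)
    have "walk u (s1 @ (e1, y) # s3)" using P(1) unfolding s by (simp add: walk_append)
    moreover have "last (stops u (s1 @ (e1, y) # s3)) \<in> B" using P(3) unfolding s by (cases s3) auto
    moreover have "fst ` set (s1 @ (e1, y) # s3) \<subseteq> J" using P(4) unfolding s by auto
    ultimately have "length s \<le> length (s1 @ (e1, y) # s3)" using min P(2) by blast
    then show False using s by simp
  qed
  show thesis
  proof (rule that[of u s])
    show "walk u s" "u \<in> A" "last (stops u s) \<in> B" "fst ` set s \<subseteq> J" using P by auto
    show "set (map snd s) \<inter> A = {}" using A by auto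
    then show "distinct (stops u s)" using dist P(2) by auto
    show "set (butlast (stops u s)) \<inter> B = {}"
    proof (cases "s = []")
      case False
      have "x \<notin> B" if "x \<in> set (butlast (map snd s))" for x
      proof -
        have "x \<in> set (map snd (butlast s))" using that by (simp add: map_butlast)
        then obtain e where "(e, x) \<in> set (butlast s)" by auto
        then obtain s1 s2 where b: "butlast s = s1 @ (e, x) # s2" using split_list by metis
        have "s = s1 @ (e, x) # (s2 @ [last s])" using append_butlast_last_id[OF False] b by simp
        then show ?thesis using B by blast
      qed
      then show ?thesis using uB[OF False] False by auto
    qed simp
  qed
qed

lemma conn_path:
  assumes "conn J u w"
  obtains s where "walk u s" "last (stops u s) = w" "fst ` set s \<subseteq> J" "distinct (stops u s)"
proof -
  obtain u' s where "walk u' s" "u' \<in> {u}" "last (stops u' s) \<in> {w}" "fst ` set s \<subseteq> J" "distinct (stops u' s)"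
    using shortest_walk[OF assms, of "{u}" "{w}"] by (metis singletonI)
  then show thesis using that[of s] by simp
qed

text \<open>An edge at \<open>v\<close> followed by a path back through the other edges is a
  nonempty even subset, hence the whole circuit.\<close>

lemma circ_walk:
  assumes "circ C" "v \<in> ends C"
  obtains s where "walk v s" "last (stops v s) = v" "distinct (map fst s)" "fst ` set s = C"
proof -
  obtain e x where e: "e \<in> C" "{t e, h e} = {v, x}"
    using assms(2) unfolding ends_def by (metis (no_types, lifting) UnE imageE insert_commute)
  have "joins {e} v x" using e by (intro joins_single)
  moreover have "joins C v v" using circD(1)[OF assms(1)] by (simp add: joins_refl_iff)
  ultimately have "joins (C - {e}) x v" using joins_Diff[of C v v "{e}" x] e by simp
  then have "conn (C - {e}) x v" unfolding conn_def by blast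
  then obtain s where s: "walk x s" "last (stops x s) = v" "fst ` set s \<subseteq> C - {e}" "distinct (stops x s)"
    using conn_path by blast
  have w: "walk v ((e, x) # s)" using s e by simp
  have d: "distinct (map fst ((e, x) # s))" using walk_distinct[OF s(1,4)] s(3) by auto
  have l: "last (stops v ((e, x) # s)) = v" using s(2) by simp
  have "joins (fst ` set ((e, x) # s)) v v" using walk_joins[OF w d] l by simp
  then have "fst ` set ((e, x) # s) = C"
    using circ_sub[OF assms(1), of "fst ` set ((e, x) # s)"] s(3) e(1) by (auto simp: joins_refl_iff)
  then show thesis using that w d l by blast
qed

lemma circ_split:
  assumes "circ U" "a \<in> ends U" "b \<in> ends U"
  obtains A where "A \<subseteq> U" "joins A a b" "joins (U - A) a b"
proof -
  obtain A where A: "A \<subseteq> U" "joins A a b" using circ_conn[OF assms] unfolding conn_def by blast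
  have "joins U a a" using circD(1)[OF assms(1)] by (simp add: joins_refl_iff)
  then have "joins (U - A) b a" using joins_Diff[of U a a A b] A by simp
  then show thesis using that A joins_sym by blast
qed

text \<open>\<open>D\<close> is an ear of \<open>U\<close>; its minimality says that it is a path without inner vertices on \<open>U\<close>.\<close>

lemma ear_circ:
  assumes U: "circ U" and ab: "a \<noteq> b" and D: "joins D a b" "D \<inter> U = {}"
    and min: "\<And>D' x y. D' \<subset> D \<Longrightarrow> x \<in> ends U \<Longrightarrow> y \<in> ends U \<Longrightarrow> x \<noteq> y \<Longrightarrow> \<not> joins D' x y"
    and A: "A \<subseteq> U" "joins A a b" and ends: "a \<in> ends U" "b \<in> ends U"
  shows "circ (D \<union> A)"
proof -
  have fin: "finite D" "finite A" using D A joinsD by blast+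
  have "joins (D \<union> A) a a" using joins_Un[OF D(1) joins_sym[OF A(2)]] D(2) A(1) by blast
  then have ev: "even_set (D \<union> A)" by (simp add: joins_refl_iff)
  have ne: "D \<union> A \<noteq> {}" using joins_once[OF A(2) ab] by auto
  have "Y = D \<union> A" if Y: "Y \<subseteq> D \<union> A" "even_set Y" "Y \<noteq> {}" for Y
  \<comment> \<open>An even part of the ear could be removed from it, so by minimality it is empty.
    Then \<open>Y\<close> would be the circuit \<open>U\<close> inside one of its arcs.\<close>
  proof (cases "even_set (Y \<inter> D)")
    case True
    have "Y \<inter> D = {}"
    proof (rule ccontr)
      assume "Y \<inter> D \<noteq> {}"
      then have "D - (Y \<inter> D) \<subset> D" by blast
      moreover have "joins (D - (Y \<inter> D)) a b" using joins_Diff_even[OF D(1) True] by blast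
      ultimately show False using min ends ab by blast
    qed
    then have "Y \<subseteq> A" using Y by blast
    then have "Y = U" using circ_sub[OF U, of Y] A Y by blast
    then have "A = U" using \<open>Y \<subseteq> A\<close> A by blast
    then have "joins A a a" using circD(1)[OF U] by (simp add: joins_refl_iff)
    then show ?thesis using ab A(2) unfolding joins_def by blast
  next
    \<comment> \<open>The odd vertices of \<open>Y \<inter> D\<close> are odd in
      \<open>Y \<inter> A\<close> as well, so they lie on \<open>U\<close>. By minimality a join of
      two of them inside \<open>Y \<inter> D\<close> is all of \<open>D\<close>, and the remainder
      of \<open>D \<union> A\<close> is an even set inside an arc.\<close>
    case False
    have finY: "finite (Y \<inter> D)" using fin by simp
    have odd_end: "g \<in> ends U" if g: "odd (card (Y \<inter> D \<inter> cut {g}))" for g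
    proof -
      have "Y \<inter> cut {g} = (Y \<inter> D \<inter> cut {g}) \<union> (Y \<inter> A \<inter> cut {g})" using Y by blast
      moreover have "(Y \<inter> D \<inter> cut {g}) \<inter> (Y \<inter> A \<inter> cut {g}) = {}" using D(2) A(1) by blast
      ultimately have "card (Y \<inter> cut {g}) = card (Y \<inter> D \<inter> cut {g}) + card (Y \<inter> A \<inter> cut {g})"
        using fin by (simp add: card_Un_disjoint)
      moreover have "even (card (Y \<inter> cut {g}))" using Y(2) by (simp add: even_set_def)
      ultimately have "odd (card (Y \<inter> A \<inter> cut {g}))" using g by simp
      then have "Y \<inter> A \<inter> cut {g} \<noteq> {}" by (metis card.empty even_zero)
      then obtain e where "e \<in> A" "e \<in> cut {g}" by blast
      then show ?thesis using A(1) unfolding ends_def in_cut_single by blast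
    qed
    obtain g where g: "odd (card (Y \<inter> D \<inter> cut {g}))" using False finY by (auto simp: even_set_def)
    obtain g' K where K: "g' \<noteq> g" "odd (card (Y \<inter> D \<inter> cut {g'}))" "K \<subseteq> Y \<inter> D" "joins K g g'"
      using odd_vertex_partner[OF finY g] by blast
    have "\<not> K \<subset> D" using min[of K g g'] K odd_end g by blast
    then have KD: "K = D" "D \<subseteq> Y" using K(3) by blast+
    have "joins (D \<union> A - Y) a a" using joins_Diff_even[of "D \<union> A" a a Y] ev Y by (simp add: joins_refl_iff)
    moreover have "D \<union> A - Y \<subseteq> A" using KD by blast
    ultimately have "D \<union> A - Y = {} \<or> D \<union> A - Y = U"
      using circ_sub[OF U, of "D \<union> A - Y"] A(1) by (auto simp: joins_refl_iff)
    moreover have "D \<union> A - Y \<noteq> U"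
    proof
      assume "D \<union> A - Y = U"
      then have "A = U" using \<open>D \<union> A - Y \<subseteq> A\<close> A by blast
      then have "joins A a a" using circD(1)[OF U] by (simp add: joins_refl_iff)
      then show False using A(2) ab unfolding joins_def by blast
    qed
    ultimately show ?thesis using Y(1) by blast
  qed
  then show ?thesis using ev ne unfolding circ_def by blast
qed

section \<open>Decompositions of even sets into circuits\<close>

definition decomp :: "'b set set \<Rightarrow> 'b set \<Rightarrow> bool" where
  "decomp \<C> A \<longleftrightarrow> finite \<C> \<and> disjoint \<C> \<and> \<Union>\<C> = A \<and> (\<forall>C\<in>\<C>. circ C)"

lemma decomp_finite: "decomp \<C> A \<Longrightarrow> finite A"
  using circD(3) by (auto simp: decomp_def)

lemma decomp_disjoint: "decomp \<C> A \<Longrightarrow> C \<in> \<C> \<Longrightarrow> C' \<in> \<C> \<Longrightarrow> C \<noteq> C' \<Longrightarrow> C \<inter> C' = {}"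
  by (auto simp: decomp_def disjoint_def)

lemma decomp_Un: "decomp \<C> A \<Longrightarrow> decomp \<D> B \<Longrightarrow> A \<inter> B = {} \<Longrightarrow> decomp (\<C> \<union> \<D>) (A \<union> B)"
  unfolding decomp_def by (auto intro!: disjoint_union simp: Union_Un_distrib)

lemma decomp_Diff:
  assumes "decomp \<C> A" "\<D> \<subseteq> \<C>"
  shows "decomp (\<C> - \<D>) (A - \<Union>\<D>)"
proof -
  have "\<Union>(\<C> - \<D>) = A - \<Union>\<D>"
    using assms decomp_disjoint[OF assms(1)] unfolding decomp_def by blast
  then show ?thesis using assms unfolding decomp_def disjoint_def by auto
qed

lemma even_decomp:
  assumes "even_set A"
  obtains \<C> where "decomp \<C> A"
proof -
  have "\<exists>\<C>. decomp \<C> A"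
    using assms
  proof (induction "card A" arbitrary: A rule: less_induct)
    case less
    have fin: "finite A" using less.prems by (rule even_setD)
    show ?case
    proof (cases "A = {}")
      case True
      then have "decomp {} A" by (simp add: decomp_def)
      then show ?thesis by blast
    next
      case False
      let ?F = "{C. C \<subseteq> A \<and> C \<noteq> {} \<and> even_set C}"
      have "finite ?F" using fin by simp
      moreover have "A \<in> ?F" using less.prems False by simp
      ultimately obtain C where C: "C \<in> ?F" "\<And>D. D \<in> ?F \<Longrightarrow> card C \<le> card D"
        using finite_ex_least[of ?F A card] by blast
      have "D = C" if "D \<subseteq> C" "even_set D" "D \<noteq> {}" for D
      proof -
        have "card C \<le> card D" using C that by blast
        moreover have "finite C" using C(1) fin finite_subset by blast
        ultimately show ?thesis using that(1) by (simp add: card_seteq)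
      qed
      then have circ: "circ C" using C(1) unfolding circ_def by blast
      then have "decomp {C} C" by (simp add: decomp_def)
      moreover have "card (A - C) < card A" using C(1) fin by (intro psubset_card_mono) auto
      then obtain \<C> where "decomp \<C> (A - C)"
        using less.hyps[of "A - C"] even_set_Diff[OF less.prems, of C] C(1) by blast
      ultimately have "decomp ({C} \<union> \<C>) (C \<union> (A - C))" by (intro decomp_Un) auto
      moreover have "C \<union> (A - C) = A" using C(1) by blast
      ultimately show ?thesis by metis
    qed
  qed
  then show thesis using that by blast
qed

end

section \<open>Balanced circuits, barbells and conflicts\<close>

locale signed_multigraph = multigraph t h for t h :: "'b \<Rightarrow> 'a" +
  fixes N :: "'b set"
begin

definition bal :: "'b set \<Rightarrow> bool" where
  "bal C \<longleftrightarrow> circ C \<and> even (card (C \<inter> N))"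

definition unb :: "'b set \<Rightarrow> bool" where
  "unb C \<longleftrightarrow> circ C \<and> odd (card (C \<inter> N))"

definition nonconf :: "'b set \<Rightarrow> 'b set \<Rightarrow> bool" where
  "nonconf U U' \<longleftrightarrow> U \<inter> U' = {} \<and> (\<forall>x\<in>ends U \<inter> ends U'. \<forall>y\<in>ends U \<inter> ends U'. x = y)"

text \<open>Short and long barbells in one: the walk is empty for the short ones.\<close>

definition barbell :: "'b set \<Rightarrow> bool" where
  "barbell F \<longleftrightarrow> (\<exists>U U' u s. unb U \<and> unb U' \<and> U \<inter> U' = {} \<and> walk u s \<and> distinct (stops u s) \<and>
     set (stops u s) \<inter> ends U = {u} \<and> set (stops u s) \<inter> ends U' = {last (stops u s)} \<and>
     ends U \<inter> ends U' = (if s = [] then {u} else {}) \<and> F = U \<union> U' \<union> fst ` set s)"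

definition scirc :: "'b set \<Rightarrow> bool" where
  "scirc F \<longleftrightarrow> bal F \<or> barbell F"

lemma unbD: "unb U \<Longrightarrow> circ U" "unb U \<Longrightarrow> finite U"
  using circD(3) by (auto simp: unb_def)

lemma circ_bal_unb: "circ C \<Longrightarrow> bal C \<or> unb C"
  by (auto simp: bal_def unb_def)

lemma nonconf_sym: "nonconf U U' \<Longrightarrow> nonconf U' U"
  by (auto simp: nonconf_def)

lemma circ_ends: "circ U \<Longrightarrow> ends U \<noteq> {}"
  using circD(2) by (auto simp: ends_def)

text \<open>If the circuits share a vertex, they are a short barbell and \<open>J\<close> is not
  entered; otherwise a shortest walk in \<open>J\<close> links them. The connectivity of
  \<open>F\<close> is recorded because it makes \<open>F\<close> cross every bridge between the two
  circuits.\<close>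

lemma barbell_ex:
  assumes U: "unb U" "unb U'" "nonconf U U'"
    and J: "u0 \<in> ends U" "w0 \<in> ends U'" "conn J u0 w0"
  obtains F where "scirc F" "U \<union> U' \<subseteq> F" "F \<subseteq> U \<union> U' \<union> J"
    "\<And>x y. x \<in> ends U \<Longrightarrow> y \<in> ends U' \<Longrightarrow> conn F x y"
proof -
  obtain u s where s: "walk u s" "u \<in> ends U" "last (stops u s) \<in> ends U'" "fst ` set s \<subseteq> J"
      "distinct (stops u s)" "set (map snd s) \<inter> ends U = {}" "set (butlast (stops u s)) \<inter> ends U' = {}"
      "s = [] \<or> ends U \<inter> ends U' = {}"
  proof (cases "ends U \<inter> ends U' = {}")
    case True
    then show thesis using shortest_walk[OF J(3,1,2)] that by auto
  next
    case False
    then obtain u where "u \<in> ends U" "u \<in> ends U'" by blast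
    then show thesis using that[of u "[]"] by simp
  qed
  let ?F = "U \<union> U' \<union> fst ` set s"
  have disj: "U \<inter> U' = {}" using U(3) by (simp add: nonconf_def)
  have stU: "set (stops u s) \<inter> ends U = {u}" using s(2,6) by auto
  have "set (stops u s) = insert (last (stops u s)) (set (butlast (stops u s)))"
    using append_butlast_last_id[of "stops u s"] by (metis list.distinct(1) list.set(2) rotate1.simps(2) set_rotate1)
  then have stU': "set (stops u s) \<inter> ends U' = {last (stops u s)}" using s(3,7) by auto
  have meet: "ends U \<inter> ends U' = (if s = [] then {u} else {})"
  proof (cases "s = []")
    case True
    then have "u \<in> ends U \<inter> ends U'" using s(2,3) by simp
    then show ?thesis using U(3) True unfolding nonconf_def by auto
  next
    case False
    then show ?thesis using s(8) by simp
  qed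
  have "barbell ?F"
    unfolding barbell_def using U(1,2) disj s(1,5) stU stU' meet by blast
  moreover have "conn ?F x y" if "x \<in> ends U" "y \<in> ends U'" for x y
  proof -
    have "conn U x u" using circ_conn[OF unbD(1)[OF U(1)]] that s(2) by blast
    moreover have "conn U' (last (stops u s)) y" using circ_conn[OF unbD(1)[OF U(2)]] that s(3) by blast
    moreover have "conn (fst ` set s) u (last (stops u s))" using walk_conn[OF s(1), of "fst ` set s"] last_in_set[of "stops u s"] by blast
    ultimately have "conn ?F x u" "conn ?F u (last (stops u s))" "conn ?F (last (stops u s)) y"
      by (auto elim!: conn_mono)
    then show ?thesis using conn_trans by blast
  qed
  ultimately show thesis using that[of ?F] s(4) unfolding scirc_def by blast
qed

text \<open>A smallest part of \<open>U'\<close> that joins two vertices of \<open>U\<close> is an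
  ear, and with \<open>U\<close> it forms a theta graph. The two arcs of the unbalanced
  \<open>U\<close> have different parities, so one of them closes the ear to a balanced
  circuit.\<close>

lemma conflict_bal:
  assumes U: "unb U" "unb U'" "U \<inter> U' = {}" and n: "\<not> nonconf U U'"
  obtains C where "bal C" "C \<subseteq> U \<union> U'"
proof -
  obtain x y where xy: "x \<noteq> y" "x \<in> ends U" "y \<in> ends U" "x \<in> ends U'" "y \<in> ends U'"
    using n U(3) unfolding nonconf_def by blast
  obtain J where J: "J \<subseteq> U'" "joins J x y"
    using circ_conn[OF unbD(1)[OF U(2)] xy(4,5)] unfolding conn_def by blast
  let ?F = "{D. D \<subseteq> U' \<and> (\<exists>a\<in>ends U. \<exists>b\<in>ends U. a \<noteq> b \<and> joins D a b)}"
  have "finite ?F" using unbD(2)[OF U(2)] by simp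
  moreover have "J \<in> ?F" using J xy by blast
  ultimately obtain D where D: "D \<in> ?F" "\<And>D'. D' \<in> ?F \<Longrightarrow> card D \<le> card D'"
    using finite_ex_least[of ?F J card] by blast
  then obtain a b where ab: "D \<subseteq> U'" "a \<in> ends U" "b \<in> ends U" "a \<noteq> b" "joins D a b" by blast
  have finD: "finite D" using ab(5) joinsD by blast
  have min: "\<not> joins D' x y" if "D' \<subset> D" "x \<in> ends U" "y \<in> ends U" "x \<noteq> y" for D' x y
  proof
    assume "joins D' x y"
    then have "D' \<in> ?F" using that ab(1) by blast
    then have "card D \<le> card D'" by (rule D(2))
    then show False using psubset_card_mono[OF finD that(1)] by simp
  qed
  have disj: "D \<inter> U = {}" using ab(1) U(3) by blast
  obtain A where A: "A \<subseteq> U" "joins A a b" "joins (U - A) a b" using circ_split[OF unbD(1)[OF U(1)] ab(2,3)] by blast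
  have finU: "finite U" using unbD(2)[OF U(1)] .
  have par: "card ((D \<union> A) \<inter> N) = card (D \<inter> N) + card (A \<inter> N)" if "A \<subseteq> U" for A
  proof -
    have "(D \<union> A) \<inter> N = D \<inter> N \<union> A \<inter> N" by blast
    moreover have "(D \<inter> N) \<inter> (A \<inter> N) = {}" using that disj by blast
    ultimately show ?thesis using finD finite_subset[OF that finU] by (simp add: card_Un_disjoint)
  qed
  have "U \<inter> N = (A \<inter> N) \<union> ((U - A) \<inter> N)" using A(1) by blast
  moreover have "(A \<inter> N) \<inter> ((U - A) \<inter> N) = {}" by blast
  ultimately have "card (U \<inter> N) = card (A \<inter> N) + card ((U - A) \<inter> N)"
    using finU finite_subset[OF A(1) finU] by (simp add: card_Un_disjoint)
  then have "odd (card (A \<inter> N)) \<noteq> odd (card ((U - A) \<inter> N))" using U(1) unfolding unb_def by simp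
  then have "even (card ((D \<union> A) \<inter> N)) \<or> even (card ((D \<union> (U - A)) \<inter> N))"
    using par[OF A(1)] par[of "U - A"] by auto
  moreover have "circ (D \<union> A)" using ear_circ[OF unbD(1)[OF U(1)] ab(4,5) disj min A(1,2) ab(2,3)] .
  moreover have "circ (D \<union> (U - A))" using ear_circ[OF unbD(1)[OF U(1)] ab(4,5) disj min _ A(3) ab(2,3)] by blast
  ultimately show thesis using that ab(1) A(1) unfolding bal_def by blast
qed

text \<open>The conflicting pair is replaced by a balanced circuit in its union and any
  decomposition of what remains. That the other members are kept is used where one of them must not
  get lost.\<close>

lemma decomp_exchange:
  assumes C: "decomp \<C> A" and U: "U \<in> \<C>" "U' \<in> \<C>" "unb U" "unb U'" "U \<noteq> U'" "\<not> nonconf U U'"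
  obtains \<C>' where "decomp \<C>' A" "\<C> - {U, U'} \<subseteq> \<C>'" "card {C\<in>\<C>. bal C} < card {C\<in>\<C>'. bal C}"
proof -
  have disj: "U \<inter> U' = {}" using decomp_disjoint[OF C U(1,2,5)] .
  obtain B where B: "bal B" "B \<subseteq> U \<union> U'" using conflict_bal[OF U(3,4) disj U(6)] by blast
  have cB: "circ B" using B(1) by (simp add: bal_def)
  have "even_set (U \<union> U' - B)"
    using even_set_Diff even_set_Un[OF circD(1) circD(1) disj] unbD(1) U(3,4) circD(1)[OF cB] B(2) by blast
  then obtain \<D> where D: "decomp \<D> (U \<union> U' - B)" using even_decomp by blast
  have dB: "decomp {B} B" using cB by (simp add: decomp_def)
  have "decomp ({B} \<union> \<D>) (B \<union> (U \<union> U' - B))" using decomp_Un[OF dB D] by blast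
  then have 1: "decomp ({B} \<union> \<D>) (U \<union> U')" using B(2) by (simp add: Un_absorb1)
  have 2: "decomp (\<C> - {U, U'}) (A - (U \<union> U'))" using decomp_Diff[OF C, of "{U, U'}"] U by simp
  let ?C = "(\<C> - {U, U'}) \<union> ({B} \<union> \<D>)"
  have "decomp ?C ((A - (U \<union> U')) \<union> (U \<union> U'))" using decomp_Un[OF 2 1] by blast
  moreover have "(A - (U \<union> U')) \<union> (U \<union> U') = A" using U(1,2) C unfolding decomp_def by blast
  ultimately have 3: "decomp ?C A" by simp
  have "B \<notin> \<C>"
  proof
    assume "B \<in> \<C>"
    moreover have "B \<inter> U \<noteq> {} \<or> B \<inter> U' \<noteq> {}" using B(2) circD(2)[OF cB] by blast
    ultimately have "B = U \<or> B = U'" using decomp_disjoint[OF C] U(1,2) by blast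
    then show False using B(1) U(3,4) by (auto simp: bal_def unb_def)
  qed
  moreover have "insert B {C\<in>\<C>. bal C} \<subseteq> {C\<in>?C. bal C}"
    using B(1) U(3,4) by (auto simp: bal_def unb_def)
  moreover have "finite ?C" "finite \<C>" using 3 C by (auto simp: decomp_def)
  ultimately have "card {C\<in>\<C>. bal C} < card {C\<in>?C. bal C}"
    by (intro psubset_card_mono) auto
  then show thesis using that[OF 3] by blast
qed

definition nonconf_decomp :: "'b set set \<Rightarrow> 'b set \<Rightarrow> bool" where
  "nonconf_decomp \<C> A \<longleftrightarrow> decomp \<C> A \<and>
     (\<forall>U\<in>\<C>. \<forall>U'\<in>\<C>. unb U \<longrightarrow> unb U' \<longrightarrow> U \<noteq> U' \<longrightarrow> nonconf U U')"

text \<open>\<open>P\<close> is a side condition: trivial in \<open>nonconf_decomp_ex\<close>, while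
  \<open>box_system\<close> insists on an unbalanced member.\<close>

lemma max_bal_decomp:
  assumes "decomp \<C> A" "P \<C>"
  obtains \<D> where "decomp \<D> A" "P \<D>"
    "\<And>\<D>'. decomp \<D>' A \<Longrightarrow> P \<D>' \<Longrightarrow> card {C\<in>\<D>'. bal C} \<le> card {C\<in>\<D>. bal C}"
proof -
  have fin: "finite A" using decomp_finite[OF assms(1)] .
  let ?F = "{\<C>. decomp \<C> A \<and> P \<C>}"
  have "?F \<subseteq> Pow (Pow A)" by (auto simp: decomp_def)
  then have "finite ?F" using fin finite_subset by blast
  moreover have "\<C> \<in> ?F" using assms by simp
  ultimately obtain \<D> where "\<D> \<in> ?F" "\<And>\<D>'. \<D>' \<in> ?F \<Longrightarrow> - int (card {C\<in>\<D>. bal C}) \<le> - int (card {C\<in>\<D>'. bal C})"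
    using finite_ex_least[of ?F \<C> "\<lambda>\<C>. - int (card {C\<in>\<C>. bal C})"] by blast
  then show thesis using that[of \<D>] by simp
qed

lemma nonconf_decomp_ex:
  assumes "even_set A"
  obtains \<C> where "nonconf_decomp \<C> A"
proof -
  obtain \<C> where C: "decomp \<C> A" using even_decomp[OF assms] .
  then obtain \<D> where D: "decomp \<D> A" "\<And>\<D>'. decomp \<D>' A \<Longrightarrow> card {C\<in>\<D>'. bal C} \<le> card {C\<in>\<D>. bal C}"
    using max_bal_decomp[of \<C> A "\<lambda>_. True"] by auto
  have "nonconf U U'" if UU: "U \<in> \<D>" "U' \<in> \<D>" "unb U" "unb U'" "U \<noteq> U'" for U U'
  proof (rule ccontr)
    assume "\<not> nonconf U U'"
    then obtain \<D>' where "decomp \<D>' A" "card {C\<in>\<D>. bal C} < card {C\<in>\<D>'. bal C}"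
      using decomp_exchange[OF D(1) UU] by force
    then show False using D(2)[of \<D>'] by simp
  qed
  then show thesis using that[of \<D>] D(1) unfolding nonconf_decomp_def by blast
qed

end

section \<open>Systems of lollipops\<close>

text \<open>
  A lollipop at \<open>x\<close> is an unbalanced circuit with a connection to \<open>x\<close>; two of them at the same
  vertex make a barbell. A supplier is a piece that contains an unbalanced circuit. The predicate
  \<open>system v xs A Q k\<close> states that the pieces \<open>Q\<close> have signed circuits and lollipops at the vertices
  \<open>xs\<close>, all inside \<open>A\<close> and of total size at most \<open>k\<close>, that cover \<open>X \<inter> \<Union>Q\<close>. Moreover, every bridge
  of \<open>A\<close> that separates some supplier from \<open>v\<close> is already covered or separates a lollipop from \<open>v\<close>.
\<close>

locale lollipops = signed_multigraph t h N for t h :: "'b \<Rightarrow> 'a" and N :: "'b set" +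
  fixes E X :: "'b set"
begin

definition nonbridge :: "'b \<Rightarrow> bool" where
  "nonbridge e \<longleftrightarrow> (\<forall>S. E \<inter> cut S \<noteq> {e})"

definition supp :: "'b set set \<Rightarrow> 'b set set" where
  "supp Q = {U. unb U \<and> (\<exists>p\<in>Q. U \<subseteq> p)}"

definition lolli :: "'b set \<Rightarrow> 'b set set \<Rightarrow> 'a \<Rightarrow> 'b set \<times> 'b set \<Rightarrow> bool" where
  "lolli A Q x l \<longleftrightarrow> fst l \<in> supp Q \<and> fst l \<union> snd l \<subseteq> A \<and> (\<exists>u\<in>ends (fst l). joins (snd l) u x)"

abbreviation cost :: "'b set list \<Rightarrow> ('b set \<times> 'b set) list \<Rightarrow> nat" where
  "cost fs ls \<equiv> sum_list (map card fs) + sum_list (map (\<lambda>l. card (fst l \<union> snd l)) ls)"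

definition pending :: "'a \<Rightarrow> 'b set \<Rightarrow> 'b set set \<Rightarrow> 'b set list \<Rightarrow> ('b set \<times> 'b set) list \<Rightarrow> bool" where
  "pending v A Q fs ls \<longleftrightarrow> (\<forall>b\<in>A. \<forall>S. E \<inter> cut S = {b} \<longrightarrow> v \<notin> S \<longrightarrow> (\<exists>U\<in>supp Q. ends U \<subseteq> S) \<longrightarrow>
     b \<in> \<Union>(set fs) \<or> (\<exists>l\<in>set ls. ends (fst l) \<subseteq> S))"

text \<open>Every supplying circuit is linked to \<open>v\<close> inside \<open>A\<close>. Hence a
  bridge of \<open>E\<close> between such a circuit and \<open>v\<close> belongs to
  \<open>A\<close>, and the restriction to \<open>A\<close> in \<open>pending\<close> loses
  nothing.\<close>

definition ground :: "'a \<Rightarrow> 'b set \<Rightarrow> 'b set set \<Rightarrow> bool" where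
  "ground v A Q \<longleftrightarrow> finite A \<and> A \<subseteq> E \<and> (\<forall>U\<in>supp Q. \<forall>u\<in>ends U. conn A u v)"

definition system :: "'a \<Rightarrow> 'a list \<Rightarrow> 'b set \<Rightarrow> 'b set set \<Rightarrow> nat \<Rightarrow> bool" where
  "system v xs A Q k \<longleftrightarrow> ground v A Q \<and> (\<exists>fs ls. list_all2 (lolli A Q) xs ls \<and>
     (\<forall>F\<in>set fs. scirc F \<and> F \<subseteq> A) \<and> cost fs ls \<le> k \<and>
     X \<inter> \<Union>Q \<subseteq> \<Union>(set fs) \<union> \<Union>(fst ` set ls) \<and> pending v A Q fs ls)"

lemma supp_Un: "supp (Q \<union> R) = supp Q \<union> supp R"
  by (auto simp: supp_def)

lemma supp_mono: "Q \<subseteq> R \<Longrightarrow> supp Q \<subseteq> supp R"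
  by (auto simp: supp_def)

lemma lolli_mono: "lolli A Q x l \<Longrightarrow> A \<subseteq> A' \<Longrightarrow> Q \<subseteq> Q' \<Longrightarrow> lolli A' Q' x l"
  using supp_mono[of Q Q'] unfolding lolli_def by blast

lemma lolli_all_mono: "list_all2 (lolli A Q) xs ls \<Longrightarrow> A \<subseteq> A' \<Longrightarrow> Q \<subseteq> Q' \<Longrightarrow> list_all2 (lolli A' Q') xs ls"
  using lolli_mono by (auto elim!: list_all2_mono)

lemma ground_apart:
  assumes "ground v A Q" "U \<in> supp Q" "E \<inter> cut S = {b}" "b \<notin> A" "v \<notin> S" "u \<in> ends U"
  shows "u \<notin> S"
proof -
  have "conn A u v" "A \<subseteq> E" using assms unfolding ground_def by blast+
  moreover have "A \<inter> cut S = {}" using calculation(2) assms(3,4) by auto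
  ultimately show ?thesis using conn_closed assms(5) by blast
qed

lemma ground_far:
  assumes "ground v A Q" "U \<in> supp Q" "E \<inter> cut S = {b}" "v \<notin> S" "ends U \<subseteq> S"
  shows "b \<in> A"
proof (rule ccontr)
  assume "b \<notin> A"
  moreover have "unb U" using assms(2) by (simp add: supp_def)
  then obtain u where "u \<in> ends U" using circ_ends unbD(1) by blast
  ultimately show False using ground_apart[OF assms(1-3) _ assms(4)] assms(5) by blast
qed

lemma ground_Un: "ground v A Q \<Longrightarrow> ground v B R \<Longrightarrow> ground v (A \<union> B) (Q \<union> R)"
  unfolding ground_def supp_Un by (metis Un_iff conn_mono finite_Un le_sup_iff sup.cobounded1 sup.cobounded2)

lemma system_le: "system v xs A Q k \<Longrightarrow> k \<le> k' \<Longrightarrow> system v xs A Q k'"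
  unfolding system_def by (meson order_trans)

lemma system_swap:
  assumes "system v [x, y] A Q k"
  shows "system v [y, x] A Q k"
proof -
  obtain fs ls where s: "ground v A Q" "list_all2 (lolli A Q) [x, y] ls"
    "\<forall>F\<in>set fs. scirc F \<and> F \<subseteq> A" "cost fs ls \<le> k"
    "X \<inter> \<Union>Q \<subseteq> \<Union>(set fs) \<union> \<Union>(fst ` set ls)" "pending v A Q fs ls"
    using assms unfolding system_def by blast
  obtain l l' where ls: "ls = [l, l']" "lolli A Q x l" "lolli A Q y l'" using s(2) by (auto simp: list_all2_Cons1)
  have set: "set [l', l] = set ls" using ls by auto
  have "pending v A Q fs [l', l]" using s(6) set unfolding pending_def by simp
  moreover have "cost fs [l', l] \<le> k" using s(4) ls by simp
  moreover have "X \<inter> \<Union>Q \<subseteq> \<Union>(set fs) \<union> \<Union>(fst ` set [l', l])" using s(5) set by simp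
  moreover have "list_all2 (lolli A Q) [y, x] [l', l]" using ls by simp
  ultimately show ?thesis using s(1,3) unfolding system_def by blast
qed

text \<open>The connection changes by the symmetric difference with \<open>{e}\<close>: going back
  over an edge shortens it, and the cost grows by at most one in any case. As \<open>e\<close> is no
  bridge, \<open>pending\<close> acquires no new demand.\<close>

lemma system_extend:
  assumes s: "system v (x # xs) A Q k" and e: "{t e, h e} = {x, y}" "nonbridge e" "e \<in> E"
  shows "system v (y # xs) (insert e A) Q (k + 1)"
proof -
  obtain fs ls' where s: "ground v A Q" "list_all2 (lolli A Q) (x # xs) ls'"
    "\<forall>F\<in>set fs. scirc F \<and> F \<subseteq> A" "cost fs ls' \<le> k"
    "X \<inter> \<Union>Q \<subseteq> \<Union>(set fs) \<union> \<Union>(fst ` set ls')" "pending v A Q fs ls'"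
    using s unfolding system_def by blast
  obtain U J ls where ls: "ls' = (U, J) # ls" "lolli A Q x (U, J)" "list_all2 (lolli A Q) xs ls"
    using s(2) by (auto simp: list_all2_Cons1)
  obtain u where u: "u \<in> ends U" "joins J u x" "U \<in> supp Q" "U \<union> J \<subseteq> A" using ls(2) by (auto simp: lolli_def)
  have fin: "finite A" using s(1) by (simp add: ground_def)
  have "joins (sym_diff J {e}) u y" using joins_trans[OF u(2) joins_single[OF e(1)]] .
  then have "lolli (insert e A) Q y (U, sym_diff J {e})" using u by (auto simp: lolli_def)
  moreover have "list_all2 (lolli (insert e A) Q) xs ls" using lolli_all_mono[OF ls(3)] by blast
  moreover have "card (U \<union> sym_diff J {e}) \<le> card (U \<union> J) + 1"
  proof -
    have "finite (U \<union> J)" using u(4) fin finite_subset by blast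
    then have "card (U \<union> sym_diff J {e}) \<le> card (insert e (U \<union> J))" by (intro card_mono) auto
    also have "\<dots> \<le> card (U \<union> J) + 1" using \<open>finite (U \<union> J)\<close> by (simp add: card_insert_if)
    finally show ?thesis .
  qed
  then have "cost fs ((U, sym_diff J {e}) # ls) \<le> k + 1" using s(4) ls(1) by simp
  moreover have "X \<inter> \<Union>Q \<subseteq> \<Union>(set fs) \<union> \<Union>(fst ` set ((U, sym_diff J {e}) # ls))" using s(5) ls(1) by simp
  moreover have "pending v (insert e A) Q fs ((U, sym_diff J {e}) # ls)"
    using s(6) e(2) unfolding pending_def nonbridge_def ls(1) by simp
  moreover have "ground v (insert e A) Q"
    using s(1) e(3) unfolding ground_def by (auto intro: conn_mono)
  moreover have "\<forall>F\<in>set fs. scirc F \<and> F \<subseteq> insert e A" using s(3) by blast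
  ultimately show ?thesis unfolding system_def by blast
qed

lemma system_add_edges:
  assumes s: "system v xs A Q k" and B: "finite B" "B \<subseteq> E" "\<And>b. b \<in> B \<Longrightarrow> nonbridge b"
  shows "system v xs (A \<union> B) Q k"
proof -
  obtain fs ls where s: "ground v A Q" "list_all2 (lolli A Q) xs ls"
    "\<forall>F\<in>set fs. scirc F \<and> F \<subseteq> A" "cost fs ls \<le> k"
    "X \<inter> \<Union>Q \<subseteq> \<Union>(set fs) \<union> \<Union>(fst ` set ls)" "pending v A Q fs ls"
    using s unfolding system_def by blast
  have "pending v (A \<union> B) Q fs ls" using s(6) B(3) unfolding pending_def nonbridge_def by blast
  moreover have "ground v (A \<union> B) Q" using s(1) B(1,2) unfolding ground_def by (metis conn_mono finite_Un le_sup_iff sup.cobounded1)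
  moreover have "list_all2 (lolli (A \<union> B) Q) xs ls" using lolli_all_mono[OF s(2)] by blast
  moreover have "\<forall>F\<in>set fs. scirc F \<and> F \<subseteq> A \<union> B" using s(3) by blast
  ultimately show ?thesis using s(4,5) unfolding system_def by blast
qed

text \<open>A bridge that separates \<open>x\<close> from \<open>y\<close> would have to be
  \<open>e\<close> itself, so the base vertex may move along with the lollipop.\<close>

lemma system_step:
  assumes s: "system x (x # xs) A Q k" and e: "{t e, h e} = {x, y}" "nonbridge e" "e \<in> E"
  shows "system y (y # xs) (insert e A) Q (k + 1)"
proof -
  obtain fs ls where s: "ground x (insert e A) Q" "list_all2 (lolli (insert e A) Q) (y # xs) ls"
    "\<forall>F\<in>set fs. scirc F \<and> F \<subseteq> insert e A" "cost fs ls \<le> k + 1"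
    "X \<inter> \<Union>Q \<subseteq> \<Union>(set fs) \<union> \<Union>(fst ` set ls)" "pending x (insert e A) Q fs ls"
    using system_extend[OF s e] unfolding system_def by blast
  have "x \<notin> S" if "E \<inter> cut S = {b}" "y \<notin> S" for b S
  proof
    assume "x \<in> S"
    then have "e \<in> cut S" using e(1) that(2) unfolding cut_def by (auto simp: doubleton_eq_iff)
    then have "b = e" using e(3) that(1) by auto
    then show False using e(2) that(1) unfolding nonbridge_def by blast
  qed
  then have "pending y (insert e A) Q fs ls" using s(6) unfolding pending_def by blast
  moreover have "conn (insert e A) x y" using conn_single[OF e(1)] by blast
  then have "ground y (insert e A) Q" using s(1) conn_trans unfolding ground_def by metis
  ultimately show ?thesis using s(2-5) unfolding system_def by blast
qed

lemma system_walk: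
  "walk x s \<Longrightarrow> system v (x # xs) A Q k \<Longrightarrow> fst ` set s \<subseteq> E \<Longrightarrow> (\<And>e. e \<in> fst ` set s \<Longrightarrow> nonbridge e) \<Longrightarrow>
   system v (last (stops x s) # xs) (A \<union> fst ` set s) Q (k + length s)"
proof (induction x s arbitrary: A k rule: walk.induct)
  case (1 u)
  then show ?case by simp
next
  case (2 u e x s)
  have "system v (x # xs) (insert e A) Q (k + 1)" using 2 by (intro system_extend[of v u]) auto
  then have "system v (last (stops x s) # xs) (insert e A \<union> fst ` set s) Q (k + 1 + length s)"
    using 2 by (intro 2(1)) auto
  then show ?case by simp
qed

text \<open>Here \<open>e\<close> may be a bridge, so the base vertex and all lollipops cross
  together. At least one is needed: lying beyond \<open>e\<close>, it answers the demand of
  \<open>pending\<close> for \<open>e\<close>.\<close>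

lemma system_cross:
  assumes s: "system u (replicate c u) A Q k" and c: "c > 0"
    and e: "{t e, h e} = {u, v}" "e \<notin> A" "e \<in> E"
  shows "system v (replicate c v) (insert e A) Q (k + c)"
proof -
  obtain fs ls where s: "ground u A Q" "list_all2 (lolli A Q) (replicate c u) ls"
    "\<forall>F\<in>set fs. scirc F \<and> F \<subseteq> A" "cost fs ls \<le> k"
    "X \<inter> \<Union>Q \<subseteq> \<Union>(set fs) \<union> \<Union>(fst ` set ls)" "pending u A Q fs ls"
    using s unfolding system_def by blast
  have fin: "finite A" using s(1) by (simp add: ground_def)
  let ?f = "\<lambda>(U, J). (U, sym_diff J {e})"
  have len: "length ls = c" using list_all2_lengthD[OF s(2)] by simp
  have lol: "lolli A Q u l" if "l \<in> set ls" for l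
    using s(2) that len by (auto simp: list_all2_conv_all_nth in_set_conv_nth)
  have lol': "lolli (insert e A) Q v (?f l)" if l: "lolli A Q u l" for l
  proof -
    obtain U J where lUJ: "l = (U, J)" by fastforce
    then obtain y where "y \<in> ends U" "joins J y u" "U \<in> supp Q" "U \<union> J \<subseteq> A" using l by (auto simp: lolli_def)
    moreover have "joins (sym_diff J {e}) y v" using joins_trans[OF calculation(2) joins_single[OF e(1)]] .
    ultimately show ?thesis using lUJ by (auto simp: lolli_def)
  qed
  have co: "card (fst (?f l) \<union> snd (?f l)) \<le> card (fst l \<union> snd l) + 1" if l: "lolli A Q u l" for l
  proof -
    obtain U J where lUJ: "l = (U, J)" by fastforce
    have "finite (U \<union> J)" using l lUJ fin finite_subset unfolding lolli_def by fastforce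
    then have "card (U \<union> sym_diff J {e}) \<le> card (insert e (U \<union> J))" by (intro card_mono) auto
    also have "\<dots> \<le> card (U \<union> J) + 1" using \<open>finite (U \<union> J)\<close> by (simp add: card_insert_if)
    finally show ?thesis using lUJ by simp
  qed
  have "list_all2 (lolli (insert e A) Q) (replicate c v) (map ?f ls)"
    using lol lol' len by (simp add: list_all2_conv_all_nth)
  moreover have "sum_list (map (\<lambda>l. card (fst l \<union> snd l)) (map ?f ls)) \<le>
      sum_list (map (\<lambda>l. card (fst l \<union> snd l)) ls) + length ls"
  proof -
    have "sum_list (map (\<lambda>l. card (fst (?f l) \<union> snd (?f l))) ls) \<le> sum_list (map (\<lambda>l. card (fst l \<union> snd l) + 1) ls)"
      using lol co by (intro sum_list_mono) blast
    also have "\<dots> = sum_list (map (\<lambda>l. card (fst l \<union> snd l)) ls) + length ls"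
      by (induction ls) auto
    finally show ?thesis by (simp add: comp_def)
  qed
  then have "cost fs (map ?f ls) \<le> k + c" using s(4) len by linarith
  moreover have fstf: "fst ` set (map ?f ls) = fst ` set ls" by force
  then have "X \<inter> \<Union>Q \<subseteq> \<Union>(set fs) \<union> \<Union>(fst ` set (map ?f ls))" using s(5) by simp
  moreover have "pending v (insert e A) Q fs (map ?f ls)"
    unfolding pending_def
  proof (intro ballI allI impI)
    fix b S assume b: "b \<in> insert e A" and S: "E \<inter> cut S = {b}" "v \<notin> S" "\<exists>U\<in>supp Q. ends U \<subseteq> S"
    have "b \<in> \<Union>(set fs) \<or> (\<exists>l\<in>set ls. ends (fst l) \<subseteq> S)"
    proof (cases "b = e")
      case True
      then have "e \<in> cut S" using S(1) by blast
      then have "u \<in> S" using e(1) S(2) unfolding cut_def by (auto simp: doubleton_eq_iff)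
      have "A \<inter> cut S = {}" using S(1) True e(2) s(1) unfolding ground_def by auto
      have "ls \<noteq> []" using len c by auto
      then have l: "hd ls \<in> set ls" by simp
      have "ends (fst (hd ls)) \<subseteq> S"
      proof
        fix y assume "y \<in> ends (fst (hd ls))"
        then have "conn A y u" using lol[OF l] s(1) unfolding ground_def lolli_def by blast
        then show "y \<in> S" using conn_closed[OF _ \<open>A \<inter> cut S = {}\<close>] \<open>u \<in> S\<close> by blast
      qed
      then show ?thesis using l by blast
    next
      case False
      then have "e \<notin> cut S" using S(1) e(3) by auto
      then have "u \<notin> S" using e(1) S(2) unfolding cut_def by (auto simp: doubleton_eq_iff)
      then show ?thesis using s(6) b False S unfolding pending_def by blast
    qed
    moreover have "(\<exists>l\<in>set ls. ends (fst l) \<subseteq> S) \<longleftrightarrow> (\<exists>U\<in>fst ` set ls. ends U \<subseteq> S)" by blast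
    moreover have "(\<exists>l\<in>set (map ?f ls). ends (fst l) \<subseteq> S) \<longleftrightarrow> (\<exists>U\<in>fst ` set (map ?f ls). ends U \<subseteq> S)" by blast
    ultimately show "b \<in> \<Union>(set fs) \<or> (\<exists>l\<in>set (map ?f ls). ends (fst l) \<subseteq> S)" using fstf by fastforce
  qed
  moreover have "conn (insert e A) u v" using conn_single[OF e(1)] by blast
  then have "ground v (insert e A) Q"
    using s(1) e(3) conn_trans[of "insert e A" _ u v] conn_mono[of A _ u "insert e A"]
    unfolding ground_def by blast
  moreover have "\<forall>F\<in>set fs. scirc F \<and> F \<subseteq> insert e A" using s(3) by blast
  ultimately show ?thesis unfolding system_def by blast
qed

lemma system_union:
  assumes s: "system v xs A Q k" and s': "system v ys B R k'"
    and nb: "\<And>b. b \<in> A \<Longrightarrow> b \<in> B \<Longrightarrow> nonbridge b"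
  shows "system v (xs @ ys) (A \<union> B) (Q \<union> R) (k + k')"
proof -
  obtain fs ls where s: "ground v A Q" "list_all2 (lolli A Q) xs ls"
    "\<forall>F\<in>set fs. scirc F \<and> F \<subseteq> A" "cost fs ls \<le> k"
    "X \<inter> \<Union>Q \<subseteq> \<Union>(set fs) \<union> \<Union>(fst ` set ls)" "pending v A Q fs ls"
    using s unfolding system_def by blast
  obtain fs' ls' where s': "ground v B R" "list_all2 (lolli B R) ys ls'"
    "\<forall>F\<in>set fs'. scirc F \<and> F \<subseteq> B" "cost fs' ls' \<le> k'"
    "X \<inter> \<Union>R \<subseteq> \<Union>(set fs') \<union> \<Union>(fst ` set ls')" "pending v B R fs' ls'"
    using s' unfolding system_def by blast
  have "list_all2 (lolli (A \<union> B) (Q \<union> R)) xs ls" using lolli_all_mono[OF s(2)] by blast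
  moreover have "list_all2 (lolli (A \<union> B) (Q \<union> R)) ys ls'" using lolli_all_mono[OF s'(2)] by blast
  ultimately have "list_all2 (lolli (A \<union> B) (Q \<union> R)) (xs @ ys) (ls @ ls')" by (rule list_all2_appendI)
  moreover have "\<forall>F\<in>set (fs @ fs'). scirc F \<and> F \<subseteq> A \<union> B" using s(3) s'(3) by auto
  moreover have "cost (fs @ fs') (ls @ ls') \<le> k + k'" using s(4) s'(4) by simp
  moreover have "X \<inter> \<Union>(Q \<union> R) \<subseteq> \<Union>(set (fs @ fs')) \<union> \<Union>(fst ` set (ls @ ls'))"
  proof -
    have "X \<inter> \<Union>(Q \<union> R) = X \<inter> \<Union>Q \<union> X \<inter> \<Union>R" by blast
    then show ?thesis using s(5) s'(5) by auto
  qed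
  moreover have "pending v (A \<union> B) (Q \<union> R) (fs @ fs') (ls @ ls')"
    unfolding pending_def
  proof (intro ballI allI impI)
    fix b S assume b: "b \<in> A \<union> B" and S: "E \<inter> cut S = {b}" "v \<notin> S" "\<exists>U\<in>supp (Q \<union> R). ends U \<subseteq> S"
    then obtain U where U: "U \<in> supp Q \<or> U \<in> supp R" "ends U \<subseteq> S" unfolding supp_Un by blast
    from U(1) have "b \<in> \<Union>(set fs) \<or> (\<exists>l\<in>set ls. ends (fst l) \<subseteq> S) \<or>
       b \<in> \<Union>(set fs') \<or> (\<exists>l\<in>set ls'. ends (fst l) \<subseteq> S)"
    proof
      assume "U \<in> supp Q"
      then show ?thesis using ground_far[OF s(1) _ S(1,2) U(2)] s(6) S(1,2) U(2) unfolding pending_def by blast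
    next
      assume "U \<in> supp R"
      then show ?thesis using ground_far[OF s'(1) _ S(1,2) U(2)] s'(6) S(1,2) U(2) unfolding pending_def by blast
    qed
    then show "b \<in> \<Union>(set (fs @ fs')) \<or> (\<exists>l\<in>set (ls @ ls'). ends (fst l) \<subseteq> S)" by auto
  qed
  ultimately show ?thesis using ground_Un[OF s(1) s'(1)] unfolding system_def by blast
qed

text \<open>One lollipop of each system becomes a barbell inside the union of the two, at no extra
  cost. A bridge lies in only one of \<open>A\<close> and \<open>B\<close>; if it separated the
  lollipop of that system from \<open>v\<close>, the circuit of the other is on the side of
  \<open>v\<close>, and the barbell crosses the bridge.\<close>

lemma system_merge:
  assumes s: "system v (v # xs) A Q k" and s': "system v (v # ys) B R k'"
    and nb: "\<And>b. b \<in> A \<Longrightarrow> b \<in> B \<Longrightarrow> nonbridge b"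
    and nc: "\<And>U U'. U \<in> supp Q \<Longrightarrow> U' \<in> supp R \<Longrightarrow> nonconf U U'"
  shows "system v (xs @ ys) (A \<union> B) (Q \<union> R) (k + k')"
proof -
  obtain fs ls0 where s: "ground v A Q" "list_all2 (lolli A Q) (v # xs) ls0"
    "\<forall>F\<in>set fs. scirc F \<and> F \<subseteq> A" "cost fs ls0 \<le> k"
    "X \<inter> \<Union>Q \<subseteq> \<Union>(set fs) \<union> \<Union>(fst ` set ls0)" "pending v A Q fs ls0"
    using s unfolding system_def by blast
  obtain fs' ls0' where s': "ground v B R" "list_all2 (lolli B R) (v # ys) ls0'"
    "\<forall>F\<in>set fs'. scirc F \<and> F \<subseteq> B" "cost fs' ls0' \<le> k'"
    "X \<inter> \<Union>R \<subseteq> \<Union>(set fs') \<union> \<Union>(fst ` set ls0')" "pending v B R fs' ls0'"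
    using s' unfolding system_def by blast
  obtain U J ls where ls: "ls0 = (U, J) # ls" "lolli A Q v (U, J)" "list_all2 (lolli A Q) xs ls"
    using s(2) by (auto simp: list_all2_Cons1)
  obtain U' J' ls' where ls': "ls0' = (U', J') # ls'" "lolli B R v (U', J')" "list_all2 (lolli B R) ys ls'"
    using s'(2) by (auto simp: list_all2_Cons1)
  obtain u where u: "u \<in> ends U" "joins J u v" "U \<in> supp Q" "U \<union> J \<subseteq> A" using ls(2) by (auto simp: lolli_def)
  obtain u' where u': "u' \<in> ends U'" "joins J' u' v" "U' \<in> supp R" "U' \<union> J' \<subseteq> B" using ls'(2) by (auto simp: lolli_def)
  have fin: "finite A" "finite B" using s(1) s'(1) by (auto simp: ground_def)
  have AE: "A \<subseteq> E" "B \<subseteq> E" using s(1) s'(1) by (auto simp: ground_def)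
  have "joins (sym_diff J J') u u'" using joins_trans[OF u(2) joins_sym[OF u'(2)]] .
  then have "conn (J \<union> J') u u'" unfolding conn_def by (intro exI[of _ "sym_diff J J'"]) auto
  moreover have "unb U" "unb U'" using u(3) u'(3) by (auto simp: supp_def)
  ultimately obtain F where F: "scirc F" "U \<union> U' \<subseteq> F" "F \<subseteq> U \<union> U' \<union> (J \<union> J')"
      "\<And>x y. x \<in> ends U \<Longrightarrow> y \<in> ends U' \<Longrightarrow> conn F x y"
    using barbell_ex[of U U' u u' "J \<union> J'"] nc[OF u(3) u'(3)] u(1) u'(1) by metis
  have FAB: "F \<subseteq> A \<union> B" using F(3) u(4) u'(4) by blast
  have "finite (U \<union> J)" "finite (U' \<union> J')" using u(4) u'(4) fin finite_subset by blast+
  then have "card F \<le> card ((U \<union> J) \<union> (U' \<union> J'))" using F(3) by (intro card_mono) auto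
  also have "\<dots> \<le> card (U \<union> J) + card (U' \<union> J')" by (rule card_Un_le)
  finally have "cost (F # fs @ fs') (ls @ ls') \<le> k + k'" using s(4) s'(4) ls(1) ls'(1) by simp
  moreover have "list_all2 (lolli (A \<union> B) (Q \<union> R)) (xs @ ys) (ls @ ls')"
    using lolli_all_mono[OF ls(3), of "A \<union> B" "Q \<union> R"] lolli_all_mono[OF ls'(3), of "A \<union> B" "Q \<union> R"]
    by (intro list_all2_appendI) auto
  moreover have "\<forall>F'\<in>set (F # fs @ fs'). scirc F' \<and> F' \<subseteq> A \<union> B" using s(3) s'(3) F(1) FAB by auto
  moreover have "X \<inter> \<Union>(Q \<union> R) \<subseteq> \<Union>(set (F # fs @ fs')) \<union> \<Union>(fst ` set (ls @ ls'))"
  proof -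
    have "X \<inter> \<Union>(Q \<union> R) = X \<inter> \<Union>Q \<union> X \<inter> \<Union>R" by blast
    then show ?thesis using s(5) s'(5) F(2) ls(1) ls'(1) by auto
  qed
  moreover have "pending v (A \<union> B) (Q \<union> R) (F # fs @ fs') (ls @ ls')"
    unfolding pending_def
  proof (intro ballI allI impI)
    fix b S assume b: "b \<in> A \<union> B" and S: "E \<inter> cut S = {b}" "v \<notin> S" "\<exists>U\<in>supp (Q \<union> R). ends U \<subseteq> S"
    then obtain V where V: "V \<in> supp Q \<or> V \<in> supp R" "ends V \<subseteq> S" unfolding supp_Un by blast
    have nbb: "\<not> (b \<in> A \<and> b \<in> B)" using nb S(1) unfolding nonbridge_def by blast
    have bF: "b \<in> F" if "x \<in> ends U" "y \<in> ends U'" "x \<in> S \<longleftrightarrow> y \<notin> S" for x y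
    proof (rule ccontr)
      assume "b \<notin> F"
      then have "F \<inter> cut S = {}" using S(1) FAB AE by fastforce
      then show False using conn_closed[OF F(4)[OF that(1,2)]] that(3) by blast
    qed
    obtain y where y: "y \<in> ends U" using u(1) by blast
    obtain y' where y': "y' \<in> ends U'" using u'(1) by blast
    from V(1) have "b \<in> F \<or> b \<in> \<Union>(set fs) \<or> (\<exists>l\<in>set ls. ends (fst l) \<subseteq> S) \<or>
       b \<in> \<Union>(set fs') \<or> (\<exists>l\<in>set ls'. ends (fst l) \<subseteq> S)"
    proof
      assume V': "V \<in> supp Q"
      then have bA: "b \<in> A" using ground_far[OF s(1) _ S(1,2) V(2)] by blast
      then have "y' \<notin> S" using ground_apart[OF s'(1) u'(3) S(1) _ S(2) y'] nbb by blast
      moreover have "b \<in> \<Union>(set fs) \<or> (\<exists>l\<in>set ls0. ends (fst l) \<subseteq> S)"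
        using s(6) bA S(1,2) V' V(2) unfolding pending_def by blast
      ultimately show ?thesis using bF[OF y y'] y ls(1) by auto
    next
      assume V': "V \<in> supp R"
      then have bB: "b \<in> B" using ground_far[OF s'(1) _ S(1,2) V(2)] by blast
      then have "y \<notin> S" using ground_apart[OF s(1) u(3) S(1) _ S(2) y] nbb by blast
      moreover have "b \<in> \<Union>(set fs') \<or> (\<exists>l\<in>set ls0'. ends (fst l) \<subseteq> S)"
        using s'(6) bB S(1,2) V' V(2) unfolding pending_def by blast
      ultimately show ?thesis using bF[OF y y'] y' ls'(1) by auto
    qed
    then show "b \<in> \<Union>(set (F # fs @ fs')) \<or> (\<exists>l\<in>set (ls @ ls'). ends (fst l) \<subseteq> S)" by auto
  qed
  ultimately show ?thesis using ground_Un[OF s(1) s'(1)] unfolding system_def by blast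
qed

text \<open>Without suppliers nothing has to be linked to \<open>v\<close>, and one copy of each
  balanced circuit suffices.\<close>

lemma system_plain:
  assumes s: "system v xs A Q k" and R: "finite R" "supp R = {}" "finite (\<Union>R)" "\<Union>R \<subseteq> E"
    "\<And>p. p \<in> R \<Longrightarrow> bal p \<or> X \<inter> p = {}"
  shows "system v xs (A \<union> \<Union>R) (Q \<union> R) (k + sum card {p\<in>R. bal p})"
proof -
  obtain fs ls where s: "ground v A Q" "list_all2 (lolli A Q) xs ls"
    "\<forall>F\<in>set fs. scirc F \<and> F \<subseteq> A" "cost fs ls \<le> k"
    "X \<inter> \<Union>Q \<subseteq> \<Union>(set fs) \<union> \<Union>(fst ` set ls)" "pending v A Q fs ls"
    using s unfolding system_def by blast
  obtain gs where gs: "set gs = {p\<in>R. bal p}" "distinct gs"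
    using finite_distinct_list[of "{p\<in>R. bal p}"] R(1) by auto
  have "sum_list (map card gs) = sum card {p\<in>R. bal p}"
    using gs by (metis sum.distinct_set_conv_list)
  then have "cost (gs @ fs) ls \<le> k + sum card {p\<in>R. bal p}" using s(4) by simp
  moreover have "list_all2 (lolli (A \<union> \<Union>R) (Q \<union> R)) xs ls" using lolli_all_mono[OF s(2)] by blast
  moreover have "\<forall>F\<in>set (gs @ fs). scirc F \<and> F \<subseteq> A \<union> \<Union>R" using s(3) gs(1) unfolding scirc_def by auto
  moreover have "X \<inter> \<Union>(Q \<union> R) \<subseteq> \<Union>(set (gs @ fs)) \<union> \<Union>(fst ` set ls)"
  proof -
    have "e \<in> \<Union>(set gs)" if e: "e \<in> X" "e \<in> p" "p \<in> R" for e p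
    proof -
      have "bal p" using R(5)[OF e(3)] e(1,2) by blast
      then show ?thesis using gs(1) e(2,3) by blast
    qed
    then have "X \<inter> \<Union>R \<subseteq> \<Union>(set gs)" by blast
    moreover have "X \<inter> \<Union>(Q \<union> R) = X \<inter> \<Union>Q \<union> X \<inter> \<Union>R" by blast
    moreover have "\<Union>(set (gs @ fs)) = \<Union>(set gs) \<union> \<Union>(set fs)" by simp
    ultimately show ?thesis using s(5) by auto
  qed
  moreover have sup: "supp (Q \<union> R) = supp Q" using R(2) supp_Un by simp
  have "ground v (A \<union> \<Union>R) (Q \<union> R)"
    using s(1) R(3,4) conn_mono[of A _ v "A \<union> \<Union>R"] unfolding ground_def sup by blast
  moreover have "pending v (A \<union> \<Union>R) (Q \<union> R) (gs @ fs) ls"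
    unfolding pending_def
  proof (intro ballI allI impI)
    fix b S assume S: "E \<inter> cut S = {b}" "v \<notin> S" "\<exists>U\<in>supp (Q \<union> R). ends U \<subseteq> S"
    then obtain U where U: "U \<in> supp Q" "ends U \<subseteq> S" using sup by auto
    have "b \<in> A" using ground_far[OF s(1) U(1) S(1,2) U(2)] .
    then show "b \<in> \<Union>(set (gs @ fs)) \<or> (\<exists>l\<in>set ls. ends (fst l) \<subseteq> S)"
      using s(6) S(1,2) U unfolding pending_def by auto
  qed
  ultimately show ?thesis unfolding system_def by blast
qed

lemma system_unb:
  assumes "unb p" "p \<subseteq> E" "v \<in> ends p" "\<And>b. b \<in> p \<Longrightarrow> nonbridge b"
  shows "system v [v] p {p} (card p)"
proof -
  have sup: "U = p" if "U \<in> supp {p}" for U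
    using that assms(1) circ_sub[of p U] unfolding supp_def unb_def circ_def by blast
  have "p \<in> supp {p}" using assms(1) by (simp add: supp_def)
  then have "list_all2 (lolli p {p}) [v] [(p, {})]"
    using assms(3) joins_empty by (auto simp: lolli_def)
  moreover have "ground v p {p}"
    unfolding ground_def using sup circ_conn[OF unbD(1)[OF assms(1)]] assms unbD(2) by auto
  moreover have "pending v p {p} [] [(p, {})]"
    using assms(4) unfolding pending_def nonbridge_def by blast
  moreover have "cost [] [(p, {})] \<le> card p" by simp
  moreover have "X \<inter> \<Union>{p} \<subseteq> \<Union>(set []) \<union> \<Union>(fst ` set [(p, {})])" by simp
  moreover have "\<forall>F\<in>set []. scirc F \<and> F \<subseteq> p" by simp
  ultimately show ?thesis unfolding system_def by (intro conjI exI[of _ "[]"] exI[of _ "[(p, {})]"])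
qed

text \<open>A piece as a black box with the gate \<open>x\<close>, where it delivers one lollipop or
  two, in either case at twice its size. The minimal sides of bridges are treated in this
  way.\<close>

definition box :: "'b set \<Rightarrow> 'a \<Rightarrow> bool" where
  "box p x \<longleftrightarrow> system x [x] p {p} (2 * card p) \<and> system x [x, x] p {p} (2 * card p)"

definition simple :: "'b set \<Rightarrow> bool" where
  "simple p \<longleftrightarrow> circ p \<or> (\<exists>e. p = {e} \<and> X \<inter> p = {})"

definition pieces :: "('b set \<Rightarrow> 'a) \<Rightarrow> 'b set set \<Rightarrow> bool" where
  "pieces w Q \<longleftrightarrow> finite Q \<and>
     (\<forall>p\<in>Q. p \<noteq> {} \<and> finite p \<and> p \<subseteq> E \<and> (\<forall>u\<in>ends p. \<forall>v\<in>ends p. conn p u v)) \<and>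
     (\<forall>p\<in>Q. \<forall>q\<in>Q. p \<noteq> q \<longrightarrow> p \<inter> q = {} \<and> (\<forall>U\<in>supp {p}. \<forall>U'\<in>supp {q}. nonconf U U')) \<and>
     (\<forall>p\<in>Q. simple p \<or> box p (w p) \<and> (\<forall>q\<in>Q. q \<noteq> p \<longrightarrow> ends p \<inter> ends q \<subseteq> {w p}))"

lemma pieces_mono: "pieces w Q \<Longrightarrow> R \<subseteq> Q \<Longrightarrow> pieces w R"
  unfolding pieces_def by (meson finite_subset subsetD)

lemma supp_box: "box p x \<Longrightarrow> supp {p} \<noteq> {}"
  unfolding box_def system_def lolli_def by (auto simp: list_all2_Cons1)

lemma supp_circ: "circ p \<Longrightarrow> supp {p} = (if unb p then {p} else {})"
  using circ_sub[of p] unfolding supp_def unb_def circ_def by auto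

lemma supp_single: "\<not> circ {e} \<Longrightarrow> supp {{e}} = {}"
  using circD(2) unfolding supp_def unb_def by (auto simp: subset_singleton_iff)

lemma supp_elem: "U \<in> supp Q \<Longrightarrow> \<exists>p\<in>Q. U \<in> supp {p}"
  by (auto simp: supp_def)

lemma pieces_plain:
  assumes "pieces w R" "supp R = {}" "p \<in> R"
  shows "bal p \<or> X \<inter> p = {}"
proof -
  have e: "supp {p} = {}" using supp_mono[of "{p}" R] assms by blast
  then have "\<not> box p x" for x using supp_box by blast
  then have "simple p" using assms unfolding pieces_def by auto
  moreover have "circ p \<Longrightarrow> bal p" using e supp_circ[of p] circ_bal_unb[of p] by (auto split: if_splits)
  ultimately show ?thesis unfolding simple_def by blast
qed

lemma pieces_finite: "pieces w Q \<Longrightarrow> finite (\<Union>Q)" "pieces w Q \<Longrightarrow> \<Union>Q \<subseteq> E" "pieces w Q \<Longrightarrow> finite Q"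
  unfolding pieces_def by auto

lemma pieces_nonconf:
  assumes "pieces w Q" "R \<subseteq> Q" "R' \<subseteq> Q" "R \<inter> R' = {}" "U \<in> supp R" "U' \<in> supp R'"
  shows "nonconf U U'"
proof -
  obtain p q where "p \<in> R" "U \<in> supp {p}" "q \<in> R'" "U' \<in> supp {q}" using supp_elem assms(5,6) by meson
  moreover have "p \<noteq> q" using calculation assms(4) by blast
  ultimately show ?thesis using assms(1-3) unfolding pieces_def by (meson subset_iff)
qed

lemma pieces_disjoint:
  assumes "pieces w Q" "R \<subseteq> Q" "R' \<subseteq> Q" "R \<inter> R' = {}"
  shows "\<Union>R \<inter> \<Union>R' = {}"
proof (rule equals0I)
  fix e assume "e \<in> \<Union>R \<inter> \<Union>R'"
  then obtain p q where "e \<in> p" "p \<in> R" "e \<in> q" "q \<in> R'" by blast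
  moreover have "p \<noteq> q" using calculation assms(4) by blast
  ultimately show False using assms(1-3) unfolding pieces_def by force
qed

text \<open>If \<open>K\<close> has suppliers, it delivers two lollipops at \<open>x\<close>: one
  forms a barbell with the lollipop that is already there, the other takes its place. This is why
  the number of open lollipops never matters for what is absorbed.\<close>

lemma system_absorb:
  assumes s: "system x (x # xs) A Q k" and K: "pieces w K"
    and IH: "supp K \<noteq> {} \<Longrightarrow> system x [x, x] (\<Union>K) K (2 * sum card K)"
    and nb: "\<And>b. b \<in> A \<Longrightarrow> b \<in> \<Union>K \<Longrightarrow> nonbridge b"
    and nc: "\<And>U U'. U \<in> supp Q \<Longrightarrow> U' \<in> supp K \<Longrightarrow> nonconf U U'"
  shows "system x (x # xs) (A \<union> \<Union>K) (Q \<union> K) (k + 2 * sum card K)"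
proof (cases "supp K = {}")
  case True
  have "system x (x # xs) (A \<union> \<Union>K) (Q \<union> K) (k + sum card {p\<in>K. bal p})"
    using system_plain[OF s pieces_finite(3)[OF K] True pieces_finite(1,2)[OF K]] pieces_plain[OF K True] by blast
  moreover have "sum card {p\<in>K. bal p} \<le> sum card K"
    using pieces_finite(3)[OF K] by (intro sum_mono2) auto
  ultimately show ?thesis by (elim system_le) simp
next
  case False
  have "system x ([x] @ xs) (\<Union>K \<union> A) (K \<union> Q) (2 * sum card K + k)"
    using IH[OF False] s nb nc nonconf_sym by (intro system_merge) auto
  then show ?thesis by (simp add: Un_commute add.commute)
qed

section \<open>Supplying lollipops\<close>

definition reach :: "'b set set \<Rightarrow> 'a \<Rightarrow> 'b set \<Rightarrow> bool" where
  "reach R x p \<longleftrightarrow> (\<exists>y\<in>ends p. conn (\<Union>R) x y)"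

text \<open>Both numbers are demanded at the same price, since the user decides: one lollipop is
  passed on, two are needed for absorbing.\<close>

definition supplies :: "'b set set \<Rightarrow> 'a \<Rightarrow> bool" where
  "supplies K x \<longleftrightarrow> system x [x] (\<Union>K) K (2 * sum card K) \<and> system x [x, x] (\<Union>K) K (2 * sum card K)"

text \<open>All subcollections are included, because a tour splits the pieces according to the stops
  at which they are served.\<close>

definition supplying :: "'b set set \<Rightarrow> 'a set \<Rightarrow> bool" where
  "supplying R Z \<longleftrightarrow> (\<forall>K\<subseteq>R. \<forall>x\<in>Z. (\<forall>q\<in>K. reach K x q) \<longrightarrow> supp K \<noteq> {} \<longrightarrow> supplies K x)"

lemma supplying_mono: "supplying R Z \<Longrightarrow> R' \<subseteq> R \<Longrightarrow> Z' \<subseteq> Z \<Longrightarrow> supplying R' Z'"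
  unfolding supplying_def by (meson subset_trans subsetD)

lemma edge_ends: "e \<in> p \<Longrightarrow> t e \<in> ends p" "e \<in> p \<Longrightarrow> h e \<in> ends p"
  by (auto simp: ends_def)

lemma cut_ends: "e \<in> p \<Longrightarrow> e \<in> cut S \<Longrightarrow> \<exists>y\<in>ends p. y \<in> S"
  using edge_ends unfolding cut_def by blast

lemma reach_comp:
  assumes K: "K = {q\<in>R. reach R x q}" and q: "q \<in> K"
  shows "reach K x q"
proof -
  let ?S = "{y. conn (\<Union>K) x y}"
  have "\<Union>R \<inter> cut ?S = {}"
  proof (rule equals0I)
    fix e assume "e \<in> \<Union>R \<inter> cut ?S"
    then obtain p where p: "e \<in> p" "p \<in> R" "e \<in> cut ?S" by blast
    then obtain y where y: "y \<in> ends p" "conn (\<Union>K) x y" using cut_ends by blast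
    have "\<Union>K \<subseteq> \<Union>R" using K by blast
    then have "conn (\<Union>R) x y" using y(2) conn_mono by blast
    then have "p \<in> K" using K p(2) y(1) unfolding reach_def by blast
    then have "e \<in> \<Union>K \<inter> cut ?S" using p by blast
    then show False using comp_cut[of "\<Union>K" x] by blast
  qed
  moreover obtain y where y: "y \<in> ends q" "conn (\<Union>R) x y" using q K unfolding reach_def by blast
  moreover have "x \<in> ?S" by (simp add: conn_refl)
  ultimately have "y \<in> ?S" using conn_closed[of "\<Union>R" x y ?S] by blast
  then show ?thesis using y(1) unfolding reach_def by blast
qed

lemma reach_rest:
  assumes K: "K = {q\<in>R. reach R x q}" and p: "p \<in> R - K" "reach R z p"
    and con: "\<And>q u v. q \<in> R \<Longrightarrow> u \<in> ends q \<Longrightarrow> v \<in> ends q \<Longrightarrow> conn q u v"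
  shows "reach (R - K) z p"
proof -
  obtain y where y: "y \<in> ends p" "conn (\<Union>R) z y" using p(2) unfolding reach_def by blast
  let ?S = "{v. conn (\<Union>(R - K)) y v}"
  have "\<Union>R \<inter> cut ?S = {}"
  proof (rule equals0I)
    fix e assume "e \<in> \<Union>R \<inter> cut ?S"
    then obtain q where q: "e \<in> q" "q \<in> R" "e \<in> cut ?S" by blast
    show False
    proof (cases "q \<in> K")
      case False
      then have "e \<in> \<Union>(R - K) \<inter> cut ?S" using q by blast
      then show False using comp_cut[of "\<Union>(R - K)" y] by blast
    next
      case True
      obtain v where v: "v \<in> ends q" "conn (\<Union>(R - K)) y v" using cut_ends[OF q(1,3)] by blast
      obtain u where u: "u \<in> ends q" "conn (\<Union>R) x u" using True K unfolding reach_def by blast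
      have "conn q u v" using con[OF q(2) u(1) v(1)] .
      then have "conn (\<Union>R) u v" by (rule conn_mono) (use q(2) in blast)
      moreover have "conn (\<Union>R) v y" by (rule conn_mono[OF conn_sym[OF v(2)]]) blast
      ultimately have "conn (\<Union>R) x y" using u(2) conn_trans by blast
      then show False using p(1) K y(1) unfolding reach_def by blast
    qed
  qed
  moreover have "y \<in> ?S" by (simp add: conn_refl)
  ultimately have "z \<in> ?S" using conn_closed[OF y(2), of ?S] by blast
  then have "conn (\<Union>(R - K)) z y" using conn_sym by blast
  then show ?thesis using y(1) unfolding reach_def by blast
qed

lemma pieces_conn: "pieces w R \<Longrightarrow> q \<in> R \<Longrightarrow> u \<in> ends q \<Longrightarrow> v \<in> ends q \<Longrightarrow> conn q u v"
  unfolding pieces_def by auto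

text \<open>The pieces reached from \<open>x\<close> form a union of components, so they are
  connected to \<open>x\<close> by themselves, and the others do not need them to reach the
  remaining stops. They are served at \<open>x\<close>, and the rest is left to the remainder of a
  walk.\<close>

lemma pieces_split:
  assumes R: "pieces w R" "\<And>q. q \<in> R \<Longrightarrow> \<exists>z\<in>Z. reach R z q"
    and K: "K = {q\<in>R. reach R x q}" and Z: "Z \<subseteq> insert x Z'"
  shows "K \<subseteq> R" "\<And>q. q \<in> K \<Longrightarrow> reach K x q" "pieces w K" "pieces w (R - K)"
    "\<And>q. q \<in> R - K \<Longrightarrow> \<exists>z\<in>Z'. reach (R - K) z q" "K \<union> (R - K) = R"
    "sum card R = sum card K + sum card (R - K)" "\<Union>K \<inter> \<Union>(R - K) = {}"
    "\<And>U U'. U \<in> supp (R - K) \<Longrightarrow> U' \<in> supp K \<Longrightarrow> nonconf U U'"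
proof -
  show KR: "K \<subseteq> R" using K by blast
  show "reach K x q" if "q \<in> K" for q using reach_comp[OF K that] .
  show "pieces w K" "pieces w (R - K)" using pieces_mono[OF R(1)] KR by blast+
  show "\<exists>z\<in>Z'. reach (R - K) z q" if q: "q \<in> R - K" for q
  proof -
    obtain z where z: "z \<in> Z" "reach R z q" using R(2) q by blast
    have "z \<noteq> x" using z(2) q K by blast
    moreover have "reach (R - K) z q" using reach_rest[OF K q z(2)] pieces_conn[OF R(1)] by blast
    ultimately show ?thesis using z(1) Z by blast
  qed
  show "K \<union> (R - K) = R" using KR by blast
  show "sum card R = sum card K + sum card (R - K)"
    using sum.subset_diff[OF KR pieces_finite(3)[OF R(1)], of card] by simp
  show "\<Union>K \<inter> \<Union>(R - K) = {}" using pieces_disjoint[OF R(1) KR, of "R - K"] by blast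
  show "nonconf U U'" if "U \<in> supp (R - K)" "U' \<in> supp K" for U U'
    using pieces_nonconf[OF R(1), of "R - K" K] that KR by blast
qed

text \<open>The lollipop obtained from the later stops is brought back over the edge to
  \<open>x\<close>, where the pieces hanging at \<open>x\<close> are absorbed. In this way each step
  of the walk is paid once. The second form leaves a further lollipop at the last stop.\<close>

lemma system_tour:
  assumes "walk x s" "fst ` set s \<subseteq> E" "\<And>e. e \<in> fst ` set s \<Longrightarrow> nonbridge e"
    "pieces w R" "supplying R (set (stops x s))" "\<And>q. q \<in> R \<Longrightarrow> \<exists>z\<in>set (stops x s). reach R z q" "supp R \<noteq> {}"
  shows "system x [x] (\<Union>R \<union> fst ` set s) R (2 * sum card R + length s) \<and>
    system x [x, last (stops x s)] (\<Union>R \<union> fst ` set s) R (2 * sum card R + length s)"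
  using assms
proof (induction x s arbitrary: R rule: walk.induct)
  case (1 x)
  have "supplies R x" using 1(5,6,7) unfolding supplying_def by auto
  then show ?case unfolding supplies_def by simp
next
  case (2 x e z s)
  define K where "K = {q\<in>R. reach R x q}"
  let ?R = "R - K" and ?y = "last (stops z s)"
  note sp = pieces_split[OF 2(5,7) K_def, of "set (stops z s)"]
  have sp: "K \<subseteq> R" "\<And>q. q \<in> K \<Longrightarrow> reach K x q" "pieces w K" "pieces w ?R"
    "\<And>q. q \<in> ?R \<Longrightarrow> \<exists>z\<in>set (stops z s). reach ?R z q" "K \<union> ?R = R"
    "sum card R = sum card K + sum card ?R" "\<Union>K \<inter> \<Union>?R = {}"
    "\<And>U U'. U \<in> supp ?R \<Longrightarrow> U' \<in> supp K \<Longrightarrow> nonconf U U'"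
    using sp by simp_all
  have UR: "\<Union>R = \<Union>K \<union> \<Union>?R" using sp(6) by blast
  have e: "{t e, h e} = {x, z}" "{t e, h e} = {z, x}" "nonbridge e" "e \<in> E" using 2(2,3,4) by auto
  have w: "walk z s" "fst ` set s \<subseteq> E" "\<And>e. e \<in> fst ` set s \<Longrightarrow> nonbridge e" using 2(2,3,4) by auto
  have supK: "supplies K x" if "supp K \<noteq> {}"
    using 2(6) sp(1,2) that unfolding supplying_def by simp
  have last: "last (stops x ((e, z) # s)) = ?y" by simp
  show ?case
  proof (cases "supp ?R = {}")
    case False
    have sR: "supplying ?R (set (stops z s))" by (rule supplying_mono[OF 2(6)]) auto
    have IH: "system z [z] (\<Union>?R \<union> fst ` set s) ?R (2 * sum card ?R + length s)"
      "system z [z, ?y] (\<Union>?R \<union> fst ` set s) ?R (2 * sum card ?R + length s)"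
      using 2(1)[OF w sp(4) sR sp(5) False] by blast+
    have abs: "system x (x # xs) (\<Union>R \<union> fst ` set ((e, z) # s)) R (2 * sum card R + length ((e, z) # s))"
      if sys: "system z (z # xs) (\<Union>?R \<union> fst ` set s) ?R (2 * sum card ?R + length s)" for xs
    proof -
      have 1: "system x (x # xs) (insert e (\<Union>?R \<union> fst ` set s)) ?R (2 * sum card ?R + length s + 1)"
        using system_step[OF sys e(2,3,4)] .
      have nb: "nonbridge b" if "b \<in> insert e (\<Union>?R \<union> fst ` set s)" "b \<in> \<Union>K" for b
        using that sp(8) e(3) w(3) by blast
      have "system x (x # xs) (insert e (\<Union>?R \<union> fst ` set s) \<union> \<Union>K) (?R \<union> K)
         (2 * sum card ?R + length s + 1 + 2 * sum card K)"
        using system_absorb[OF 1 sp(3) _ nb sp(9)] supK unfolding supplies_def by blast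
      moreover have "insert e (\<Union>?R \<union> fst ` set s) \<union> \<Union>K = \<Union>R \<union> fst ` set ((e, z) # s)" using UR by auto
      moreover have "?R \<union> K = R" using sp(6) by blast
      ultimately show ?thesis using sp(7) by (simp add: add.commute add.left_commute)
    qed
    show ?thesis using abs[OF IH(1)] abs[OF IH(2)] last by simp
  next
    case True
    then have "supp K \<noteq> {}" using 2(8) supp_Un[of K ?R] sp(6) by simp
    then have S: "system x [x] (\<Union>K) K (2 * sum card K)" "system x [x, x] (\<Union>K) K (2 * sum card K)"
      using supK unfolding supplies_def by blast+
    let ?es = "fst ` set ((e, z) # s)"
    have es: "finite ?es" "?es \<subseteq> E" "\<And>b. b \<in> ?es \<Longrightarrow> nonbridge b" using 2(3,4) by auto
    have plain: "system x xs (\<Union>R \<union> ?es) R (k + 2 * sum card ?R)"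
      if sys: "system x xs (\<Union>K \<union> ?es) K k" for xs k
    proof -
      have "system x xs (\<Union>K \<union> ?es \<union> \<Union>?R) (K \<union> ?R) (k + sum card {p\<in>?R. bal p})"
        using system_plain[OF sys pieces_finite(3)[OF sp(4)] True pieces_finite(1,2)[OF sp(4)]]
          pieces_plain[OF sp(4) True] by blast
      moreover have "\<Union>K \<union> ?es \<union> \<Union>?R = \<Union>R \<union> ?es" using UR by blast
      moreover have "sum card {p\<in>?R. bal p} \<le> sum card ?R"
        using pieces_finite(3)[OF sp(4)] by (intro sum_mono2) auto
      ultimately show ?thesis using sp(6) by (auto elim!: system_le)
    qed
    have "system x [x] (\<Union>K \<union> ?es) K (2 * sum card K)"
      using system_add_edges[OF S(1) es] .
    then have "system x [x] (\<Union>R \<union> ?es) R (2 * sum card K + 2 * sum card ?R)" by (rule plain)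
    moreover have "system x [?y, x] (\<Union>K \<union> ?es) K (2 * sum card K + length ((e, z) # s))"
      using system_walk[OF 2(2) S(2) es(2,3)] last by simp
    then have "system x [x, ?y] (\<Union>R \<union> ?es) R (2 * sum card K + length ((e, z) # s) + 2 * sum card ?R)"
      using plain system_swap by blast
    ultimately show ?thesis using sp(7) last by (auto elim!: system_le)
  qed
qed

text \<open>A lollipop at the last stop is carried against the direction of the walk to
  \<open>x\<close> and absorbs the pieces at each stop.\<close>

lemma system_carry:
  assumes "walk x s" "fst ` set s \<subseteq> E" "\<And>e. e \<in> fst ` set s \<Longrightarrow> nonbridge e"
    "pieces w R" "supplying R (set (stops x s))" "\<And>q. q \<in> R \<Longrightarrow> \<exists>z\<in>set (stops x s). reach R z q"
    "system (last (stops x s)) (last (stops x s) # xs) A Q k"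
    "\<And>b. b \<in> A \<Longrightarrow> b \<in> \<Union>R \<Longrightarrow> nonbridge b" "\<And>U U'. U \<in> supp Q \<Longrightarrow> U' \<in> supp R \<Longrightarrow> nonconf U U'"
  shows "system x (x # xs) (A \<union> \<Union>R \<union> fst ` set s) (Q \<union> R) (k + 2 * sum card R + length s)"
  using assms
proof (induction x s arbitrary: R rule: walk.induct)
  case (1 x)
  have "system x [x, x] (\<Union>R) R (2 * sum card R)" if "supp R \<noteq> {}"
    using 1(5,6) that unfolding supplying_def supplies_def by auto
  then have "system x (x # xs) (A \<union> \<Union>R) (Q \<union> R) (k + 2 * sum card R)"
    using 1(4,7,8,9) by (intro system_absorb) auto
  then show ?case by simp
next
  case (2 x e z s)
  define K where "K = {q\<in>R. reach R x q}"
  let ?R = "R - K" and ?y = "last (stops z s)"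
  note sp = pieces_split[OF 2(5,7) K_def, of "set (stops z s)"]
  have sp: "K \<subseteq> R" "\<And>q. q \<in> K \<Longrightarrow> reach K x q" "pieces w K" "pieces w ?R"
    "\<And>q. q \<in> ?R \<Longrightarrow> \<exists>z\<in>set (stops z s). reach ?R z q" "K \<union> ?R = R"
    "sum card R = sum card K + sum card ?R" "\<Union>K \<inter> \<Union>?R = {}"
    "\<And>U U'. U \<in> supp ?R \<Longrightarrow> U' \<in> supp K \<Longrightarrow> nonconf U U'"
    using sp by simp_all
  have UR: "\<Union>R = \<Union>K \<union> \<Union>?R" using sp(6) by blast
  have e: "{t e, h e} = {z, x}" "nonbridge e" "e \<in> E" using 2(2,3,4) by auto
  have w: "walk z s" "fst ` set s \<subseteq> E" "\<And>e. e \<in> fst ` set s \<Longrightarrow> nonbridge e" using 2(2,3,4) by auto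
  have supK: "system x [x, x] (\<Union>K) K (2 * sum card K)" if "supp K \<noteq> {}"
    using 2(6) sp(1,2) that unfolding supplying_def supplies_def by simp
  have nbR: "nonbridge b" if "b \<in> A" "b \<in> \<Union>?R" for b using 2(9)[of b] that by blast
  have ncR: "nonconf U U'" if "U \<in> supp Q" "U' \<in> supp ?R" for U U'
    using 2(10)[of U U'] that supp_mono[of ?R R] by blast
  have sR: "supplying ?R (set (stops z s))" using supplying_mono[OF 2(6)] by (simp add: subsetI)
  have sys: "system ?y (?y # xs) A Q k" using 2(8) by simp
  have "system z (z # xs) (A \<union> \<Union>?R \<union> fst ` set s) (Q \<union> ?R) (k + 2 * sum card ?R + length s)"
    using 2(1)[OF w sp(4) sR sp(5) sys nbR ncR] .
  from system_step[OF this e]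
  have 1: "system x (x # xs) (insert e (A \<union> \<Union>?R \<union> fst ` set s)) (Q \<union> ?R) (k + 2 * sum card ?R + length s + 1)" .
  have nb: "nonbridge b" if "b \<in> insert e (A \<union> \<Union>?R \<union> fst ` set s)" "b \<in> \<Union>K" for b
    using that sp(1,8) e(2) w(3) 2(9)[of b] by blast
  have nc: "nonconf U U'" if "U \<in> supp (Q \<union> ?R)" "U' \<in> supp K" for U U'
    using that sp(9) 2(10)[of U U'] supp_mono[OF sp(1)] unfolding supp_Un by blast
  have "system x (x # xs) (insert e (A \<union> \<Union>?R \<union> fst ` set s) \<union> \<Union>K) (Q \<union> ?R \<union> K)
       (k + 2 * sum card ?R + length s + 1 + 2 * sum card K)"
    using system_absorb[OF 1 sp(3) supK nb nc] .
  moreover have "insert e (A \<union> \<Union>?R \<union> fst ` set s) \<union> \<Union>K = A \<union> \<Union>R \<union> fst ` set ((e, z) # s)" using UR by auto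
  moreover have "Q \<union> ?R \<union> K = Q \<union> R" using sp(6) by blast
  ultimately show ?case using sp(7) by (simp add: add.commute add.left_commute)
qed

lemma reach_remove:
  assumes p: "p \<in> Q" "v \<in> ends p" and q: "reach Q v q"
  shows "\<exists>z\<in>ends p. reach (Q - {p}) z q"
proof -
  let ?R = "Q - {p}"
  let ?S = "{y. \<exists>z\<in>ends p. conn (\<Union>?R) z y}"
  have "\<Union>Q \<inter> cut ?S = {}"
  proof (rule equals0I)
    fix e assume e: "e \<in> \<Union>Q \<inter> cut ?S"
    show False
    proof (cases "e \<in> p")
      case True
      then have "t e \<in> ?S" "h e \<in> ?S" using edge_ends[OF True] conn_refl by blast+
      then show False using e unfolding cut_def by blast
    next
      case False
      then have "e \<in> \<Union>?R" using e by blast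
      then have "conn (\<Union>?R) (t e) (h e)" by (rule conn_edge)
      then have "t e \<in> ?S \<longleftrightarrow> h e \<in> ?S" using conn_trans conn_sym by blast
      then show False using e unfolding cut_def by blast
    qed
  qed
  moreover obtain y where y: "y \<in> ends q" "conn (\<Union>Q) v y" using q unfolding reach_def by blast
  moreover have "v \<in> ?S" using p(2) conn_refl by blast
  ultimately have "y \<in> ?S" using conn_closed[of "\<Union>Q" v y ?S] by blast
  then show ?thesis using y(1) unfolding reach_def by blast
qed

lemma reach_attached:
  assumes p: "p \<in> Q" "v \<in> ends p" and att: "\<And>r. r \<in> Q \<Longrightarrow> r \<noteq> p \<Longrightarrow> ends p \<inter> ends r \<subseteq> {v}"
    and q: "reach Q v q" "q \<in> Q" "q \<noteq> p"
  shows "reach (Q - {p}) v q"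
proof -
  let ?R = "Q - {p}"
  obtain z y where z: "z \<in> ends p" "y \<in> ends q" "conn (\<Union>?R) z y"
    using reach_remove[OF p q(1)] unfolding reach_def by blast
  have "z = v"
  proof (rule ccontr)
    assume n: "z \<noteq> v"
    have "\<Union>?R \<inter> cut {z} = {}"
    proof (rule equals0I)
      fix e assume "e \<in> \<Union>?R \<inter> cut {z}"
      then obtain r where r: "r \<in> Q" "r \<noteq> p" "e \<in> r" "e \<in> cut {z}" by blast
      then have "z \<in> ends r" using cut_ends by blast
      then show False using att[OF r(1,2)] z(1) n by blast
    qed
    then have "y = z" using conn_closed[OF z(3)] by blast
    then show False using att[OF q(2,3)] z n by blast
  qed
  then show ?thesis using z unfolding reach_def by blast
qed

lemma circ_nonbridge: "circ C \<Longrightarrow> C \<subseteq> E \<Longrightarrow> e \<in> C \<Longrightarrow> nonbridge e"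
  unfolding nonbridge_def
proof (intro allI notI)
  fix S assume C: "circ C" "C \<subseteq> E" "e \<in> C" and S: "E \<inter> cut S = {e}"
  have "C \<inter> cut S = {e}" using C S by blast
  then show False using even_set_cut[OF circD(1)[OF C(1)], of S] by simp
qed

lemma circ_tour:
  assumes "circ p" "v \<in> ends p"
  obtains s where "walk v s" "last (stops v s) = v" "fst ` set s = p" "length s = card p" "set (stops v s) = ends p"
proof -
  obtain s where s: "walk v s" "last (stops v s) = v" "distinct (map fst s)" "fst ` set s = p"
    using circ_walk[OF assms] .
  have "length s = card p" using distinct_card[OF s(3)] s(4) by simp
  moreover have "snd ` set s \<subseteq> ends (fst ` set s)" using s(1)
  proof (induction v s rule: walk.induct)
    case (1 u)
    then show ?case by simp
  next
    case (2 u e x s)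
    have "x \<in> {t e, h e}" using 2(2) by simp
    then show ?case using 2 by (auto simp: ends_def)
  qed
  moreover have "ends p \<subseteq> set (stops v s)" using walk_edge_ends[OF s(1)] s(4) unfolding ends_def by blast
  ultimately show thesis using that[of s] s assms(2) by auto
qed

text \<open>
  A piece \<open>p\<close> at \<open>v\<close> is toured once, and the components of the other pieces are served on the way. An
  unbalanced \<open>p\<close> also has to supply itself: for one lollipop, \<open>p\<close> is carried around its own tour; for
  two, the tour yields one of them and \<open>p\<close> is the other.
\<close>

theorem pieces_supply:
  assumes "pieces w Q" "\<And>q. q \<in> Q \<Longrightarrow> simple q \<or> v \<notin> ends q \<or> v = w q"
    "\<And>q. q \<in> Q \<Longrightarrow> reach Q v q" "supp Q \<noteq> {}"
  shows "supplies Q v"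
  using assms
proof (induction "card Q" arbitrary: Q v rule: less_induct)
  case less
  note Q = less.prems
  have finQ: "finite Q" using pieces_finite(3)[OF Q(1)] .
  have con: "conn q u u'" if "q \<in> Q" "u \<in> ends q" "u' \<in> ends q" for q u u'
    using pieces_conn[OF Q(1) that] .
  obtain p where p: "p \<in> Q" "v \<in> ends p"
  proof -
    obtain q where q: "q \<in> Q" using Q(4) by (auto simp: supp_def)
    then obtain y where y: "y \<in> ends q" "conn (\<Union>Q) v y" using Q(3) unfolding reach_def by blast
    show thesis
    proof (cases "\<Union>Q \<inter> cut {v} = {}")
      case True
      then have "y = v" using conn_closed[OF y(2) True] by blast
      then show thesis using that q y(1) by blast
    next
      case False
      then obtain e q' where "e \<in> q'" "q' \<in> Q" "e \<in> cut {v}" by blast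
      then show thesis using that[of q'] cut_ends[of e q' "{v}"] by blast
    qed
  qed
  let ?R = "Q - {p}"
  have pR: "pieces w ?R" using pieces_mono[OF Q(1)] by blast
  have p': "p \<noteq> {}" "finite p" "p \<subseteq> E" using Q(1) p(1) unfolding pieces_def by auto
  have sumQ: "sum card Q = card p + sum card ?R" using sum.remove[OF finQ p(1)] .
  have UQ: "\<Union>Q = p \<union> \<Union>?R" "?R \<union> {p} = Q" "{p} \<union> ?R = Q" using p(1) by blast+
  have disj: "p \<inter> \<Union>?R = {}" using pieces_disjoint[OF Q(1), of "{p}" ?R] p(1) by auto
  have ncp: "nonconf U U'" if "U \<in> supp {p}" "U' \<in> supp ?R" for U U'
    using pieces_nonconf[OF Q(1), of "{p}" ?R] that p(1) by blast
  have supQ: "supp Q = supp {p} \<union> supp ?R" using supp_Un[of "{p}" ?R] UQ(3) by simp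
  have IH: "supplies K x" if "K \<subseteq> ?R" "\<And>q. q \<in> K \<Longrightarrow> reach K x q" "supp K \<noteq> {}"
    "\<And>q. q \<in> K \<Longrightarrow> simple q \<or> x \<notin> ends q \<or> x = w q" for K x
  proof (rule less.hyps)
    show "card K < card Q" using that(1) p(1) finQ by (intro psubset_card_mono) auto
    show "pieces w K" using pieces_mono[OF pR that(1)] .
  qed (use that in auto)
  have reachR: "\<exists>z\<in>ends p. reach ?R z q" if q: "q \<in> ?R" for q
    using reach_remove[OF p Q(3)] q by blast
  \<comment> \<open>The tour of \<open>p\<close> can enter a box only at its gate, as
    \<open>p\<close> meets it nowhere else; so the induction hypothesis applies at every vertex of
    \<open>p\<close>.\<close>
  have supR: "supplying ?R (ends p)"
    unfolding supplying_def
  proof (intro allI ballI impI)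
    fix K x assume K: "K \<subseteq> ?R" "\<forall>q\<in>K. reach K x q" "supp K \<noteq> {}" and x: "x \<in> ends p"
    have "simple q \<or> x \<notin> ends q \<or> x = w q" if q: "q \<in> K" for q
    proof -
      have "q \<in> Q" "q \<noteq> p" using q K(1) by blast+
      then have "simple q \<or> ends q \<inter> ends p \<subseteq> {w q}" using Q(1) p(1) unfolding pieces_def by fastforce
      then show ?thesis using x by blast
    qed
    then show "supplies K x" using IH K by blast
  qed
  consider (unb) "unb p" | (bal) "bal p" | (edge) e where "p = {e}" "X \<inter> p = {}" "\<not> circ p"
    | (box) "\<not> simple p" "box p (w p)" "\<And>q. q \<in> Q \<Longrightarrow> q \<noteq> p \<Longrightarrow> ends p \<inter> ends q \<subseteq> {w p}"
    using Q(1) p(1) circ_bal_unb[of p] unfolding pieces_def simple_def by metis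
  then show ?case
  proof cases
    case unb
    have circ: "circ p" using unb by (simp add: unb_def)
    have nb: "nonbridge b" if "b \<in> p" for b using circ_nonbridge[OF circ p'(3) that] .
    obtain s where s: "walk v s" "last (stops v s) = v" "fst ` set s = p" "length s = card p" "set (stops v s) = ends p"
      using circ_tour[OF circ p(2)] .
    have A: "system v [v] p {p} (card p)" using system_unb[OF unb p'(3) p(2) nb] .
    have "system v [v] (p \<union> \<Union>?R \<union> fst ` set s) ({p} \<union> ?R) (card p + 2 * sum card ?R + length s)"
    proof (rule system_carry[OF s(1) _ _ pR])
      show "fst ` set s \<subseteq> E" using s(3) p'(3) by simp
      show "nonbridge e" if "e \<in> fst ` set s" for e using that s(3) nb by simp
      show "supplying ?R (set (stops v s))" using supR s(5) by simp
      show "\<exists>z\<in>set (stops v s). reach ?R z q" if "q \<in> ?R" for q using reachR[OF that] s(5) by simp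
      show "system (last (stops v s)) [last (stops v s)] p {p} (card p)" using A s(2) by simp
      show "nonbridge b" if "b \<in> p" for b using nb[OF that] .
      show "nonconf U U'" if "U \<in> supp {p}" "U' \<in> supp ?R" for U U' using ncp[OF that] .
    qed
    then have c1: "system v [v] (\<Union>Q) Q (2 * sum card Q)" using s(3,4) UQ sumQ by (simp add: Un_commute)
    have "system v [v, v] (\<Union>Q) Q (2 * sum card Q)"
    proof (cases "supp ?R = {}")
      case True
      \<comment> \<open>Without another supplier, \<open>p\<close> itself serves as both lollipops,
        and these two copies are its budget.\<close>
      have "system v [v, v] p {p} (card p + card p)" using system_union[OF A A nb] by simp
      from system_plain[OF this pieces_finite(3)[OF pR] True pieces_finite(1,2)[OF pR]]
      have "system v [v, v] (p \<union> \<Union>?R) ({p} \<union> ?R) (card p + card p + sum card {q\<in>?R. bal q})"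
        using pieces_plain[OF pR True] by blast
      moreover have "sum card {q\<in>?R. bal q} \<le> sum card ?R" using pieces_finite(3)[OF pR] by (intro sum_mono2) auto
      ultimately show ?thesis using UQ sumQ by (auto elim!: system_le)
    next
      case False
      have "system v [v] (\<Union>?R \<union> fst ` set s) ?R (2 * sum card ?R + length s)"
        using system_tour[OF s(1) _ _ pR _ _ False] s(3,5) p'(3) nb supR reachR by metis
      then have "system v [v] (\<Union>?R \<union> p) ?R (2 * sum card ?R + card p)" using s(3,4) by simp
      from system_union[OF A this nb]
      have "system v [v, v] (p \<union> (\<Union>?R \<union> p)) ({p} \<union> ?R) (card p + (2 * sum card ?R + card p))" by simp
      moreover have "p \<union> (\<Union>?R \<union> p) = \<Union>Q" using UQ(1) by blast
      ultimately show ?thesis using UQ sumQ by (auto elim!: system_le)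
    qed
    then show ?thesis using c1 unfolding supplies_def by blast
  next
    case bal
    have circ: "circ p" using bal by (simp add: bal_def)
    have sp: "supp {p} = {}" using supp_circ[OF circ] bal unfolding bal_def unb_def by simp
    then have sR: "supp ?R \<noteq> {}" using Q(4) supQ by simp
    have nb: "nonbridge b" if "b \<in> p" for b using circ_nonbridge[OF circ p'(3) that] .
    obtain s where s: "walk v s" "last (stops v s) = v" "fst ` set s = p" "length s = card p" "set (stops v s) = ends p"
      using circ_tour[OF circ p(2)] .
    have T: "system v [v] (\<Union>?R \<union> fst ` set s) ?R (2 * sum card ?R + length s) \<and>
        system v [v, last (stops v s)] (\<Union>?R \<union> fst ` set s) ?R (2 * sum card ?R + length s)"
      using system_tour[OF s(1) _ _ pR _ _ sR] s(3,5) p'(3) nb supR reachR by metis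
    \<comment> \<open>A balanced \<open>p\<close> is paid twice: as the route of the tour and as a
      signed circuit.\<close>
    have add: "system v xs (\<Union>Q) Q (2 * sum card Q)" if sys: "system v xs (\<Union>?R \<union> p) ?R (2 * sum card ?R + card p)" for xs
    proof -
      have "system v xs (\<Union>?R \<union> p \<union> \<Union>{p}) (?R \<union> {p}) (2 * sum card ?R + card p + sum card {q\<in>{p}. bal q})"
        using system_plain[OF sys _ sp] p'(2,3) bal by simp
      moreover have "{q\<in>{p}. bal q} = {p}" using bal by blast
      moreover have "\<Union>?R \<union> p \<union> \<Union>{p} = \<Union>Q" using UQ(1) by blast
      ultimately show ?thesis using UQ(2) sumQ by (auto elim!: system_le)
    qed
    have T1: "system v [v] (\<Union>?R \<union> p) ?R (2 * sum card ?R + card p)" using T s(3,4) by simp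
    have T2: "system v [v, v] (\<Union>?R \<union> p) ?R (2 * sum card ?R + card p)" using T s(2,3,4) by simp
    show ?thesis using add[OF T1] add[OF T2] unfolding supplies_def by blast
  next
    case edge
    have sp: "supp {p} = {}" using supp_single[of e] edge by simp
    then have sR: "supp ?R \<noteq> {}" using Q(4) supQ by simp
    obtain u where u: "{t e, h e} = {u, v}" "ends p = {u, v}"
      using p(2) edge(1) unfolding ends_def by (auto simp: insert_commute)
    have eE: "e \<in> E" "e \<notin> \<Union>?R" using p'(3) disj edge(1) by auto
    have nobal: "{q\<in>{p}. bal q} = {}" using edge(3) by (auto simp: bal_def)
    have add: "system v xs (\<Union>Q) Q k" if sys: "system v xs A ?R k" and A: "A \<union> p = \<Union>Q" for xs A k
    proof -
      have "system v xs (A \<union> \<Union>{p}) (?R \<union> {p}) (k + sum card {q\<in>{p}. bal q})"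
        using system_plain[OF sys _ sp] p'(2,3) edge(2) by simp
      then show ?thesis by (simp only: nobal sum.empty add_0_right Union_insert Union_empty Un_empty_right A UQ(2))
    qed
    \<comment> \<open>The pieces that are reached from \<open>v\<close> without \<open>e\<close>;
      the others hang at the far end \<open>u\<close>.\<close>
    define K where "K = {q\<in>?R. reach ?R v q}"
    let ?R' = "?R - K"
    have Rr: "\<And>q. q \<in> ?R \<Longrightarrow> \<exists>z\<in>{v, u}. reach ?R z q" using reachR u(2) by blast
    have spl: "K \<subseteq> ?R" "\<And>q. q \<in> K \<Longrightarrow> reach K v q" "pieces w K" "pieces w ?R'"
      "\<And>q. q \<in> ?R' \<Longrightarrow> reach ?R' u q" "K \<union> ?R' = ?R"
      "sum card ?R = sum card K + sum card ?R'" "\<Union>K \<inter> \<Union>?R' = {}"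
      "\<And>U U'. U \<in> supp ?R' \<Longrightarrow> U' \<in> supp K \<Longrightarrow> nonconf U U'"
      using pieces_split[OF pR Rr K_def, of "{u}"] by simp_all
    have UR: "\<Union>?R = \<Union>K \<union> \<Union>?R'" using spl(6) by blast
    have supK: "supplies K v" if "supp K \<noteq> {}"
      using supR spl(1,2) that p(2) unfolding supplying_def by simp
    show ?thesis
    proof (cases "supp ?R' = {}")
      case True
      then have "supp K \<noteq> {}" using sR supp_Un[of K ?R'] spl(6) by simp
      note K = supK[OF this, unfolded supplies_def]
      have plain: "system v xs (\<Union>Q) Q (2 * sum card Q)" if sys: "system v xs (\<Union>K) K (2 * sum card K)" for xs
      proof -
        have "system v xs (\<Union>K \<union> \<Union>?R') (K \<union> ?R') (2 * sum card K + sum card {q\<in>?R'. bal q})"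
          using system_plain[OF sys pieces_finite(3)[OF spl(4)] True pieces_finite(1,2)[OF spl(4)]]
            pieces_plain[OF spl(4) True] by blast
        then have "system v xs (\<Union>?R) ?R (2 * sum card K + sum card {q\<in>?R'. bal q})" using spl(6) UR by simp
        then have "system v xs (\<Union>Q) Q (2 * sum card K + sum card {q\<in>?R'. bal q})"
          by (rule add) (use UQ(1) in blast)
        moreover have "sum card {q\<in>?R'. bal q} \<le> sum card ?R'" using pieces_finite(3)[OF spl(4)] by (intro sum_mono2) auto
        ultimately show ?thesis using sumQ spl(7) by (auto elim!: system_le)
      qed
      show ?thesis using plain K unfolding supplies_def by blast
    next
      case False
      have u_in: "u \<in> ends p" using u(2) by blast
      have S: "supplies ?R' u"
        using supR spl(5) False u_in unfolding supplying_def by auto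
      have eR': "e \<notin> \<Union>?R'" using eE(2) by blast
      have "system u (replicate 1 u) (\<Union>?R') ?R' (2 * sum card ?R')" using S unfolding supplies_def by simp
      from system_cross[OF this _ u(1) eR' eE(1)]
      have s1: "system v [v] (insert e (\<Union>?R')) ?R' (2 * sum card ?R' + 1)" by simp
      have "system u (replicate 2 u) (\<Union>?R') ?R' (2 * sum card ?R')"
        using S unfolding supplies_def by (simp add: numeral_2_eq_2)
      from system_cross[OF this _ u(1) eR' eE(1)]
      have s2: "system v [v, v] (insert e (\<Union>?R')) ?R' (2 * sum card ?R' + 2)" by (simp add: numeral_2_eq_2)
      \<comment> \<open>If there are suppliers beyond \<open>e\<close>, one or two lollipops cross
        it, so \<open>e\<close> is paid at most twice.\<close>
      have fin: "system v (v # xs) (\<Union>Q) Q (2 * sum card Q)"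
        if sys: "system v (v # xs) (insert e (\<Union>?R')) ?R' (2 * sum card ?R' + k)" "k \<le> 2" for xs k
      proof -
        have nb: "nonbridge b" if "b \<in> insert e (\<Union>?R')" "b \<in> \<Union>K" for b
          using that eE(2) UR spl(8) by blast
        have supK': "supp K \<noteq> {} \<Longrightarrow> system v [v, v] (\<Union>K) K (2 * sum card K)"
          using supK unfolding supplies_def by blast
        have "system v (v # xs) (insert e (\<Union>?R') \<union> \<Union>K) (?R' \<union> K) (2 * sum card ?R' + k + 2 * sum card K)"
          using system_absorb[OF sys(1) spl(3) supK' nb spl(9)] .
        moreover have "?R' \<union> K = ?R" using spl(6) by blast
        ultimately have "system v (v # xs) (insert e (\<Union>?R') \<union> \<Union>K) ?R (2 * sum card ?R' + k + 2 * sum card K)" by simp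
        then have "system v (v # xs) (\<Union>Q) Q (2 * sum card ?R' + k + 2 * sum card K)"
          by (rule add) (use UQ(1) UR edge(1) in blast)
        moreover have "card p = 1" using edge(1) by simp
        ultimately show ?thesis using sumQ spl(7) sys(2) by (auto elim!: system_le)
      qed
      show ?thesis using fin[OF s1] fin[OF s2] unfolding supplies_def by simp
    qed
  next
    case box
    have v: "v = w p" using Q(2)[OF p(1)] box(1) p(2) by blast
    have reachv: "reach ?R v q" if q: "q \<in> ?R" for q
      using reach_attached[OF p, of q] box(3) v Q(3) q by blast
    have supR': "supp ?R \<noteq> {} \<Longrightarrow> system v [v, v] (\<Union>?R) ?R (2 * sum card ?R)"
      using supR reachv p(2) unfolding supplying_def supplies_def by blast
    have abs: "system v (v # xs) (\<Union>Q) Q (2 * sum card Q)" if sys: "system v (v # xs) p {p} (2 * card p)" for xs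
    proof -
      have "system v (v # xs) (p \<union> \<Union>?R) ({p} \<union> ?R) (2 * card p + 2 * sum card ?R)"
        using system_absorb[OF sys pR supR' _ ncp] disj by blast
      then show ?thesis using UQ sumQ by simp
    qed
    show ?thesis using abs box(2) v unfolding box_def supplies_def by simp
  qed
qed

end

section \<open>Bridges\<close>

context signed_multigraph
begin

lemma parity_decomp:
  assumes "decomp \<C> A"
  shows "odd (card (A \<inter> N)) \<longleftrightarrow> odd (card {C\<in>\<C>. unb C})"
proof -
  have fin: "finite \<C>" "\<And>C. C \<in> \<C> \<Longrightarrow> finite C" using assms circD(3) by (auto simp: decomp_def)
  have "A \<inter> N = (\<Union>C\<in>\<C>. C \<inter> N)" using assms by (auto simp: decomp_def)
  moreover have "(C \<inter> N) \<inter> (C' \<inter> N) = {}" if "C \<in> \<C>" "C' \<in> \<C>" "C \<noteq> C'" for C C'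
    using decomp_disjoint[OF assms that] by blast
  then have "card (\<Union>C\<in>\<C>. C \<inter> N) = (\<Sum>C\<in>\<C>. card (C \<inter> N))"
    using fin by (intro card_UN_disjoint) auto
  ultimately have "card (A \<inter> N) = (\<Sum>C\<in>\<C>. card (C \<inter> N))" by simp
  moreover have "odd (\<Sum>C\<in>\<C>. card (C \<inter> N)) \<longleftrightarrow> odd (card {C\<in>\<C>. odd (card (C \<inter> N))})"
    using even_sum_iff[OF fin(1), of "\<lambda>C. card (C \<inter> N)"] by simp
  moreover have "{C\<in>\<C>. odd (card (C \<inter> N))} = {C\<in>\<C>. unb C}"
    using assms by (auto simp: decomp_def unb_def)
  ultimately show ?thesis by simp
qed

lemma decomp_card: "decomp \<C> A \<Longrightarrow> sum card \<C> = card A"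
  using card_Union_disjoint[of \<C>] circD(3) unfolding decomp_def disjoint_def pairwise_def disjnt_def by auto

lemma decomp_list:
  assumes "decomp \<C> A"
  obtains fs where "set fs = \<C>" "sum_list (map card fs) = card A"
proof -
  obtain fs where fs: "set fs = \<C>" "distinct fs"
    using finite_distinct_list[of \<C>] assms by (auto simp: decomp_def)
  then have "sum_list (map card fs) = sum card \<C>" by (metis sum.distinct_set_conv_list)
  then show thesis using that fs(1) decomp_card[OF assms] by simp
qed

text \<open>The fundamental circuit of \<open>e\<close> with respect to the positive edges in
  \<open>T\<close>: its only negative edge is \<open>e\<close>.\<close>

lemma fund_circ:
  assumes "conn T (t e) (h e)" "T \<inter> N = {}" "e \<in> N"
  obtains C where "unb C" "e \<in> C" "C \<subseteq> insert e T"
proof -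
  obtain J where J: "J \<subseteq> T" "joins J (t e) (h e)" using assms(1) unfolding conn_def by blast
  have "{e} \<inter> J = {}" using J(1) assms(2,3) by blast
  from joins_Un[OF joins_sym[OF joins_edge] J(2) this]
  have "even_set ({e} \<union> J)" by (simp add: joins_refl_iff)
  then obtain \<C> where C: "decomp \<C> ({e} \<union> J)" using even_decomp by blast
  then obtain C where "C \<in> \<C>" "e \<in> C" "circ C" "C \<subseteq> {e} \<union> J" unfolding decomp_def by blast
  moreover have "C \<inter> N = {e}" using calculation J(1) assms(2,3) by blast
  ultimately show thesis using that[of C] J(1) unfolding unb_def by auto
qed

lemma walk_leaves: "walk u s \<Longrightarrow> e \<in> fst ` set s \<Longrightarrow> \<exists>y\<in>set (butlast (stops u s)). y \<in> {t e, h e}"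
proof (induction u s rule: walk.induct)
  case (2 u e' x s)
  then show ?case by (cases "e = e'") auto
qed simp

end

text \<open>
  Minimum signatures satisfy \<open>bridge_pos\<close>; in a flow-admissible signed graph, the conservation laws
  of a side without negative edges would give its bridge the flow \<open>0\<close>, whence \<open>bridge_side\<close>.
\<close>

locale spanned = lollipops t h N E X for t h :: "'b \<Rightarrow> 'a" and N E X :: "'b set" +
  fixes V :: "'a set" and T :: "'b set"
  assumes finV: "finite V" and finE: "finite E" and EV: "ends E \<subseteq> V"
    and NE: "N \<subseteq> E" and TE: "T \<subseteq> E" and TN: "T \<inter> N = {}"
    and Tconn: "\<And>u v. u \<in> V \<Longrightarrow> v \<in> V \<Longrightarrow> conn T u v"
    and Xeven: "even_set X" and NX: "N \<subseteq> X" and XT: "X \<subseteq> N \<union> T"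
    and bridge_pos: "\<And>S b. E \<inter> cut S = {b} \<Longrightarrow> b \<notin> N"
    and bridge_side: "\<And>S b. E \<inter> cut S = {b} \<Longrightarrow> \<exists>e\<in>N. t e \<in> S \<and> h e \<in> S"
begin

section \<open>Shores of bridges\<close>

definition side :: "'a set \<Rightarrow> bool" where
  "side S \<longleftrightarrow> S \<subseteq> V \<and> (\<exists>b. E \<inter> cut S = {b})"

text \<open>The leaves of the tree formed by the bridges. They become the boxes, being pairwise
  disjoint and free of bridges, and every side contains one.\<close>

definition min_side :: "'a set \<Rightarrow> bool" where
  "min_side S \<longleftrightarrow> side S \<and> (\<forall>S'. side S' \<longrightarrow> \<not> S' \<subset> S)"

definition inn :: "'a set \<Rightarrow> 'b set" where
  "inn S = {e \<in> T \<union> N. t e \<in> S \<and> h e \<in> S}"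

lemma edge_V: "e \<in> E \<Longrightarrow> t e \<in> V" "e \<in> E \<Longrightarrow> h e \<in> V"
  using EV by (auto simp: ends_def)

lemma cut_V: "E \<inter> cut (S \<inter> V) = E \<inter> cut S"
  using edge_V by (auto simp: cut_def)

lemma cut_minus: "E \<inter> cut (V - S) = E \<inter> cut S"
  using edge_V by (auto simp: cut_def)

lemma bridge_T:
  assumes "E \<inter> cut S = {b}" shows "b \<in> T"
proof -
  have b: "b \<in> E" "b \<in> cut S" using assms by blast+
  have "conn T (t b) (h b)" using Tconn edge_V[OF b(1)] by blast
  then have "T \<inter> cut S \<noteq> {}" using conn_closed[of T "t b" "h b" S] b(2) unfolding cut_def by blast
  then show ?thesis using assms TE by auto
qed

lemma cut_nonempty:
  assumes "S \<subseteq> V" "S \<noteq> {}" "S \<noteq> V" shows "E \<inter> cut S \<noteq> {}"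
proof -
  obtain u v where "u \<in> S" "v \<in> V" "v \<notin> S" using assms by blast
  then have "T \<inter> cut S \<noteq> {}" using conn_closed[OF Tconn[of u v], of S] assms(1) by blast
  then show ?thesis using TE by blast
qed

text \<open>The two differences together have at most as many leaving edges as \<open>S\<close> and
  \<open>S'\<close>, namely two; neither has none, so each has exactly one.\<close>

lemma side_uncross:
  assumes S: "side S" "side S'" "S - S' \<noteq> {}" "S' - S \<noteq> {}"
  shows "side (S - S')"
proof -
  have V: "S \<subseteq> V" "S' \<subseteq> V" using S by (auto simp: side_def)
  have ind: "card (E \<inter> Y) = (\<Sum>e\<in>E. if e \<in> Y then 1 else 0)" for Y
    using finE by (simp add: sum.If_cases Int_def)
  have "card (E \<inter> cut (S - S')) + card (E \<inter> cut (S' - S)) \<le> card (E \<inter> cut S) + card (E \<inter> cut S')"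
    unfolding ind sum.distrib[symmetric] by (intro sum_mono) (auto simp: cut_def)
  also have "\<dots> = 2" using S(1,2) by (auto simp: side_def)
  finally have le: "card (E \<inter> cut (S - S')) + card (E \<inter> cut (S' - S)) \<le> 2" .
  have "E \<inter> cut (S - S') \<noteq> {}" "E \<inter> cut (S' - S) \<noteq> {}"
    using cut_nonempty[of "S - S'"] cut_nonempty[of "S' - S"] V S(3,4) by blast+
  then have "card (E \<inter> cut (S - S')) > 0" "card (E \<inter> cut (S' - S)) > 0"
    using finE by (simp_all add: card_gt_0_iff)
  then have "card (E \<inter> cut (S - S')) = 1" using le by linarith
  then show ?thesis using V unfolding side_def by (auto simp: card_1_singleton_iff)
qed

lemma min_side_disjoint:
  assumes "min_side S" "min_side S'" "S \<noteq> S'"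
  shows "S \<inter> S' = {}"
proof (rule ccontr)
  assume n: "S \<inter> S' \<noteq> {}"
  have s: "side S" "side S'" using assms by (auto simp: min_side_def)
  have "\<not> S \<subset> S'" "\<not> S' \<subset> S" using assms s by (auto simp: min_side_def)
  then have "S - S' \<noteq> {}" "S' - S \<noteq> {}" using assms(3) by blast+
  then have "side (S - S')" using side_uncross s by blast
  moreover have "S - S' \<subset> S" using n by blast
  ultimately show False using assms(1) unfolding min_side_def by blast
qed

lemma min_side_ex:
  assumes "side S"
  obtains S' where "min_side S'" "S' \<subseteq> S"
proof -
  let ?F = "{S'. side S' \<and> S' \<subseteq> S}"
  have "?F \<subseteq> Pow V" by (auto simp: side_def)
  then have "finite ?F" using finV finite_subset by blast
  then obtain S' where S': "S' \<in> ?F" "\<And>S''. S'' \<in> ?F \<Longrightarrow> card S' \<le> card S''"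
    using finite_ex_least[of ?F S card] assms by blast
  have fin: "finite S'" using S'(1) finV finite_subset unfolding side_def by blast
  have "\<not> S'' \<subset> S'" if "side S''" for S''
  proof
    assume s: "S'' \<subset> S'"
    then have "card S' \<le> card S''" using S' that by blast
    then show False using psubset_card_mono[OF fin s] by simp
  qed
  then show thesis using that S'(1) unfolding min_side_def by blast
qed

lemma side_compl: "side S \<Longrightarrow> side (V - S)"
  unfolding side_def using cut_minus by blast

lemma side_other:
  assumes "side S" shows "V - S \<noteq> {}"
proof -
  obtain b where b: "E \<inter> cut S = {b}" using assms by (auto simp: side_def)
  then have "b \<in> E" "b \<in> cut S" by blast+
  then show ?thesis using edge_V[of b] unfolding cut_def by blast
qed

text \<open>A bridge inside \<open>S\<close> has two shores in \<open>V\<close>, both meeting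
  \<open>S\<close> without containing it. Uncrossing with the minimal \<open>S\<close> forces both
  of them into \<open>S\<close>, which would leave nothing outside \<open>S\<close>.\<close>

lemma min_side_nonbridge:
  assumes S: "min_side S" and e: "e \<in> inn S"
  shows "nonbridge e"
  unfolding nonbridge_def
proof (intro allI notI)
  fix S0 assume S0: "E \<inter> cut S0 = {e}"
  define S' where "S' = S0 \<inter> V"
  have s: "side S" using S by (auto simp: min_side_def)
  have S': "side S'" "E \<inter> cut S' = {e}" using S0 cut_V[of S0] unfolding S'_def side_def by auto
  have eS: "t e \<in> S" "h e \<in> S" "(t e \<in> S') \<noteq> (h e \<in> S')"
    using e S'(2) unfolding inn_def cut_def by blast+
  have no: "S' - S = {}" if "side S'" "S \<inter> S' \<noteq> {}" "S - S' \<noteq> {}" for S'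
  proof (rule ccontr)
    assume "S' - S \<noteq> {}"
    then have "side (S - S')" using side_uncross[OF s that(1,3)] by blast
    moreover have "S - S' \<subset> S" using that(2) by blast
    ultimately show False using S unfolding min_side_def by blast
  qed
  have SV: "S \<subseteq> V" using s by (simp add: side_def)
  have "S' - S = {}" by (rule no[OF S'(1)]) (use eS in blast)+
  moreover have "(V - S') - S = {}" by (rule no[OF side_compl[OF S'(1)]]) (use eS SV in blast)+
  ultimately have "V - S = {}" by blast
  then show False using side_other[OF s] by blast
qed

text \<open>\<open>T\<close> can leave \<open>S\<close> only through \<open>b\<close>, whose end in
  \<open>S\<close> is \<open>w\<close>; so the part of \<open>T\<close> inside \<open>S\<close>
  still connects everything to \<open>w\<close>.\<close>

lemma side_spanned:
  assumes S: "S \<subseteq> V" "E \<inter> cut S = {b}" and w: "w \<in> {t b, h b}" "w \<in> S" and v: "v \<in> S"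
  shows "conn (T \<inter> inn S) v w"
proof (rule ccontr)
  assume n: "\<not> conn (T \<inter> inn S) v w"
  let ?R = "{x\<in>S. conn (T \<inter> inn S) v x}"
  have "T \<inter> cut ?R = {}"
  proof (rule equals0I)
    fix e assume e: "e \<in> T \<inter> cut ?R"
    show False
    proof (cases "t e \<in> S \<and> h e \<in> S")
      case True
      then have i: "e \<in> T \<inter> inn S" using e by (simp add: inn_def)
      then have "conn (T \<inter> inn S) (t e) (h e)" by (rule conn_edge)
      then have "conn (T \<inter> inn S) v (t e) \<longleftrightarrow> conn (T \<inter> inn S) v (h e)"
        using conn_trans conn_sym by metis
      then show False using e True unfolding cut_def by blast
    next
      case False
      then have "e \<in> E \<inter> cut S" using e TE unfolding cut_def by blast
      then have "e = b" using S(2) by blast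
      then show False using e w n False unfolding cut_def by auto
    qed
  qed
  then have "v \<in> ?R \<longleftrightarrow> w \<in> ?R" using conn_closed[OF Tconn[of v w]] S(1) v w(2) by blast
  then show False using v n by (simp add: conn_refl)
qed

text \<open>The single edges are positive tree edges and supply nothing, so conflicts can only arise
  between circuits of \<open>\<C>\<close>.\<close>

lemma simple_pieces:
  assumes C: "nonconf_decomp \<C> (X \<inter> A)" and Q: "Q = \<C> \<union> (\<lambda>e. {e}) ` (T \<inter> A - X)"
    and A: "A \<subseteq> T \<union> X" "A \<subseteq> E"
  shows "pieces w Q \<and> (\<forall>p\<in>Q. simple p) \<and> \<Union>Q = A \<and> sum card Q = card A"
proof -
  have dec: "decomp \<C> (X \<inter> A)" using C by (simp add: nonconf_decomp_def)
  have finA: "finite A" using A(2) finE finite_subset by blast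
  have UC: "finite \<C>" "\<Union>\<C> = X \<inter> A" using dec by (auto simp: decomp_def)
  have UQ: "\<Union>Q = A" unfolding Q using UC(2) A(1) by auto
  have finQ: "finite Q" unfolding Q using UC(1) finA by simp
  have cl: "circ p \<and> p \<subseteq> X \<and> p \<in> \<C> \<or> (\<exists>e. p = {e} \<and> e \<in> T - X)" if "p \<in> Q" for p
    using that dec unfolding Q decomp_def by blast
  have dis: "p \<inter> q = {}" if "p \<in> Q" "q \<in> Q" "p \<noteq> q" for p q
    using cl[OF that(1)] cl[OF that(2)] that(3) decomp_disjoint[OF dec] by blast
  have pc: "conn p u v" if "p \<in> Q" "u \<in> ends p" "v \<in> ends p" for p u v
    using cl[OF that(1)]
  proof
    assume "circ p \<and> p \<subseteq> X \<and> p \<in> \<C>"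
    then show ?thesis using circ_conn that by blast
  next
    assume "\<exists>e. p = {e} \<and> e \<in> T - X"
    then obtain e where e: "p = {e}" by blast
    then have "conn p (t e) (h e)" using conn_edge[of e p] by blast
    then show ?thesis using that(2,3) e conn_sym conn_refl unfolding ends_def by auto
  qed
  have supe: "supp {{e}} = {}" if "e \<in> T" for e
  proof -
    have "\<not> unb U" if U: "U \<subseteq> {e}" for U
    proof -
      have "U \<inter> N = {}" using U \<open>e \<in> T\<close> TN by blast
      then show ?thesis by (simp add: unb_def)
    qed
    then show ?thesis by (auto simp: supp_def)
  qed
  have nc: "nonconf W W'" if "p \<in> Q" "q \<in> Q" "p \<noteq> q" "W \<in> supp {p}" "W' \<in> supp {q}" for p q W W'
  proof -
    have p: "circ p \<and> p \<in> \<C>" using cl[OF that(1)] supe that(4) by blast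
    have q: "circ q \<and> q \<in> \<C>" using cl[OF that(2)] supe that(5) by blast
    have "W = p \<and> unb p" using supp_circ[of p] p that(4) by (auto split: if_splits)
    moreover have "W' = q \<and> unb q" using supp_circ[of q] q that(5) by (auto split: if_splits)
    ultimately show ?thesis using C that(3) p q unfolding nonconf_decomp_def by blast
  qed
  have simp: "simple p" if "p \<in> Q" for p
    using cl[OF that] unfolding simple_def by blast
  have ne: "p \<noteq> {} \<and> finite p \<and> p \<subseteq> E" if "p \<in> Q" for p
  proof -
    have "p \<subseteq> A" using UQ that by blast
    moreover have "p \<noteq> {}" using cl[OF that] circD(2) by blast
    ultimately show ?thesis using A(2) finA finite_subset by blast
  qed
  have "pieces w Q" unfolding pieces_def using finQ ne pc dis nc simp by auto
  moreover have "sum card Q = card A"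
    using card_Union_disjoint[of Q] dis ne UQ unfolding pairwise_def disjnt_def by auto
  ultimately show ?thesis using simp UQ by blast
qed

text \<open>
  If all circuits in \<open>XS\<close> are balanced, choose an unbalanced circuit \<open>C\<close> with \<open>C - XS\<close> minimal. Then
  \<open>C - XS\<close> lies on every unbalanced circuit in \<open>sym_diff C XS\<close>, so a decomposition of this set has
  exactly one, \<open>U\<close>. If not, two conflicting circuits of a decomposition play the roles of \<open>C\<close> and \<open>U\<close>.
  In both cases \<open>C\<close> and \<open>U\<close> share a vertex \<open>a\<close>, and connecting one of them to \<open>w\<close> by \<open>J\<close> and the other
  by \<open>sym_diff J XS\<close> uses no edge too often.
\<close>

lemma box_system:
  assumes S: "min_side S" and b: "E \<inter> cut S = {b}" "w \<in> {t b, h b}" "w \<in> S"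
  shows "box (inn S) w"
proof -
  let ?p = "inn S"
  define TS where "TS = T \<inter> ?p"
  define XS where "XS = X \<inter> ?p"
  have SV: "S \<subseteq> V" using S by (auto simp: min_side_def side_def)
  have "?p \<subseteq> E" using NE TE unfolding inn_def by blast
  then have pE: "?p \<subseteq> E" "finite ?p" using finE finite_subset by blast+
  have finp: "finite TS" "finite XS" using pE(2) unfolding TS_def XS_def by auto
  have nb: "nonbridge e" if "e \<in> ?p" for e using min_side_nonbridge[OF S that] .
  have Tw: "conn TS v w" if "v \<in> S" for v using side_spanned[OF SV b that] unfolding TS_def .
  have Tc: "conn TS u v" if "u \<in> S" "v \<in> S" for u v using conn_trans[OF Tw[OF that(1)] conn_sym[OF Tw[OF that(2)]]] .
  have endsp: "ends ?p \<subseteq> S" unfolding ends_def inn_def by blast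
  have endsS: "x \<in> S" if "x \<in> ends D" "D \<subseteq> ?p" for x D using that endsp unfolding ends_def by blast
  have pTX: "?p = TS \<union> XS" "TS \<subseteq> ?p" "XS \<subseteq> ?p" using NX unfolding TS_def XS_def inn_def by blast+
  have TSN: "TS \<inter> N = {}" using TN unfolding TS_def by blast
  have "X \<inter> cut S = {}"
  proof (rule ccontr)
    assume n: "X \<inter> cut S \<noteq> {}"
    have "X \<inter> cut S \<subseteq> {b}" using XT NE TE b(1) by blast
    then have "X \<inter> cut S = {b}" using n by blast
    then show False using even_set_cut[OF Xeven, of S] by simp
  qed
  then have "XS = {x\<in>X. t x \<in> S}" using XT unfolding XS_def inn_def cut_def by blast
  then have XSe: "even_set XS" using even_set_inside[OF Xeven] \<open>X \<inter> cut S = {}\<close> by metis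
  have gr: "ground w ?p {?p}"
    unfolding ground_def using pE Tw endsS conn_mono[OF _ pTX(2)] by (auto simp: supp_def)
  have pend: "pending w ?p {?p} fs ls" for fs ls using nb unfolding pending_def nonbridge_def by blast
  have XSp: "X \<inter> \<Union>{?p} = XS" by (auto simp: XS_def)
  have suppI: "U \<in> supp {?p}" if "unb U" "U \<subseteq> ?p" for U using that by (auto simp: supp_def)
  obtain e where e: "e \<in> N" "t e \<in> S" "h e \<in> S" using bridge_side[OF b(1)] by blast
  have ep: "e \<in> ?p" using e by (simp add: inn_def)
  obtain Ce where Ce: "unb Ce" "e \<in> Ce" "Ce \<subseteq> insert e TS" using fund_circ[OF Tc[OF e(2,3)] TSN e(1)] .
  have Cep: "Ce \<subseteq> ?p" using Ce(3) ep pTX(2) by blast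
  show ?thesis
  \<comment> \<open>If \<open>XS\<close> has such a decomposition, its circuits and the remaining
    tree edges are pieces that supply themselves, and only the result is repackaged as one
    piece.\<close>
  proof (cases "\<exists>\<C>. nonconf_decomp \<C> XS \<and> (\<exists>U\<in>\<C>. unb U)")
    case True
    then obtain \<C> U where C: "nonconf_decomp \<C> XS" "U \<in> \<C>" "unb U" by blast
    have dec: "decomp \<C> XS" using C(1) by (simp add: nonconf_decomp_def)
    have fin\<C>: "finite \<C>" "\<Union>\<C> = XS" using dec by (auto simp: decomp_def)
    define Q where "Q = \<C> \<union> (\<lambda>e. {e}) ` (T \<inter> ?p - X)"
    have "X \<inter> ?p = XS" by (simp add: XS_def)
    note sp = simple_pieces[of \<C> ?p Q, unfolded this, OF C(1) Q_def _ pE(1)]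
    have pcs: "pieces (\<lambda>_. w) Q" and simp: "\<And>p. p \<in> Q \<Longrightarrow> simple p" and UQ: "\<Union>Q = ?p"
      and card: "sum card Q = card ?p"
      using sp pTX(1) unfolding TS_def XS_def by blast+
    have ne: "p \<noteq> {} \<and> finite p \<and> p \<subseteq> E" if "p \<in> Q" for p using pcs that unfolding pieces_def by auto
    have rch: "reach Q w q" if "q \<in> Q" for q
    proof -
      have "ends q \<noteq> {}" using ne[OF that] by (auto simp: ends_def)
      then obtain y where y: "y \<in> ends q" by blast
      have "y \<in> S" using endsS[OF y] UQ that by blast
      then have "conn ?p w y" using conn_mono[OF conn_sym[OF Tw] pTX(2)] by blast
      then show ?thesis using y UQ unfolding reach_def by auto
    qed
    have "U \<in> supp Q" using C unfolding supp_def Q_def by blast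
    then have sup: "supplies Q w" using pieces_supply[OF pcs _ rch] simp by blast
    have conv: "system w xs ?p {?p} k" if sys: "system w xs ?p Q k" for xs k
    proof -
      obtain fs ls where s: "list_all2 (lolli ?p Q) xs ls" "\<forall>F\<in>set fs. scirc F \<and> F \<subseteq> ?p" "cost fs ls \<le> k"
        "X \<inter> \<Union>Q \<subseteq> \<Union>(set fs) \<union> \<Union>(fst ` set ls)"
        using sys unfolding system_def by blast
      have "supp Q \<subseteq> supp {?p}" using UQ unfolding supp_def by blast
      then have "lolli ?p {?p} x l" if "lolli ?p Q x l" for x l using that unfolding lolli_def by blast
      then have "list_all2 (lolli ?p {?p}) xs ls" using s(1) by (auto elim!: list_all2_mono)
      then show ?thesis using s(2,3,4) gr pend UQ unfolding system_def by auto
    qed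
    then show ?thesis using sup UQ card unfolding box_def supplies_def by auto
  next
    case False
    obtain \<C> where C: "nonconf_decomp \<C> XS" using nonconf_decomp_ex[OF XSe] .
    have dec: "decomp \<C> XS" using C by (simp add: nonconf_decomp_def)
    have balC: "bal D" if "D \<in> \<C>" for D
      using False C that dec circ_bal_unb unfolding decomp_def by blast
    obtain ds where ds: "set ds = \<C>" "sum_list (map card ds) = card XS" using decomp_list[OF dec] .
    have evN: "even (card (XS \<inter> N))"
    proof -
      have "{D\<in>\<C>. unb D} = {}" using balC unfolding bal_def unb_def by blast
      then show ?thesis using parity_decomp[OF dec] by (metis card.empty even_zero)
    qed
    have UC: "\<Union>\<C> = XS" using dec by (simp add: decomp_def)
    \<comment> \<open>The balanced circuits of \<open>\<C>\<close> use \<open>XS\<close> once, and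
      the lollipop, a fundamental circuit with a connection along the tree, stays inside
      \<open>insert e TS\<close>.\<close>
    have one: "system w [w] ?p {?p} (2 * card ?p)"
    proof -
      obtain u where u: "u \<in> ends Ce" using circ_ends unbD(1) Ce(1) by blast
      have "conn TS u w" using Tw endsS[OF u Cep] by blast
      then obtain J where J: "J \<subseteq> TS" "joins J u w" unfolding conn_def by blast
      have "list_all2 (lolli ?p {?p}) [w] [(Ce, J)]"
        using suppI[OF Ce(1) Cep] u J Cep pTX(2) by (auto simp: lolli_def)
      moreover have "card (Ce \<union> J) \<le> card (insert e TS)" using Ce(3) J(1) finp by (intro card_mono) auto
      then have "card (Ce \<union> J) \<le> card TS + 1" using finp by (simp add: card_insert_if split: if_splits)
      moreover have "card (insert e TS) \<le> card ?p" using ep pTX(2) pE(2) by (intro card_mono) auto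
      moreover have "e \<notin> TS" using e(1) TSN by blast
      moreover have "card XS \<le> card ?p" using pTX(3) pE(2) by (intro card_mono)
      ultimately have "list_all2 (lolli ?p {?p}) [w] [(Ce, J)]" "cost ds [(Ce, J)] \<le> 2 * card ?p"
        using ds(2) finp by simp_all
      moreover have "\<forall>F\<in>set ds. scirc F \<and> F \<subseteq> ?p" using ds(1) balC UC pTX(3) unfolding scirc_def by blast
      moreover have "X \<inter> \<Union>{?p} \<subseteq> \<Union>(set ds) \<union> \<Union>(fst ` set [(Ce, J)])" using XSp UC ds(1) by auto
      ultimately show ?thesis using gr pend unfolding system_def by blast
    qed
    have two: "system w [w, w] ?p {?p} (2 * card ?p)"
      if C: "unb C" "C \<subseteq> ?p" and D: "decomp (insert U \<B>) (sym_diff C XS)" "U \<notin> \<B>" "unb U" "\<And>D. D \<in> \<B> \<Longrightarrow> bal D"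
        and J: "a \<in> ends C" "a \<in> ends U" "J \<subseteq> TS" "J \<inter> (C - XS) = {}" "joins J a w" for C U \<B> a J
    proof -
      have UY: "U \<union> \<Union>\<B> = sym_diff C XS" using D(1) by (simp add: decomp_def)
      have Up: "U \<subseteq> ?p" using UY C(2) pTX(3) by blast
      have "decomp (insert U \<B> - {U}) (sym_diff C XS - \<Union>{U})" by (rule decomp_Diff[OF D(1)]) blast
      then have dB: "decomp \<B> (sym_diff C XS - U)" using D(2) by simp
      obtain fs where fs: "set fs = \<B>" "sum_list (map card fs) = card (sym_diff C XS - U)" using decomp_list[OF dB] .
      have J': "joins (sym_diff J XS) a w" using joins_even[OF J(5) XSe] .
      let ?ls = "[(C, J), (U, sym_diff J XS)]"
      have "list_all2 (lolli ?p {?p}) [w, w] ?ls"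
        using suppI[OF C] suppI[OF D(3) Up] C(2) Up J J' pTX by (auto simp: lolli_def)
      \<comment> \<open>No edge is used three times. On \<open>sym_diff C XS - U\<close> only one
        further use is allowed: an edge of \<open>C - XS\<close> is avoided by \<open>J\<close>,
        hence by \<open>sym_diff J XS\<close> too, and an edge of \<open>XS - C\<close> is in
        exactly one of the two connections.\<close>
      moreover have "card (sym_diff C XS - U) + (card (C \<union> J) + card (U \<union> sym_diff J XS)) \<le> 2 * card ?p"
      proof -
        have ind: "card Y = (\<Sum>e\<in>?p. if e \<in> Y then 1 else 0)" if "Y \<subseteq> ?p" for Y
          using that pE(2) by (simp add: sum.If_cases Int_absorb1)
        have sub: "sym_diff C XS - U \<subseteq> ?p" "C \<union> J \<subseteq> ?p" "U \<union> sym_diff J XS \<subseteq> ?p"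
          using C(2) Up J(3) pTX by blast+
        have "card (sym_diff C XS - U) + (card (C \<union> J) + card (U \<union> sym_diff J XS)) \<le> (\<Sum>e\<in>?p. 2)"
          unfolding ind[OF sub(1)] ind[OF sub(2)] ind[OF sub(3)] sum.distrib[symmetric]
        proof (rule sum_mono)
          fix x assume "x \<in> ?p"
          have 1: "x \<in> U \<Longrightarrow> (x \<in> C) \<noteq> (x \<in> XS)" using UY by blast
          have 2: "x \<in> J \<Longrightarrow> x \<in> C \<Longrightarrow> x \<in> XS" using J(4) by blast
          show "(if x \<in> sym_diff C XS - U then 1 else 0) + ((if x \<in> C \<union> J then 1 else 0) +
             (if x \<in> U \<union> sym_diff J XS then 1 else 0)) \<le> (2::nat)"
            using 1 2 by (cases "x \<in> U"; cases "x \<in> C"; cases "x \<in> XS"; cases "x \<in> J") simp_all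
        qed
        then show ?thesis by simp
      qed
      then have "cost fs ?ls \<le> 2 * card ?p" using fs(2) by simp
      moreover have "\<forall>F\<in>set fs. scirc F \<and> F \<subseteq> ?p"
      proof
        fix F assume "F \<in> set fs"
        then have "F \<in> \<B>" using fs(1) by simp
        then show "scirc F \<and> F \<subseteq> ?p" using D(4) UY C(2) pTX(3) unfolding scirc_def by blast
      qed
      moreover have "X \<inter> \<Union>{?p} \<subseteq> \<Union>(set fs) \<union> \<Union>(fst ` set ?ls)"
        unfolding XSp fs(1) using UY by auto
      ultimately show ?thesis using gr pend unfolding system_def by blast
    qed
    have "system w [w, w] ?p {?p} (2 * card ?p)"
    proof (cases "\<exists>D\<subseteq>XS. unb D")
      case False
      let ?F = "{C. unb C \<and> C \<subseteq> ?p}"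
      have "finite ?F" using pE(2) by simp
      moreover have "Ce \<in> ?F" using Ce(1) Cep by simp
      ultimately obtain C where "C \<in> ?F" "\<And>D. D \<in> ?F \<Longrightarrow> card (C - XS) \<le> card (D - XS)"
        using finite_ex_least[of ?F Ce "\<lambda>C. card (C - XS)"] by blast
      then have C: "unb C" "C \<subseteq> ?p" and Cmin: "\<And>D. unb D \<Longrightarrow> D \<subseteq> ?p \<Longrightarrow> card (C - XS) \<le> card (D - XS)"
        by simp_all
      have ne: "C - XS \<noteq> {}" using False C by blast
      have finC: "finite C" using C pE(2) finite_subset by blast
      have Yev: "even_set (sym_diff C XS)" using even_set_sym_diff circD(1) unbD(1)[OF C(1)] XSe by blast
      then obtain \<D> where D: "decomp \<D> (sym_diff C XS)" using even_decomp by blast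
      have UD: "\<Union>\<D> = sym_diff C XS" using D by (simp add: decomp_def)
      have "odd (card (sym_diff C XS \<inter> N))"
        using odd_card_sym_diff_Int[OF finC finp(2), of N] C(1) evN unfolding unb_def by blast
      then have "{D\<in>\<D>. unb D} \<noteq> {}" using parity_decomp[OF D] by (metis card.empty even_zero)
      then obtain U where U: "U \<in> \<D>" "unb U" by blast
      have full: "C - XS \<subseteq> D" if "D \<in> \<D>" "unb D" for D
      proof -
        have sub: "D - XS \<subseteq> C - XS" "D \<subseteq> ?p" using that(1) UD C(2) pTX(3) by blast+
        then have "card (C - XS) \<le> card (D - XS)" using Cmin that(2) by blast
        then have "D - XS = C - XS" using sub(1) finC by (intro card_seteq) auto
        then show ?thesis by blast
      qed
      have balD: "bal D" if "D \<in> \<D> - {U}" for D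
      proof (rule ccontr)
        assume "\<not> bal D"
        then have "unb D" using that D circ_bal_unb unfolding decomp_def by blast
        then have "C - XS \<subseteq> D \<inter> U" using full[of D] full[OF U] that by blast
        then show False using ne decomp_disjoint[OF D, of D U] that U(1) by blast
      qed
      \<comment> \<open>The connection from \<open>w\<close> stops at its first vertex of
        \<open>C - XS\<close>, so it uses no edge of this set. That vertex lies on \<open>U\<close>
        as well, since \<open>U\<close> contains \<open>C - XS\<close>.\<close>
      obtain f where f: "f \<in> C - XS" using ne by blast
      have "t f \<in> S" using f C(2) unfolding inn_def by blast
      then have cw: "conn TS w (t f)" using conn_sym[OF Tw] by blast
      have tf: "t f \<in> ends (C - XS)" using f unfolding ends_def by blast
      obtain u s where s: "walk u s" "u \<in> {w}" "last (stops u s) \<in> ends (C - XS)" "fst ` set s \<subseteq> TS"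
          "distinct (stops u s)" "set (map snd s) \<inter> {w} = {}" "set (butlast (stops u s)) \<inter> ends (C - XS) = {}"
        using shortest_walk[OF cw singletonI tf] .
      let ?a = "last (stops u s)"
      let ?J = "fst ` set s"
      have "joins ?J w ?a" using walk_joins[OF s(1) walk_distinct[OF s(1,5)]] s(2) by auto
      moreover have "?J \<inter> (C - XS) = {}"
      proof (rule equals0I)
        fix x assume x: "x \<in> ?J \<inter> (C - XS)"
        then obtain y where "y \<in> set (butlast (stops u s))" "y \<in> {t x, h x}" using walk_leaves[OF s(1)] by blast
        moreover have "y \<in> ends (C - XS)" using calculation(2) x unfolding ends_def by blast
        ultimately show False using s(7) by blast
      qed
      moreover have "?a \<in> ends C" "?a \<in> ends U" using s(3) full[OF U] unfolding ends_def by blast+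
      moreover have "insert U (\<D> - {U}) = \<D>" using U(1) by blast
      ultimately show ?thesis
        using two[OF C, of U "\<D> - {U}" ?a ?J] D U(2) balD s(4) joins_sym by auto
    next
      case True
      then obtain D where D: "D \<subseteq> XS" "unb D" by blast
      have "even_set (XS - D)" using even_set_Diff[OF XSe circD(1)[OF unbD(1)[OF D(2)]] D(1)] .
      then obtain \<D>0 where "decomp \<D>0 (XS - D)" using even_decomp by blast
      moreover have "decomp {D} D" using unbD(1)[OF D(2)] by (simp add: decomp_def)
      ultimately have "decomp ({D} \<union> \<D>0) (D \<union> (XS - D))" by (intro decomp_Un) auto
      moreover have "D \<union> (XS - D) = XS" using D(1) by blast
      ultimately have "decomp ({D} \<union> \<D>0) XS" by simp
      then obtain \<D> where DD: "decomp \<D> XS" "\<exists>U\<in>\<D>. unb U"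
        and max: "\<And>\<D>'. decomp \<D>' XS \<Longrightarrow> \<exists>U\<in>\<D>'. unb U \<Longrightarrow> card {C\<in>\<D>'. bal C} \<le> card {C\<in>\<D>. bal C}"
        using max_bal_decomp[of "{D} \<union> \<D>0" XS "\<lambda>\<D>. \<exists>U\<in>\<D>. unb U"] D(2) by blast
      obtain U U' where UU: "U \<in> \<D>" "U' \<in> \<D>" "unb U" "unb U'" "U \<noteq> U'" "\<not> nonconf U U'"
        using False DD unfolding nonconf_decomp_def by fastforce
      \<comment> \<open>The exchange of \<open>U\<close> and \<open>U'\<close> would keep a third
        unbalanced member \<open>W\<close> and so contradict the choice of
        \<open>\<D>\<close>.\<close>
      have rest: "bal W" if W: "W \<in> \<D> - {U, U'}" for W
      proof (rule ccontr)
        assume "\<not> bal W"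
        then have "unb W" using W DD(1) circ_bal_unb unfolding decomp_def by blast
        obtain \<D>' where D': "decomp \<D>' XS" "\<D> - {U, U'} \<subseteq> \<D>'" "card {C\<in>\<D>. bal C} < card {C\<in>\<D>'. bal C}"
          using decomp_exchange[OF DD(1) UU] .
        have "card {C\<in>\<D>'. bal C} \<le> card {C\<in>\<D>. bal C}" using max[OF D'(1)] D'(2) W \<open>unb W\<close> by blast
        then show False using D'(3) by simp
      qed
      have dis: "U \<inter> U' = {}" using decomp_disjoint[OF DD(1) UU(1,2,5)] .
      obtain a where a: "a \<in> ends U" "a \<in> ends U'" using UU(6) dis unfolding nonconf_def by blast
      have Usub: "U \<subseteq> XS" using DD(1) UU(1) unfolding decomp_def by blast
      have Up: "U \<subseteq> ?p" using Usub pTX(3) by blast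
      have "conn TS a w" using Tw endsS[OF a(1) Up] by blast
      then obtain J where J: "J \<subseteq> TS" "joins J a w" unfolding conn_def by blast
      have "decomp (\<D> - {U}) (XS - \<Union>{U})" by (rule decomp_Diff[OF DD(1)]) (use UU(1) in blast)
      moreover have "XS - \<Union>{U} = sym_diff U XS" using Usub by blast
      moreover have "\<D> - {U} = insert U' (\<D> - {U, U'})" using UU(2,5) by blast
      ultimately have "decomp (insert U' (\<D> - {U, U'})) (sym_diff U XS)" by simp
      then show ?thesis using two[OF UU(3) Up, of U' "\<D> - {U, U'}" a J] UU(4) rest a J Usub by blast
    qed
    then show ?thesis using one unfolding box_def by blast
  qed
qed

section \<open>Covering the negative edges and the bridges\<close>

lemma even_side: "side S \<Longrightarrow> X \<inter> cut S = {}"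
proof (rule ccontr)
  assume "side S" and n: "X \<inter> cut S \<noteq> {}"
  then obtain b where "E \<inter> cut S = {b}" by (auto simp: side_def)
  then have "X \<inter> cut S \<subseteq> {b}" using XT NE TE by blast
  then have "X \<inter> cut S = {b}" using n by blast
  then show False using even_set_cut[OF Xeven, of S] by simp
qed

lemma nonconf_ends: "ends U \<inter> ends U' = {} \<Longrightarrow> nonconf U U'"
  by (auto simp: nonconf_def ends_def)

lemma ends_mono: "A \<subseteq> B \<Longrightarrow> ends A \<subseteq> ends B"
  by (auto simp: ends_def)

lemma side_nonempty: "side S \<Longrightarrow> S \<noteq> {}"
  by (auto simp: side_def cut_def)

text \<open>The pieces are boxes for the minimal sides, circuits of \<open>X\<close> outside them,
  and single tree edges. The root is the gate of one box, the end in the side of its bridge. That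
  box and the rest each deliver one lollipop there, and merging these leaves none. Every bridge has
  a minimal side on its shore away from the root, and the box there has a supplier; since no
  lollipop is left, \<open>pending\<close> says that the bridge is covered.\<close>

lemma cover_with_bridges:
  assumes "side S00"
  obtains fs where "\<And>F. F \<in> set fs \<Longrightarrow> scirc F \<and> F \<subseteq> E" "sum_list (map card fs) \<le> 2 * card (T \<union> N)"
    "X \<subseteq> \<Union>(set fs)" "\<And>b S. E \<inter> cut S = {b} \<Longrightarrow> b \<in> \<Union>(set fs)"
proof -
  define M where "M = {S. min_side S}"
  have MV: "S \<subseteq> V" "side S" if "S \<in> M" for S using that by (auto simp: M_def min_side_def side_def)
  have finM: "finite M" using MV(1) finV finite_subset[of M "Pow V"] by blast
  have Mdis: "S \<inter> S' = {}" if "S \<in> M" "S' \<in> M" "S \<noteq> S'" for S S'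
    using that min_side_disjoint unfolding M_def by blast
  have "\<exists>x. x \<in> S \<and> box (inn S) x \<and> (\<exists>b. E \<inter> cut S = {b} \<and> x \<in> {t b, h b})" if S: "S \<in> M" for S
  proof -
    obtain b where b: "E \<inter> cut S = {b}" using MV(2)[OF S] by (auto simp: side_def)
    then have "b \<in> cut S" by blast
    then obtain x where x: "x \<in> {t b, h b}" "x \<in> S" unfolding cut_def by blast
    then have "box (inn S) x" using box_system[OF _ b] S unfolding M_def by blast
    then show ?thesis using x b by blast
  qed
  then obtain g where g: "\<And>S. S \<in> M \<Longrightarrow> g S \<in> S" "\<And>S. S \<in> M \<Longrightarrow> box (inn S) (g S)"
    "\<And>S. S \<in> M \<Longrightarrow> \<exists>b. E \<inter> cut S = {b} \<and> g S \<in> {t b, h b}" by metis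
  have inne: "\<exists>e\<in>N. e \<in> inn S" if S: "S \<in> M" for S
    using bridge_side MV(2)[OF S] unfolding side_def inn_def by blast
  have endsI: "ends (inn S) \<subseteq> S" for S unfolding ends_def inn_def by blast
  have inj: "inj_on inn M"
  proof (rule inj_onI)
    fix S S' assume S: "S \<in> M" "S' \<in> M" "inn S = inn S'"
    obtain e where "e \<in> inn S" using inne[OF S(1)] by blast
    then have "t e \<in> S \<inter> S'" using S(3) unfolding inn_def by blast
    then show "S = S'" using Mdis S(1,2) by blast
  qed
  define w where "w = g \<circ> inv_into M inn"
  have wS: "w (inn S) = g S" if "S \<in> M" for S using that inj by (simp add: w_def)
  define W where "W = \<Union>M"
  \<comment> \<open>The part of \<open>X\<close> outside the minimal sides; it is even because an
    even set crosses no bridge.\<close>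
  define XR where "XR = {x \<in> X. t x \<in> - W}"
  have XM: "X \<inter> cut S = {}" if "S \<in> M" for S using even_side[OF MV(2)[OF that]] .
  have XW: "X \<inter> cut (- W) = {}"
  proof (rule equals0I)
    fix x assume x: "x \<in> X \<inter> cut (- W)"
    then obtain S where "S \<in> M" "(t x \<in> S) \<noteq> (h x \<in> S)" unfolding cut_def W_def by blast
    then show False using XM[of S] x unfolding cut_def by blast
  qed
  have XRe: "even_set XR" unfolding XR_def using even_set_inside[OF Xeven XW] .
  have endsXR: "ends XR \<inter> W = {}" using XW unfolding ends_def XR_def cut_def by blast
  obtain \<C> where C: "nonconf_decomp \<C> XR" using nonconf_decomp_ex[OF XRe] .
  have dec: "decomp \<C> XR" using C by (simp add: nonconf_decomp_def)
  have UC: "finite \<C>" "\<Union>\<C> = XR" using dec by (auto simp: decomp_def)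
  have XE: "X \<subseteq> E" using XT NE TE by blast
  have finT: "finite T" using TE finE finite_subset by blast
  define Q where "Q = inn ` M \<union> \<C> \<union> (\<lambda>e. {e}) ` (T - X - \<Union>(inn ` M))"
  have finQ: "finite Q" unfolding Q_def using finM UC(1) finT by simp
  have cl: "(\<exists>S\<in>M. p = inn S) \<or> (circ p \<and> p \<subseteq> XR \<and> p \<in> \<C>) \<or> (\<exists>e. p = {e} \<and> e \<in> T \<and> e \<notin> X \<and> (\<forall>S\<in>M. e \<notin> inn S))"
    if "p \<in> Q" for p
    using that dec unfolding Q_def decomp_def by blast
  have d1: "inn S \<inter> inn S' = {}" if "S \<in> M" "S' \<in> M" "S \<noteq> S'" for S S'
    using Mdis[OF that] unfolding inn_def by blast
  have d2: "inn S \<inter> XR = {}" if "S \<in> M" for S using that unfolding inn_def XR_def W_def by blast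
  have d3: "XR \<subseteq> X" by (auto simp: XR_def)
  have dis: "p \<inter> q = {}" if pq: "p \<in> Q" "q \<in> Q" "p \<noteq> q" for p q
  proof -
    have sing: "{e} \<inter> q = {}" if "e \<in> T" "e \<notin> X" "\<forall>S\<in>M. e \<notin> inn S" "q \<in> Q" "{e} \<noteq> q" for e q
      using cl[OF that(4)] that(1-3,5) d3 by blast
    have bx: "inn S \<inter> q = {}" if "S \<in> M" "q \<in> Q" "inn S \<noteq> q" for S q
      using cl[OF that(2)] that(1,3) d1 d2 by blast
    from cl[OF pq(1)] show ?thesis
    proof (elim disjE)
      assume "\<exists>S\<in>M. p = inn S"
      then show ?thesis using bx pq by blast
    next
      assume "\<exists>e. p = {e} \<and> e \<in> T \<and> e \<notin> X \<and> (\<forall>S\<in>M. e \<notin> inn S)"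
      then show ?thesis using sing pq by blast
    next
      assume p: "circ p \<and> p \<subseteq> XR \<and> p \<in> \<C>"
      from cl[OF pq(2)] show ?thesis
      proof (elim disjE)
        assume "\<exists>S\<in>M. q = inn S"
        then show ?thesis using bx[of _ p] pq by blast
      next
        assume "\<exists>e. q = {e} \<and> e \<in> T \<and> e \<notin> X \<and> (\<forall>S\<in>M. e \<notin> inn S)"
        then show ?thesis using sing[of _ p] pq by blast
      next
        assume "circ q \<and> q \<subseteq> XR \<and> q \<in> \<C>"
        then show ?thesis using p decomp_disjoint[OF dec] pq(3) by blast
      qed
    qed
  qed
  have UQ: "\<Union>Q = T \<union> N"
  proof
    show "\<Union>Q \<subseteq> T \<union> N"
    proof
      fix e assume "e \<in> \<Union>Q"
      then obtain p where p: "p \<in> Q" "e \<in> p" by blast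
      show "e \<in> T \<union> N" using cl[OF p(1)] p(2) d3 XT unfolding inn_def by blast
    qed
    show "T \<union> N \<subseteq> \<Union>Q"
    proof
      fix e assume e: "e \<in> T \<union> N"
      show "e \<in> \<Union>Q"
      proof (cases "e \<in> \<Union>(inn ` M)")
        case True
        then show ?thesis unfolding Q_def by blast
      next
        case n: False
        show ?thesis
        proof (cases "e \<in> X")
          case True
          have "t e \<notin> W"
          proof
            assume "t e \<in> W"
            then obtain S where S: "S \<in> M" "t e \<in> S" unfolding W_def by blast
            then have "h e \<in> S" using XM[OF S(1)] True unfolding cut_def by blast
            then show False using n S e unfolding inn_def by blast
          qed
          then have "e \<in> XR" using True unfolding XR_def by blast
          then show ?thesis using UC(2) unfolding Q_def by blast
        next
          case False
          then have "e \<in> T" using e NX by blast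
          then show ?thesis using n False unfolding Q_def by blast
        qed
      qed
    qed
  qed
  have QE: "\<Union>Q \<subseteq> E" "finite (\<Union>Q)" using UQ NE TE finE finite_subset by auto
  have ne: "p \<noteq> {} \<and> finite p \<and> p \<subseteq> E" if "p \<in> Q" for p
  proof -
    have "p \<subseteq> \<Union>Q" using that by blast
    moreover have "p \<noteq> {}" using cl[OF that] circD(2) inne by blast
    ultimately show ?thesis using QE finite_subset by blast
  qed
  have pc: "conn p u v" if p: "p \<in> Q" "u \<in> ends p" "v \<in> ends p" for p u v
    using cl[OF p(1)]
  proof (elim disjE)
    assume "circ p \<and> p \<subseteq> XR \<and> p \<in> \<C>"
    then show ?thesis using circ_conn p by blast
  next
    assume "\<exists>e. p = {e} \<and> e \<in> T \<and> e \<notin> X \<and> (\<forall>S\<in>M. e \<notin> inn S)"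
    then obtain e where e: "p = {e}" by blast
    then have "conn p (t e) (h e)" using conn_edge[of e p] by blast
    then show ?thesis using p(2,3) e conn_sym conn_refl unfolding ends_def by auto
  next
    assume "\<exists>S\<in>M. p = inn S"
    then obtain S where S: "S \<in> M" "p = inn S" by blast
    obtain b where b: "E \<inter> cut S = {b}" "g S \<in> {t b, h b}" using g(3)[OF S(1)] by blast
    have "conn (T \<inter> inn S) u (g S)" "conn (T \<inter> inn S) v (g S)"
      using side_spanned[OF MV(1)[OF S(1)] b g(1)[OF S(1)]] p(2,3) endsI[of S] S(2) by blast+
    then have "conn (T \<inter> inn S) u v" using conn_trans conn_sym by blast
    then show ?thesis using conn_mono[of "T \<inter> inn S" u v p] S(2) by blast
  qed
  have supe: "supp {{e}} = {}" if e: "e \<in> T" for e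
  proof -
    have "\<not> unb U" if U: "U \<subseteq> {e}" for U
    proof -
      have "U \<inter> N = {}" using U e TN by blast
      then show ?thesis by (simp add: unb_def)
    qed
    then show ?thesis by (auto simp: supp_def)
  qed
  have supS: "U \<subseteq> p" if "U \<in> supp {p}" for U p using that by (simp add: supp_def)
  have nc: "nonconf U U'" if pq: "p \<in> Q" "q \<in> Q" "p \<noteq> q" and U: "U \<in> supp {p}" "U' \<in> supp {q}" for p q U U'
  proof -
    have p: "(\<exists>S\<in>M. p = inn S) \<or> (circ p \<and> p \<subseteq> XR \<and> p \<in> \<C>)" using cl[OF pq(1)] supe U(1) by blast
    have q: "(\<exists>S\<in>M. q = inn S) \<or> (circ q \<and> q \<subseteq> XR \<and> q \<in> \<C>)" using cl[OF pq(2)] supe U(2) by blast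
    have eU: "ends U \<subseteq> ends p" "ends U' \<subseteq> ends q" using supS U ends_mono by blast+
    have bx: "ends (inn S) \<inter> ends r = {}" if "S \<in> M" "inn S \<noteq> r" "(\<exists>S\<in>M. r = inn S) \<or> r \<subseteq> XR" for S r
      using that(3)
    proof
      assume "\<exists>S\<in>M. r = inn S"
      then obtain S' where "S' \<in> M" "r = inn S'" by blast
      then show ?thesis using Mdis[of S S'] that(1,2) endsI[of S] endsI[of S'] by blast
    next
      assume "r \<subseteq> XR"
      then have "ends r \<inter> W = {}" using ends_mono[of r XR] endsXR by blast
      then show ?thesis using endsI[of S] that(1) unfolding W_def by blast
    qed
    show ?thesis
    proof (cases "(\<exists>S\<in>M. p = inn S) \<or> (\<exists>S\<in>M. q = inn S)")
      case True
      then have "ends p \<inter> ends q = {}" using bx[of _ q] bx[of _ p] p q pq(3) by blast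
      then show ?thesis using eU by (intro nonconf_ends) blast
    next
      case False
      then have c: "circ p" "p \<in> \<C>" "circ q" "q \<in> \<C>" using p q by blast+
      have "U = p \<and> unb p" using supp_circ[OF c(1)] U(1) by (auto split: if_splits)
      moreover have "U' = q \<and> unb q" using supp_circ[OF c(3)] U(2) by (auto split: if_splits)
      ultimately show ?thesis using C pq(3) c unfolding nonconf_decomp_def by blast
    qed
  qed
  \<comment> \<open>The bridge is the only edge leaving \<open>S\<close>, so other pieces can touch
    the box only at its gate.\<close>
  have att: "ends (inn S) \<inter> ends q \<subseteq> {g S}" if S: "S \<in> M" and q: "q \<in> Q" "q \<noteq> inn S" for S q
    using cl[OF q(1)]
  proof (elim disjE)
    assume "\<exists>S\<in>M. q = inn S"
    then obtain S' where "S' \<in> M" "q = inn S'" by blast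
    then show ?thesis using Mdis[of S S'] S q(2) endsI[of S] endsI[of S'] by blast
  next
    assume "circ q \<and> q \<subseteq> XR \<and> q \<in> \<C>"
    then have "ends q \<inter> W = {}" using ends_mono[of q XR] endsXR by blast
    then show ?thesis using endsI[of S] S unfolding W_def by blast
  next
    assume "\<exists>e. q = {e} \<and> e \<in> T \<and> e \<notin> X \<and> (\<forall>S\<in>M. e \<notin> inn S)"
    then obtain e where e: "q = {e}" "e \<in> T" "e \<notin> inn S" using S by blast
    obtain b where b: "E \<inter> cut S = {b}" "g S \<in> {t b, h b}" using g(3)[OF S] by blast
    have bS: "b \<in> cut S" using b(1) by blast
    show ?thesis
    proof
      fix x assume x: "x \<in> ends (inn S) \<inter> ends q"
      have xS: "x \<in> S" using x endsI[of S] by blast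
      have xe: "x \<in> {t e, h e}" using x e(1) unfolding ends_def by blast
      have "\<not> (t e \<in> S \<and> h e \<in> S)" using e(2,3) unfolding inn_def by blast
      then have "e \<in> cut S" using xS xe unfolding cut_def by blast
      then have "e = b" using b(1) e(2) TE by blast
      then show "x \<in> {g S}" using bS xS xe b(2) g(1)[OF S] unfolding cut_def by auto
    qed
  qed
  have kind: "simple p \<or> box p (w p) \<and> (\<forall>q\<in>Q. q \<noteq> p \<longrightarrow> ends p \<inter> ends q \<subseteq> {w p})" if p: "p \<in> Q" for p
    using cl[OF p]
  proof (elim disjE)
    assume "\<exists>S\<in>M. p = inn S"
    then obtain S where S: "S \<in> M" "p = inn S" by blast
    then show ?thesis using g(2)[OF S(1)] wS[OF S(1)] att[OF S(1)] by simp
  qed (auto simp: simple_def)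
  have pcs: "pieces w Q"
    unfolding pieces_def using finQ ne pc dis nc kind by auto
  have sumQ: "sum card Q = card (T \<union> N)"
    using card_Union_disjoint[of Q] dis ne UQ unfolding pairwise_def disjnt_def by auto
  obtain S0 where S0: "S0 \<in> M" using min_side_ex[OF assms] unfolding M_def by blast
  let ?p = "inn S0" and ?v = "g S0"
  have p0: "?p \<in> Q" using S0 unfolding Q_def by blast
  let ?R = "Q - {?p}"
  have vV: "?v \<in> V" using g(1)[OF S0] MV(1)[OF S0] by blast
  have vp: "?v \<in> ends ?p"
  proof -
    obtain e where e: "e \<in> ?p" using inne[OF S0] by blast
    obtain b where b: "E \<inter> cut S0 = {b}" "g S0 \<in> {t b, h b}" using g(3)[OF S0] by blast
    have "t e \<in> S0" using e unfolding inn_def by blast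
    then have c: "conn ?p (t e) ?v"
      using side_spanned[OF MV(1)[OF S0] b g(1)[OF S0]] conn_mono[of "T \<inter> inn S0" _ _ ?p] by blast
    show ?thesis
    proof (cases "?p \<inter> cut {?v} = {}")
      case True
      then have "t e = ?v" using conn_closed[OF c True] by blast
      then show ?thesis using edge_ends(1)[OF e] by simp
    next
      case False
      then show ?thesis using cut_ends[of _ ?p "{?v}"] by blast
    qed
  qed
  have rchQ: "reach Q ?v q" if "q \<in> Q" for q
  proof -
    have "ends q \<noteq> {}" using ne[OF that] by (auto simp: ends_def)
    then obtain y where y: "y \<in> ends q" by blast
    have "y \<in> V" using y ne[OF that] ends_mono[of q E] EV by blast
    then have "conn T ?v y" using Tconn[OF vV] by blast
    then have "conn (\<Union>Q) ?v y" by (rule conn_mono) (use UQ in blast)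
    then show ?thesis using y unfolding reach_def by blast
  qed
  have rch: "reach ?R ?v q" if "q \<in> ?R" for q
    using reach_attached[OF p0 vp att[OF S0] rchQ] that by blast
  have ok: "simple q \<or> ?v \<notin> ends q \<or> ?v = w q" if q: "q \<in> ?R" for q
  proof (cases "\<exists>S\<in>M. q = inn S")
    case True
    then obtain S where S: "S \<in> M" "q = inn S" by blast
    then have "S \<noteq> S0" using q by blast
    then show ?thesis using Mdis[OF S(1) S0] g(1)[OF S0] endsI[of S] S(2) by blast
  next
    case False
    then have "simple q" using cl[of q] q unfolding simple_def by blast
    then show ?thesis by blast
  qed
  have supR: "supp ?R \<noteq> {}"
  proof -
    \<comment> \<open>The opposite shore of the bridge at \<open>S0\<close> contains a minimal side
      too, which guarantees a partner for the first box.\<close>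
    obtain S1 where S1: "min_side S1" "S1 \<subseteq> V - S0" using min_side_ex[OF side_compl[OF MV(2)[OF S0]]] .
    have M1: "S1 \<in> M" using S1(1) by (simp add: M_def)
    have "S1 \<noteq> S0" using S1(2) side_nonempty[OF MV(2)[OF M1]] by blast
    then have "inn S1 \<noteq> ?p" using inj_onD[OF inj _ M1 S0] by blast
    then have "inn S1 \<in> ?R" using M1 unfolding Q_def by blast
    then show ?thesis using supp_box[OF g(2)[OF M1]] supp_mono[of "{inn S1}" ?R] by blast
  qed
  have pR: "pieces w ?R" using pieces_mono[OF pcs] by blast
  have 1: "system ?v [?v] (\<Union>?R) ?R (2 * sum card ?R)"
    using pieces_supply[OF pR ok rch supR] unfolding supplies_def by blast
  have 2: "system ?v [?v] ?p {?p} (2 * card ?p)" using g(2)[OF S0] by (simp add: box_def)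
  have "system ?v ([] @ []) (?p \<union> \<Union>?R) ({?p} \<union> ?R) (2 * card ?p + 2 * sum card ?R)"
  proof (rule system_merge[OF 2 1])
    show "nonbridge b" if "b \<in> ?p" "b \<in> \<Union>?R" for b
      using that pieces_disjoint[OF pcs, of "{?p}" ?R] p0 by blast
    show "nonconf U U'" if "U \<in> supp {?p}" "U' \<in> supp ?R" for U U'
      using that pieces_nonconf[OF pcs, of "{?p}" ?R] p0 by blast
  qed
  moreover have "?p \<union> \<Union>?R = \<Union>Q" "{?p} \<union> ?R = Q" using p0 by blast+
  moreover have "card ?p + sum card ?R = card (T \<union> N)" using sum.remove[OF finQ p0, of card] sumQ by simp
  ultimately have sys: "system ?v [] (\<Union>Q) Q (2 * card (T \<union> N))" by (simp flip: distrib_left)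
  then obtain fs where fs: "\<And>F. F \<in> set fs \<Longrightarrow> scirc F \<and> F \<subseteq> \<Union>Q" "sum_list (map card fs) \<le> 2 * card (T \<union> N)"
      "X \<inter> \<Union>Q \<subseteq> \<Union>(set fs)" "pending ?v (\<Union>Q) Q fs []"
    unfolding system_def by auto
  have bcov: "b \<in> \<Union>(set fs)" if S: "E \<inter> cut S = {b}" for b S
  proof -
    have "\<exists>S'. S' \<subseteq> V \<and> ?v \<notin> S' \<and> E \<inter> cut S' = {b}"
    proof (cases "?v \<in> S")
      case True
      then show ?thesis using cut_minus[of S] S by (intro exI[of _ "V - S"]) auto
    next
      case False
      then show ?thesis using cut_V[of S] S by (intro exI[of _ "S \<inter> V"]) auto
    qed
    then obtain S' where S': "S' \<subseteq> V" "?v \<notin> S'" "E \<inter> cut S' = {b}" by blast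
    then obtain S1 where S1: "min_side S1" "S1 \<subseteq> S'" using min_side_ex[of S'] unfolding side_def by blast
    have M1: "S1 \<in> M" using S1(1) by (simp add: M_def)
    obtain U where U: "U \<in> supp {inn S1}" using supp_box[OF g(2)[OF M1]] by blast
    have "U \<in> supp Q" using U M1 supp_mono[of "{inn S1}" Q] unfolding Q_def by blast
    moreover have "ends U \<subseteq> S'" using ends_mono[OF supS[OF U]] endsI[of S1] S1(2) by blast
    moreover have "b \<in> \<Union>Q" using bridge_T[OF S'(3)] UQ by blast
    ultimately show ?thesis using fs(4) S'(2,3) unfolding pending_def by fastforce
  qed
  show thesis
  proof (rule that[of fs])
    show "scirc F \<and> F \<subseteq> E" if "F \<in> set fs" for F using fs(1)[OF that] QE(1) by blast
    show "X \<subseteq> \<Union>(set fs)" using fs(3) UQ XT by blast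
  qed (use fs(2) bcov in auto)
qed

end

section \<open>Pairing unbalanced circuits along a common join\<close>

context signed_multigraph
begin

text \<open>Each \<open>D\<close> has a token at \<open>r D\<close>. All tokens are sent to
  \<open>v0\<close> along joins in \<open>J0\<close>, and the sum modulo 2 of these joins uses each
  edge at most once; an odd number of tokens leaves its parity at \<open>v0\<close>.\<close>

lemma token_join:
  assumes "finite \<U>" "finite J0" "\<And>D. D \<in> \<U> \<Longrightarrow> conn J0 (r D) v0"
  shows "\<exists>J\<subseteq>J0. \<forall>x. odd (card (J \<inter> cut {x})) \<longleftrightarrow> (odd (card {D\<in>\<U>. r D = x}) \<noteq> (x = v0 \<and> odd (card \<U>)))"
  using assms(1,3)
proof (induction \<U>)
  case empty
  then show ?case by (intro exI[of _ "{}"]) auto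
next
  case (insert D \<U>)
  obtain J where J: "J \<subseteq> J0"
      "\<And>x. odd (card (J \<inter> cut {x})) \<longleftrightarrow> (odd (card {D\<in>\<U>. r D = x}) \<noteq> (x = v0 \<and> odd (card \<U>)))"
    using insert.IH insert.prems by auto
  obtain K where K: "K \<subseteq> J0" "joins K (r D) v0" using insert.prems unfolding conn_def by blast
  have fin: "finite J" "finite K" using J(1) K(1) assms(2) finite_subset by blast+
  have "odd (card (sym_diff J K \<inter> cut {x})) \<longleftrightarrow>
      (odd (card {D'\<in>insert D \<U>. r D' = x}) \<noteq> (x = v0 \<and> odd (card (insert D \<U>))))" for x
  proof -
    have "odd (card (sym_diff J K \<inter> cut {x})) \<longleftrightarrow> (odd (card (J \<inter> cut {x})) \<noteq> ((x = r D) \<noteq> (x = v0)))"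
      using odd_card_sym_diff_Int[OF fin] K(2) unfolding joins_def by blast
    moreover have "{D'\<in>insert D \<U>. r D' = x} = (if r D = x then insert D {D'\<in>\<U>. r D' = x} else {D'\<in>\<U>. r D' = x})"
      by auto
    moreover have "finite {D'\<in>\<U>. r D' = x}" "D \<notin> {D'\<in>\<U>. r D' = x}" using insert.hyps by auto
    ultimately show ?thesis using J(2)[of x] insert.hyps by auto
  qed
  moreover have "sym_diff J K \<subseteq> J0" using J(1) K(1) by blast
  ultimately show ?case by blast
qed

text \<open>Two circuits whose tokens coincide, or are joined inside \<open>J\<close>, make a
  barbell. The join \<open>K\<close> that links them is then taken out of \<open>J\<close>, so that
  no edge of \<open>J\<close> is paid twice.\<close>

lemma pair_up:
  assumes "finite \<U>" "\<And>D. D \<in> \<U> \<Longrightarrow> unb D \<and> r D \<in> ends D"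
    "\<And>D D'. D \<in> \<U> \<Longrightarrow> D' \<in> \<U> \<Longrightarrow> D \<noteq> D' \<Longrightarrow> nonconf D D'"
    "finite J" "\<And>x. odd (card (J \<inter> cut {x})) \<longleftrightarrow> odd (card {D\<in>\<U>. r D = x})"
  shows "\<exists>fs. (\<forall>F\<in>set fs. scirc F \<and> F \<subseteq> \<Union>\<U> \<union> J) \<and> (\<forall>D\<in>\<U>. \<exists>F\<in>set fs. D \<subseteq> F) \<and>
    sum_list (map card fs) \<le> sum card \<U> + card J"
  using assms
proof (induction "card \<U>" arbitrary: \<U> J rule: less_induct)
  case less
  note U = less.prems
  show ?case
  proof (cases "\<U> = {}")
    case True
    then show ?thesis by (intro exI[of _ "[]"]) simp
  next
    case False
    then obtain D where D: "D \<in> \<U>" by blast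
    obtain D' K where K: "D' \<in> \<U>" "D' \<noteq> D" "K \<subseteq> J" "joins K (r D) (r D')"
    proof (cases "\<exists>D'\<in>\<U>. D' \<noteq> D \<and> r D' = r D")
      case True
      then show thesis using that[of _ "{}"] joins_empty by fastforce
    next
      case False
      then have "{D'\<in>\<U>. r D' = r D} = {D}" using D by blast
      then have "odd (card (J \<inter> cut {r D}))" using U(5)[of "r D"] by simp
      then obtain g K where g: "g \<noteq> r D" "odd (card (J \<inter> cut {g}))" "K \<subseteq> J" "joins K (r D) g"
        using odd_vertex_partner[OF U(4)] by blast
      then have "{D'\<in>\<U>. r D' = g} \<noteq> {}" using U(5)[of g] by (metis card.empty even_zero)
      then show thesis using that g by blast
    qed
    have finK: "finite K" "finite (J - K)" using K(3) U(4) finite_subset by auto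
    have DD: "unb D" "unb D'" "r D \<in> ends D" "r D' \<in> ends D'" using U(2) D K(1) by blast+
    have "conn K (r D) (r D')" using K(4) unfolding conn_def by blast
    then obtain F where F: "scirc F" "D \<union> D' \<subseteq> F" "F \<subseteq> D \<union> D' \<union> K"
      using barbell_ex[OF DD(1,2) U(3)[OF D K(1)] DD(3,4)] K(2) by metis
    let ?U = "\<U> - {D, D'}"
    have Usplit: "\<U> = insert D (insert D' ?U)" using D K(1) by blast
    have par: "odd (card ((J - K) \<inter> cut {x})) \<longleftrightarrow> odd (card {D\<in>?U. r D = x})" for x
    proof -
      have "J \<inter> cut {x} = ((J - K) \<inter> cut {x}) \<union> (K \<inter> cut {x})" using K(3) by blast
      moreover have "((J - K) \<inter> cut {x}) \<inter> (K \<inter> cut {x}) = {}" by blast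
      ultimately have "card (J \<inter> cut {x}) = card ((J - K) \<inter> cut {x}) + card (K \<inter> cut {x})"
        using finK by (simp add: card_Un_disjoint)
      moreover have "odd (card (K \<inter> cut {x})) \<longleftrightarrow> (x = r D) \<noteq> (x = r D')" using K(4) by (simp add: joins_def)
      moreover have "card {W\<in>\<U>. r W = x} = card {W\<in>?U. r W = x} + (if r D = x then 1 else 0) + (if r D' = x then 1 else 0)"
      proof -
        have "{W\<in>\<U>. r W = x} = {W\<in>?U. r W = x} \<union> {W\<in>{D, D'}. r W = x}" using D K(1) by blast
        moreover have "{W\<in>?U. r W = x} \<inter> {W\<in>{D, D'}. r W = x} = {}" by blast
        ultimately have "card {W\<in>\<U>. r W = x} = card {W\<in>?U. r W = x} + card {W\<in>{D, D'}. r W = x}"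
          using U(1) by (simp add: card_Un_disjoint)
        moreover have "{W\<in>{D, D'}. r W = x} = (if r D = x then {D} else {}) \<union> (if r D' = x then {D'} else {})" by auto
        ultimately show ?thesis using K(2) by auto
      qed
      ultimately show ?thesis using U(5)[of x] by auto
    qed
    have "card ?U < card \<U>" using D U(1) by (intro psubset_card_mono) auto
    then obtain fs where fs: "\<forall>F\<in>set fs. scirc F \<and> F \<subseteq> \<Union>?U \<union> (J - K)" "\<forall>D\<in>?U. \<exists>F\<in>set fs. D \<subseteq> F"
        "sum_list (map card fs) \<le> sum card ?U + card (J - K)"
      using less.hyps[of ?U "J - K"] U(1,2,3) finK(2) par by auto
    have "finite (D \<union> D' \<union> K)" using unbD(2) DD finK by blast
    then have "card F \<le> card (D \<union> D' \<union> K)" using F(3) by (intro card_mono)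
    also have "\<dots> \<le> card D + card D' + card K"
      using card_Un_le[of "D \<union> D'" K] card_Un_le[of D D'] by linarith
    finally have cF: "card F \<le> card D + card D' + card K" .
    have "sum card \<U> = card D + (card D' + sum card ?U)"
      by (subst Usplit) (use U(1) K(2) in simp)
    moreover have "card J = card (J - K) + card K"
      using K(3) finK by (metis card_Diff_subset card_mono le_add_diff_inverse2 U(4))
    ultimately have "sum_list (map card (F # fs)) \<le> sum card \<U> + card J" using cF fs(3) by simp
    moreover have "\<forall>F'\<in>set (F # fs). scirc F' \<and> F' \<subseteq> \<Union>\<U> \<union> J"
    proof
      fix F' assume "F' \<in> set (F # fs)"
      then consider "F' = F" | "F' \<in> set fs" by auto
      then show "scirc F' \<and> F' \<subseteq> \<Union>\<U> \<union> J"
      proof cases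
        case 1
        then show ?thesis using F(1,3) D K(1,3) by blast
      next
        case 2
        then have "scirc F' \<and> F' \<subseteq> \<Union>?U \<union> (J - K)" using fs(1) by blast
        then show ?thesis by blast
      qed
    qed
    moreover have "\<forall>W\<in>\<U>. \<exists>F'\<in>set (F # fs). W \<subseteq> F'"
    proof
      fix W assume "W \<in> \<U>"
      then consider "W = D \<or> W = D'" | "W \<in> ?U" by blast
      then show "\<exists>F'\<in>set (F # fs). W \<subseteq> F'" using F(2) fs(2) by cases auto
    qed
    ultimately show ?thesis by blast
  qed
qed

end

section \<open>All negative edges on one circuit\<close>

context multigraph
begin

lemma walk_nth:
  "walk u s \<Longrightarrow> k < length s \<Longrightarrow> {t (fst (s ! k)), h (fst (s ! k))} = {stops u s ! k, stops u s ! Suc k}"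
proof (induction u s arbitrary: k rule: walk.induct)
  case (1 u)
  then show ?case by simp
next
  case (2 u e x s)
  then show ?case by (cases k) auto
qed

lemma walk_segment_conn:
  assumes "walk u s" "i \<le> j" "j \<le> length s"
  shows "conn ((\<lambda>k. fst (s ! k)) ` {i..<j}) (stops u s ! i) (stops u s ! j)"
  using assms(2,3)
proof (induction j rule: dec_induct)
  case base
  then show ?case by (simp add: conn_refl)
next
  case (step j)
  let ?f = "\<lambda>k. fst (s ! k)"
  have "conn (?f ` {i..<j}) (stops u s ! i) (stops u s ! j)" using step by simp
  then have "conn (?f ` {i..<Suc j}) (stops u s ! i) (stops u s ! j)" by (rule conn_mono) auto
  moreover have "conn (?f ` {i..<Suc j}) (stops u s ! j) (stops u s ! Suc j)"
  proof (rule conn_single)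
    show "{t (?f j), h (?f j)} = {stops u s ! j, stops u s ! Suc j}" using walk_nth[OF assms(1), of j] step.prems by simp
    show "?f j \<in> ?f ` {i..<Suc j}" using step.hyps by (intro imageI) simp
  qed
  ultimately show ?case using conn_trans by blast
qed

lemma path_segment_joins:
  assumes "walk u s" "distinct (map fst s)" "i \<le> j" "j \<le> length s"
  shows "joins ((\<lambda>k. fst (s ! k)) ` {i..<j}) (stops u s ! i) (stops u s ! j)"
  using assms(3,4)
proof (induction j rule: dec_induct)
  case base
  then show ?case by (simp add: joins_empty)
next
  case (step j)
  let ?f = "\<lambda>k. fst (s ! k)"
  have "joins (?f ` {i..<j}) (stops u s ! i) (stops u s ! j)" using step by simp
  moreover have "joins {?f j} (stops u s ! j) (stops u s ! Suc j)"
    using walk_nth[OF assms(1), of j] step.prems by (intro joins_single) simp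
  moreover have "?f ` {i..<j} \<inter> {?f j} = {}"
    using nth_eq_iff_index_eq[OF assms(2)] step.prems by auto
  ultimately have "joins (?f ` {i..<j} \<union> {?f j}) (stops u s ! i) (stops u s ! Suc j)" by (rule joins_Un)
  moreover have "?f ` {i..<Suc j} = ?f ` {i..<j} \<union> {?f j}" using step.hyps by (auto simp: less_Suc_eq)
  ultimately show ?case by simp
qed

text \<open>The tour of a spanning tree, without the tree: an edge at \<open>r\<close> is dropped if
  its other end remains reachable; otherwise it is passed in both directions around a tour of the
  part behind it. The two tours then share no edge.\<close>

lemma tour_ex:
  assumes "finite K"
  shows "\<exists>s. walk r s \<and> last (stops r s) = r \<and> fst ` set s \<subseteq> K \<and>
    (\<forall>x. conn K r x \<longrightarrow> x \<in> set (stops r s)) \<and> (\<forall>e. count_list (map fst s) e \<le> 2)"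
  using assms
proof (induction "card K" arbitrary: K r rule: less_induct)
  case less
  show ?case
  proof (cases "K \<inter> cut {r} = {}")
    case True
    have "x = r" if "conn K r x" for x using conn_closed[OF that True] by blast
    then show ?thesis by (intro exI[of _ "[]"]) auto
  next
    case False
    then obtain e where e: "e \<in> K" "e \<in> cut {r}" by blast
    then obtain u where u: "{t e, h e} = {r, u}" unfolding in_cut_single by blast
    let ?K = "K - {e}"
    have sm: "card ?K < card K" "finite ?K" using card_Diff1_less[OF less.prems e(1)] less.prems by simp_all
    have IH: "\<exists>s. walk r s \<and> last (stops r s) = r \<and> fst ` set s \<subseteq> ?K \<and>
        (\<forall>x. conn ?K r x \<longrightarrow> x \<in> set (stops r s)) \<and> (\<forall>e. count_list (map fst s) e \<le> 2)" for r
      using less.hyps[OF sm] .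
    have sub: "conn ?K r x \<or> conn ?K u x" if c: "conn K r x" for x
    proof -
      let ?S = "{x. conn ?K r x \<or> conn ?K u x}"
      have "K \<inter> cut ?S = {}"
      proof (rule equals0I)
        fix f assume f: "f \<in> K \<inter> cut ?S"
        show False
        proof (cases "f = e")
          case True
          have "r \<in> ?S" "u \<in> ?S" using conn_refl by blast+
          then have "t e \<in> ?S" "h e \<in> ?S" using u by (metis insert_iff singletonD)+
          then show False using f True unfolding cut_def by blast
        next
          case False
          then have "conn ?K (t f) (h f)" using f by (intro conn_edge) blast
          then have "t f \<in> ?S \<longleftrightarrow> h f \<in> ?S" using conn_trans conn_sym by blast
          then show False using f unfolding cut_def by blast
        qed
      qed
      moreover have "r \<in> ?S" using conn_refl by blast
      ultimately have "x \<in> ?S" using conn_closed[OF c] by blast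
      then show ?thesis by blast
    qed
    obtain s1 where s1: "walk r s1" "last (stops r s1) = r" "fst ` set s1 \<subseteq> ?K"
      "\<And>x. conn ?K r x \<Longrightarrow> x \<in> set (stops r s1)" "\<And>e. count_list (map fst s1) e \<le> 2" using IH[of r] by blast
    show ?thesis
    proof (cases "conn ?K r u")
      case True
      have "x \<in> set (stops r s1)" if "conn K r x" for x
        using sub[OF that] s1(4) conn_trans[OF True] by blast
      then show ?thesis using s1 by (intro exI[of _ s1]) blast
    next
      case False
      obtain s2 where s2: "walk u s2" "last (stops u s2) = u" "fst ` set s2 \<subseteq> ?K"
        "\<And>x. conn ?K u x \<Longrightarrow> x \<in> set (stops u s2)" "\<And>e. count_list (map fst s2) e \<le> 2" using IH[of u] by blast
      let ?s = "(e, u) # s2 @ (e, r) # s1"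
      have eu: "{t e, h e} = {u, r}" using u by (simp add: insert_commute)
      have w: "walk r ?s" using u eu s1(1) s2(1,2) by (simp add: walk_append)
      have l: "last (stops r ?s) = r" using s1(2) by (cases s1) auto
      have sb: "fst ` set ?s \<subseteq> K" using s1(3) s2(3) e(1) by auto
      have vis: "x \<in> set (stops r ?s)" if "conn K r x" for x
        using sub[OF that] s1(4)[of x] s2(4)[of x] by auto
      have c0: "count_list (map fst s') f = 0" if "fst ` set s' \<subseteq> A" "f \<notin> A" for s' :: "('b \<times> 'a) list" and f A
        using that by (intro count_notin) auto
      have "count_list (map fst ?s) f \<le> 2" for f
      proof (cases "f = e")
        case True
        have "e \<notin> ?K" by blast
        then show ?thesis using c0[OF s1(3)] c0[OF s2(3)] True by simp
      next
        case f: False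
        show ?thesis
        proof (cases "f \<in> fst ` set s1 \<and> f \<in> fst ` set s2")
          case True
          have "t f \<in> set (stops r s1)" "t f \<in> set (stops u s2)"
            using walk_edge_ends[OF s1(1)] walk_edge_ends[OF s2(1)] True by blast+
          then have "conn ?K r (t f)" "conn ?K u (t f)"
            using walk_conn[OF s1(1,3)] walk_conn[OF s2(1,3)] by blast+
          then have "conn ?K r u" using conn_trans conn_sym by blast
          then show ?thesis using False by blast
        next
          case False
          then have "count_list (map fst s1) f = 0 \<or> count_list (map fst s2) f = 0"
            using c0[of s1 "fst ` set s1" f] c0[of s2 "fst ` set s2" f] by auto
          then show ?thesis using f s1(5)[of f] s2(5)[of f] by auto
        qed
      qed
      then show ?thesis using w l sb vis by blast
    qed
  qed
qed

text \<open>Otherwise each pair of intervals has a common point outside the third. One of these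
  three points lies between the other two, which both belong to the interval that it should
  avoid.\<close>

lemma interval_helly:
  fixes l1 l2 l3 :: nat
  shows "{l1..<r1} \<inter> {l2..<r2} \<subseteq> {l3..<r3} \<or> {l1..<r1} \<inter> {l3..<r3} \<subseteq> {l2..<r2} \<or>
    {l2..<r2} \<inter> {l3..<r3} \<subseteq> {l1..<r1}"
proof (rule ccontr)
  assume "\<not> ?thesis"
  then obtain i j k where "i \<in> {l1..<r1}" "i \<in> {l2..<r2}" "i \<notin> {l3..<r3}"
    "j \<in> {l1..<r1}" "j \<in> {l3..<r3}" "j \<notin> {l2..<r2}" "k \<in> {l2..<r2}" "k \<in> {l3..<r3}" "k \<notin> {l1..<r1}"
    by force
  then show False by auto
qed

text \<open>The complements of arcs through \<open>x\<close> are intervals of the path \<open>U - {x}\<close>.\<close>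

lemma three_arcs:
  assumes U: "circ U" "x \<in> U"
    and A: "\<And>i. i \<in> {1, 2, 3::nat} \<Longrightarrow> A i \<subseteq> U \<and> x \<in> A i \<and> joins (A i) (a i) (b i)"
  shows "A 1 \<subseteq> A 2 \<union> A 3 \<or> A 2 \<subseteq> A 1 \<union> A 3 \<or> A 3 \<subseteq> A 1 \<union> A 2"
proof -
  have UU: "joins U v v" for v using circD(1)[OF U(1)] by (simp add: joins_refl_iff)
  have "joins (U - {x}) (h x) (t x)" using joins_Diff[OF UU joins_edge[of x]] U(2) by blast
  then have "conn (U - {x}) (h x) (t x)" unfolding conn_def by blast
  then obtain s where s: "walk (h x) s" "last (stops (h x) s) = t x" "fst ` set s \<subseteq> U - {x}" "distinct (stops (h x) s)"
    using conn_path by blast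
  have d: "distinct (map fst s)" using walk_distinct[OF s(1,4)] .
  have "joins (fst ` set s) (h x) (t x)" using walk_joins[OF s(1) d] s(2) by simp
  then have "joins ({x} \<union> fst ` set s) (t x) (t x)" using joins_Un[OF joins_edge[of x]] s(3) by blast
  then have "{x} \<union> fst ` set s = U" using circ_sub[OF U(1), of "{x} \<union> fst ` set s"] s(3) U(2)
    by (auto simp: joins_refl_iff)
  then have sU: "fst ` set s = U - {x}" using s(3) by blast
  let ?f = "\<lambda>k. fst (s ! k)"
  have inj: "inj_on ?f {..<length s}"
    using nth_eq_iff_index_eq[OF d] by (auto intro!: inj_onI)
  \<comment> \<open>Two joins with the same ends inside \<open>U - {x}\<close> differ by an even set
    that misses \<open>x\<close>, hence coincide; so the join is the segment of the path between its
    ends.\<close>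
  have int: "\<exists>l r. r \<le> length s \<and> F = ?f ` {l..<r}" if F: "F \<subseteq> U - {x}" "joins F a b" for F a b
  proof (cases "a = b")
    case True
    then have "even_set F" using F(2) by (simp add: joins_refl_iff)
    then have "F = {}" using circ_sub[OF U(1), of F] F(1) U(2) by blast
    then show ?thesis by (intro exI[of _ 0]) simp
  next
    case False
    have ab: "v \<in> set (stops (h x) s)" if "v = a \<or> v = b" for v
    proof -
      have "odd (card (F \<inter> cut {v}))" using F(2) False that unfolding joins_def by auto
      then have "F \<inter> cut {v} \<noteq> {}" by (metis card.empty even_zero)
      then obtain e where e: "e \<in> F" "e \<in> cut {v}" by blast
      then have "{t e, h e} \<subseteq> set (stops (h x) s)" using walk_edge_ends[OF s(1)] F(1) sU by blast
      then show ?thesis using e(2) unfolding in_cut_single by blast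
    qed
    obtain i where i: "i < length (stops (h x) s)" "stops (h x) s ! i = a" using ab[of a] by (meson in_set_conv_nth)
    obtain j where j: "j < length (stops (h x) s)" "stops (h x) s ! j = b" using ab[of b] unfolding in_set_conv_nth by blast
    have main: "F = ?f ` {i..<j}" if ij: "i \<le> j" "j \<le> length s" "joins F (stops (h x) s ! i) (stops (h x) s ! j)" for i j
    proof -
      have J: "joins (?f ` {i..<j}) (stops (h x) s ! i) (stops (h x) s ! j)" using path_segment_joins[OF s(1) d ij(1,2)] .
      have sub: "?f ` {i..<j} \<subseteq> U - {x}" using ij(2) sU by fastforce
      have "even_set (sym_diff F (?f ` {i..<j}))" using joins_joins_even[OF ij(3) J] .
      moreover have "sym_diff F (?f ` {i..<j}) \<subseteq> U - {x}" using F(1) sub by blast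
      ultimately have "sym_diff F (?f ` {i..<j}) = {}" using circ_sub[OF U(1), of "sym_diff F (?f ` {i..<j})"] U(2) by blast
      then show ?thesis by blast
    qed
    show ?thesis
    proof (cases "i \<le> j")
      case True
      then show ?thesis using main[of i j] F(2) i j using less_Suc_eq_le by auto
    next
      case False
      then show ?thesis using main[of j i] joins_sym[OF F(2)] i j by (metis Suc_length_conv length_map less_Suc_eq_le linorder_not_le order_less_imp_le)
    qed
  qed
  have "\<exists>l r. r \<le> length s \<and> U - A i = ?f ` {l..<r}" if i: "i \<in> {1, 2, 3}" for i
  proof (rule int)
    show "U - A i \<subseteq> U - {x}" using A[OF i] by blast
    show "joins (U - A i) (a i) (b i)"
      using joins_Diff[OF UU[of "b i"] joins_sym] A[OF i] by blast
  qed
  then obtain l r where lr: "\<And>i. i \<in> {1, 2, 3} \<Longrightarrow> r i \<le> length s \<and> U - A i = ?f ` {l i..<r i}" by metis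
  have fint: "?f ` {l i..<r i} \<inter> ?f ` {l j..<r j} \<subseteq> ?f ` {l k..<r k}"
    if "i \<in> {1, 2, 3}" "j \<in> {1, 2, 3}" "{l i..<r i} \<inter> {l j..<r j} \<subseteq> {l k..<r k}" for i j k
  proof -
    have sub: "{l i..<r i} \<subseteq> {..<length s}" "{l j..<r j} \<subseteq> {..<length s}" using lr[OF that(1)] lr[OF that(2)] by auto
    have "?f ` {l i..<r i} \<inter> ?f ` {l j..<r j} = ?f ` ({l i..<r i} \<inter> {l j..<r j})"
      using inj_on_image_Int[OF inj sub] by simp
    then show ?thesis using that(3) by blast
  qed
  have "A k \<subseteq> A i \<union> A j" if "i \<in> {1, 2, 3}" "j \<in> {1, 2, 3}" "k \<in> {1, 2, 3}" "{l i..<r i} \<inter> {l j..<r j} \<subseteq> {l k..<r k}" for i j k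
  proof
    fix y assume y: "y \<in> A k"
    show "y \<in> A i \<union> A j"
    proof (rule ccontr)
      assume n: "y \<notin> A i \<union> A j"
      have yU: "y \<in> U" using A[OF that(3)] y by blast
      have "y \<in> U - A i" "y \<in> U - A j" using n yU by blast+
      then have "y \<in> ?f ` {l i..<r i}" "y \<in> ?f ` {l j..<r j}" using lr[OF that(1)] lr[OF that(2)] by simp_all
      then have "y \<in> ?f ` {l k..<r k}" using fint[OF that(1,2,4)] by (meson IntI subsetD)
      then have "y \<in> U - A k" using lr[OF that(3)] by simp
      then show False using y by blast
    qed
  qed
  then show ?thesis using interval_helly[of "l 1" "r 1" "l 2" "r 2" "l 3" "r 3"] by blast
qed

end

context signed_multigraph
begin

text \<open>
  A closed tour of \<open>T\<close> is cut at its visits of \<open>U\<close>. Each piece without edges of \<open>U\<close> contains an ear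
  of \<open>U\<close>, which makes a balanced circuit with one of the two arcs between its ends. An edge \<open>n \<in> N\<close>
  that is on none of these arcs would be crossed by no colour change: the vertices of \<open>U\<close> that are
  joined in \<open>U - {n}\<close> by an odd number of negative edges would not be joined by the tour.
\<close>

lemma circle_cover:
  assumes U: "unb U" and NU: "N \<subseteq> U" and N1: "card N \<noteq> 1" and T: "finite T" "T \<inter> N = {}"
    and Tc: "\<And>x y. x \<in> ends U \<Longrightarrow> y \<in> ends U \<Longrightarrow> conn T x y"
  obtains fs where "\<And>F. F \<in> set fs \<Longrightarrow> bal F \<and> F \<subseteq> T \<union> U"
    "sum_list (map card fs) \<le> 2 * card (T \<union> U)" "\<And>n. n \<in> N \<Longrightarrow> \<exists>F\<in>set fs. n \<in> F"
proof -
  have cU: "circ U" and finU: "finite U" using unbD U by auto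
  have finN: "finite N" using finU NU finite_subset by blast
  have oddN: "odd (card N)" using U NU unfolding unb_def by (simp add: Int_absorb1)
  obtain r where r: "r \<in> ends U" using circ_ends[OF cU] by blast
  obtain s where s: "walk r s" "last (stops r s) = r" "fst ` set s \<subseteq> T"
    "\<And>x. conn T r x \<Longrightarrow> x \<in> set (stops r s)" "\<And>e. count_list (map fst s) e \<le> 2"
    using tour_ex[OF T(1), of r] by blast
  define st where "st = (\<lambda>k. stops r s ! k)"
  define ed where "ed = (\<lambda>k. fst (s ! k))"
  have edT: "ed k \<in> T" if "k < length s" for k using s(3) that unfolding ed_def by (meson imageI nth_mem subsetD)
  have edst: "{t (ed k), h (ed k)} = {st k, st (Suc k)}" if "k < length s" for k
    using walk_nth[OF s(1) that] unfolding ed_def st_def .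
  define gap where "gap = (\<lambda>(i, j). i < j \<and> j \<le> length s \<and> st i \<in> ends U \<and> st j \<in> ends U \<and>
    (\<forall>k. i < k \<longrightarrow> k < j \<longrightarrow> st k \<notin> ends U))"
  \<comment> \<open>The gaps that contain an ear: distinct ends, and no edge of \<open>U\<close> on
    the way.\<close>
  define G where "G = {(i, j). gap (i, j) \<and> st i \<noteq> st j \<and> ed ` {i..<j} \<inter> U = {}}"
  have gap_uniq: "g = g'" if g: "gap g" "gap g'" "k \<in> {fst g..<snd g}" "k \<in> {fst g'..<snd g'}" for g g' k
  proof -
    obtain i j i' j' where ij: "g = (i, j)" "g' = (i', j')" by (metis surj_pair)
    have "\<not> i < i'" "\<not> i' < i" "\<not> j < j'" "\<not> j' < j" using g unfolding ij gap_def by force+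
    then show ?thesis using ij by auto
  qed
  have "\<exists>C. bal C \<and> C - U \<subseteq> ed ` {i..<j} \<and> joins (C \<inter> U) (st i) (st j)" if g: "(i, j) \<in> G" for i j
  proof -
    have ij: "i < j" "j \<le> length s" "st i \<in> ends U" "st j \<in> ends U" "st i \<noteq> st j" "ed ` {i..<j} \<inter> U = {}"
      "\<And>k. i < k \<Longrightarrow> k < j \<Longrightarrow> st k \<notin> ends U"
      using g unfolding G_def gap_def by auto
    have "conn (ed ` {i..<j}) (st i) (st j)"
      using walk_segment_conn[OF s(1), of i j] ij(1,2) unfolding ed_def st_def by simp
    then obtain J where J: "J \<subseteq> ed ` {i..<j}" "joins J (st i) (st j)" unfolding conn_def by blast
    let ?F = "{D. D \<subseteq> ed ` {i..<j} \<and> joins D (st i) (st j)}"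
    have "finite ?F" by simp
    moreover have "J \<in> ?F" using J by blast
    ultimately obtain D where "D \<in> ?F" "\<And>D'. D' \<in> ?F \<Longrightarrow> card D \<le> card D'"
      using finite_ex_least[of ?F J card] by blast
    then have D: "D \<subseteq> ed ` {i..<j}" "joins D (st i) (st j)"
      and Dmin: "\<And>D'. D' \<subseteq> ed ` {i..<j} \<Longrightarrow> joins D' (st i) (st j) \<Longrightarrow> card D \<le> card D'" by auto
    have finD: "finite D" using D(2) joinsD by blast
    have disj: "D \<inter> U = {}" using D(1) ij(6) by blast
    \<comment> \<open>Between its ends a gap avoids the vertices of \<open>U\<close>, so only the
      two ends of the gap can be odd vertices on \<open>U\<close>. This makes a smallest join in the
      gap a minimal ear.\<close>
    have touch: "v = st i \<or> v = st j" if v: "v \<in> ends U" "odd (card (D' \<inter> cut {v}))" "D' \<subseteq> D" for v D'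
    proof -
      have "D' \<inter> cut {v} \<noteq> {}" using v(2) by (metis card.empty even_zero)
      then obtain e where e: "e \<in> D'" "e \<in> cut {v}" by blast
      then obtain k where k: "e = ed k" "i \<le> k" "k < j" using v(3) D(1) by auto
      then have "v \<in> {st k, st (Suc k)}" using edst[of k] ij(2) e(2) unfolding in_cut_single by (metis insert_iff le_trans linorder_not_le)
      moreover have "st k \<in> ends U \<Longrightarrow> k = i" using ij(7)[of k] k by force
      moreover have "st (Suc k) \<in> ends U \<Longrightarrow> Suc k = j" using ij(7)[of "Suc k"] k by force
      ultimately show ?thesis using v(1) by blast
    qed
    have min: "\<not> joins D' x y" if D': "D' \<subset> D" "x \<in> ends U" "y \<in> ends U" "x \<noteq> y" for D' x y
    proof
      assume j: "joins D' x y"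
      have "odd (card (D' \<inter> cut {x}))" "odd (card (D' \<inter> cut {y}))" using j D'(4) unfolding joins_def by auto
      then have "x = st i \<or> x = st j" "y = st i \<or> y = st j" using touch D' by blast+
      then have "joins D' (st i) (st j)" using j D'(4) joins_sym by blast
      then have "card D \<le> card D'" using Dmin[of D'] D'(1) D(1) by blast
      then show False using psubset_card_mono[OF finD D'(1)] by simp
    qed
    obtain A where A: "A \<subseteq> U" "joins A (st i) (st j)" "joins (U - A) (st i) (st j)" using circ_split[OF cU ij(3,4)] .
    have finA: "finite A" using A(1) finU finite_subset by blast
    have DN: "D \<inter> N = {}" using disj NU by blast
    have par: "(D \<union> B) \<inter> N = B \<inter> N" for B using DN by blast
    have "N = (A \<inter> N) \<union> ((U - A) \<inter> N)" using NU A(1) by blast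
    moreover have "(A \<inter> N) \<inter> ((U - A) \<inter> N) = {}" by blast
    ultimately have "card N = card (A \<inter> N) + card ((U - A) \<inter> N)"
      using finN by (metis card_Un_disjoint finite_Int)
    then have "even (card (A \<inter> N)) \<or> even (card ((U - A) \<inter> N))" using oddN by auto
    then obtain B where B: "B \<subseteq> U" "joins B (st i) (st j)" "even (card (B \<inter> N))" using A by blast
    have "circ (D \<union> B)" using ear_circ[OF cU ij(5) D(2) disj min B(1,2) ij(3,4)] .
    then have "bal (D \<union> B)" unfolding bal_def using B(3) par by simp
    moreover have "(D \<union> B) \<inter> U = B" using disj B(1) by blast
    moreover have "(D \<union> B) - U \<subseteq> ed ` {i..<j}" using D(1) B(1) by blast
    ultimately show ?thesis using B(2) by metis
  qed
  then have "\<forall>g\<in>G. \<exists>C. bal C \<and> C - U \<subseteq> ed ` {fst g..<snd g} \<and> joins (C \<inter> U) (st (fst g)) (st (snd g))"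
    by auto
  then obtain C where C: "\<And>g. g \<in> G \<Longrightarrow> bal (C g)" "\<And>g. g \<in> G \<Longrightarrow> C g - U \<subseteq> ed ` {fst g..<snd g}"
    "\<And>g. g \<in> G \<Longrightarrow> joins (C g \<inter> U) (st (fst g)) (st (snd g))"
    using bchoice[of G] by metis
  have cover: "\<exists>g\<in>G. n \<in> C g" if n: "n \<in> N" for n
  proof -
    have nU: "n \<in> U" using n NU by blast
    have uniq: "A = B" if "A \<subseteq> U - {n}" "B \<subseteq> U - {n}" "joins A x y" "joins B x y" for A B x y
    proof -
      have "even_set (sym_diff A B)" using joins_joins_even[OF that(3,4)] .
      moreover have "sym_diff A B \<subseteq> U - {n}" using that by blast
      ultimately have "sym_diff A B = {}" using circ_sub[OF cU, of "sym_diff A B"] nU by blast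
      then show ?thesis by blast
    qed
    have ex: "\<exists>A\<subseteq>U - {n}. joins A x y" if xy: "x \<in> ends U" "y \<in> ends U" for x y
    proof -
      obtain A where "A \<subseteq> U" "joins A x y" "joins (U - A) x y" using circ_split[OF cU xy] .
      then show ?thesis by (cases "n \<in> A") blast+
    qed
    \<comment> \<open>The colour of \<open>x\<close>: the parity of the number of negative edges on
      the arc from \<open>r\<close> to \<open>x\<close> that avoids \<open>n\<close>.\<close>
    define c where "c = (\<lambda>x. \<exists>A\<subseteq>U - {n}. joins A r x \<and> odd (card (A \<inter> N)))"
    have cval: "c x \<longleftrightarrow> odd (card (A \<inter> N))" if "A \<subseteq> U - {n}" "joins A r x" for A x
      using that uniq unfolding c_def by blast
    have key: "c x \<noteq> c y \<longleftrightarrow> odd (card (B \<inter> N))"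
      if B: "B \<subseteq> U - {n}" "joins B x y" and xy: "x \<in> ends U" "y \<in> ends U" for B x y
    proof -
      obtain A where A: "A \<subseteq> U - {n}" "joins A r x" using ex[OF r xy(1)] by blast
      have "joins (sym_diff A B) r y" using joins_trans[OF A(2) B(2)] .
      moreover have "sym_diff A B \<subseteq> U - {n}" using A(1) B(1) by blast
      ultimately have "c y \<longleftrightarrow> odd (card (sym_diff A B \<inter> N))" using cval by blast
      moreover have "finite A" "finite B" using A(1) B(1) finU finite_subset by blast+
      ultimately show ?thesis using cval[OF A] odd_card_sym_diff_Int[of A B N] by blast
    qed
    \<comment> \<open>A second negative edge has ends of different colours. This is where
      \<open>card N \<noteq> 1\<close> enters.\<close>
    obtain n' where n': "n' \<in> N" "n' \<noteq> n"
    proof -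
      have "N \<noteq> {n}" using N1 by auto
      then show thesis using that n by blast
    qed
    have ends': "t n' \<in> ends U" "h n' \<in> ends U" using n'(1) NU by (auto simp: ends_def)
    have "c (t n') \<noteq> c (h n')"
    proof -
      have "{n'} \<subseteq> U - {n}" using n' NU by blast
      moreover have "{n'} \<inter> N = {n'}" using n'(1) by blast
      ultimately show ?thesis using key[OF _ joins_edge[of n'] ends'] by simp
    qed
    moreover have vis: "\<exists>k\<le>length s. st k = x" if "x \<in> ends U" for x
    proof -
      have "x \<in> set (stops r s)" using s(4) Tc r that by blast
      then obtain k where "k < length (stops r s)" "stops r s ! k = x" unfolding in_set_conv_nth by blast
      then show ?thesis unfolding st_def by (intro exI[of _ k]) simp
    qed
    ultimately have ex0: "\<exists>i j. i < j \<and> j \<le> length s \<and> st i \<in> ends U \<and> st j \<in> ends U \<and> c (st i) \<noteq> c (st j)"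
    proof -
      obtain i j where "i \<le> length s" "st i = t n'" "j \<le> length s" "st j = h n'" using vis ends' by blast
      then show ?thesis using \<open>c (t n') \<noteq> c (h n')\<close> ends' by (cases i j rule: linorder_cases) metis+
    qed
    \<comment> \<open>A closest pair of visits of \<open>U\<close> with different colours is a gap,
      as a visit in between would differ in colour from one of the two.\<close>
    let ?P = "\<lambda>(i, j). i < j \<and> j \<le> length s \<and> st i \<in> ends U \<and> st j \<in> ends U \<and> c (st i) \<noteq> c (st j)"
    obtain ij0 where "?P ij0" using ex0 by auto
    then obtain ij where ij: "?P ij" "\<And>ij'. ?P ij' \<Longrightarrow> snd ij - fst ij \<le> snd ij' - fst ij'"
      using ex_has_least_nat[of ?P ij0 "\<lambda>ij. snd ij - fst ij"] by blast
    obtain i j where "ij = (i, j)" by fastforce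
    then have P: "i < j" "j \<le> length s" "st i \<in> ends U" "st j \<in> ends U" "c (st i) \<noteq> c (st j)"
      and min: "\<And>i' j'. ?P (i', j') \<Longrightarrow> j - i \<le> j' - i'"
      using ij(1) ij(2)[of "(_, _)"] by auto
    have inner: "st k \<notin> ends U" if k: "i < k" "k < j" for k
    proof
      assume e: "st k \<in> ends U"
      have "c (st i) \<noteq> c (st k) \<or> c (st k) \<noteq> c (st j)" using P(5) by blast
      then have "j - i \<le> k - i \<or> j - i \<le> j - k" using min[of i k] min[of k j] P k e by auto
      then show False using k by linarith
    qed
    \<comment> \<open>An edge of \<open>U\<close> on the tour is positive and different from
      \<open>n\<close>, so it cannot change the colour.\<close>
    have noU: "ed ` {i..<j} \<inter> U = {}"
    proof (rule equals0I)
      fix f assume "f \<in> ed ` {i..<j} \<inter> U"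
      then obtain k where k: "i \<le> k" "k < j" "f = ed k" "f \<in> U" by auto
      have kk: "{t f, h f} = {st k, st (Suc k)}" using edst[of k] k(2,3) P(2) by simp
      have fe: "t f \<in> ends U" "h f \<in> ends U" using k(4) by (auto simp: ends_def)
      then have "st k \<in> ends U" "st (Suc k) \<in> ends U" using kk by (metis insert_iff singletonD)+
      then have kij: "k = i" "Suc k = j" using inner[of k] inner[of "Suc k"] k(1,2) by force+
      have "f \<notin> N" using edT[of k] k(2,3) P(2) T(2) by auto
      then have "{f} \<subseteq> U - {n}" "{f} \<inter> N = {}" using k(4) n by blast+
      moreover have "joins {f} (st i) (st j)" using joins_single[OF kk] kij by simp
      ultimately show False using key[of "{f}" "st i" "st j"] P(3,4,5) by simp
    qed
    have "st i \<noteq> st j" using P(5) by metis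
    then have G: "(i, j) \<in> G" unfolding G_def gap_def using P inner noU by auto
    have "n \<in> C (i, j)"
    proof (rule ccontr)
      assume nn: "n \<notin> C (i, j)"
      have "C (i, j) \<inter> U \<subseteq> U - {n}" using nn by blast
      then have "odd (card (C (i, j) \<inter> U \<inter> N))" using key[OF _ _ P(3,4)] C(3)[OF G] P(5) by simp
      moreover have "C (i, j) \<inter> U \<inter> N = C (i, j) \<inter> N" using NU by blast
      ultimately show False using C(1)[OF G] by (simp add: bal_def)
    qed
    then show ?thesis using G by blast
  qed
  have finG: "finite G"
  proof -
    have "G \<subseteq> {..length s} \<times> {..length s}" unfolding G_def gap_def by auto
    then show ?thesis using finite_subset by blast
  qed
  \<comment> \<open>A smallest subfamily that still covers \<open>N\<close>. Of three of its arcs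
    through a common edge, one would lie in the union of the others and could be dropped.\<close>
  let ?F = "{I. I \<subseteq> G \<and> N \<subseteq> \<Union>(C ` I)}"
  have "finite ?F" using finG by simp
  moreover have "G \<in> ?F" using cover by blast
  ultimately obtain I where "I \<in> ?F" and Imin: "\<And>I'. I' \<in> ?F \<Longrightarrow> card I \<le> card I'"
    using finite_ex_least[of ?F G card] by blast
  then have I: "I \<subseteq> G" "N \<subseteq> \<Union>(C ` I)" by auto
  have finI: "finite I" using I(1) finG finite_subset by blast
  have finC: "finite (C g)" if "g \<in> G" for g using C(1)[OF that] circD(3) unfolding bal_def by blast
  have twoU: "card {g\<in>I. x \<in> C g} \<le> 2" if x: "x \<in> U" for x
  proof (rule ccontr)
    assume "\<not> ?thesis"
    then have "3 \<le> card {g\<in>I. x \<in> C g}" by simp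
    then obtain Y where Y: "Y \<subseteq> {g\<in>I. x \<in> C g}" "card Y = 3" by (meson obtain_subset_with_card_n)
    then obtain g1 g2 g3 where g: "Y = {g1, g2, g3}" "g1 \<noteq> g2" "g2 \<noteq> g3" "g1 \<noteq> g3" by (auto simp: card_3_iff)
    define g where "g = (\<lambda>i::nat. if i = 1 then g1 else if i = 2 then g2 else g3)"
    have gI: "g i \<in> I" "x \<in> C (g i)" for i using Y(1) g(1) unfolding g_def by auto
    have arcs: "C (g i) \<inter> U \<subseteq> U \<and> x \<in> C (g i) \<inter> U \<and> joins (C (g i) \<inter> U) (st (fst (g i))) (st (snd (g i)))" for i
      using gI[of i] x I(1) C(3)[of "g i"] by blast
    have drop: False if k: "C k \<inter> U \<subseteq> C i \<union> C j" "k \<in> I" "i \<in> I" "j \<in> I" "k \<noteq> i" "k \<noteq> j" for i j k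
    proof -
      have "I - {k} \<in> ?F"
      proof -
        have "N \<subseteq> \<Union>(C ` (I - {k}))"
        proof
          fix n assume n: "n \<in> N"
          then obtain g where "g \<in> I" "n \<in> C g" using I(2) by blast
          then show "n \<in> \<Union>(C ` (I - {k}))" using k n NU by (cases "g = k") blast+
        qed
        then show ?thesis using I(1) by blast
      qed
      then have "card I \<le> card (I - {k})" using Imin by blast
      then show False using k(2) finI card_Diff1_less[of I k] by simp
    qed
    have "C (g 1) \<inter> U \<subseteq> (C (g 2) \<inter> U) \<union> (C (g 3) \<inter> U) \<or> C (g 2) \<inter> U \<subseteq> (C (g 1) \<inter> U) \<union> (C (g 3) \<inter> U) \<or>
       C (g 3) \<inter> U \<subseteq> (C (g 1) \<inter> U) \<union> (C (g 2) \<inter> U)"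
      using three_arcs[OF cU x, of "\<lambda>i. C (g i) \<inter> U"] arcs by fastforce
    moreover have "g 1 = g1" "g 2 = g2" "g 3 = g3" by (simp_all add: g_def)
    ultimately show False using drop[of g1 g2 g3] drop[of g2 g1 g3] drop[of g3 g1 g2] gI[of 1] gI[of 2] gI[of 3] g(2-4)
      by auto
  qed
  \<comment> \<open>The gaps are disjoint stretches of the tour, which passes every edge at most
    twice.\<close>
  have twoT: "card {g\<in>I. x \<in> C g} \<le> 2" if x: "x \<in> T - U" for x
  proof -
    let ?K = "{k. k < length s \<and> ed k = x}"
    have "card ?K = count_list (map fst s) x"
      unfolding count_list_eq_length_filter length_filter_conv_card ed_def by (auto intro!: arg_cong[where f = card])
    then have K2: "card ?K \<le> 2" using s(5)[of x] by simp
    have "\<exists>k. k \<in> ?K \<and> k \<in> {fst g..<snd g}" if g: "g \<in> {g\<in>I. x \<in> C g}" for g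
    proof -
      have gG: "g \<in> G" using g I(1) by blast
      then have "x \<in> ed ` {fst g..<snd g}" using C(2)[OF gG] g x by blast
      then obtain k where k: "k \<in> {fst g..<snd g}" "x = ed k" by blast
      have "snd g \<le> length s" using gG unfolding G_def gap_def by auto
      then show ?thesis using k using linorder_not_le by fastforce
    qed
    then obtain f where f: "\<And>g. g \<in> {g\<in>I. x \<in> C g} \<Longrightarrow> f g \<in> ?K \<and> f g \<in> {fst g..<snd g}" by meson
    have "inj_on f {g\<in>I. x \<in> C g}"
    proof (rule inj_onI)
      fix g g' assume g: "g \<in> {g\<in>I. x \<in> C g}" "g' \<in> {g\<in>I. x \<in> C g}" "f g = f g'"
      have "gap g" "gap g'" using g I(1) unfolding G_def by auto
      then show "g = g'" using gap_uniq[of g g' "f g"] f[OF g(1)] f[OF g(2)] g(3) by simp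
    qed
    moreover have "f ` {g\<in>I. x \<in> C g} \<subseteq> ?K" using f by blast
    ultimately have "card {g\<in>I. x \<in> C g} \<le> card ?K" by (intro card_inj_on_le) auto
    then show ?thesis using K2 by simp
  qed
  have CTU: "C g \<subseteq> T \<union> U" if "g \<in> G" for g
  proof -
    have "snd g \<le> length s" using that unfolding G_def gap_def by auto
    then have "ed ` {fst g..<snd g} \<subseteq> T" using edT by auto
    then show ?thesis using C(2)[OF that] by blast
  qed
  have finTU: "finite (T \<union> U)" using T(1) finU by blast
  have "(\<Sum>g\<in>I. card (C g)) = (\<Sum>g\<in>I. \<Sum>x\<in>T \<union> U. if x \<in> C g then 1 else 0)"
  proof (rule sum.cong[OF refl])
    fix g assume "g \<in> I"
    then have "C g \<subseteq> T \<union> U" using CTU I(1) by blast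
    then show "card (C g) = (\<Sum>x\<in>T \<union> U. if x \<in> C g then 1 else 0)" using finTU by (simp add: sum.If_cases Int_absorb1)
  qed
  also have "\<dots> = (\<Sum>x\<in>T \<union> U. \<Sum>g\<in>I. if x \<in> C g then 1 else 0)" by (rule sum.swap)
  also have "\<dots> = (\<Sum>x\<in>T \<union> U. card {g\<in>I. x \<in> C g})"
    using finI by (intro sum.cong refl) (simp add: sum.If_cases Int_def)
  also have "\<dots> \<le> (\<Sum>x\<in>T \<union> U. 2)" using twoU twoT by (intro sum_mono) blast
  finally have total: "(\<Sum>g\<in>I. card (C g)) \<le> 2 * card (T \<union> U)" by simp
  obtain gs where gs: "set gs = I" "distinct gs" using finite_distinct_list[OF finI] by blast
  show thesis
  proof (rule that[of "map C gs"])
    show "bal F \<and> F \<subseteq> T \<union> U" if "F \<in> set (map C gs)" for F using that gs(1) I(1) C(1) CTU by fastforce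
    have "sum_list (map card (map C gs)) = (\<Sum>g\<in>I. card (C g))"
      using gs by (simp add: comp_def sum.distinct_set_conv_list flip: gs(1))
    then show "sum_list (map card (map C gs)) \<le> 2 * card (T \<union> U)" using total by simp
    show "\<exists>F\<in>set (map C gs). n \<in> F" if "n \<in> N" for n using I(2) that gs(1) by auto
  qed
qed

end

section \<open>Connected signed graphs\<close>

context spanned
begin

text \<open>The case distinction is on the unbalanced circuits of a nonconflicting decomposition of
  \<open>X\<close>. None: the decomposition is a cover. Two: one of them is toured and the other
  guarantees a supply. Just one, \<open>U\<close>: it is linked to a nonconflicting partner if there
  is any; it is handled by \<open>circle_cover\<close> if it has all negative edges; otherwise
  \<open>sym_diff U D\<close> replaces \<open>U\<close>, for the fundamental circuit
  \<open>D\<close> of a negative edge off \<open>U\<close>. In the last two situations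
  \<open>X\<close> need not be covered, but the negative edges are covered by circuits, which
  suffices for cuts of two edges.\<close>

lemma cover_without_bridges:
  assumes nb: "\<And>S b. E \<inter> cut S \<noteq> {b}" and N1: "card N \<noteq> 1"
  obtains fs where "\<And>F. F \<in> set fs \<Longrightarrow> scirc F \<and> F \<subseteq> E" "sum_list (map card fs) \<le> 2 * card (T \<union> N)"
    "X \<subseteq> \<Union>(set fs) \<or> (\<forall>n\<in>N. \<exists>F\<in>set fs. \<exists>C\<subseteq>F. circ C \<and> n \<in> C)"
proof -
  have TNE: "T \<union> N \<subseteq> E" using TE NE by blast
  have finTN: "finite (T \<union> N)" using TNE finE finite_subset by blast
  have XTN: "X \<subseteq> T \<union> N" using XT by blast
  have XI: "X \<inter> (T \<union> N) = X" using XTN by blast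
  have cX: "card Y \<le> card (T \<union> N)" if "Y \<subseteq> T \<union> N" for Y using that finTN by (intro card_mono)
  have nbr: "nonbridge e" for e using nb by (simp add: nonbridge_def)
  obtain \<C> where C: "nonconf_decomp \<C> X" using nonconf_decomp_ex[OF Xeven] .
  have dec: "decomp \<C> X" using C by (simp add: nonconf_decomp_def)
  have UC: "finite \<C>" "\<Union>\<C> = X" using dec by (auto simp: decomp_def)
  have circC: "circ D" "D \<subseteq> X" if "D \<in> \<C>" for D using that dec by (auto simp: decomp_def)
  have endV: "x \<in> V" if "x \<in> ends D" "D \<subseteq> T \<union> N" for x D using that TNE EV unfolding ends_def by blast
  consider "\<And>D. D \<in> \<C> \<Longrightarrow> \<not> unb D" | U U' where "U \<in> \<C>" "U' \<in> \<C>" "unb U" "unb U'" "U \<noteq> U'"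
    | U where "U \<in> \<C>" "unb U" "\<And>D. D \<in> \<C> \<Longrightarrow> unb D \<Longrightarrow> D = U" by fastforce
  then show thesis
  proof cases
    case 1
    obtain fs where fs: "set fs = \<C>" "sum_list (map card fs) = card X" using decomp_list[OF dec] .
    have "scirc F \<and> F \<subseteq> E" if "F \<in> set fs" for F
      using that fs(1) 1 circC circ_bal_unb TNE XTN unfolding scirc_def by blast
    moreover have "sum_list (map card fs) \<le> 2 * card (T \<union> N)" using fs(2) cX[OF XTN] by simp
    moreover have "X \<subseteq> \<Union>(set fs)" using fs(1) UC(2) by simp
    ultimately show thesis using that by blast
  next
    case (2 U U')
    define Q where "Q = \<C> \<union> (\<lambda>e. {e}) ` (T \<inter> (T \<union> N) - X)"
    have sp: "pieces (\<lambda>_. undefined) Q" "\<And>p. p \<in> Q \<Longrightarrow> simple p" "\<Union>Q = T \<union> N" "sum card Q = card (T \<union> N)"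
      using simple_pieces[of \<C> "T \<union> N" Q, unfolded XI, OF C Q_def _ TNE] NX by blast+
    have UQ: "U \<in> Q" "U' \<in> Q" using 2 unfolding Q_def by blast+
    let ?R = "Q - {U}"
    have pR: "pieces (\<lambda>_. undefined) ?R" using pieces_mono[OF sp(1)] by blast
    have cU: "circ U" using circC 2 by blast
    have UE: "U \<subseteq> E" using circC(2)[OF 2(1)] XTN TNE by blast
    obtain v where v: "v \<in> ends U" using circ_ends[OF cU] by blast
    have vV: "v \<in> V" using endV[OF v] circC(2)[OF 2(1)] XTN by blast
    have rch: "\<exists>z\<in>ends U. reach ?R z q" if q: "q \<in> ?R" for q
    proof (rule reach_remove[OF UQ(1) v])
      have "q \<noteq> {}" "q \<subseteq> T \<union> N" using q sp(1,3) unfolding pieces_def by auto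
      then obtain y where y: "y \<in> ends q" "y \<in> V" using endV unfolding ends_def by blast
      have "conn (\<Union>Q) v y" by (rule conn_mono[OF Tconn[OF vV y(2)]]) (use sp(3) in blast)
      then show "reach Q v q" using y(1) unfolding reach_def by blast
    qed
    have sup: "supplying ?R Z" for Z
      unfolding supplying_def
    proof (intro allI ballI impI)
      fix K x assume K: "K \<subseteq> ?R" "\<forall>q\<in>K. reach K x q" "supp K \<noteq> {}"
      show "supplies K x" by (rule pieces_supply[OF pieces_mono[OF pR K(1)]]) (use K sp(2) in blast)+
    qed
    have "U' \<in> supp ?R" using 2 UQ unfolding supp_def by blast
    then have sR: "supp ?R \<noteq> {}" by blast
    obtain s where s: "walk v s" "last (stops v s) = v" "fst ` set s = U" "length s = card U" "set (stops v s) = ends U"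
      using circ_tour[OF cU v] .
    have "system v [v] (\<Union>?R \<union> fst ` set s) ?R (2 * sum card ?R + length s)"
    proof (rule conjunct1[OF system_tour[OF s(1) _ nbr pR sup _ sR]])
      show "fst ` set s \<subseteq> E" using s(3) UE by simp
      show "\<exists>z\<in>set (stops v s). reach ?R z q" if "q \<in> ?R" for q using rch[OF that] s(5) by simp
    qed
    then have S1: "system v [v] (\<Union>?R \<union> U) ?R (2 * sum card ?R + card U)" using s(3,4) by simp
    have S2: "system v [v] U {U} (card U)" using system_unb[OF 2(3) UE v nbr] .
    \<comment> \<open>\<open>U\<close> is paid twice, as the route of the tour and as the partner of
      the lollipop that the tour yields.\<close>
    have "system v ([] @ []) (U \<union> (\<Union>?R \<union> U)) ({U} \<union> ?R) (card U + (2 * sum card ?R + card U))"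
      by (rule system_merge[OF S2 S1 nbr]) (use pieces_nonconf[OF sp(1), of "{U}" ?R] UQ in blast)
    moreover have "U \<union> (\<Union>?R \<union> U) = T \<union> N" "{U} \<union> ?R = Q" using UQ sp(3) by blast+
    moreover have "card U + sum card ?R = card (T \<union> N)"
      using sum.remove[OF pieces_finite(3)[OF sp(1)] UQ(1), of card] sp(4) by simp
    ultimately have "system v [] (T \<union> N) Q (2 * card (T \<union> N))" by (auto elim!: system_le)
    then obtain fs where fs: "\<And>F. F \<in> set fs \<Longrightarrow> scirc F \<and> F \<subseteq> T \<union> N" "sum_list (map card fs) \<le> 2 * card (T \<union> N)"
        "X \<inter> \<Union>Q \<subseteq> \<Union>(set fs)"
      unfolding system_def by auto
    show thesis using that[of fs] fs TNE XTN sp(3) by (metis XI subset_iff)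
  next
    case (3 U)
    have UX: "U \<subseteq> X" "circ U" using circC[OF 3(1)] by simp_all
    have decR: "decomp (\<C> - {U}) (X - U)" using decomp_Diff[OF dec, of "{U}"] 3(1) by simp
    have balR: "bal D" if "D \<in> \<C> - {U}" for D using that 3(3) circC circ_bal_unb by blast
    obtain rs where rs: "set rs = \<C> - {U}" "sum_list (map card rs) = card (X - U)" using decomp_list[OF decR] .
    have rsE: "scirc F \<and> F \<subseteq> E" if "F \<in> set rs" for F
      using that rs(1) balR circC(2) XTN TNE unfolding scirc_def by fastforce
    obtain v where v: "v \<in> ends U" using circ_ends[OF UX(2)] by blast
    have UTN: "U \<subseteq> T \<union> N" using UX XTN by blast
    have finU: "finite U" using unbD(2)[OF 3(2)] .
    show thesis
    proof (cases "\<exists>D. unb D \<and> D \<subseteq> T \<union> N \<and> nonconf U D")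
      case True
      then obtain D where D: "unb D" "D \<subseteq> T \<union> N" "nonconf U D" by blast
      obtain y where y: "y \<in> ends D" using circ_ends unbD(1)[OF D(1)] by blast
      have "conn T v y" using Tconn endV v y UTN D(2) by blast
      then obtain F where F: "scirc F" "U \<union> D \<subseteq> F" "F \<subseteq> U \<union> D \<union> T"
        using barbell_ex[OF 3(2) D(1,3) v y] by metis
      have FTN: "F \<subseteq> T \<union> N" using F(3) UTN D(2) by blast
      have "card F + card (X - U) \<le> 2 * card (T \<union> N)" using cX[OF FTN] cX[of "X - U"] XTN by fastforce
      then have "sum_list (map card (F # rs)) \<le> 2 * card (T \<union> N)" using rs(2) by simp
      moreover have "X \<subseteq> \<Union>(set (F # rs))"
        using rs(1) decR F(2) unfolding decomp_def by auto
      moreover have "scirc F' \<and> F' \<subseteq> E" if "F' \<in> set (F # rs)" for F' using that rsE F(1) FTN TNE by auto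
      ultimately show thesis using that[of "F # rs"] by blast
    next
      case noD: False
      show thesis
      proof (cases "N \<subseteq> U")
        case True
        have "conn T x y" if "x \<in> ends U" "y \<in> ends U" for x y using Tconn endV that UTN by blast
        moreover have "finite T" using finTN by simp
        ultimately obtain fs where fs: "\<And>F. F \<in> set fs \<Longrightarrow> bal F \<and> F \<subseteq> T \<union> U"
          "sum_list (map card fs) \<le> 2 * card (T \<union> U)" "\<And>n. n \<in> N \<Longrightarrow> \<exists>F\<in>set fs. n \<in> F"
          using circle_cover[OF 3(2) True N1 _ TN] by blast
        have "T \<union> U = T \<union> N" using True UTN by blast
        then have "sum_list (map card fs) \<le> 2 * card (T \<union> N)" using fs(2) by simp
        moreover have "scirc F \<and> F \<subseteq> E" if "F \<in> set fs" for F
          using fs(1)[OF that] UTN TNE unfolding scirc_def by blast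
        moreover have "\<exists>F\<in>set fs. \<exists>C\<subseteq>F. circ C \<and> n \<in> C" if "n \<in> N" for n
          using fs(1,3) that unfolding bal_def by blast
        ultimately show thesis using that[of fs] by auto
      next
        case False
        then obtain e where e: "e \<in> N" "e \<notin> U" by blast
        have "conn T (t e) (h e)" using Tconn edge_V e(1) NE by blast
        then obtain D where D: "unb D" "e \<in> D" "D \<subseteq> insert e T" using fund_circ TN e(1) by metis
        have DN: "D \<inter> N = {e}" using D e TN by blast
        have DTN: "D \<subseteq> T \<union> N" using D e by blast
        have YTN: "sym_diff U D \<subseteq> T \<union> N" using UTN DTN by blast
        have "even_set (sym_diff U D)" using even_set_sym_diff circD(1) UX(2) unbD(1)[OF D(1)] by blast
        then obtain \<D> where Dd: "nonconf_decomp \<D> (sym_diff U D)" using nonconf_decomp_ex by blast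
        then have dD: "decomp \<D> (sym_diff U D)" by (simp add: nonconf_decomp_def)
        have UD: "finite \<D>" "\<Union>\<D> = sym_diff U D" using dD by (auto simp: decomp_def)
        define \<U> where "\<U> = {W\<in>\<D>. unb W}"
        have finU': "finite \<U>" "\<U> \<subseteq> \<D>" using UD(1) by (auto simp: \<U>_def)
        \<comment> \<open>\<open>U\<close> and \<open>D\<close> are both unbalanced, so the
          unbalanced members of \<open>\<D>\<close> are even in number. Each of them meets
          \<open>U\<close>, since it conflicts with \<open>U\<close>; hence they can be paired along
          \<open>U\<close>.\<close>
        have "even (card (sym_diff U D \<inter> N))"
          using odd_card_sym_diff_Int[OF finU unbD(2)[OF D(1)], of N] 3(2) D(1) unfolding unb_def by blast
        then have evU: "even (card \<U>)" using parity_decomp[OF dD] unfolding \<U>_def by blast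
        have "\<exists>x. x \<in> ends W \<and> x \<in> ends U" if W: "W \<in> \<U>" for W
        proof -
          have "unb W" "W \<subseteq> T \<union> N" using W UD(2) YTN unfolding \<U>_def by blast+
          then have "\<not> nonconf U W" using noD by blast
          then show ?thesis using nonconf_ends[of U W] by blast
        qed
        then obtain r where r: "\<And>W. W \<in> \<U> \<Longrightarrow> r W \<in> ends W \<and> r W \<in> ends U" by metis
        have "conn U (r W) v" if "W \<in> \<U>" for W using circ_conn[OF UX(2)] r[OF that] v by blast
        then obtain J where J: "J \<subseteq> U"
          "\<And>x. odd (card (J \<inter> cut {x})) \<longleftrightarrow> (odd (card {W\<in>\<U>. r W = x}) \<noteq> (x = v \<and> odd (card \<U>)))"
          using token_join[OF finU'(1) finU, of r v] by blast
        have par: "odd (card (J \<inter> cut {x})) \<longleftrightarrow> odd (card {W\<in>\<U>. r W = x})" for x using J(2) evU by blast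
        have finJ: "finite J" using J(1) finU finite_subset by blast
        have rU: "unb W \<and> r W \<in> ends W" if "W \<in> \<U>" for W using r[OF that] that by (simp add: \<U>_def)
        have ncU: "nonconf W W'" if "W \<in> \<U>" "W' \<in> \<U>" "W \<noteq> W'" for W W'
          using Dd that unfolding nonconf_decomp_def \<U>_def by blast
        obtain fs where fs: "\<forall>F\<in>set fs. scirc F \<and> F \<subseteq> \<Union>\<U> \<union> J" "\<forall>D\<in>\<U>. \<exists>F\<in>set fs. D \<subseteq> F"
            "sum_list (map card fs) \<le> sum card \<U> + card J"
          using pair_up[of \<U> r J, OF finU'(1) rU ncU finJ par] by blast
        obtain bs where bs: "set bs = \<D> - \<U>" "distinct bs" using finite_distinct_list[of "\<D> - \<U>"] UD(1) by auto
        have "sum_list (map card bs) = sum card (\<D> - \<U>)" using bs by (metis sum.distinct_set_conv_list)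
        moreover have "sum card \<D> = sum card (\<D> - \<U>) + sum card \<U>" using sum.subset_diff[OF finU'(2) UD(1)] .
        moreover have "sum card \<D> = card (sym_diff U D)" using decomp_card[OF dD] .
        moreover have "card J \<le> card U" using J(1) finU by (intro card_mono)
        \<comment> \<open>The members cost \<open>card (X - U)\<close>,
          \<open>card (sym_diff U D)\<close> and at most \<open>card U\<close> for the links along
          \<open>U\<close>; the first and the last make up \<open>card X\<close>.\<close>
        moreover have "card (X - U) + card U = card X"
          using UX(1) finU by (metis card_Diff_subset card_mono le_add_diff_inverse2 even_setD Xeven)
        moreover have "card X \<le> card (T \<union> N)" "card (sym_diff U D) \<le> card (T \<union> N)" using cX XTN YTN by blast+
        ultimately have "sum_list (map card (rs @ fs @ bs)) \<le> 2 * card (T \<union> N)" using rs(2) fs(3) by simp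
        moreover have "scirc F \<and> F \<subseteq> E" if F: "F \<in> set (rs @ fs @ bs)" for F
        proof -
          consider "F \<in> set rs" | "F \<in> set fs" | "F \<in> set bs" using F by auto
          then show ?thesis
          proof cases
            case 1
            then show ?thesis by (rule rsE)
          next
            case 2
            then have "scirc F" "F \<subseteq> \<Union>\<U> \<union> J" using fs(1) by blast+
            moreover have "\<Union>\<U> \<subseteq> T \<union> N" using finU'(2) UD(2) YTN by blast
            ultimately show ?thesis using J(1) UTN TNE by blast
          next
            case 3
            then have F: "F \<in> \<D>" "\<not> unb F" using bs(1) by (auto simp: \<U>_def)
            then have "bal F" using dD circ_bal_unb unfolding decomp_def by blast
            then show ?thesis using F(1) UD(2) YTN TNE unfolding scirc_def by blast
          qed
        qed
        moreover have "\<exists>F\<in>set (rs @ fs @ bs). \<exists>C\<subseteq>F. circ C \<and> n \<in> C" if n: "n \<in> N" for n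
        proof (cases "n \<in> sym_diff U D")
          case True
          then obtain W where W: "W \<in> \<D>" "n \<in> W" "circ W" using dD unfolding decomp_def by blast
          show ?thesis
          proof (cases "W \<in> \<U>")
            case True
            then obtain F where "F \<in> set fs" "W \<subseteq> F" using fs(2) by blast
            then show ?thesis using W by auto
          next
            case False
            then have "W \<in> set bs" using W(1) bs(1) by blast
            then show ?thesis using W by auto
          qed
        next
          case False
          then have "n \<notin> U" using DN e(2) n by auto
          then have "n \<in> X - U" using n NX by blast
          then obtain W where "W \<in> \<C> - {U}" "n \<in> W" "circ W" using decR unfolding decomp_def by blast
          then show ?thesis using rs(1) by auto
        qed
        ultimately show thesis using that[of "rs @ fs @ bs"] by auto
      qed
    qed
  qed
qed

text \<open>By minimality of the signature a cut with one positive edge has at most one negative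
  edge. So a bridge of the positive edges is a bridge of \<open>E\<close>, or it forms a 2-edge cut
  with a negative edge and lies on every even set through that edge.\<close>

lemma small_cover:
  assumes N1: "card N \<noteq> 1" and min: "\<And>S. card (N \<inter> cut S) \<le> card ((E - N) \<inter> cut S)"
  obtains fs where "\<And>F. F \<in> set fs \<Longrightarrow> scirc F \<and> F \<subseteq> E" "sum_list (map card fs) \<le> 2 * card (T \<union> N)"
    "N \<subseteq> \<Union>(set fs)" "\<And>b S. (E - N) \<inter> cut S = {b} \<Longrightarrow> b \<in> \<Union>(set fs)"
proof -
  have finN: "finite N" using NE finE finite_subset by blast
  have crossing: "E \<inter> cut S = {b} \<or> (\<exists>n\<in>N. E \<inter> cut S = {b, n} \<and> b \<notin> N)" if S: "(E - N) \<inter> cut S = {b}" for b S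
  proof -
    have "card (N \<inter> cut S) \<le> 1" using min[of S] S by simp
    then have "N \<inter> cut S = {} \<or> (\<exists>n. N \<inter> cut S = {n})"
      using finN by (metis card_1_singletonE card_eq_0_iff finite_Int le_neq_implies_less less_one)
    moreover have "E \<inter> cut S = (E - N) \<inter> cut S \<union> N \<inter> cut S" using NE by blast
    moreover have "b \<notin> N" using S by blast
    ultimately show ?thesis using S by auto
  qed
  have inX: "b \<in> C" if C: "even_set C" "C \<subseteq> E" "n \<in> C" "E \<inter> cut S = {b, n}" for C n b S
  proof (rule ccontr)
    assume "b \<notin> C"
    then have "C \<inter> cut S = {n}" using C by auto
    then show False using even_set_cut[OF C(1), of S] by simp
  qed
  have XE: "X \<subseteq> E" using XT NE TE by blast
  show thesis
  proof (cases "\<exists>S. side S")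
    case True
    then obtain S0 where "side S0" by blast
    then obtain fs where fs: "\<And>F. F \<in> set fs \<Longrightarrow> scirc F \<and> F \<subseteq> E" "sum_list (map card fs) \<le> 2 * card (T \<union> N)"
      "X \<subseteq> \<Union>(set fs)" "\<And>b S. E \<inter> cut S = {b} \<Longrightarrow> b \<in> \<Union>(set fs)"
      using cover_with_bridges by blast
    have "b \<in> \<Union>(set fs)" if S: "(E - N) \<inter> cut S = {b}" for b S
      using crossing[OF S] fs(3,4) inX[OF Xeven XE] NX by blast
    then show thesis using that[of fs] fs NX by blast
  next
    case False
    have nb: "E \<inter> cut S \<noteq> {b}" for S b
    proof
      assume "E \<inter> cut S = {b}"
      then have "side (S \<inter> V)" using cut_V[of S] unfolding side_def by auto
      then show False using False by blast
    qed
    obtain fs where fs: "\<And>F. F \<in> set fs \<Longrightarrow> scirc F \<and> F \<subseteq> E" "sum_list (map card fs) \<le> 2 * card (T \<union> N)"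
      "X \<subseteq> \<Union>(set fs) \<or> (\<forall>n\<in>N. \<exists>F\<in>set fs. \<exists>C\<subseteq>F. circ C \<and> n \<in> C)"
      using cover_without_bridges[OF nb N1] by metis
    have Ncov: "N \<subseteq> \<Union>(set fs)" using fs(3) NX by blast
    have "b \<in> \<Union>(set fs)" if S: "(E - N) \<inter> cut S = {b}" for b S
    proof -
      obtain n where n: "n \<in> N" "E \<inter> cut S = {b, n}" using crossing[OF S] nb by blast
      from fs(3) show ?thesis
      proof
        assume "X \<subseteq> \<Union>(set fs)"
        then show ?thesis using inX[OF Xeven XE _ n(2)] n(1) NX by blast
      next
        assume "\<forall>n\<in>N. \<exists>F\<in>set fs. \<exists>C\<subseteq>F. circ C \<and> n \<in> C"
        then obtain F C where F: "F \<in> set fs" "C \<subseteq> F" "circ C" "n \<in> C" using n(1) by blast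
        have "C \<subseteq> E" using fs(1)[OF F(1)] F(2) by blast
        then have "b \<in> C" using inX[OF circD(1)[OF F(3)] _ F(4) n(2)] by blast
        then show ?thesis using F(1,2) by blast
      qed
    qed
    then show thesis using that[of fs] fs(1,2) Ncov by blast
  qed
qed

end

section \<open>Spanning tree, total count and splitting into components\<close>

context multigraph
begin

lemma ends_in: "ends E \<subseteq> V \<Longrightarrow> e \<in> E \<Longrightarrow> t e \<in> V \<and> h e \<in> V"
  by (auto simp: ends_def)

lemma spanning_tree:
  assumes V: "finite V" "V \<noteq> {}" and P: "\<And>u v. u \<in> V \<Longrightarrow> v \<in> V \<Longrightarrow> conn P u v" "ends P \<subseteq> V"
  obtains T where "T \<subseteq> P" "finite T" "card T + 1 \<le> card V" "\<And>u v. u \<in> V \<Longrightarrow> v \<in> V \<Longrightarrow> conn T u v"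
proof -
  obtain r where r: "r \<in> V" using V(2) by blast
  let ?F = "{S. r \<in> S \<and> S \<subseteq> V \<and> (\<exists>T\<subseteq>P. finite T \<and> card T + 1 \<le> card S \<and> (\<forall>u\<in>S. conn T r u))}"
  have "finite ?F" using V(1) by simp
  moreover have "{r} \<in> ?F" using r conn_refl by (auto intro!: exI[of _ "{}"])
  ultimately obtain S where S: "S \<in> ?F" "\<And>S'. S' \<in> ?F \<Longrightarrow> - int (card S) \<le> - int (card S')"
    using finite_ex_least[of ?F "{r}" "\<lambda>S. - int (card S)"] by (smt (verit))
  obtain T where T: "T \<subseteq> P" "finite T" "card T + 1 \<le> card S" "\<And>u. u \<in> S \<Longrightarrow> conn T r u" using S(1) by blast
  have rS: "r \<in> S" "S \<subseteq> V" using S(1) by auto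
  have finS: "finite S" using rS(2) V(1) finite_subset by blast
  have "S = V"
  proof (rule ccontr)
    assume "S \<noteq> V"
    then obtain v where v: "v \<in> V" "v \<notin> S" using rS by blast
    have "P \<inter> cut S \<noteq> {}" using conn_closed[OF P(1)[OF r v(1)], of S] rS v by blast
    then obtain e where e: "e \<in> P" "e \<in> cut S" by blast
    then obtain x y where xy: "{t e, h e} = {x, y}" "x \<in> S" "y \<notin> S" unfolding cut_def by blast
    have yV: "y \<in> V" using ends_in[OF P(2) e(1)] xy(1) by (metis insertI1 insert_commute insert_iff singletonD)
    have "conn (insert e T) r u" if "u \<in> insert y S" for u
    proof -
      have "conn (insert e T) r u" if "u \<in> S" for u using conn_mono[OF T(4)[OF that]] by blast
      moreover have "conn (insert e T) x y" using conn_single[OF xy(1)] by blast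
      ultimately show ?thesis using that xy(2) conn_trans by blast
    qed
    moreover have "card (insert e T) + 1 \<le> card (insert y S)"
      using T(2,3) finS xy(3) by (simp add: card_insert_if)
    ultimately have "insert y S \<in> ?F" using rS yV T(1,2) e(1)
      by (intro CollectI conjI exI[of _ "insert e T"]) auto
    then have "card (insert y S) \<le> card S" using S(2) by auto
    then show False using finS xy(3) by simp
  qed
  moreover have "conn T u v" if "u \<in> S" "v \<in> S" for u v using T(4) that conn_trans conn_sym by blast
  ultimately show thesis using that[of T] T by blast
qed

end

context signed_multigraph
begin

text \<open>The three even sets come from \<open>P\<close> with its bridges contracted, and the
  remaining edges from \<open>small_cover\<close>. The count in thirds is
  \<open>5 (|E| - |N|) + 6 (|V| - 1) + 6 |N|\<close>.\<close>

lemma connected_cover: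
  assumes fin: "finite V" "V \<noteq> {}" "finite E" and EV: "ends E \<subseteq> V" and NE: "N \<subseteq> E"
    and con: "\<And>u v. u \<in> V \<Longrightarrow> v \<in> V \<Longrightarrow> conn E u v"
    and min: "\<And>S. card (N \<inter> cut S) \<le> card ((E - N) \<inter> cut S)"
    and br: "\<And>S b. E \<inter> cut S = {b} \<Longrightarrow> \<exists>e\<in>N. t e \<in> S \<and> h e \<in> S"
    and N1: "card N \<noteq> 1"
  obtains fs where "\<And>F. F \<in> set fs \<Longrightarrow> scirc F \<and> F \<subseteq> E" "E \<subseteq> \<Union>(set fs)"
    "3 * sum_list (map card fs) + 6 \<le> 5 * card E + 6 * card V + card N"
proof -
  define P where "P = E - N"
  define Br where "Br = {b \<in> P. \<exists>S. P \<inter> cut S = {b}}"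
  have finP: "finite P" "finite N" "finite Br" using fin(3) NE finite_subset unfolding P_def Br_def by auto
  have PE: "P \<subseteq> E" "P \<inter> N = {}" "E = P \<union> N" using NE unfolding P_def by blast+
  have minP: "card (N \<inter> cut S) \<le> card (P \<inter> cut S)" for S using min unfolding P_def .
  \<comment> \<open>A cut without positive edges has no negative edges either, so dropping
    \<open>N\<close> does not disconnect the graph.\<close>
  have conP: "conn P u v" if "u \<in> V" "v \<in> V" for u v
  proof -
    let ?S = "{x. conn P u x}"
    have "P \<inter> cut ?S = {}" by (rule comp_cut)
    then have "N \<inter> cut ?S = {}" using minP[of ?S] finP(2) by simp
    then have "E \<inter> cut ?S = {}" using \<open>P \<inter> cut ?S = {}\<close> PE(3) by blast
    then have "u \<in> ?S \<longleftrightarrow> v \<in> ?S" using conn_closed[OF con[OF that]] by blast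
    then show ?thesis by (simp add: conn_refl)
  qed
  have endP: "ends P \<subseteq> V" using EV PE(1) unfolding ends_def by blast
  obtain T where T: "T \<subseteq> P" "finite T" "card T + 1 \<le> card V" "\<And>u v. u \<in> V \<Longrightarrow> v \<in> V \<Longrightarrow> conn T u v"
    using spanning_tree[OF fin(1,2) conP endP] by blast
  have TN: "T \<inter> N = {}" using T(1) PE(2) by blast
  obtain J where J: "J \<subseteq> T" "even_set (N \<union> J)"
    using even_completion[OF finP(2), of T] TN T(4) ends_in[OF EV] NE by blast
  have pos: "b \<notin> N" if S: "E \<inter> cut S = {b}" for S b
  proof
    assume "b \<in> N"
    then have "N \<inter> cut S = {b}" "P \<inter> cut S = {}" using S PE by auto
    then show False using minP[of S] by simp
  qed
  interpret spanned t h N E "N \<union> J" V T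
    by unfold_locales (use fin EV NE PE T TN J pos br in auto)
  obtain fs where fs: "\<And>F. F \<in> set fs \<Longrightarrow> scirc F \<and> F \<subseteq> E" "sum_list (map card fs) \<le> 2 * card (T \<union> N)"
    "N \<subseteq> \<Union>(set fs)" "\<And>b S. (E - N) \<inter> cut S = {b} \<Longrightarrow> b \<in> \<Union>(set fs)"
    using small_cover[OF N1 min] by blast
  have Brcov: "Br \<subseteq> \<Union>(set fs)" using fs(4) unfolding Br_def P_def by blast
  obtain p :: "'a \<Rightarrow> 'a" where p: "\<And>S. Br \<inter> cut (p -` S) = {}"
      "\<And>C. multigraph.even_set (p \<circ> t) (p \<circ> h) C \<Longrightarrow> C \<inter> Br = {} \<Longrightarrow> \<exists>J\<subseteq>Br. even_set (C \<union> J)"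
    using contract_all[OF finP(3)] by blast
  have cutp: "multigraph.cut (p \<circ> t) (p \<circ> h) S = cut (p -` S)" for S
    unfolding multigraph.cut_def by auto
  have no1: "card ((P - Br) \<inter> multigraph.cut (p \<circ> t) (p \<circ> h) S) \<noteq> 1" for S
  proof
    assume "card ((P - Br) \<inter> multigraph.cut (p \<circ> t) (p \<circ> h) S) = 1"
    then obtain b where b: "(P - Br) \<inter> cut (p -` S) = {b}" unfolding cutp by (auto simp: card_1_singleton_iff)
    then have "P \<inter> cut (p -` S) = {b}" using p(1)[of S] by blast
    then have "b \<in> Br" unfolding Br_def by blast
    then show False using b by blast
  qed
  obtain A B C where ABC: "multigraph.even_set (p \<circ> t) (p \<circ> h) A" "multigraph.even_set (p \<circ> t) (p \<circ> h) B"
      "multigraph.even_set (p \<circ> t) (p \<circ> h) C" "A \<union> B \<union> C = P - Br" "3 * (card A + card B + card C) \<le> 5 * card (P - Br)"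
    using multigraph.even_cover[of "P - Br" "p \<circ> t" "p \<circ> h"] finP no1 by blast
  have ev: "\<exists>as. (\<forall>F\<in>set as. bal F) \<and> \<Union>(set as) = D \<and> sum_list (map card as) = card D"
    if D: "multigraph.even_set (p \<circ> t) (p \<circ> h) D" "D \<subseteq> P - Br" for D
  proof -
    obtain J where J: "J \<subseteq> Br" "even_set (D \<union> J)" using p(2)[OF D(1)] D(2) by blast
    \<comment> \<open>Lifting from the contracted graph might add bridges of \<open>P\<close>, but
      no bridge lies in an even set.\<close>
    have "J = {}"
    proof (rule ccontr)
      assume "J \<noteq> {}"
      then obtain b S where b: "b \<in> J" "P \<inter> cut S = {b}" using J(1) unfolding Br_def by blast
      have "D \<union> J \<subseteq> P" using D(2) J(1) unfolding Br_def by blast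
      then have "(D \<union> J) \<inter> cut S = {b}" using b by blast
      then show False using even_set_cut[OF J(2), of S] by simp
    qed
    then obtain \<C> where C: "decomp \<C> D" using even_decomp J(2) by auto
    obtain as where as: "set as = \<C>" "sum_list (map card as) = card D" using decomp_list[OF C] .
    have "bal F" if "F \<in> \<C>" for F
    proof -
      have "F \<inter> N = {}" "circ F" using that C D(2) PE(2) unfolding decomp_def by blast+
      then show ?thesis by (simp add: bal_def)
    qed
    then show ?thesis using as C unfolding decomp_def by blast
  qed
  obtain as where as: "\<forall>F\<in>set as. bal F" "\<Union>(set as) = A" "sum_list (map card as) = card A"
    using ev[OF ABC(1)] ABC(4) by blast
  obtain bs where bs: "\<forall>F\<in>set bs. bal F" "\<Union>(set bs) = B" "sum_list (map card bs) = card B"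
    using ev[OF ABC(2)] ABC(4) by blast
  obtain cs where cs: "\<forall>F\<in>set cs. bal F" "\<Union>(set cs) = C" "sum_list (map card cs) = card C"
    using ev[OF ABC(3)] ABC(4) by blast
  let ?fs = "as @ bs @ cs @ fs"
  have cov: "\<Union>(set ?fs) = (P - Br) \<union> \<Union>(set fs)" using as(2) bs(2) cs(2) ABC(4) by auto
  show thesis
  proof (rule that[of ?fs])
    show "scirc F \<and> F \<subseteq> E" if F: "F \<in> set ?fs" for F
    proof (cases "F \<in> set fs")
      case True
      then show ?thesis by (rule fs(1))
    next
      case False
      then have "bal F" "F \<subseteq> A \<union> B \<union> C" using F as(1,2) bs(1,2) cs(1,2) by auto
      then show ?thesis using ABC(4) PE(1) unfolding scirc_def by blast
    qed
    show "E \<subseteq> \<Union>(set ?fs)" unfolding cov using PE(3) fs(3) Brcov by blast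
    have "card (T \<union> N) \<le> card T + card N" by (rule card_Un_le)
    moreover have "card (P - Br) \<le> card P" using finP by (intro card_mono) auto
    moreover have "card E = card P + card N" using PE finP by (simp add: card_Un_disjoint)
    ultimately show "3 * sum_list (map card ?fs) + 6 \<le> 5 * card E + 6 * card V + card N"
      using ABC(5) as(3) bs(3) cs(3) fs(2) T(3) by simp
  qed
qed

end

context multigraph
begin

text \<open>For parts of the graph \<open>N\<close> is restricted to the part, and signed circuits
  found there have to be signed circuits for the whole \<open>N\<close>.\<close>

lemma scirc_mono:
  assumes "signed_multigraph.scirc t h N F" "F \<inter> N = F \<inter> N'"
  shows "signed_multigraph.scirc t h N' F"
proof -
  have par: "U \<inter> N = U \<inter> N'" if "U \<subseteq> F" for U using that assms(2) by blast
  have u: "signed_multigraph.unb t h N U \<longleftrightarrow> signed_multigraph.unb t h N' U" if "U \<subseteq> F" for U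
    using par[OF that] by (simp add: signed_multigraph.unb_def)
  have b: "signed_multigraph.bal t h N F \<longleftrightarrow> signed_multigraph.bal t h N' F"
    using assms(2) by (simp add: signed_multigraph.bal_def)
  have "signed_multigraph.barbell t h N' F" if bar: "signed_multigraph.barbell t h N F"
  proof -
    obtain U U' v s where F: "signed_multigraph.unb t h N U" "signed_multigraph.unb t h N U'"
      "U \<inter> U' = {}" "walk v s" "distinct (stops v s)"
      "set (stops v s) \<inter> ends U = {v}" "set (stops v s) \<inter> ends U' = {last (stops v s)}"
      "ends U \<inter> ends U' = (if s = [] then {v} else {})" "F = U \<union> U' \<union> fst ` set s"
      using bar unfolding signed_multigraph.barbell_def by blast
    have "U \<subseteq> F" "U' \<subseteq> F" using F(9) by blast+
    then have "signed_multigraph.unb t h N' U" "signed_multigraph.unb t h N' U'" using u F(1,2) by blast+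
    then show ?thesis unfolding signed_multigraph.barbell_def using F(3-9) by blast
  qed
  then show ?thesis using assms(1) b unfolding signed_multigraph.scirc_def by blast
qed

text \<open>Without connectedness the graph is split along an empty cut \<open>S\<close>. A cut of a
  part is the cut of a subset of \<open>S\<close> in the whole graph, so all hypotheses are
  inherited. The constant is then gained twice, which is more than enough.\<close>

lemma general_cover:
  assumes "finite V" "V \<noteq> {}" "finite E" "ends E \<subseteq> V" "N \<subseteq> E"
    and "\<And>S. card (N \<inter> cut S) \<le> card ((E - N) \<inter> cut S)"
    and "\<And>S b. E \<inter> cut S = {b} \<Longrightarrow> \<exists>e\<in>N. t e \<in> S \<and> h e \<in> S"
    and "\<And>S. E \<inter> cut S = {} \<Longrightarrow> card {e\<in>N. t e \<in> S} \<noteq> 1"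
  shows "\<exists>fs. (\<forall>F\<in>set fs. signed_multigraph.scirc t h N F \<and> F \<subseteq> E) \<and> E \<subseteq> \<Union>(set fs) \<and>
    3 * sum_list (map card fs) + 6 \<le> 5 * card E + 6 * card V + card N"
  using assms
proof (induction "card V" arbitrary: V E N rule: less_induct)
  case less
  note H = less.prems
  show ?case
  proof (cases "\<exists>S. E \<inter> cut S = {} \<and> V \<inter> S \<noteq> {} \<and> V - S \<noteq> {}")
    case False
    interpret G: signed_multigraph t h N .
    have con: "conn E u v" if "u \<in> V" "v \<in> V" for u v
    proof (rule ccontr)
      assume "\<not> conn E u v"
      then have "v \<in> V - {x. conn E u x}" "u \<in> V \<inter> {x. conn E u x}" using that conn_refl by blast+
      then show False using False comp_cut[of E u] by blast
    qed
    have "card N \<noteq> 1" using H(8)[of UNIV] by (simp add: cut_def)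
    then obtain fs where "\<And>F. F \<in> set fs \<Longrightarrow> G.scirc F \<and> F \<subseteq> E" "E \<subseteq> \<Union>(set fs)"
      "3 * sum_list (map card fs) + 6 \<le> 5 * card E + 6 * card V + card N"
      using G.connected_cover[OF H(1-5) con H(6,7)] by force
    then show ?thesis by blast
  next
    case True
    then obtain S0 where S0: "E \<inter> cut S0 = {}" "V \<inter> S0 \<noteq> {}" "V - S0 \<noteq> {}" by blast
    have part: "\<exists>fs. (\<forall>F\<in>set fs. signed_multigraph.scirc t h N F \<and> F \<subseteq> E) \<and> {e\<in>E. t e \<in> S} \<subseteq> \<Union>(set fs) \<and>
        3 * sum_list (map card fs) + 6 \<le> 5 * card {e\<in>E. t e \<in> S} + 6 * card (V \<inter> S) + card {e\<in>N. t e \<in> S}"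
      if S: "E \<inter> cut S = {}" "V \<inter> S \<noteq> {}" "V - S \<noteq> {}" for S
    proof -
      let ?E = "{e\<in>E. t e \<in> S}" and ?N = "{e\<in>N. t e \<in> S}" and ?V = "V \<inter> S"
      have hS: "t e \<in> S \<longleftrightarrow> h e \<in> S" if "e \<in> E" for e using S(1) that unfolding cut_def by blast
      have cutE: "?E \<inter> cut S' = E \<inter> cut (S' \<inter> S)" for S'
        using hS unfolding cut_def by blast
      have cutN: "?N \<inter> cut S' = N \<inter> cut (S' \<inter> S)" for S'
        using hS H(5) unfolding cut_def by blast
      have cutP: "(?E - ?N) \<inter> cut S' = (E - N) \<inter> cut (S' \<inter> S)" for S'
        using hS unfolding cut_def by blast
      have "\<exists>fs. (\<forall>F\<in>set fs. signed_multigraph.scirc t h ?N F \<and> F \<subseteq> ?E) \<and> ?E \<subseteq> \<Union>(set fs) \<and>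
        3 * sum_list (map card fs) + 6 \<le> 5 * card ?E + 6 * card ?V + card ?N"
      proof (rule less.hyps)
        show "card ?V < card V" using S(3) H(1) by (intro psubset_card_mono) blast+
        show "finite ?V" "?V \<noteq> {}" "finite ?E" using H(1,3) S(2) by auto
        show "ends ?E \<subseteq> ?V" using H(4) hS unfolding ends_def by blast
        show "?N \<subseteq> ?E" using H(5) by blast
        show "card (?N \<inter> cut S') \<le> card ((?E - ?N) \<inter> cut S')" for S' using H(6) unfolding cutN cutP .
        show "\<exists>e\<in>?N. t e \<in> S' \<and> h e \<in> S'" if "?E \<inter> cut S' = {b}" for S' b
          using H(7)[of "S' \<inter> S" b] that unfolding cutE by blast
        show "card {e\<in>?N. t e \<in> S'} \<noteq> 1" if "?E \<inter> cut S' = {}" for S'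
        proof -
          have "{e\<in>?N. t e \<in> S'} = {e\<in>N. t e \<in> S' \<inter> S}" by blast
          then show ?thesis using H(8)[of "S' \<inter> S"] that unfolding cutE by simp
        qed
      qed
      then obtain fs where fs: "\<forall>F\<in>set fs. signed_multigraph.scirc t h ?N F \<and> F \<subseteq> ?E" "?E \<subseteq> \<Union>(set fs)"
        "3 * sum_list (map card fs) + 6 \<le> 5 * card ?E + 6 * card ?V + card ?N" by blast
      have "signed_multigraph.scirc t h N F \<and> F \<subseteq> E" if "F \<in> set fs" for F
      proof -
        have F: "signed_multigraph.scirc t h ?N F" "F \<subseteq> ?E" using fs(1) that by blast+
        have "F \<inter> ?N = F \<inter> N" using F(2) by blast
        then show ?thesis using scirc_mono[OF F(1)] F(2) by blast
      qed
      then show ?thesis using fs(2,3) by blast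
    qed
    obtain f1 where f1: "\<forall>F\<in>set f1. signed_multigraph.scirc t h N F \<and> F \<subseteq> E" "{e\<in>E. t e \<in> S0} \<subseteq> \<Union>(set f1)"
        "3 * sum_list (map card f1) + 6 \<le> 5 * card {e\<in>E. t e \<in> S0} + 6 * card (V \<inter> S0) + card {e\<in>N. t e \<in> S0}"
      using part[OF S0] by blast
    have c: "E \<inter> cut (- S0) = {}" "V \<inter> - S0 \<noteq> {}" "V - - S0 \<noteq> {}" using S0 cut_compl[of S0] by auto
    obtain f2 where f2: "\<forall>F\<in>set f2. signed_multigraph.scirc t h N F \<and> F \<subseteq> E" "{e\<in>E. t e \<in> - S0} \<subseteq> \<Union>(set f2)"
        "3 * sum_list (map card f2) + 6 \<le> 5 * card {e\<in>E. t e \<in> - S0} + 6 * card (V \<inter> - S0) + card {e\<in>N. t e \<in> - S0}"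
      using part[OF c] by blast
    have split: "card {x\<in>Y. f x \<in> S0} + card {x\<in>Y. f x \<in> - S0} = card Y" if "finite Y" for Y :: "'b set" and f :: "'b \<Rightarrow> 'a"
    proof -
      have "Y = {x\<in>Y. f x \<in> S0} \<union> {x\<in>Y. f x \<in> - S0}" by blast
      moreover have "{x\<in>Y. f x \<in> S0} \<inter> {x\<in>Y. f x \<in> - S0} = {}" by blast
      ultimately show ?thesis using that by (metis (no_types, lifting) card_Un_disjoint finite_Un)
    qed
    have finN: "finite N" using H(3,5) finite_subset by blast
    have "V = (V \<inter> S0) \<union> (V \<inter> - S0)" "(V \<inter> S0) \<inter> (V \<inter> - S0) = {}" by blast+
    then have cV: "card V = card (V \<inter> S0) + card (V \<inter> - S0)" using H(1) by (metis card_Un_disjoint finite_Un)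
    have "3 * sum_list (map card (f1 @ f2)) + 6 \<le> 5 * card E + 6 * card V + card N"
      using f1(3) f2(3) split[OF H(3), of t] split[OF finN, of t] cV by simp
    moreover have "E \<subseteq> \<Union>(set (f1 @ f2))" using f1(2) f2(2) by auto
    moreover have "\<forall>F\<in>set (f1 @ f2). signed_multigraph.scirc t h N F \<and> F \<subseteq> E" using f1(1) f2(1) by auto
    ultimately show ?thesis by blast
  qed
qed

section \<open>Signed graphs\<close>

text \<open>Cuts are the orthogonal complement of the cycle space: the parity of \<open>D\<close>
  along a join from a fixed representative of the component is a well-defined potential, and
  \<open>S\<close> is the set of vertices where it is odd.\<close>

lemma cut_if_even:
  assumes "finite E" "D \<subseteq> E" and ev: "\<And>C. C \<subseteq> E \<Longrightarrow> even_set C \<Longrightarrow> even (card (C \<inter> D))"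
  obtains S where "D = E \<inter> cut S"
proof -
  define r where "r = (\<lambda>x. SOME y. conn E x y)"
  have rx: "conn E (r x) x" for x
    unfolding r_def using someI[of "conn E x" x] conn_refl conn_sym by blast
  have req: "r x = r y" if "conn E x y" for x y
  proof -
    have "conn E x = conn E y" using that conn_trans conn_sym by (intro ext) blast
    then show ?thesis by (simp add: r_def)
  qed
  obtain J where J: "\<And>x. J x \<subseteq> E" "\<And>x. joins (J x) (r x) x" using rx unfolding conn_def by metis
  let ?S = "{x. odd (card (J x \<inter> D))}"
  have "e \<in> D \<longleftrightarrow> e \<in> cut ?S" if e: "e \<in> E" for e
  proof -
    have "r (t e) = r (h e)" using req[OF conn_edge[OF e]] .
    then have "joins (sym_diff (J (t e)) (J (h e))) (t e) (h e)"
      using joins_trans[OF joins_sym[OF J(2)[of "t e"]]] J(2)[of "h e"] by simp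
    then have even: "even_set (sym_diff (sym_diff (J (t e)) (J (h e))) {e})" (is "even_set ?C")
      using joins_joins_even joins_edge by blast
    have "?C \<subseteq> E" using J(1)[of "t e"] J(1)[of "h e"] e by blast
    then have "even (card (?C \<inter> D))" using ev even by blast
    moreover have fin: "finite (J x)" for x using J(1)[of x] assms(1) finite_subset by blast
    then have "odd (card (?C \<inter> D)) \<longleftrightarrow> ((odd (card (J (t e) \<inter> D)) \<noteq> odd (card (J (h e) \<inter> D))) \<noteq> odd (card ({e} \<inter> D)))"
      by (simp add: odd_card_sym_diff_Int)
    moreover have "odd (card ({e} \<inter> D)) \<longleftrightarrow> e \<in> D" by (cases "e \<in> D") auto
    ultimately show ?thesis unfolding cut_def by auto
  qed
  then have "D = E \<inter> cut ?S" using assms(2) by blast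
  then show thesis by (rule that)
qed

text \<open>
  The values \<open>a e\<close> and \<open>b e\<close> of a flow at the two ends of \<open>e\<close> are opposite on positive edges and
  equal on negative edges, so only the edges of \<open>N\<close> inside \<open>S\<close> and the edges of \<open>cut S\<close> contribute
  to the sum of the conservation laws over \<open>S\<close>.
\<close>

lemma flow_cut_sum:
  fixes a b :: "'b \<Rightarrow> int"
  assumes fin: "finite E" "finite V" and EV: "ends E \<subseteq> V" and N: "N \<subseteq> E"
    and pos: "\<And>e. e \<in> E - N \<Longrightarrow> b e = - a e" and neg: "\<And>e. e \<in> N \<Longrightarrow> b e = a e"
    and flow: "\<And>v. v \<in> V \<Longrightarrow> (\<Sum>e\<in>{e\<in>E. t e = v}. a e) + (\<Sum>e\<in>{e\<in>E. h e = v}. b e) = 0"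
  shows "(\<Sum>e\<in>{e\<in>N. t e \<in> S \<and> h e \<in> S}. 2 * a e) + (\<Sum>e\<in>E \<inter> cut S. if t e \<in> S then a e else b e) = 0"
proof -
  let ?V = "V \<inter> S"
  have finV: "finite ?V" using fin(2) by simp
  have eV: "t e \<in> V" "h e \<in> V" if "e \<in> E" for e using ends_in[OF EV that] by simp_all
  have tail: "(\<Sum>v\<in>?V. \<Sum>e\<in>{e\<in>E. f e = v}. c e) = (\<Sum>e\<in>E. if f e \<in> S then c e else 0)"
    if f: "\<And>e. e \<in> E \<Longrightarrow> f e \<in> V" for f :: "'b \<Rightarrow> 'a" and c :: "'b \<Rightarrow> int"
  proof -
    have "(\<Sum>v\<in>?V. \<Sum>e\<in>{e\<in>E. f e = v}. c e) = (\<Sum>v\<in>?V. \<Sum>e\<in>E. if f e = v then c e else 0)"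
      by (simp only: sum.inter_filter[OF fin(1)])
    also have "\<dots> = (\<Sum>e\<in>E. \<Sum>v\<in>?V. if f e = v then c e else 0)" by (rule sum.swap)
    also have "\<dots> = (\<Sum>e\<in>E. if f e \<in> S then c e else 0)"
      using f finV by (intro sum.cong refl) simp
    finally show ?thesis .
  qed
  have "(\<Sum>v\<in>?V. (\<Sum>e\<in>{e\<in>E. t e = v}. a e) + (\<Sum>e\<in>{e\<in>E. h e = v}. b e)) = 0"
    using flow by (intro sum.neutral) blast
  then have "(\<Sum>e\<in>E. if t e \<in> S then a e else 0) + (\<Sum>e\<in>E. if h e \<in> S then b e else 0) = 0"
    using tail[of t a, OF eV(1)] tail[of h b, OF eV(2)] by (simp add: sum.distrib)
  then have "(\<Sum>e\<in>E. (if t e \<in> S then a e else 0) + (if h e \<in> S then b e else 0)) = 0"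
    by (simp add: sum.distrib)
  moreover have "(\<Sum>e\<in>E. (if t e \<in> S then a e else 0) + (if h e \<in> S then b e else 0)) =
      (\<Sum>e\<in>E. (if e \<in> {e\<in>N. t e \<in> S \<and> h e \<in> S} then 2 * a e else 0) +
        (if e \<in> E \<inter> cut S then if t e \<in> S then a e else b e else 0))"
  proof (rule sum.cong[OF refl])
    fix e assume e: "e \<in> E"
    show "(if t e \<in> S then a e else 0) + (if h e \<in> S then b e else 0) =
      (if e \<in> {e\<in>N. t e \<in> S \<and> h e \<in> S} then 2 * a e else 0) +
        (if e \<in> E \<inter> cut S then if t e \<in> S then a e else b e else 0)"
      using e pos[of e] neg[of e] unfolding cut_def by (cases "e \<in> N"; cases "t e \<in> S"; cases "h e \<in> S") auto
  qed
  moreover have ind: "(\<Sum>e\<in>E. if e \<in> Y then c e else 0) = sum c Y" if "Y \<subseteq> E" for Y and c :: "'b \<Rightarrow> int"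
    using that fin(1) by (simp add: sum.If_cases Int_absorb1)
  have sub: "{e\<in>N. t e \<in> S \<and> h e \<in> S} \<subseteq> E" using N by blast
  have "(\<Sum>e\<in>E. (if e \<in> {e\<in>N. t e \<in> S \<and> h e \<in> S} then 2 * a e else 0) +
        (if e \<in> E \<inter> cut S then if t e \<in> S then a e else b e else 0)) =
      (\<Sum>e\<in>{e\<in>N. t e \<in> S \<and> h e \<in> S}. 2 * a e) + (\<Sum>e\<in>E \<inter> cut S. if t e \<in> S then a e else b e)"
    unfolding sum.distrib ind[of _ "\<lambda>e. 2 * a e", OF sub] ind[of "E \<inter> cut S" "\<lambda>e. if t e \<in> S then a e else b e", OF Int_lower1] ..
  ultimately show ?thesis by metis
qed

end

section \<open>Translation between edge sets and digraphs\<close>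

definition edge_graph :: "('a, 'b) pre_digraph \<Rightarrow> 'b set \<Rightarrow> ('a, 'b) pre_digraph" where
  "edge_graph G A = \<lparr>verts = tail G ` A \<union> head G ` A, arcs = A, tail = tail G, head = head G\<rparr>"

lemma edge_graph_simps [simp]:
  "verts (edge_graph G A) = multigraph.ends (tail G) (head G) A"
  "arcs (edge_graph G A) = A" "tail (edge_graph G A) = tail G" "head (edge_graph G A) = head G"
  by (simp_all add: edge_graph_def multigraph.ends_def)

lemma edge_graph_wf: "wf_digraph (edge_graph G A)"
  by unfold_locales (auto simp: multigraph.ends_def)

lemma edge_graph_subgraph: "A \<subseteq> B \<Longrightarrow> subgraph (edge_graph G A) (edge_graph G B)"
  using edge_graph_wf[of G] by (auto simp: subgraph_def compatible_def multigraph.ends_def)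

lemma edge_graph_subgraph': "wf_digraph G \<Longrightarrow> A \<subseteq> arcs G \<Longrightarrow> subgraph (edge_graph G A) G"
  using edge_graph_wf[of G A] wf_digraph.tail_in_verts[of G] wf_digraph.head_in_verts[of G]
  by (auto simp: subgraph_def compatible_def multigraph.ends_def)

text \<open>A loop adds two to the degree and nothing to the cut of its vertex, so both have the
  same parity.\<close>

lemma circuit_even:
  assumes "circuit C"
  shows "multigraph.even_set (tail C) (head C) (arcs C)"
proof -
  interpret multigraph "tail C" "head C" .
  interpret fin_digraph C using assms by (simp add: circuit_def)
  have "even (card (arcs C \<inter> cut {v}))" for v
  proof (cases "v \<in> verts C")
    case True
    define L where "L = {e \<in> arcs C. tail C e = v \<and> head C e = v}"
    define O' where "O' = {e \<in> arcs C. tail C e = v \<and> head C e \<noteq> v}"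
    define I' where "I' = {e \<in> arcs C. tail C e \<noteq> v \<and> head C e = v}"
    have fin: "finite L" "finite O'" "finite I'" unfolding L_def O'_def I'_def by auto
    have "out_arcs C v = O' \<union> L" "O' \<inter> L = {}" by (auto simp: out_arcs_def O'_def L_def)
    then have "out_degree C v = card O' + card L" using fin by (simp add: out_degree_def card_Un_disjoint)
    moreover have "in_arcs C v = I' \<union> L" "I' \<inter> L = {}" by (auto simp: in_arcs_def I'_def L_def)
    then have "in_degree C v = card I' + card L" using fin by (simp add: in_degree_def card_Un_disjoint)
    moreover have "arcs C \<inter> cut {v} = O' \<union> I'" "O' \<inter> I' = {}" by (auto simp: cut_def O'_def I'_def)
    then have "card (arcs C \<inter> cut {v}) = card O' + card I'" using fin by (simp add: card_Un_disjoint)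
    moreover have "out_degree C v + in_degree C v = 2" using assms True by (simp add: circuit_def degree_def)
    ultimately have "card (arcs C \<inter> cut {v}) + 2 * card L = 2" by simp
    then show ?thesis by (metis even_add even_mult_iff even_numeral)
  next
    case False
    then have "arcs C \<inter> cut {v} = {}" unfolding in_cut_single[abs_def] using tail_in_verts head_in_verts by (auto simp: cut_def)
    then show ?thesis by simp
  qed
  then show ?thesis by (simp add: even_set_def)
qed

lemma conn_reachable:
  assumes "multigraph.conn (tail G) (head G) A u v" "u \<in> multigraph.ends (tail G) (head G) A"
  shows "reachable (with_proj (mk_symmetric (edge_graph G A))) u v"
proof -
  interpret multigraph "tail G" "head G" .
  let ?M = "with_proj (mk_symmetric (edge_graph G A))"
  interpret W: wf_digraph "edge_graph G A" by (rule edge_graph_wf)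
  interpret M: pair_wf_digraph "mk_symmetric (edge_graph G A)" by (rule W.wellformed_mk_symmetric)
  have adj: "(x, y) \<in> arcs_ends ?M" if "e \<in> A" "{tail G e, head G e} = {x, y}" for e x y
    using that by (auto simp: parcs_mk_symmetric doubleton_eq_iff)
  obtain s where s: "walk u s" "last (stops u s) = v" "fst ` set s \<subseteq> A" using conn_walk[OF assms(1)] .
  have "walk u s \<Longrightarrow> fst ` set s \<subseteq> A \<Longrightarrow> u \<in> ends A \<Longrightarrow> reachable ?M u (last (stops u s))"
  proof (induction u s rule: walk.induct)
    case (1 u)
    then show ?case by auto
  next
    case (2 u e x s)
    have e: "e \<in> A" "{tail G e, head G e} = {u, x}" using 2(2,3) by auto
    have "x \<in> ends A" using e unfolding ends_def by (auto simp: doubleton_eq_iff)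
    then have "reachable ?M x (last (stops x s))" using 2 by simp
    then have "reachable ?M u (last (stops x s))" by (metis M.adj_reachable_trans adj e(1,2) with_proj_simps(3))
    then show ?case by simp
  qed
  then show ?thesis using s assms(2) by simp
qed

lemma circ_circuit:
  assumes "multigraph.circ (tail G) (head G) A"
  shows "circuit (edge_graph G A)"
proof -
  interpret multigraph "tail G" "head G" .
  interpret W: wf_digraph "edge_graph G A" by (rule edge_graph_wf)
  have A: "finite A" "A \<noteq> {}" "even_set A" using circD[OF assms] by auto
  have "fin_digraph (edge_graph G A)"
    by unfold_locales (use A(1) in \<open>auto simp: ends_def\<close>)
  moreover have "Digraph_Component.connected (edge_graph G A)"
    unfolding Digraph_Component.connected_def strongly_connected_def
    using A(2) conn_reachable[OF circ_conn[OF assms]] by (auto simp: ends_def)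
  moreover have "degree (edge_graph G A) v = 2" if v: "v \<in> ends A" for v
  proof (cases "\<exists>x\<in>A. tail G x = head G x")
    case True
    then obtain x where x: "A = {x}" "tail G x = head G x" using circ_loop[OF assms] by blast
    then have "v = tail G x" using v by (auto simp: ends_def)
    then have "out_arcs (edge_graph G A) v = {x}" "in_arcs (edge_graph G A) v = {x}"
      using x by (auto simp: out_arcs_def in_arcs_def)
    then show ?thesis by (simp add: degree_def out_degree_def in_degree_def)
  next
    case False
    obtain e where e: "e \<in> A" "v = tail G e \<or> v = head G e" using v by (auto simp: ends_def)
    then have "e \<in> cut {v}" using False unfolding in_cut_single by blast
    then obtain e' where e': "e' \<noteq> e" "A \<inter> cut {v} = {e, e'}" using circ_at[OF assms e(1)] by blast
    have "out_arcs (edge_graph G A) v \<union> in_arcs (edge_graph G A) v = A \<inter> cut {v}"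
      using False by (auto simp: out_arcs_def in_arcs_def in_cut_single)
    moreover have "out_arcs (edge_graph G A) v \<inter> in_arcs (edge_graph G A) v = {}"
      using False by (auto simp: out_arcs_def in_arcs_def)
    moreover have "finite (out_arcs (edge_graph G A) v)" "finite (in_arcs (edge_graph G A) v)"
      using A(1) by (auto simp: out_arcs_def in_arcs_def)
    ultimately have "degree (edge_graph G A) v = card (A \<inter> cut {v})"
      unfolding degree_def out_degree_def in_degree_def by (metis card_Un_disjoint)
    then show ?thesis using e' by simp
  qed
  ultimately show ?thesis unfolding circuit_def by simp
qed

lemma negative_edges_edge_graph: "A \<subseteq> arcs G \<Longrightarrow> negative_edges (edge_graph G A) \<tau> = A \<inter> negative_edges G \<tau>"
  by (auto simp: negative_edges_def)

text \<open>Signed circuits are constructed for the minimum signature but wanted for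
  \<open>\<sigma>\<close>. Equivalence speaks of balanced circuits only; a circuit that is not
  balanced is unbalanced, so the circuits of barbells are transferred as well.\<close>

lemma scirc_signed_circuit:
  assumes G: "wf_digraph G" and eq: "equivalent_signatures G \<sigma> \<tau>"
    and F: "signed_multigraph.scirc (tail G) (head G) (negative_edges G \<tau>) F" "F \<subseteq> arcs G"
  shows "signed_circuit \<sigma> (edge_graph G F)"
proof -
  interpret signed_multigraph "tail G" "head G" "negative_edges G \<tau>" .
  have sub: "subgraph (edge_graph G A) G" if "A \<subseteq> arcs G" for A using edge_graph_subgraph'[OF G that] .
  have B: "balanced_circuit \<sigma> (edge_graph G A)" if "bal A" "A \<subseteq> arcs G" for A
  proof -
    have "balanced_circuit \<tau> (edge_graph G A)"
      using that circ_circuit[of G A] negative_edges_edge_graph[OF that(2)] unfolding bal_def balanced_circuit_def by simp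
    then show ?thesis using eq sub[OF that(2)] unfolding equivalent_signatures_def by blast
  qed
  have U: "unbalanced_circuit \<sigma> (edge_graph G A)" if "unb A" "A \<subseteq> arcs G" for A
  proof -
    have c: "circuit (edge_graph G A)" using that(1) circ_circuit[of G A] unfolding unb_def by simp
    have "\<not> balanced_circuit \<tau> (edge_graph G A)"
      using that negative_edges_edge_graph[OF that(2)] unfolding unb_def balanced_circuit_def by simp
    then have "\<not> balanced_circuit \<sigma> (edge_graph G A)" using eq sub[OF that(2)] unfolding equivalent_signatures_def by blast
    then show ?thesis using c unfolding unbalanced_circuit_def balanced_circuit_def by blast
  qed
  from F(1) consider "bal F" | "barbell F" unfolding scirc_def by blast
  then show ?thesis
  proof cases
    case 1
    then show ?thesis using B F(2) unfolding signed_circuit_def by blast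
  next
    case 2
    then obtain A A' u s where b: "unb A" "unb A'" "A \<inter> A' = {}" "walk u s" "distinct (stops u s)"
      "set (stops u s) \<inter> ends A = {u}" "set (stops u s) \<inter> ends A' = {last (stops u s)}"
      "ends A \<inter> ends A' = (if s = [] then {u} else {})" "F = A \<union> A' \<union> fst ` set s"
      unfolding barbell_def by blast
    have AF: "A \<subseteq> F" "A' \<subseteq> F" "fst ` set s \<subseteq> F" using b(9) by blast+
    have uA: "unbalanced_circuit \<sigma> (edge_graph G A)" "unbalanced_circuit \<sigma> (edge_graph G A')"
      using U b(1,2) AF F(2) by blast+
    have sA: "subgraph (edge_graph G A) (edge_graph G F)" "subgraph (edge_graph G A') (edge_graph G F)"
      using edge_graph_subgraph AF by blast+
    have eU: "ends (A \<union> B) = ends A \<union> ends B" for A B by (auto simp: ends_def)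
    show ?thesis
    proof (cases "s = []")
      case True
      have "short_barbell \<sigma> (edge_graph G F)"
        unfolding short_barbell_def
        by (rule exI[of _ "edge_graph G A"], rule exI[of _ "edge_graph G A'"])
          (use sA uA b(3,8,9) True eU in auto)
      then show ?thesis by (simp add: signed_circuit_def)
    next
      case False
      let ?P = "edge_graph G (fst ` set s)"
      have eP: "ends (fst ` set s) = set (stops u s)"
      proof
        show "ends (fst ` set s) \<subseteq> set (stops u s)" using walk_edge_ends[OF b(4)] unfolding ends_def by blast
        have "snd ` set s \<subseteq> ends (fst ` set s)" using b(4)
        proof (induction u s rule: walk.induct)
          case (1 u)
          then show ?case by simp
        next
          case (2 u e x s)
          have "x \<in> {tail G e, head G e}" using 2(2) by simp
          then show ?case using 2 by (auto simp: ends_def)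
        qed
        moreover have "u \<in> ends (fst ` set s)" using b(4) False by (cases s) (auto simp: ends_def)
        ultimately show "set (stops u s) \<subseteq> ends (fst ` set s)" by simp
      qed
      have "is_path ?P u (last (stops u s))"
        unfolding is_path_def
      proof (intro exI conjI)
        show "length (stops u s) = Suc (length (map fst s))" by simp
        show "distinct (stops u s)" using b(5) .
        show "distinct (map fst s)" using walk_distinct[OF b(4,5)] .
        show "hd (stops u s) = u" by simp
        show "last (stops u s) = last (stops u s)" by simp
        show "verts ?P = set (stops u s)" using eP by simp
        show "arcs ?P = set (map fst s)" by simp
        show "\<forall>i<length (map fst s). {tail ?P (map fst s ! i), head ?P (map fst s ! i)} =
          {stops u s ! i, stops u s ! Suc i}" using walk_nth[OF b(4)] by simp
      qed
      moreover have "subgraph ?P (edge_graph G F)" using edge_graph_subgraph[OF AF(3)] .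
      ultimately have "long_barbell \<sigma> (edge_graph G F)"
        unfolding long_barbell_def
        by (metis False b(6,7,8,9) eP eU edge_graph_simps(1,2) sA(1,2) uA(1,2))
      then show ?thesis by (simp add: signed_circuit_def)
    qed
  qed
qed

text \<open>Equivalent signatures differ by switching: the edges on which they differ meet every
  circuit, hence every even set, evenly, and so form a cut.\<close>

lemma equivalent_switch:
  assumes G: "fin_digraph G" and sig: "is_signature G \<sigma>" "is_signature G \<tau>" and eq: "equivalent_signatures G \<sigma> \<tau>"
  obtains S where "\<And>e. e \<in> arcs G \<Longrightarrow> \<tau> e = (if e \<in> multigraph.cut (tail G) (head G) S then - \<sigma> e else \<sigma> e)"
proof -
  interpret fin_digraph G by (rule G)
  interpret multigraph "tail G" "head G" .
  define D where "D = sym_diff (negative_edges G \<sigma>) (negative_edges G \<tau>)"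
  have fin: "finite (negative_edges G \<rho>)" for \<rho> :: "'b \<Rightarrow> int" by (simp add: negative_edges_def)
  have circ_even: "even (card (C \<inter> D))" if C: "circ C" "C \<subseteq> arcs G" for C
  proof -
    have "balanced_circuit \<sigma> (edge_graph G C) \<longleftrightarrow> balanced_circuit \<tau> (edge_graph G C)"
      using eq edge_graph_subgraph'[OF wf_digraph C(2)] unfolding equivalent_signatures_def by blast
    then have "even (card (C \<inter> negative_edges G \<sigma>)) \<longleftrightarrow> even (card (C \<inter> negative_edges G \<tau>))"
      using circ_circuit[OF C(1)] negative_edges_edge_graph[OF C(2)] unfolding balanced_circuit_def by simp
    then show ?thesis using odd_card_sym_diff_Int[OF fin fin, of \<sigma> \<tau> C] unfolding D_def by (simp add: Int_commute)
  qed
  have "even (card (C \<inter> D))" if C: "C \<subseteq> arcs G" "even_set C" for C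
  proof -
    obtain \<C> where dec: "decomp \<C> C" using even_decomp[OF C(2)] .
    interpret S: signed_multigraph "tail G" "head G" D .
    have "{B\<in>\<C>. S.unb B} = {}" using circ_even dec C(1) unfolding decomp_def S.unb_def by blast
    then show ?thesis using S.parity_decomp[OF dec] by (metis card.empty even_zero)
  qed
  moreover have "D \<subseteq> arcs G" by (auto simp: D_def negative_edges_def)
  ultimately obtain S where S: "D = arcs G \<inter> cut S" using cut_if_even[of "arcs G" D] by auto
  have "\<tau> e = (if e \<in> cut S then - \<sigma> e else \<sigma> e)" if e: "e \<in> arcs G" for e
  proof -
    have "\<sigma> e \<in> {1, -1}" "\<tau> e \<in> {1, -1}" using sig e by (auto simp: is_signature_def)
    moreover have "e \<in> cut S \<longleftrightarrow> (\<sigma> e = -1) \<noteq> (\<tau> e = -1)" using S e unfolding D_def negative_edges_def by blast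
    ultimately show ?thesis by auto
  qed
  then show thesis by (rule that)
qed

text \<open>Switching at \<open>S\<close> preserves the parity of negative edges on each circuit,
  because a circuit meets a cut evenly. It exchanges positive and negative edges on the cut, so
  minimality gives the inequality.\<close>

lemma minimum_cut:
  assumes G: "fin_digraph G" and min: "minimum_signature G \<sigma> \<tau>"
  shows "card (negative_edges G \<tau> \<inter> multigraph.cut (tail G) (head G) S) \<le>
    card ((arcs G - negative_edges G \<tau>) \<inter> multigraph.cut (tail G) (head G) S)"
proof -
  interpret fin_digraph G by (rule G)
  interpret multigraph "tail G" "head G" .
  have sig: "is_signature G \<tau>" and eq: "equivalent_signatures G \<sigma> \<tau>" using min by (auto simp: minimum_signature_def)
  let ?N = "negative_edges G \<tau>"
  define \<rho> where "\<rho> = (\<lambda>e. if e \<in> cut S then - \<tau> e else \<tau> e)"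
  have sr: "is_signature G \<rho>" using sig by (auto simp: is_signature_def \<rho>_def)
  have N\<rho>: "negative_edges G \<rho> = sym_diff ?N (arcs G \<inter> cut S)"
  proof (rule set_eqI)
    fix e
    show "e \<in> negative_edges G \<rho> \<longleftrightarrow> e \<in> sym_diff ?N (arcs G \<inter> cut S)"
    proof (cases "e \<in> arcs G")
      case True
      then have "\<tau> e = 1 \<or> \<tau> e = -1" using sig by (auto simp: is_signature_def)
      then show ?thesis using True by (auto simp: negative_edges_def \<rho>_def)
    next
      case False
      then show ?thesis by (auto simp: negative_edges_def)
    qed
  qed
  have fin: "finite ?N" "finite (arcs G \<inter> cut S)" by (auto simp: negative_edges_def)
  have "balanced_circuit \<tau> C \<longleftrightarrow> balanced_circuit \<rho> C" if C: "subgraph C G" for C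
  proof (cases "circuit C")
    case True
    have CG: "arcs C \<subseteq> arcs G" "tail C = tail G" "head C = head G"
      using C by (auto simp: subgraph_def compatible_def)
    have neg: "negative_edges C \<rho>' = negative_edges G \<rho>' \<inter> arcs C" for \<rho>' :: "'b \<Rightarrow> int"
      using CG(1) by (auto simp: negative_edges_def)
    have "even_set (arcs C)" using circuit_even[OF True] CG(2,3) by simp
    then have "even (card (arcs C \<inter> cut S))" by (rule even_set_cut)
    moreover have "(arcs G \<inter> cut S) \<inter> arcs C = arcs C \<inter> cut S" using CG(1) by blast
    ultimately have "odd (card (negative_edges C \<rho>)) \<longleftrightarrow> odd (card (negative_edges C \<tau>))"
      unfolding neg N\<rho> using odd_card_sym_diff_Int[OF fin, of "arcs C"] by simp
    then show ?thesis by (simp add: balanced_circuit_def)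
  next
    case False
    then show ?thesis by (simp add: balanced_circuit_def)
  qed
  then have "equivalent_signatures G \<sigma> \<rho>" using eq by (simp add: equivalent_signatures_def)
  then have le: "card ?N \<le> card (sym_diff ?N (arcs G \<inter> cut S))"
    using min sr unfolding minimum_signature_def N\<rho>[symmetric] by blast
  have "sym_diff ?N (arcs G \<inter> cut S) = (?N - cut S) \<union> ((arcs G - ?N) \<inter> cut S)"
    by (auto simp: negative_edges_def)
  moreover have "(?N - cut S) \<inter> ((arcs G - ?N) \<inter> cut S) = {}" by blast
  ultimately have "card (sym_diff ?N (arcs G \<inter> cut S)) = card (?N - cut S) + card ((arcs G - ?N) \<inter> cut S)"
    using fin(1) by (simp add: card_Un_disjoint)
  moreover have "card ?N = card (?N - cut S) + card (?N \<inter> cut S)"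
    using fin(1) by (metis card_Diff_subset_Int card_mono finite_Int inf_le1 le_add_diff_inverse2)
  ultimately show ?thesis using le by simp
qed

text \<open>The flow is given for \<open>\<sigma>\<close>. Reversing all half-edges at the vertices
  of the switching set only changes the sign of the conservation laws there and turns it into a flow
  for \<open>\<tau>\<close>. \<open>a\<close> and \<open>b\<close> are its values at the tail and at
  the head.\<close>

lemma switched_flow:
  assumes G: "fin_digraph G" and sig: "is_signature G \<sigma>" "is_signature G \<tau>"
    and eq: "equivalent_signatures G \<sigma> \<tau>" and fl: "flow_admissible G \<sigma>"
  obtains a b :: "'b \<Rightarrow> int" where "\<And>e. e \<in> arcs G \<Longrightarrow> a e \<noteq> 0 \<and> b e = - \<tau> e * a e"
    "\<And>v. v \<in> verts G \<Longrightarrow> (\<Sum>e\<in>{e\<in>arcs G. tail G e = v}. a e) + (\<Sum>e\<in>{e\<in>arcs G. head G e = v}. b e) = 0"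
proof -
  interpret multigraph "tail G" "head G" .
  obtain S where S: "\<And>e. e \<in> arcs G \<Longrightarrow> \<tau> e = (if e \<in> cut S then - \<sigma> e else \<sigma> e)"
    using equivalent_switch[OF G sig eq] by blast
  obtain ot oh f where f: "is_orientation G \<sigma> ot oh" "is_flow G ot oh f" "\<forall>e\<in>arcs G. f e \<noteq> 0"
    using fl unfolding flow_admissible_def by blast
  define s :: "'a \<Rightarrow> int" where "s = (\<lambda>v. if v \<in> S then -1 else 1)"
  define a where "a = (\<lambda>e. s (tail G e) * (ot e * f e))"
  define b where "b = (\<lambda>e. s (head G e) * (oh e * f e))"
  have "a e \<noteq> 0 \<and> b e = - \<tau> e * a e" if e: "e \<in> arcs G" for e
  proof -
    have o: "ot e \<in> {1, -1}" "oh e \<in> {1, -1}" "ot e * oh e = - \<sigma> e"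
      using f(1) e by (auto simp: is_orientation_def)
    then have "oh e = - \<sigma> e * ot e" by auto
    moreover have "s (head G e) * \<sigma> e = \<tau> e * s (tail G e)" using S[OF e] unfolding s_def cut_def by auto
    ultimately have "b e = - \<tau> e * a e" unfolding a_def b_def by (simp add: algebra_simps)
    moreover have "a e \<noteq> 0" using o(1) f(3) e unfolding a_def s_def by auto
    ultimately show ?thesis by blast
  qed
  moreover have "(\<Sum>e\<in>{e\<in>arcs G. tail G e = v}. a e) + (\<Sum>e\<in>{e\<in>arcs G. head G e = v}. b e) = 0"
    if v: "v \<in> verts G" for v
  proof -
    have "(\<Sum>e\<in>{e\<in>arcs G. tail G e = v}. a e) = s v * (\<Sum>e\<in>out_arcs G v. ot e * f e)"
      unfolding sum_distrib_left by (intro sum.cong) (auto simp: out_arcs_def a_def)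
    moreover have "(\<Sum>e\<in>{e\<in>arcs G. head G e = v}. b e) = s v * (\<Sum>e\<in>in_arcs G v. oh e * f e)"
      unfolding sum_distrib_left by (intro sum.cong) (auto simp: in_arcs_def b_def)
    ultimately show ?thesis using f(2) v unfolding is_flow_def by (simp flip: distrib_left)
  qed
  ultimately show thesis by (rule that)
qed

theorem mainTheorem2:
  fixes G :: "('a, 'b) pre_digraph" and \<sigma> \<tau> :: "'b \<Rightarrow> int" and \<epsilon>\<^sub>N :: nat
  assumes "fin_digraph G"
    and "verts G \<noteq> {}"
    and "is_signature G \<sigma>"
    and "flow_admissible G \<sigma>"
    and "minimum_signature G \<sigma> \<tau>"
    and "\<epsilon>\<^sub>N = card (negative_edges G \<tau>)"
  shows "\<exists>\<C>. signed_circuit_cover G \<sigma> \<C> \<and>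
           real (cover_length \<C>) \<le>
             5 / 3 * real (card (arcs G)) + 2 * real (card (verts G)) + 1 / 3 * real \<epsilon>\<^sub>N - 2"
proof -
  interpret fin_digraph G by (rule assms(1))
  interpret multigraph "tail G" "head G" .
  let ?N = "negative_edges G \<tau>"
  have sig: "is_signature G \<tau>" and eq: "equivalent_signatures G \<sigma> \<tau>"
    using assms(5) by (auto simp: minimum_signature_def)
  have NE: "?N \<subseteq> arcs G" by (auto simp: negative_edges_def)
  have EV: "ends (arcs G) \<subseteq> verts G" by (auto simp: ends_def)
  obtain a b where ab: "\<And>e. e \<in> arcs G \<Longrightarrow> a e \<noteq> 0 \<and> b e = - \<tau> e * a e"
    "\<And>v. v \<in> verts G \<Longrightarrow> (\<Sum>e\<in>{e\<in>arcs G. tail G e = v}. a e) + (\<Sum>e\<in>{e\<in>arcs G. head G e = v}. b e) = 0"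
    using switched_flow[OF assms(1,3) sig eq assms(4)] by blast
  have pos: "b e = - a e" if "e \<in> arcs G - ?N" for e
    using ab(1)[of e] that sig by (auto simp: negative_edges_def is_signature_def)
  have neg: "b e = a e" if "e \<in> ?N" for e
    using ab(1)[of e] that by (auto simp: negative_edges_def)
  have flow: "(\<Sum>e\<in>{e\<in>?N. tail G e \<in> S \<and> head G e \<in> S}. 2 * a e) +
      (\<Sum>e\<in>arcs G \<inter> cut S. if tail G e \<in> S then a e else b e) = 0" for S
    using flow_cut_sum[OF finite_arcs finite_verts EV NE pos neg ab(2)] by blast
  \<comment> \<open>Without negative edges inside \<open>S\<close>, the flow on the bridge is the
    only term of the sum over \<open>S\<close>.\<close>
  have bridge: "\<exists>e\<in>?N. tail G e \<in> S \<and> head G e \<in> S" if S: "arcs G \<inter> cut S = {x}" for S x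
  proof (rule ccontr)
    assume "\<not> ?thesis"
    then have e: "{e\<in>?N. tail G e \<in> S \<and> head G e \<in> S} = {}" by blast
    have x: "x \<in> arcs G" using S by blast
    have "(if tail G x \<in> S then a x else b x) = 0" using flow[of S] unfolding e S by simp
    moreover have "a x \<noteq> 0" "b x = a x \<or> b x = - a x" using ab(1)[OF x] pos neg x by blast+
    ultimately show False by (auto split: if_splits)
  qed
  \<comment> \<open>With an empty cut and a single negative edge \<open>n\<close> in the part, the
    sum over \<open>S\<close> reduces to \<open>2 * a n\<close>.\<close>
  have single: "card {e\<in>?N. tail G e \<in> S} \<noteq> 1" if S: "arcs G \<inter> cut S = {}" for S
  proof
    assume "card {e\<in>?N. tail G e \<in> S} = 1"
    then obtain n where n: "{e\<in>?N. tail G e \<in> S} = {n}" by (auto simp: card_1_singleton_iff)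
    have "{e\<in>?N. tail G e \<in> S \<and> head G e \<in> S} = {e\<in>?N. tail G e \<in> S}"
      using S NE unfolding cut_def by blast
    then have "a n = 0" using flow[of S] unfolding S n by simp
    moreover have "n \<in> arcs G" using n NE by blast
    ultimately show False using ab(1) by blast
  qed
  obtain fs where fs: "\<forall>F\<in>set fs. signed_multigraph.scirc (tail G) (head G) ?N F \<and> F \<subseteq> arcs G"
    "arcs G \<subseteq> \<Union>(set fs)" "3 * sum_list (map card fs) + 6 \<le> 5 * card (arcs G) + 6 * card (verts G) + card ?N"
    using general_cover[OF finite_verts assms(2) finite_arcs EV NE minimum_cut[OF assms(1,5)] bridge single] by fastforce
  let ?C = "mset (map (edge_graph G) fs)"
  have "signed_circuit_cover G \<sigma> ?C"
    unfolding signed_circuit_cover_def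
    using fs(1,2) scirc_signed_circuit[OF wf_digraph eq] edge_graph_subgraph'[OF wf_digraph] by fastforce
  moreover have "cover_length ?C = sum_list (map card fs)"
    unfolding cover_length_def mset_map[symmetric] sum_mset_sum_list by (simp add: comp_def)
  moreover have "3 * real (sum_list (map card fs)) + 6 \<le> 5 * real (card (arcs G)) + 6 * real (card (verts G)) + real \<epsilon>\<^sub>N"
    using of_nat_mono[OF fs(3), where ?'a = real] assms(6) by simp
  ultimately show ?thesis by (intro exI[of _ ?C]) simp
qed

end
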